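(* There is a strongly polynomial time algorithm that, given as input (the rational coefficients of) a univariate polynomial matrix $P(t)$ with values in the real symmetric $n\times n$ matrices, decides whether $P(t)\succeq 0$ for all $t\in[-1,1]$.
   Context: A univariate polynomial matrix $P(t)=P_0+P_1t+\dots+P_dt^d$ (with each $P_i$ a real symmetric $n\times n$ matrix) is a matrix whose entries are polynomials in the single variable $t$; $M\succeq 0$ means that the symmetric matrix $M$ is positive semidefinite. Computation is in the Turing model. The input consists of the rational coefficients of the entries of $P(t)$, so the dimension of the input is the total number of coefficients, $\binom{n+1}{2}(d+1)$; its encoding length is the number of bits needed to write it in binary. A strongly polynomial time algorithm is one such that (i) it consists of the elementary arithmetic operations addition, subtraction, comparison, multiplication and division; (ii) the number of elementary operations is bounded by a polynomial in the dimension of the input; and (iii) the encoding length of the numbers occurring during the algorithm is bounded by a polynomial function of the encoding length of the input. *)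

theory Defs
  imports
    "Jordan_Normal_Form.Matrix"
    "HOL-Computational_Algebra.Polynomial"
    "HOL-Library.Log_Nat"
    Complex_Main
begin

section \<open>Algorithms over the rational numbers\<close>

text \<open>
  Algorithms are programs of a small imperative language, that is, structured random access
  machines. A program is a fixed finite object and works on inputs of all sizes. Every memory
  cell holds a rational number; the memory is organised in arrays, and \<open>s a i\<close> is the content of
  cell \<open>i\<close> of the array called \<open>a\<close>. Cell 0 of an array can serve as a scalar variable.

  The only operations on numbers are addition, subtraction, multiplication, division and
  comparison (in particular there is no rounding). A division by zero and an address that is
  not a natural number are errors: an execution that meets one has no result.
\<close>

type_synonym store = "string \<Rightarrow> nat \<Rightarrow> rat"

datatype arith_op = Add | Sub | Mul | Div

datatype aexp = Const rat | Cell string aexp | Arith arith_op aexp aexp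

datatype comparison = LT | LE | EQ

datatype test = Compare comparison aexp aexp

datatype com =
    Skip
  | Assign string aexp aexp  \<comment> \<open>array, address, new content\<close>
  | Seq com com
  | If test com com
  | While test com

fun arith :: "arith_op \<Rightarrow> rat \<Rightarrow> rat \<Rightarrow> rat" where
  "arith Add x y = x + y"
| "arith Sub x y = x - y"
| "arith Mul x y = x * y"
| "arith Div x y = x / y"

fun compare :: "comparison \<Rightarrow> rat \<Rightarrow> rat \<Rightarrow> bool" where
  "compare LT x y \<longleftrightarrow> x < y"
| "compare LE x y \<longleftrightarrow> x \<le> y"
| "compare EQ x y \<longleftrightarrow> x = y"

definition address :: "rat \<Rightarrow> nat" where
  "address x = nat \<lfloor>x\<rfloor>"  \<comment> \<open>only applied where \<open>x \<in> \<nat>\<close>, see \<open>defined\<close> and \<open>exec\<close>\<close>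

fun aval :: "aexp \<Rightarrow> store \<Rightarrow> rat" where
  "aval (Const x) s = x"
| "aval (Cell a e) s = s a (address (aval e s))"
| "aval (Arith f e e') s = arith f (aval e s) (aval e' s)"

fun defined :: "aexp \<Rightarrow> store \<Rightarrow> bool" where
  "defined (Const x) s \<longleftrightarrow> True"
| "defined (Cell a e) s \<longleftrightarrow> defined e s \<and> aval e s \<in> \<nat>"
| "defined (Arith f e e') s \<longleftrightarrow> defined e s \<and> defined e' s \<and> (f = Div \<longrightarrow> aval e' s \<noteq> 0)"

text \<open>
  Loading a constant, reading a cell and every arithmetic operation take one step each, and all
  intermediate results count as numbers that occur.
\<close>

fun asteps :: "aexp \<Rightarrow> nat" where
  "asteps (Const x) = 1"
| "asteps (Cell a e) = asteps e + 1"
| "asteps (Arith f e e') = asteps e + asteps e' + 1"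

fun occurring :: "aexp \<Rightarrow> store \<Rightarrow> rat set" where
  "occurring (Const x) s = {x}"
| "occurring (Cell a e) s = insert (aval (Cell a e) s) (occurring e s)"
| "occurring (Arith f e e') s =
     insert (aval (Arith f e e') s) (occurring e s \<union> occurring e' s)"

fun holds :: "test \<Rightarrow> store \<Rightarrow> bool" where
  "holds (Compare r e e') s \<longleftrightarrow> compare r (aval e s) (aval e' s)"

fun test_defined :: "test \<Rightarrow> store \<Rightarrow> bool" where
  "test_defined (Compare r e e') s \<longleftrightarrow> defined e s \<and> defined e' s"

fun test_steps :: "test \<Rightarrow> nat" where
  "test_steps (Compare r e e') = asteps e + asteps e' + 1"

fun test_occurring :: "test \<Rightarrow> store \<Rightarrow> rat set" where
  "test_occurring (Compare r e e') s = occurring e s \<union> occurring e' s"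

text \<open>
  \<open>exec c s k W s'\<close>: started in \<open>s\<close>, the program \<open>c\<close> halts without an error after \<open>k\<close> steps in \<open>s'\<close>,
  and \<open>W\<close> is the set of the numbers (addresses included) that occur on the way.
\<close>

inductive exec :: "com \<Rightarrow> store \<Rightarrow> nat \<Rightarrow> rat set \<Rightarrow> store \<Rightarrow> bool" where
  Skip: "exec Skip s 0 {} s"
| Assign: "defined i s \<Longrightarrow> aval i s \<in> \<nat> \<Longrightarrow> defined e s \<Longrightarrow>
    exec (Assign a i e) s (asteps i + asteps e + 1) (occurring i s \<union> occurring e s)
      (s(a := (s a)(address (aval i s) := aval e s)))"
| Seq: "exec c s k W s' \<Longrightarrow> exec c' s' k' W' s'' \<Longrightarrow>
    exec (Seq c c') s (k + k') (W \<union> W') s''"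
| IfTrue: "test_defined b s \<Longrightarrow> holds b s \<Longrightarrow> exec c s k W s' \<Longrightarrow>
    exec (If b c c') s (test_steps b + k) (test_occurring b s \<union> W) s'"
| IfFalse: "test_defined b s \<Longrightarrow> \<not> holds b s \<Longrightarrow> exec c' s k W s' \<Longrightarrow>
    exec (If b c c') s (test_steps b + k) (test_occurring b s \<union> W) s'"
| WhileFalse: "test_defined b s \<Longrightarrow> \<not> holds b s \<Longrightarrow>
    exec (While b c) s (test_steps b) (test_occurring b s) s"
| WhileTrue: "test_defined b s \<Longrightarrow> holds b s \<Longrightarrow> exec c s k W s' \<Longrightarrow>
    exec (While b c) s' k' W' s'' \<Longrightarrow>
    exec (While b c) s (test_steps b + k + k') (test_occurring b s \<union> W \<union> W') s''"

inductive_cases exec_SkipE: "exec Skip s k W s'"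
inductive_cases exec_AssignE: "exec (Assign a i e) s k W s'"
inductive_cases exec_SeqE: "exec (Seq c c') s k W s'"
inductive_cases exec_IfE: "exec (If b c c') s k W s'"
inductive_cases exec_WhileE: "exec (While b c) s k W s'"

lemma exec_deterministic:
  "exec c s k W s' \<Longrightarrow> exec c s k' W' s'' \<Longrightarrow> k' = k \<and> W' = W \<and> s'' = s'"
proof (induction arbitrary: k' W' s'' rule: exec.induct)
  case (Skip s)
  then show ?case by (auto elim: exec_SkipE)
next
  case (Assign i s e a)
  from Assign.prems show ?case by (rule exec_AssignE) simp
next
  case (Seq c s k W t c' l V u)
  from Seq.prems show ?case
    by (rule exec_SeqE) (use Seq.IH in blast)
next
  case (IfTrue b s c k W t c')
  from IfTrue.prems show ?case
    by (rule exec_IfE) (use IfTrue.IH IfTrue.hyps in blast)+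
next
  case (IfFalse b s c' k W t c)
  from IfFalse.prems show ?case
    by (rule exec_IfE) (use IfFalse.IH IfFalse.hyps in blast)+
next
  case (WhileFalse b s c)
  from WhileFalse.prems show ?case
    by (rule exec_WhileE) (use WhileFalse.hyps in blast)+
next
  case (WhileTrue b s c k W t l V u)
  from WhileTrue.prems show ?case
    by (rule exec_WhileE) (use WhileTrue.IH WhileTrue.hyps in blast)+
qed


section \<open>Strongly polynomial time\<close>

definition int_length :: "int \<Rightarrow> nat" where
  "int_length z = 1 + floorlog 2 (nat \<bar>z\<bar>)"  \<comment> \<open>a sign bit and the binary digits\<close>

definition encoding_length :: "rat \<Rightarrow> nat" where
  "encoding_length x = (case quotient_of x of (p, q) \<Rightarrow> int_length p + int_length q)"

text \<open>
  An input consists of a list of natural numbers, its format (such as the size of a matrix), and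
  a list of rational numbers, the data proper. Both are in memory initially; all other cells
  contain 0. Dimension and encoding length of the input refer to the data only.
\<close>

definition input_store :: "nat list \<Rightarrow> rat list \<Rightarrow> store" where
  "input_store format data a i =
     (if a = ''format'' \<and> i < length format then of_nat (format ! i)
      else if a = ''data'' \<and> i < length data then data ! i
      else 0)"

definition decides_in_strongly_polynomial_time ::
  "com \<Rightarrow> 'a set \<Rightarrow> ('a \<Rightarrow> nat list) \<Rightarrow> ('a \<Rightarrow> rat list) \<Rightarrow> ('a \<Rightarrow> bool) \<Rightarrow> bool" where
  "decides_in_strongly_polynomial_time c X format data Q \<longleftrightarrow>
     (\<exists>(p :: nat poly) (q :: nat poly). \<forall>x\<in>X. \<exists>k W s.
        exec c (input_store (format x) (data x)) k W s \<and>
        s ''result'' 0 = (if Q x then 1 else 0) \<and>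
        k \<le> poly p (length (data x)) \<and>
        (\<forall>w\<in>W. encoding_length w \<le> poly q (\<Sum>y\<leftarrow>data x. encoding_length y)))"


section \<open>Univariate polynomial matrices\<close>

definition symmetric_poly_mat :: "nat \<Rightarrow> nat \<Rightarrow> rat poly mat \<Rightarrow> bool" where
  "symmetric_poly_mat n d P \<longleftrightarrow>
     P \<in> carrier_mat n n \<and> transpose_mat P = P \<and> (\<forall>i<n. \<forall>j<n. degree (P $$ (i, j)) \<le> d)"

definition eval_poly_mat :: "rat poly mat \<Rightarrow> real \<Rightarrow> real mat" where
  "eval_poly_mat P t = map_mat (\<lambda>p. poly (map_poly of_rat p) t) P"

definition positive_semidefinite :: "real mat \<Rightarrow> bool" where
  "positive_semidefinite M \<longleftrightarrow>
     square_mat M \<and> transpose_mat M = M \<and>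
     (\<forall>v \<in> carrier_vec (dim_row M). 0 \<le> v \<bullet> (M *\<^sub>v v))"

text \<open>
  The coefficients of the entries on and above the diagonal; the coefficient of \<open>t ^ k\<close> in the entry
  \<open>(i, j)\<close>, \<open>i \<le> j\<close>, is at position \<open>(j * (j + 1) / 2 + i) * (d + 1) + k\<close>.
\<close>

definition poly_mat_coeffs :: "nat \<Rightarrow> rat poly mat \<Rightarrow> rat list" where
  "poly_mat_coeffs d P =
     [coeff (P $$ (i, j)) k. j \<leftarrow> [0..<dim_row P], i \<leftarrow> [0..<j + 1], k \<leftarrow> [0..<d + 1]]"

lemma length_poly_mat_coeffs:
  "length (poly_mat_coeffs d P) = (dim_row P + 1 choose 2) * (d + 1)"
proof -
  have "(\<Sum>j\<leftarrow>[0..<n]. (j + 1) * (d + 1)) = (n + 1 choose 2) * (d + 1)" for n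
    by (induction n) (simp_all add: numeral_2_eq_2 algebra_simps)
  then show ?thesis
    by (simp add: poly_mat_coeffs_def length_concat comp_def sum_list_triv del: upt_Suc)
qed

end

theory Submission
  imports Defs "Jordan_Normal_Form.Char_Poly"
begin

text \<open>Eigenvalues, roots and minimizers are irrational in general, so a program over the
  rationals cannot compute them; every question about them has to become one about signs of rational
  numbers. Newton's identities do this twice. The elementary symmetric functions of the eigenvalues
  of \<open>P(t)\<close> are polynomials \<open>f\<close> in \<open>t\<close>, obtained from traces
  of powers, and \<open>P(t)\<close> is positive semidefinite iff all of them are nonnegative. A
  minimum of \<open>f\<close> on [-1,1] lies at an end point or at a root of its derivative; the
  roots with \<open>f < 0\<close> and \<open>1 - t^2 > 0\<close> are counted by Hermite's quadratic
  forms, whose entries come from power sums of roots and hence are rational. The law of inertia is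
  the bridge from these roots to the negative eigenvalues of a symmetric matrix, and Descartes'
  rule, exact for real eigenvalues, reads their number off the signs of coefficients. The obstacle
  on the side of complexity is the length of numbers: bounding each operation separately gives
  exponential length along the recursions. A common denominator of all data gives polynomial bounds
  instead.\<close>

section \<open>Underdetermined linear systems and the law of inertia\<close>

lemma underdetermined_system:
  fixes k :: "'b \<Rightarrow> 'a \<Rightarrow> 'f::field"
  assumes "finite B" "finite A" "card B < card A"
  shows "\<exists>t. (\<exists>a\<in>A. t a \<noteq> 0) \<and> (\<forall>b\<in>B. (\<Sum>a\<in>A. k b a * t a) = 0)"
  using assms
proof (induction B arbitrary: A k rule: finite_induct)
  case empty
  then obtain a where "a \<in> A" by fastforce
  then show ?case by (intro exI[of _ "\<lambda>_. 1"]) auto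
next
  case (insert b B)
  show ?case
  proof (cases "\<forall>a\<in>A. k b a = 0")
    case True
    have "card B < card A" using insert by simp
    then obtain t where "\<exists>a\<in>A. t a \<noteq> 0" "\<forall>b\<in>B. (\<Sum>a\<in>A. k b a * t a) = 0"
      using insert.IH[OF insert.prems(1)] by blast
    then show ?thesis using True by (intro exI[of _ t]) simp
  next
    case False
    then obtain a0 where a0: "a0 \<in> A" "k b a0 \<noteq> 0" by blast
    \<comment> \<open>The unknown \<open>a0\<close> is eliminated with the equation
      \<open>b\<close>: \<open>?k\<close> is the remaining system, and the value of
      \<open>?t\<close> at \<open>a0\<close> is the one that the equation \<open>b\<close> then
      dictates.\<close>
    let ?A = "A - {a0}"
    let ?k = "\<lambda>c a. k c a - k c a0 * k b a / k b a0"
    have "card B < card ?A" using insert a0 by simp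
    then obtain t where t: "\<exists>a\<in>?A. t a \<noteq> 0" "\<forall>b\<in>B. (\<Sum>a\<in>?A. ?k b a * t a) = 0"
      using insert.IH[of ?A ?k] insert.prems(1) by blast
    let ?t = "t(a0 := - (\<Sum>a\<in>?A. k b a * t a) / k b a0)"
    have split: "(\<Sum>a\<in>A. k c a * ?t a) = (\<Sum>a\<in>?A. ?k c a * t a)" for c
    proof -
      have "(\<Sum>a\<in>A. k c a * ?t a) = k c a0 * ?t a0 + (\<Sum>a\<in>?A. k c a * ?t a)"
        by (rule sum.remove[OF insert.prems(1) a0(1)])
      also have "(\<Sum>a\<in>?A. k c a * ?t a) = (\<Sum>a\<in>?A. k c a * t a)" by (rule sum.cong) auto
      also have "k c a0 * ?t a0 + \<dots> = (\<Sum>a\<in>?A. k c a * t a) - (\<Sum>a\<in>?A. k c a0 * k b a / k b a0 * t a)"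
        by (simp add: sum_distrib_left sum_divide_distrib sum_negf field_simps)
      also have "\<dots> = (\<Sum>a\<in>?A. ?k c a * t a)"
        by (simp add: sum_subtractf[symmetric] left_diff_distrib)
      finally show ?thesis .
    qed
    have "(\<Sum>a\<in>A. k b a * ?t a) = 0" unfolding split using a0(2) by simp
    moreover have "\<exists>a\<in>A. ?t a \<noteq> 0" using t(1) by auto
    ultimately show ?thesis using t(2) split by (intro exI[of _ ?t]) auto
  qed
qed

text \<open>
  One half of Sylvester's law of inertia for quadratic forms in \<open>M\<close> variables. The linear forms
  are given by their coefficients, and their independence by a system of dual vectors.
\<close>

lemma inertia_le:
  fixes x :: "'a \<Rightarrow> real" and y :: "'b \<Rightarrow> real"
  assumes fin: "finite S" "finite T"
    and eq: "\<And>v. (\<Sum>a\<in>S. x a * (\<Sum>i<M. L a i * v i)\<^sup>2) = (\<Sum>b\<in>T. y b * (\<Sum>i<M. K b i * v i)\<^sup>2)"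
    and dual: "\<And>a a'. a \<in> S \<Longrightarrow> a' \<in> S \<Longrightarrow> (\<Sum>i<M. L a' i * D a i) = (if a' = a then 1 else 0)"
  shows "card {a\<in>S. x a < 0} \<le> card {b\<in>T. y b < 0}"
proof (rule ccontr)
  let ?A = "{a\<in>S. x a < 0}" and ?B = "{b\<in>T. y b < 0}"
  assume "\<not> card ?A \<le> card ?B"
  then have "card ?B < card ?A" by simp
  \<comment> \<open>Fewer conditions than unknowns: some nontrivial combination \<open>v\<close> of
    the dual vectors of negative weight annihilates all forms \<open>K b\<close> with
    \<open>y b < 0\<close>. At \<open>v\<close> the right-hand side is nonnegative and the left-hand
    side negative.\<close>
  then obtain t where t: "\<exists>a\<in>?A. t a \<noteq> 0" "\<And>b. b \<in> ?B \<Longrightarrow> (\<Sum>a\<in>?A. (\<Sum>i<M. K b i * D a i) * t a) = 0"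
    using underdetermined_system[of ?B ?A "\<lambda>b a. \<Sum>i<M. K b i * D a i"] fin by auto
  define v where "v i = (\<Sum>a\<in>?A. t a * D a i)" for i
  have Lv: "(\<Sum>i<M. L a' i * v i) = (if x a' < 0 then t a' else 0)" if "a' \<in> S" for a'
  proof -
    have "(\<Sum>i<M. L a' i * v i) = (\<Sum>i<M. \<Sum>a\<in>?A. t a * (L a' i * D a i))"
      by (simp add: v_def sum_distrib_left mult_ac)
    also have "\<dots> = (\<Sum>a\<in>?A. t a * (\<Sum>i<M. L a' i * D a i))"
      by (subst sum.swap) (simp add: sum_distrib_left)
    also have "\<dots> = (\<Sum>a\<in>?A. if a' = a then t a else 0)"
      using that by (intro sum.cong) (auto simp: dual)
    also have "\<dots> = (if x a' < 0 then t a' else 0)" using fin that by (simp add: sum.delta)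
    finally show ?thesis .
  qed
  have Kv: "(\<Sum>i<M. K b i * v i) = 0" if "b \<in> ?B" for b
  proof -
    have "(\<Sum>i<M. K b i * v i) = (\<Sum>i<M. \<Sum>a\<in>?A. K b i * D a i * t a)"
      by (simp add: v_def sum_distrib_left mult_ac)
    also have "\<dots> = (\<Sum>a\<in>?A. (\<Sum>i<M. K b i * D a i) * t a)"
      by (subst sum.swap) (simp add: sum_distrib_right)
    finally show ?thesis using t(2)[OF that] by simp
  qed
  have "(\<Sum>b\<in>T. y b * (\<Sum>i<M. K b i * v i)\<^sup>2) \<ge> 0"
  proof (rule sum_nonneg)
    fix b assume "b \<in> T"
    then show "0 \<le> y b * (\<Sum>i<M. K b i * v i)\<^sup>2"
      using Kv[of b] by (cases "y b < 0") auto
  qed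
  moreover have "(\<Sum>a\<in>S. x a * (\<Sum>i<M. L a i * v i)\<^sup>2) = (\<Sum>a\<in>S. if x a < 0 then x a * (t a)\<^sup>2 else 0)"
    by (rule sum.cong) (auto simp: Lv)
  moreover have "\<dots> < (\<Sum>a\<in>S. 0)"
  proof (rule sum_strict_mono_ex1)
    obtain a where "a \<in> S" "x a < 0" "t a \<noteq> 0" using t(1) by auto
    then show "\<exists>a\<in>S. (if x a < 0 then x a * (t a)\<^sup>2 else 0) < 0"
      by (intro bexI[of _ a]) (auto simp: mult_neg_pos)
  qed (auto simp: fin mult_nonpos_nonneg)
  ultimately show False using eq[of v] by simp
qed

subsection \<open>The spectral theorem\<close>

definition mat_app :: "nat \<Rightarrow> (nat \<Rightarrow> nat \<Rightarrow> real) \<Rightarrow> (nat \<Rightarrow> complex) \<Rightarrow> nat \<Rightarrow> complex" where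
  "mat_app N A f i = (\<Sum>j<N. of_real (A i j) * f j)"

text \<open>The number \<open>n\<close> of terms is fixed rather than tied to
  \<open>degree q\<close>, which makes the expression linear in \<open>q\<close>; it is
  \<open>q(A) f\<close> once \<open>n\<close> exceeds the degree. The scalars are complex because
  the annihilating polynomial has to split into linear factors.\<close>

definition poly_app ::
  "nat \<Rightarrow> (nat \<Rightarrow> nat \<Rightarrow> real) \<Rightarrow> (nat \<Rightarrow> complex) \<Rightarrow> nat \<Rightarrow> complex poly \<Rightarrow> nat \<Rightarrow> complex" where
  "poly_app N A f n q i = (\<Sum>k<n. coeff q k * (mat_app N A ^^ k) f i)"

lemma poly_app_linear_factor:
  assumes "degree q + 1 < n"
  shows "poly_app N A f n ([:- \<mu>, 1:] * q) i = mat_app N A (poly_app N A f n q) i - \<mu> * poly_app N A f n q i"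
proof -
  obtain m where n: "n = Suc m" using assms by (cases n) auto
  \<comment> \<open>The last of the \<open>n\<close> terms is zero, so nothing is lost when the
    powers are shifted by one.\<close>
  have m: "coeff q m = 0" using assms n by (intro coeff_eq_0) simp
  have "mat_app N A (poly_app N A f n q) i = (\<Sum>k<n. coeff q k * (mat_app N A ^^ Suc k) f i)"
    unfolding mat_app_def poly_app_def sum_distrib_left
    by (subst sum.swap) (simp add: mat_app_def sum_distrib_left mult_ac)
  also have "\<dots> = (\<Sum>k<m. coeff q k * (mat_app N A ^^ Suc k) f i)" by (simp add: n m)
  also have "\<dots> = (\<Sum>k<n. coeff (pCons 0 q) k * (mat_app N A ^^ k) f i)"
    unfolding n by (subst sum.lessThan_Suc_shift) simp
  finally have "mat_app N A (poly_app N A f n q) i = poly_app N A f n (pCons 0 q) i"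
    by (simp add: poly_app_def)
  moreover have "[:- \<mu>, 1:] * q = pCons 0 q - smult \<mu> q" by simp
  moreover have "poly_app N A f n (pCons 0 q - smult \<mu> q) i =
      poly_app N A f n (pCons 0 q) i - \<mu> * poly_app N A f n q i"
    unfolding poly_app_def sum_distrib_left sum_subtractf[symmetric]
    by (rule sum.cong) (simp_all add: left_diff_distrib)
  ultimately show ?thesis by simp
qed

lemma poly_app_smult: "poly_app N A f n (smult c q) i = c * poly_app N A f n q i"
  by (simp add: poly_app_def sum_distrib_left mult_ac)

text \<open>
  A polynomial annihilating \<open>v\<close> is applied factor by factor; the last vector before zero is an
  eigenvector. It stays in the orthogonal complement of the given eigenvectors.
\<close>

lemma symmetric_eigenvector:
  fixes A :: "nat \<Rightarrow> nat \<Rightarrow> real" and u :: "nat \<Rightarrow> nat \<Rightarrow> real"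
  assumes sym: "\<And>i j. i < N \<Longrightarrow> j < N \<Longrightarrow> A i j = A j i"
    and u: "\<And>b i. b < r \<Longrightarrow> i < N \<Longrightarrow> (\<Sum>j<N. A i j * u b j) = l b * u b i"
    and v: "\<exists>i<N. v i \<noteq> 0" "\<And>b. b < r \<Longrightarrow> (\<Sum>i<N. u b i * v i) = 0"
  shows "\<exists>w \<mu>. (\<exists>i<N. w i \<noteq> 0) \<and> (\<forall>i<N. (\<Sum>j<N. A i j * w j) = \<mu> * w i) \<and>
    (\<forall>b<r. (\<Sum>i<N. u b i * w i) = 0)"
proof -
  define f where "f i = complex_of_real (v i)" for i
  let ?A = "mat_app N A"
  define P where "P k = ((\<lambda>g i. \<Sum>j<N. A i j * g j) ^^ k) v" for k
  have P: "(?A ^^ k) f i = of_real (P k i)" for k i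
    by (induction k arbitrary: i) (simp_all add: P_def f_def mat_app_def)
  \<comment> \<open>The \<open>N + 1\<close> vectors \<open>v\<close>, \<open>A v\<close>, ...,
    \<open>A^N v\<close> have only \<open>N\<close> coordinates and are therefore dependent.\<close>
  obtain t where t: "\<exists>a\<in>{..N}. t a \<noteq> 0" "\<And>i. i < N \<Longrightarrow> (\<Sum>k\<le>N. P k i * t k) = 0"
    using underdetermined_system[of "{..<N}" "{..N}" "\<lambda>i k. P k i"] by auto
  define p where "p = (\<Sum>k\<le>N. monom (complex_of_real (t k)) k)"
  have cp: "coeff p k = (if k \<le> N then of_real (t k) else 0)" for k
    by (simp add: p_def coeff_sum sum.delta')
  have p0: "p \<noteq> 0" using t(1) cp by (auto simp: poly_eq_iff)
  have dp: "degree p \<le> N" by (rule degree_le) (simp add: cp)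
  obtain as where as: "smult (lead_coeff p) (\<Prod>a\<leftarrow>as. [:- a, 1:]) = p" "length as = degree p"
    using fundamental_theorem_algebra_factorized[of p] by blast
  \<comment> \<open>Room for a product of at most \<open>N\<close> factors and for one factor
    more.\<close>
  let ?n = "N + 2"
  define g where "g ms = poly_app N A f ?n (\<Prod>a\<leftarrow>ms. [:- a, 1:])" for ms
  have deg: "degree (\<Prod>a\<leftarrow>ms. [:- a, 1:]) = length ms" for ms :: "complex list"
    by (rule degree_linear_factors)
  have g_Cons: "g (\<mu> # ms) i = ?A (g ms) i - \<mu> * g ms i" if "length ms \<le> N" for \<mu> ms i
    unfolding g_def list.map prod_list.Cons
    by (rule poly_app_linear_factor) (use that deg[of ms] in linarith)
  have g_Nil: "g [] i = f i" for i
    by (simp add: g_def poly_app_def numeral_2_eq_2 sum.lessThan_Suc_shift del: sum.lessThan_Suc)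
  have "lead_coeff p * g as i = poly_app N A f ?n p i" for i
    by (simp only: g_def poly_app_smult[symmetric] as(1))
  moreover have "poly_app N A f ?n p i = 0" if "i < N" for i
  proof -
    have "poly_app N A f ?n p i = (\<Sum>k\<le>N. of_real (P k i * t k))"
      unfolding poly_app_def by (rule sum.mono_neutral_cong_right) (auto simp: cp P mult.commute)
    also have "\<dots> = of_real (\<Sum>k\<le>N. P k i * t k)" by simp
    finally show ?thesis using t(2)[OF that] by simp
  qed
  ultimately have g_as: "g as i = 0" if "i < N" for i
    using that p0 leading_coeff_neq_0[of p] by (metis mult_eq_0_iff)
  \<comment> \<open>The empty product leaves \<open>v\<close>, which is nonzero, and the full
    product gives zero; \<open>ms\<close> sits at the point where the vector becomes zero.\<close>
  have ex: "\<exists>\<mu> ms. length ms \<le> N \<and> (\<exists>i<N. g ms i \<noteq> 0) \<and> (\<forall>i<N. g (\<mu> # ms) i = 0)"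
    if "length as \<le> Suc N" "\<forall>i<N. g as i = 0" for as
    using that
  proof (induction as)
    case Nil
    then show ?case using v(1) g_Nil by (auto simp: f_def)
  next
    case (Cons a as)
    show ?case
    proof (cases "\<forall>i<N. g as i = 0")
      case True
      then show ?thesis using Cons by simp
    next
      case False
      then show ?thesis using Cons.prems by (intro exI[of _ a] exI[of _ as]) auto
    qed
  qed
  obtain \<mu> ms where ms: "length ms \<le> N" "\<exists>i<N. g ms i \<noteq> 0" "\<And>i. i < N \<Longrightarrow> g (\<mu> # ms) i = 0"
    using ex[of as] g_as as(2) dp by auto
  define w where "w = g ms"
  have w: "?A w i = \<mu> * w i" if "i < N" for i
    using ms(3)[OF that] g_Cons[OF ms(1)] by (simp add: w_def)
  have orth: "(\<Sum>i<N. of_real (u b i) * g ms i) = 0" if "b < r" "length ms \<le> N" for b ms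
    using that(2)
  proof (induction ms)
    case Nil
    have "(\<Sum>i<N. of_real (u b i) * g [] i) = of_real (\<Sum>i<N. u b i * v i)"
      by (simp add: g_Nil f_def)
    then show ?case using v(2)[OF that(1)] by simp
  next
    case (Cons a ms)
    have "(\<Sum>i<N. of_real (u b i) * ?A (g ms) i) =
        (\<Sum>i<N. \<Sum>j<N. of_real (A i j * u b i) * g ms j)"
      unfolding mat_app_def sum_distrib_left by (simp add: mult_ac)
    also have "\<dots> = (\<Sum>j<N. (\<Sum>i<N. of_real (A i j * u b i)) * g ms j)"
      unfolding sum_distrib_right by (rule sum.swap)
    also have "\<dots> = (\<Sum>j<N. of_real (l b * u b j) * g ms j)"
    proof (rule sum.cong[OF refl])
      fix j assume j: "j \<in> {..<N}"
      have "(\<Sum>i<N. of_real (A i j * u b i)) = complex_of_real (\<Sum>i<N. A j i * u b i)"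
        unfolding of_real_sum using j by (intro sum.cong refl, subst sym) auto
      then show "(\<Sum>i<N. of_real (A i j * u b i)) * g ms j = of_real (l b * u b j) * g ms j"
        using u[OF that(1), of j] j by (simp only: lessThan_iff)
    qed
    also have "\<dots> = of_real (l b) * (\<Sum>j<N. of_real (u b j) * g ms j)"
      by (simp add: sum_distrib_left mult_ac)
    also have "\<dots> = 0" using Cons by simp
    finally have 1: "(\<Sum>i<N. of_real (u b i) * ?A (g ms) i) = 0" .
    have "(\<Sum>i<N. of_real (u b i) * g (a # ms) i) =
        (\<Sum>i<N. of_real (u b i) * (?A (g ms) i - a * g ms i))"
      using Cons.prems by (intro sum.cong refl) (subst g_Cons, auto)
    also have "\<dots> = (\<Sum>i<N. of_real (u b i) * ?A (g ms) i) - a * (\<Sum>i<N. of_real (u b i) * g ms i)"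
      by (simp add: right_diff_distrib sum_subtractf sum_distrib_left mult_ac)
    also have "\<dots> = 0" using 1 Cons by simp
    finally show ?case .
  qed
  have worth: "(\<Sum>i<N. of_real (u b i) * w i) = 0" if "b < r" for b
    using orth[OF that ms(1)] by (simp add: w_def)
  \<comment> \<open>\<open>s\<close> is the squared norm of \<open>w\<close>. The Hermitian form of
    \<open>A\<close> at \<open>w\<close> has the value \<open>\<mu> * s\<close> and is its own
    conjugate, as \<open>A\<close> is real and symmetric; hence \<open>\<mu>\<close> is
    real.\<close>
  define s where "s = (\<Sum>i<N. (cmod (w i))\<^sup>2)"
  obtain i where i: "i < N" "w i \<noteq> 0" using ms(2) unfolding w_def by blast
  have "s > 0" unfolding s_def by (rule sum_pos2[of _ i]) (use i in auto)
  have "(\<Sum>i<N. cnj (w i) * ?A w i) = (\<Sum>i<N. \<mu> * of_real ((cmod (w i))\<^sup>2))"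
  proof (rule sum.cong[OF refl])
    fix i assume "i \<in> {..<N}"
    then show "cnj (w i) * ?A w i = \<mu> * of_real ((cmod (w i))\<^sup>2)"
      using w[of i] complex_norm_square[of "w i"] by (simp only: lessThan_iff of_real_power) (simp add: mult_ac)
  qed
  then have q1: "(\<Sum>i<N. cnj (w i) * ?A w i) = \<mu> * of_real s"
    by (simp add: s_def sum_distrib_left)
  have "cnj (\<Sum>i<N. cnj (w i) * ?A w i) = (\<Sum>i<N. \<Sum>j<N. of_real (A i j) * cnj (w j) * w i)"
    by (simp add: mat_app_def sum_distrib_left mult_ac)
  also have "\<dots> = (\<Sum>j<N. \<Sum>i<N. of_real (A i j) * cnj (w j) * w i)" by (rule sum.swap)
  also have "\<dots> = (\<Sum>j<N. \<Sum>i<N. of_real (A j i) * cnj (w j) * w i)"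
    by (intro sum.cong refl, subst sym) auto
  also have "\<dots> = (\<Sum>i<N. cnj (w i) * ?A w i)"
    by (simp add: mat_app_def sum_distrib_left mult_ac)
  finally have "cnj (\<mu> * of_real s) = \<mu> * of_real s" using q1 by simp
  then have "cnj \<mu> = \<mu>" using \<open>s > 0\<close> by simp
  then have \<mu>: "\<mu> = of_real (Re \<mu>)" by (simp add: complex_eq_iff)
  \<comment> \<open>Since \<open>A\<close>, \<open>\<mu>\<close> and all \<open>u b\<close> are
    real, the real and the imaginary part of \<open>w\<close> satisfy the same equations as
    \<open>w\<close>, and one of them is nonzero.\<close>
  have re: "(\<Sum>j<N. A i j * Re (w j)) = Re \<mu> * Re (w i)"
    and im: "(\<Sum>j<N. A i j * Im (w j)) = Re \<mu> * Im (w i)" if "i < N" for i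
  proof -
    have "(\<Sum>j<N. of_real (A i j) * w j) = of_real (Re \<mu>) * w i"
      using w[OF that] \<mu> by (simp add: mat_app_def)
    from arg_cong[OF this, of Re] arg_cong[OF this, of Im]
    show "(\<Sum>j<N. A i j * Re (w j)) = Re \<mu> * Re (w i)"
      "(\<Sum>j<N. A i j * Im (w j)) = Re \<mu> * Im (w i)" by simp_all
  qed
  have orr: "(\<Sum>i<N. u b i * Re (w i)) = 0" "(\<Sum>i<N. u b i * Im (w i)) = 0" if "b < r" for b
    using arg_cong[OF worth[OF that], of Re] arg_cong[OF worth[OF that], of Im] by simp_all
  show ?thesis
  proof (cases "Re (w i) = 0")
    case True
    then have "Im (w i) \<noteq> 0" using i(2) by (simp add: complex_eq_iff)
    then show ?thesis
      by (intro exI[of _ "\<lambda>i. Im (w i)"] exI[of _ "Re \<mu>"]) (use i im orr in auto)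
  next
    case False
    then show ?thesis
      by (intro exI[of _ "\<lambda>i. Re (w i)"] exI[of _ "Re \<mu>"]) (use i re orr in auto)
  qed
qed

text \<open>The vectors are found one at a time: orthogonality to \<open>r < N\<close> vectors is a
  system of \<open>r\<close> equations in \<open>N\<close> unknowns, and a nonzero solution can be
  turned into an eigenvector that is still orthogonal to them.\<close>

lemma symmetric_orthonormal_eigenvectors:
  fixes A :: "nat \<Rightarrow> nat \<Rightarrow> real"
  assumes sym: "\<And>i j. i < N \<Longrightarrow> j < N \<Longrightarrow> A i j = A j i" and "r \<le> N"
  shows "\<exists>u l. (\<forall>a<r. \<forall>b<r. (\<Sum>i<N. u a i * u b i) = (if a = b then 1 else 0)) \<and>
    (\<forall>a<r. \<forall>i<N. (\<Sum>j<N. A i j * u a j) = l a * u a i)"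
  using assms(2)
proof (induction r)
  case (Suc r)
  then have "r \<le> N" by simp
  from Suc.IH[OF this] obtain u l where
    ul: "\<forall>a<r. \<forall>b<r. (\<Sum>i<N. u a i * u b i) = (if a = b then 1 else 0)"
      "\<forall>a<r. \<forall>i<N. (\<Sum>j<N. A i j * u a j) = l a * u a i" by blast
  have u: "(\<Sum>i<N. u a i * u b i) = (if a = b then 1 else 0)" if "a < r" "b < r" for a b
    using ul(1) that by blast
  have l: "(\<Sum>j<N. A i j * u a j) = l a * u a i" if "a < r" "i < N" for a i
    using ul(2) that by blast
  have card: "card {..<r} < card {..<N}" using Suc.prems by simp
  obtain v where v: "\<exists>i\<in>{..<N}. v i \<noteq> 0" "\<forall>b\<in>{..<r}. (\<Sum>i<N. u b i * v i) = 0"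
    using underdetermined_system[OF finite_lessThan finite_lessThan card, of u] by blast
  have v': "\<exists>i<N. v i \<noteq> 0" "\<And>b. b < r \<Longrightarrow> (\<Sum>i<N. u b i * v i) = 0"
    using v by auto
  obtain w \<mu> where w: "\<exists>i<N. w i \<noteq> 0" "\<forall>i<N. (\<Sum>j<N. A i j * w j) = \<mu> * w i"
    "\<forall>b<r. (\<Sum>i<N. u b i * w i) = 0"
    using symmetric_eigenvector[of N A r u l v, OF sym l v'] by blast
  define s where "s = sqrt (\<Sum>i<N. (w i)\<^sup>2)"
  have pos: "(\<Sum>i<N. (w i)\<^sup>2) > 0"
  proof -
    obtain i where "i < N" "w i \<noteq> 0" using w(1) by blast
    then show ?thesis by (intro sum_pos2[of _ i]) auto
  qed
  then have s: "s > 0" "s * s = (\<Sum>i<N. (w i)\<^sup>2)" by (simp_all add: s_def)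
  define u' where "u' a i = (if a = r then w i / s else u a i)" for a i
  define l' where "l' a = (if a = r then \<mu> else l a)" for a
  have rr: "(\<Sum>i<N. w i / s * (w i / s)) = 1"
  proof -
    have "(\<Sum>i<N. w i / s * (w i / s)) = (\<Sum>i<N. (w i)\<^sup>2) / (s * s)"
      by (simp add: sum_divide_distrib power2_eq_square)
    then show ?thesis using s pos by simp
  qed
  have ar: "(\<Sum>i<N. u a i * (w i / s)) = 0" if "a < r" for a
    using w(3) that by (simp add: sum_divide_distrib[symmetric])
  have ra: "(\<Sum>i<N. w i / s * u a i) = 0" if "a < r" for a
    using ar[OF that] by (simp add: mult.commute)
  have "(\<Sum>i<N. u' a i * u' b i) = (if a = b then 1 else 0)" if "a < Suc r" "b < Suc r" for a b
    using that u[of a b] rr ar[of a] ra[of b] unfolding u'_def less_Suc_eq by auto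
  moreover have "(\<Sum>j<N. A i j * u' a j) = l' a * u' a i" if "a < Suc r" "i < N" for a i
  proof (cases "a = r")
    case True
    have "(\<Sum>j<N. A i j * (w j / s)) = (\<Sum>j<N. A i j * w j) / s" by (simp add: sum_divide_distrib)
    then show ?thesis using True w(2) that(2) by (simp add: u'_def l'_def)
  qed (use that l in \<open>simp add: u'_def l'_def\<close>)
  ultimately show ?case by blast
qed simp

text \<open>A square matrix with orthonormal rows has its transpose as a right inverse, hence also
  as a left inverse.\<close>

lemma orthonormal_columns:
  fixes u :: "nat \<Rightarrow> nat \<Rightarrow> real"
  assumes "\<And>a b. a < N \<Longrightarrow> b < N \<Longrightarrow> (\<Sum>i<N. u a i * u b i) = (if a = b then 1 else 0)"
    and "i < N" "j < N"
  shows "(\<Sum>a<N. u a i * u a j) = (if i = j then 1 else 0)"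
proof -
  define U where "U = mat N N (\<lambda>(a, i). u a i)"
  have U: "U \<in> carrier_mat N N" "transpose_mat U \<in> carrier_mat N N" by (simp_all add: U_def)
  have "U * transpose_mat U = 1\<^sub>m N"
    by (rule eq_matI) (auto simp: U_def scalar_prod_def assms(1) lessThan_atLeast0[symmetric])
  then have "transpose_mat U * U = 1\<^sub>m N" using mat_mult_left_right_inverse[OF U] by simp
  from arg_cong[OF this, of "\<lambda>M. M $$ (i, j)"] assms(2,3)
  show ?thesis by (simp add: U_def scalar_prod_def lessThan_atLeast0[symmetric])
qed

text \<open>Index functions over an arbitrary commutative ring let the same recursion serve for real
  matrices and for matrices of polynomials; it is also the recursion that the program will
  follow.\<close>

fun mat_power :: "nat \<Rightarrow> (nat \<Rightarrow> nat \<Rightarrow> 'a::comm_ring_1) \<Rightarrow> nat \<Rightarrow> nat \<Rightarrow> nat \<Rightarrow> 'a" where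
  "mat_power N A 0 i j = (if i = j then 1 else 0)"
| "mat_power N A (Suc k) i j = (\<Sum>m<N. A i m * mat_power N A k m j)"

definition trace_power :: "nat \<Rightarrow> (nat \<Rightarrow> nat \<Rightarrow> 'a::comm_ring_1) \<Rightarrow> nat \<Rightarrow> 'a" where
  "trace_power N A k = (\<Sum>i<N. mat_power N A k i i)"

text \<open>The traces of powers give access to the eigenvalues \<open>l\<close>: they are
  computable from the entries by ring operations, and they are the power sums of
  \<open>l\<close>.\<close>

lemma spectral_decomposition:
  fixes A :: "nat \<Rightarrow> nat \<Rightarrow> real"
  assumes sym: "\<And>i j. i < N \<Longrightarrow> j < N \<Longrightarrow> A i j = A j i"
  obtains u l where
    "\<And>a b. a < N \<Longrightarrow> b < N \<Longrightarrow> (\<Sum>i<N. u a i * u b i) = (if a = b then 1 else 0)"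
    "\<And>v. (\<Sum>i<N. \<Sum>j<N. v i * A i j * v j) = (\<Sum>a<N. l a * (\<Sum>i<N. u a i * v i)\<^sup>2)"
    "\<And>k. trace_power N A k = (\<Sum>a<N. l a ^ k)"
proof -
  obtain u l where
    ul: "\<forall>a<N. \<forall>b<N. (\<Sum>i<N. u a i * u b i) = (if a = b then 1 else 0)"
      "\<forall>a<N. \<forall>i<N. (\<Sum>j<N. A i j * u a j) = l a * u a i"
    using symmetric_orthonormal_eigenvectors[of N A N, OF sym order.refl] by blast
  have u: "(\<Sum>i<N. u a i * u b i) = (if a = b then 1 else 0)" if "a < N" "b < N" for a b
    using ul(1) that by blast
  have l: "(\<Sum>j<N. A i j * u a j) = l a * u a i" if "a < N" "i < N" for a i
    using ul(2) that by blast
  note c = orthonormal_columns[of N u, OF u]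
  have Am: "(\<Sum>m<N. A i m * u a m * x) = l a * u a i * x" if "a < N" "i < N" for a i x
    using l[OF that] by (simp add: sum_distrib_right[symmetric])
  have pw: "mat_power N A k i j = (\<Sum>a<N. l a ^ k * u a i * u a j)" if "i < N" "j < N" for k i j
    using that
  proof (induction k arbitrary: i)
    case 0
    then show ?case by (simp add: c)
  next
    case (Suc k)
    have "mat_power N A (Suc k) i j = (\<Sum>m<N. \<Sum>a<N. A i m * u a m * (l a ^ k * u a j))"
      using Suc by (auto simp: sum_distrib_left mult_ac intro!: sum.cong)
    also have "\<dots> = (\<Sum>a<N. l a * u a i * (l a ^ k * u a j))"
      by (subst sum.swap) (use Suc.prems in \<open>auto simp: Am intro!: sum.cong\<close>)
    finally show ?case by (simp add: mult_ac)
  qed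
  show ?thesis
  proof (rule that)
    show "(\<Sum>i<N. u a i * u b i) = (if a = b then 1 else 0)" if "a < N" "b < N" for a b
      by (rule u[OF that])
    show "(\<Sum>i<N. \<Sum>j<N. v i * A i j * v j) = (\<Sum>a<N. l a * (\<Sum>i<N. u a i * v i)\<^sup>2)" for v
    proof -
      have A: "A i j = (\<Sum>a<N. l a * u a i * u a j)" if "i < N" "j < N" for i j
      proof -
        have "mat_power N A (Suc 0) i j = (\<Sum>m<N. if m = j then A i m else 0)"
          unfolding mat_power.simps by (rule sum.cong) auto
        also have "\<dots> = A i j" using that(2) by (simp add: sum.delta)
        finally show ?thesis using pw[OF that, of "Suc 0"] by (simp only: power_Suc0_right)
      qed
      have "(\<Sum>i<N. \<Sum>j<N. v i * A i j * v j) =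
          (\<Sum>i<N. \<Sum>j<N. \<Sum>a<N. l a * ((u a i * v i) * (u a j * v j)))"
        by (intro sum.cong refl) (auto simp: A sum_distrib_left sum_distrib_right mult_ac)
      also have "\<dots> = (\<Sum>i<N. \<Sum>a<N. \<Sum>j<N. l a * ((u a i * v i) * (u a j * v j)))"
        by (intro sum.cong refl sum.swap)
      also have "\<dots> = (\<Sum>a<N. \<Sum>i<N. \<Sum>j<N. l a * ((u a i * v i) * (u a j * v j)))"
        by (rule sum.swap)
      also have "\<dots> = (\<Sum>a<N. l a * (\<Sum>i<N. u a i * v i)\<^sup>2)"
        unfolding power2_eq_square sum_product unfolding sum_distrib_left ..
      finally show ?thesis .
    qed
    show "trace_power N A k = (\<Sum>a<N. l a ^ k)" for k
    proof -
      have "trace_power N A k = (\<Sum>i<N. \<Sum>a<N. l a ^ k * u a i * u a i)"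
        unfolding trace_power_def by (intro sum.cong refl) (simp add: pw)
      also have "\<dots> = (\<Sum>a<N. l a ^ k * (\<Sum>i<N. u a i * u a i))"
        by (subst sum.swap) (simp add: sum_distrib_left mult_ac)
      also have "\<dots> = (\<Sum>a<N. l a ^ k)" by (simp add: u)
      finally show ?thesis .
    qed
  qed
qed

section \<open>Newton's identities\<close>

text \<open>Newton's identities without alternating signs: \<open>p\<close> stands for power sums
  and \<open>c\<close> for the coefficients of a product of factors \<open>1 - a x\<close>. Only
  \<open>p j\<close> with \<open>j > 0\<close> enters.\<close>

definition newton_seq :: "(nat \<Rightarrow> 'a::comm_ring_1) \<Rightarrow> (nat \<Rightarrow> 'a) \<Rightarrow> bool" where
  "newton_seq p c \<longleftrightarrow> c 0 = 1 \<and> (\<forall>k. of_nat k * c k = - (\<Sum>i<k. c i * p (k - i)))"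

text \<open>Induction over the factors. A new factor \<open>1 - a x\<close> replaces
  \<open>f\<close> by \<open>f - a * g\<close>, with \<open>g\<close> the shift of \<open>f\<close>
  by one. The terms that contain powers of \<open>a\<close> telescope along \<open>T\<close>; the
  others are the identities for \<open>f\<close> at two consecutive orders.\<close>

lemma newton_seq_list:
  fixes as :: "'a::comm_ring_1 list"
  shows "newton_seq (\<lambda>k. \<Sum>a\<leftarrow>as. a ^ k) (coeff (\<Prod>a\<leftarrow>as. [:1, - a:]))"
proof (induction as)
  case Nil
  have "of_nat k * coeff 1 k = (0::'a)" for k by (cases k) auto
  then show ?case by (simp add: newton_seq_def)
next
  case (Cons a as)
  define F where "F = (\<Prod>a\<leftarrow>as. [:1, - a:])"
  define f g p where "f = coeff F" and "g = coeff (pCons 0 F)" and "p k = (\<Sum>a\<leftarrow>as. a ^ k)" for k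
  have IH: "f 0 = 1" "of_nat k * f k = - (\<Sum>i<k. f i * p (k - i))" for k
    using Cons by (simp_all add: newton_seq_def f_def F_def p_def)
  have g: "g 0 = 0" "g (Suc k) = f k" for k by (simp_all add: g_def f_def)
  have "[:1, - a:] * F = F - smult a (pCons 0 F)" by simp
  then have c: "coeff (\<Prod>a\<leftarrow>a # as. [:1, - a:]) k = f k - a * g k" for k
    by (simp only: list.map prod_list.Cons F_def[symmetric]) (cases k; simp add: f_def g_def)
  have "of_nat k * (f k - a * g k) = - (\<Sum>i<k. (f i - a * g i) * (a ^ (k - i) + p (k - i)))" for k
  proof (cases k)
    case (Suc m)
    define T where "T i = g i * a ^ (m + 2 - i)" for i
    have 1: "(\<Sum>i<Suc m. f i * p (Suc m - i)) = - (of_nat (Suc m) * f (Suc m))"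
      unfolding IH(2) by simp
    have "(\<Sum>i<Suc m. g i * p (Suc m - i)) = (\<Sum>i<m. f i * p (m - i))"
      by (subst sum.lessThan_Suc_shift) (simp add: g)
    then have 2: "(\<Sum>i<Suc m. g i * p (Suc m - i)) = - of_nat m * f m" using IH(2)[of m] by simp
    have "(\<Sum>i<Suc m. (f i - a * g i) * a ^ (Suc m - i)) = (\<Sum>i<Suc m. T (Suc i) - T i)"
    proof (rule sum.cong[OF refl])
      fix i assume "i \<in> {..<Suc m}"
      then have "m + 2 - i = Suc (Suc m - i)" by auto
      then show "(f i - a * g i) * a ^ (Suc m - i) = T (Suc i) - T i"
        by (simp add: T_def g algebra_simps)
    qed
    also have "\<dots> = T (Suc m) - T 0" by (rule sum_lessThan_telescope)
    also have "\<dots> = f m * a" by (simp add: T_def g)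
    finally have 3: "(\<Sum>i<Suc m. (f i - a * g i) * a ^ (Suc m - i)) = f m * a" .
    have "(\<Sum>i<Suc m. (f i - a * g i) * (a ^ (Suc m - i) + p (Suc m - i))) =
        (\<Sum>i<Suc m. f i * p (Suc m - i)) - a * (\<Sum>i<Suc m. g i * p (Suc m - i)) +
        (\<Sum>i<Suc m. (f i - a * g i) * a ^ (Suc m - i))"
      unfolding sum_distrib_left sum_subtractf[symmetric] sum.distrib[symmetric]
      by (rule sum.cong) (simp_all add: algebra_simps)
    also have "\<dots> = - of_nat (Suc m) * f (Suc m) + a * of_nat m * f m + f m * a"
      unfolding 1 2 3 by (simp add: algebra_simps)
    finally show ?thesis unfolding Suc by (simp add: g algebra_simps)
  qed simp
  then show ?case
    unfolding newton_seq_def c using IH(1) g(1) by (simp add: p_def del: mult_pCons_left)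
qed

text \<open>Each identity determines \<open>of_nat k * c k\<close> from earlier coefficients, and in
  characteristic 0 the factor \<open>of_nat k\<close> can be cancelled.\<close>

lemma newton_seq_unique:
  fixes c c' :: "nat \<Rightarrow> 'a::{idom, ring_char_0}"
  assumes "newton_seq p c" "newton_seq p' c'" "\<And>k. 0 < k \<Longrightarrow> p k = p' k"
  shows "c k = c' k"
proof (induction k rule: less_induct)
  case (less k)
  have "of_nat k * c k = of_nat k * c' k"
  proof -
    have "(\<Sum>i<k. c i * p (k - i)) = (\<Sum>i<k. c' i * p' (k - i))"
      using less assms(3) by (intro sum.cong) auto
    then show ?thesis using assms(1,2) by (simp add: newton_seq_def)
  qed
  then show ?case using assms(1,2) by (cases "k = 0") (auto simp: newton_seq_def)
qed

text \<open>The identities solved in the other direction: coefficients of a polynomial yield the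
  power sums of its roots although the roots themselves are out of reach.\<close>

lemma newton_seq_power_sum:
  assumes "newton_seq p c" "0 < k"
  shows "p k = - of_nat k * c k - (\<Sum>i\<in>{1..<k}. c i * p (k - i))"
proof -
  have "(\<Sum>i<k. c i * p (k - i)) = c 0 * p (k - 0) + (\<Sum>i\<in>{1..<k}. c i * p (k - i))"
    using assms(2) unfolding lessThan_atLeast0 by (subst sum.atLeast_Suc_lessThan) auto
  moreover have "of_nat k * c k = - (\<Sum>i<k. c i * p (k - i))" "c 0 = 1"
    using assms(1) by (simp_all add: newton_seq_def)
  ultimately have "of_nat k * c k = - (p k + (\<Sum>i\<in>{1..<k}. c i * p (k - i)))" by simp
  then have "- (of_nat k * c k) = p k + (\<Sum>i\<in>{1..<k}. c i * p (k - i))" by (simp only: minus_minus)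
  then show ?thesis by (simp only: mult_minus_left add_diff_cancel_right')
qed

lemma coeff_prod_minus:
  fixes as :: "'a::comm_ring_1 list"
  shows "coeff (\<Prod>a\<leftarrow>as. [:1, a:]) k = (- 1) ^ k * coeff (\<Prod>a\<leftarrow>as. [:1, - a:]) k"
proof (induction as arbitrary: k)
  case Nil
  show ?case by (cases k) auto
next
  case (Cons a as)
  then show ?case by (cases k) (simp_all add: algebra_simps)
qed

subsection \<open>Sign variations\<close>

text \<open>Carrying the last nonzero sign along makes zero entries invisible and turns the count of
  sign changes into a recursion over the index.\<close>

fun last_sign :: "(nat \<Rightarrow> 'a::linordered_idom) \<Rightarrow> nat \<Rightarrow> 'a" where
  "last_sign f 0 = sgn (f 0)"
| "last_sign f (Suc k) = (if f (Suc k) = 0 then last_sign f k else sgn (f (Suc k)))"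

fun variations :: "(nat \<Rightarrow> 'a::linordered_idom) \<Rightarrow> nat \<Rightarrow> nat" where
  "variations f 0 = 0"
| "variations f (Suc k) = variations f k + (if last_sign f k * f (Suc k) < 0 then 1 else 0)"

lemma last_sign_cases: "f k = 0 \<or> last_sign f k = sgn (f k)"
  by (cases k) auto

lemma last_sign_unit: "f 0 \<noteq> 0 \<Longrightarrow> last_sign f k = 1 \<or> last_sign f k = - 1"
  by (induction k) (auto simp: sgn_if)

text \<open>The inductive step of Descartes' rule: \<open>g\<close> arises from \<open>f\<close> by
  the factor \<open>1 - \<mu> x\<close>. Where \<open>f\<close> changes sign,
  \<open>f (Suc k)\<close> and \<open>- \<mu> * f k\<close> do not have opposite signs, so
  \<open>g (Suc k)\<close> has the sign of \<open>f (Suc k)\<close>. The clause on last signs keeps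
  the induction going: as long as the counts are equal, it makes a change of \<open>f\<close> a
  change of \<open>g\<close> as well.\<close>

lemma variations_mult_negative:
  fixes f :: "nat \<Rightarrow> 'a::linordered_idom"
  assumes "0 < \<mu>" "f 0 \<noteq> 0" "g 0 = f 0" "\<And>k. g (Suc k) = f (Suc k) - \<mu> * f k"
  shows "variations f k \<le> variations g k \<and>
    (variations f k = variations g k \<longrightarrow> last_sign f k = last_sign g k)"
proof (induction k)
  case 0
  show ?case using assms by simp
next
  case (Suc k)
  have u: "last_sign f k = 1 \<or> last_sign f k = - 1" "last_sign g k = 1 \<or> last_sign g k = - 1"
    using assms(2,3) by (auto intro!: last_sign_unit)
  have fk: "f k = 0 \<or> last_sign f k = sgn (f k)" by (rule last_sign_cases)
  show ?case
  proof (cases "last_sign f k * f (Suc k) < 0")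
    case True
    have "last_sign f k * g (Suc k) < 0 \<and> sgn (g (Suc k)) = sgn (f (Suc k)) \<and> f (Suc k) \<noteq> 0"
    proof (cases "last_sign f k = 1")
      case T: True
      then have "f (Suc k) < 0" "0 \<le> f k" using True fk by (auto simp: sgn_if split: if_splits)
      moreover from this have "0 \<le> \<mu> * f k" using assms(1) by simp
      ultimately show ?thesis using T by (simp add: assms(4) sgn_if)
    next
      case False
      then have T: "last_sign f k = - 1" using u by simp
      then have "f (Suc k) > 0" "f k \<le> 0" using True fk by (auto simp: sgn_if split: if_splits)
      moreover from this have "\<mu> * f k \<le> 0" using assms(1) by (simp add: mult_nonneg_nonpos)
      ultimately show ?thesis using T by (simp add: assms(4) sgn_if)
    qed
    then have *: "last_sign f k * g (Suc k) < 0" "sgn (g (Suc k)) = sgn (f (Suc k))" "f (Suc k) \<noteq> 0"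
      by auto
    then have "g (Suc k) \<noteq> 0" by auto
    with * have ls: "last_sign f (Suc k) = last_sign g (Suc k)" by simp
    have "variations f (Suc k) = Suc (variations f k)" using True by simp
    moreover have "Suc (variations f k) \<le> variations g (Suc k)"
      using Suc *(1) by (cases "variations f k = variations g k") auto
    ultimately show ?thesis using ls by simp
  next
    case False
    have ls: "last_sign f (Suc k) = last_sign f k"
    proof (cases "f (Suc k) = 0")
      case False
      then have "f (Suc k) < 0 \<or> f (Suc k) > 0" by auto
      then show ?thesis using \<open>\<not> last_sign f k * f (Suc k) < 0\<close> u(1)
        by (elim disjE) (simp_all add: sgn_if)
    qed simp
    have f: "variations f (Suc k) = variations f k" using False by simp
    show ?thesis
    proof (cases "variations f (Suc k) = variations g (Suc k)")
      case True
      then have n: "variations g k = variations f k" "\<not> last_sign g k * g (Suc k) < 0"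
        using Suc f by (auto split: if_splits)
      have "last_sign g (Suc k) = last_sign g k"
      proof (cases "g (Suc k) = 0")
        case False
        then have "g (Suc k) < 0 \<or> g (Suc k) > 0" by auto
        then show ?thesis using n(2) u(2) by (elim disjE) (simp_all add: sgn_if)
      qed simp
      then show ?thesis using True Suc n(1) ls by simp
    next
      case False
      then show ?thesis using Suc f by simp
    qed
  qed
qed

text \<open>Between neighbouring nonzero entries exactly one of the two sequences changes sign.
  After zeros both may change at the same index; the second clause records that a step without any
  change has been saved up by then.\<close>

lemma variations_flip:
  fixes f :: "nat \<Rightarrow> 'a::linordered_idom"
  assumes "f 0 \<noteq> 0"
  shows "variations f k + variations (\<lambda>i. (- 1) ^ i * f i) k \<le> k \<and>
    (last_sign (\<lambda>i. (- 1) ^ i * f i) k \<noteq> (- 1) ^ k * last_sign f k \<longrightarrow>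
      variations f k + variations (\<lambda>i. (- 1) ^ i * f i) k < k)"
proof (induction k)
  case (Suc k)
  let ?g = "\<lambda>i. (- 1) ^ i * f i"
  have u: "last_sign f k = 1 \<or> last_sign f k = - 1" "last_sign ?g k = 1 \<or> last_sign ?g k = - 1"
    using assms by (auto intro!: last_sign_unit)
  have e: "(- 1) ^ k = (1::'a) \<or> (- 1) ^ k = (- 1::'a)" by (cases "even k") auto
  show ?case
  proof (cases "f (Suc k) = 0")
    case True
    then show ?thesis using Suc by simp
  next
    case False
    then have "f (Suc k) < 0 \<or> f (Suc k) > 0" by auto
    then show ?thesis using Suc u e by (elim disjE) (simp_all add: sgn_if)
  qed
qed simp

lemma variations_beyond:
  assumes "\<And>i. D < i \<Longrightarrow> f i = 0" "D \<le> k"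
  shows "variations f k = variations f D"
  using assms(2) by (induction k rule: dec_induct) (simp_all add: assms(1))

text \<open>Every factor \<open>1 + a x\<close> with \<open>a < 0\<close> adds a change of sign: the
  count up to the old degree does not drop, and if it does not grow there, the new leading
  coefficient has the sign opposite to the last one.\<close>

lemma degree_prod_negative:
  fixes G :: "'a::linordered_idom poly"
  assumes "coeff G 0 = 1" "\<forall>a\<in>set as. a < 0"
  shows "coeff ((\<Prod>a\<leftarrow>as. [:1, a:]) * G) 0 = 1 \<and>
    degree ((\<Prod>a\<leftarrow>as. [:1, a:]) * G) = length as + degree G \<and>
    length as \<le> variations (coeff ((\<Prod>a\<leftarrow>as. [:1, a:]) * G)) (length as + degree G)"
  using assms(2)
proof (induction as)
  case Nil
  then show ?case using assms(1) by simp
next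
  case (Cons a as)
  let ?F = "(\<Prod>a\<leftarrow>as. [:1, a:]) * G"
  let ?D = "length as + degree G"
  have F: "coeff ?F 0 = 1" "degree ?F = ?D" "length as \<le> variations (coeff ?F) ?D"
    using Cons by auto
  have F0: "?F \<noteq> 0" using F(1) by (metis coeff_0 zero_neq_one)
  have a: "a < 0" using Cons.prems by simp
  have eq: "(\<Prod>a\<leftarrow>a # as. [:1, a:]) * G = [:1, a:] * ?F" by (simp only: list.map prod_list.Cons mult.assoc)
  have c: "coeff ([:1, a:] * ?F) 0 = 1" "coeff ([:1, a:] * ?F) (Suc k) = coeff ?F (Suc k) - (- a) * coeff ?F k" for k
    using F(1) by simp_all
  have d: "degree ([:1, a:] * ?F) = Suc ?D"
    using F0 a F(2) by (subst degree_mult_eq) auto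
  have "Suc (length as) \<le> variations (coeff ([:1, a:] * ?F)) (Suc ?D)"
  proof -
    have lead: "coeff ?F ?D \<noteq> 0" using F0 F(2) by (metis leading_coeff_0_iff)
    have z: "coeff ?F (Suc ?D) = 0" by (rule coeff_eq_0) (simp add: F(2))
    have v: "variations (coeff ?F) ?D \<le> variations (coeff ([:1, a:] * ?F)) ?D"
      "variations (coeff ?F) ?D = variations (coeff ([:1, a:] * ?F)) ?D \<longrightarrow>
        last_sign (coeff ?F) ?D = last_sign (coeff ([:1, a:] * ?F)) ?D"
      using variations_mult_negative[of "- a" "coeff ?F" "coeff ([:1, a:] * ?F)" ?D] a c F(1) by auto
    show ?thesis
    proof (cases "variations (coeff ?F) ?D = variations (coeff ([:1, a:] * ?F)) ?D")
      case True
      then have "last_sign (coeff ([:1, a:] * ?F)) ?D = sgn (coeff ?F ?D)"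
        using v(2) last_sign_cases[of "coeff ?F" ?D] lead by auto
      moreover have "coeff ([:1, a:] * ?F) (Suc ?D) = a * coeff ?F ?D" unfolding c(2) z by simp
      moreover have "sgn (coeff ?F ?D) * (a * coeff ?F ?D) < 0"
        using a lead by (auto simp: sgn_if mult_neg_pos mult_neg_neg mult_pos_neg)
      ultimately show ?thesis using F(3) True by (simp del: mult_pCons_left)
    next
      case False
      then show ?thesis using F(3) v(1) by (simp del: mult_pCons_left)
    qed
  qed
  with c(1) d show ?case unfolding eq length_Cons add_Suc by (intro conjI)
qed

text \<open>
  Descartes' rule of signs is exact if all roots are real: it bounds the numbers of negative and of
  positive \<open>a\<close> from above, and the two bounds add up to at most the degree.
\<close>

lemma variations_real_rooted:
  fixes as :: "'a::linordered_idom list"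
  shows "variations (coeff (\<Prod>a\<leftarrow>as. [:1, a:])) (length as) = length (filter (\<lambda>a. a < 0) as)"
proof -
  define ns ps where "ns = filter (\<lambda>a. a < 0) as" and "ps = filter (\<lambda>a. 0 < a) as"
  define F where "F = (\<Prod>a\<leftarrow>as. [:1, a:])"
  define f where "f = coeff F"
  let ?N = "\<Prod>a\<leftarrow>ns. [:1, a:]" and ?P = "\<Prod>a\<leftarrow>ps. [:1, a:]"
  have F: "F = ?N * ?P"
    unfolding F_def ns_def ps_def by (induction as) (auto simp: mult_ac not_less one_pCons[symmetric] simp del: mult_pCons_left mult_pCons_right)
  have P0: "coeff (\<Prod>a\<leftarrow>xs. [:1, a:]) 0 = 1" for xs :: "'a list"
    by (induction xs) auto
  have degP: "degree (\<Prod>a\<leftarrow>xs. [:1, a:]) = length xs" if "\<forall>a\<in>set xs. a \<noteq> 0" for xs :: "'a list"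
    using that
  proof (induction xs)
    case (Cons a xs)
    have "(\<Prod>a\<leftarrow>xs. [:1, a:]) \<noteq> 0" using P0[of xs] by (metis coeff_0 zero_neq_one)
    then show ?case using Cons by (simp add: degree_mult_eq del: mult_pCons_left)
  qed simp
  let ?D = "length ns + length ps"
  have ns: "\<forall>a\<in>set ns. a < 0" and ps: "\<forall>a\<in>set ps. a \<noteq> 0" and ps': "\<forall>a\<in>set (map uminus ps). a < 0"
    and ns': "\<forall>a\<in>set (map uminus ns). a \<noteq> 0"
    unfolding ns_def ps_def by auto
  note 1 = degree_prod_negative[OF P0[of ps] ns, folded F, folded f_def, unfolded degP[OF ps]]
  have flip: "coeff (\<Prod>a\<leftarrow>map uminus xs. [:1, a:]) k = (- 1) ^ k * coeff (\<Prod>a\<leftarrow>xs. [:1, a:]) k" for xs :: "'a list" and k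
    using coeff_prod_minus[of "map uminus xs" k] by (simp add: comp_def)
  have "coeff ((\<Prod>a\<leftarrow>map uminus ps. [:1, a:]) * (\<Prod>a\<leftarrow>map uminus ns. [:1, a:])) k = (- 1) ^ k * f k" for k
    using flip[of "ps @ ns" k] by (simp only: map_append prod_list.append F f_def mult.commute)
  then have g: "coeff ((\<Prod>a\<leftarrow>map uminus ps. [:1, a:]) * (\<Prod>a\<leftarrow>map uminus ns. [:1, a:])) = (\<lambda>k. (- 1) ^ k * f k)"
    by blast
  \<comment> \<open>The positive members become negative ones after the substitution of
    \<open>-x\<close> for \<open>x\<close>, so they force changes of sign in the flipped
    sequence.\<close>
  have 2: "length ps \<le> variations (\<lambda>k. (- 1) ^ k * f k) ?D"
    using degree_prod_negative[OF P0[of "map uminus ns"] ps', unfolded g degP[OF ns']]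
    by (simp only: length_map add.commute)
  have "variations f ?D + variations (\<lambda>k. (- 1) ^ k * f k) ?D \<le> ?D"
    using variations_flip[of f ?D] 1 by simp
  then have "variations f ?D = length ns" using 1 2 by linarith
  \<comment> \<open>Members equal to 0 contribute the factor 1, so the degree \<open>?D\<close> may
    be smaller than the length; beyond the degree no changes are added.\<close>
  moreover have "?D \<le> length as"
    unfolding ns_def ps_def by (induction as) auto
  then have "variations f (length as) = variations f ?D"
    using 1 by (intro variations_beyond) (auto simp: f_def intro: coeff_eq_0)
  ultimately show ?thesis by (simp add: f_def F_def ns_def)
qed

text \<open>A sequence of nonnegative coefficients starting with 1 has no change of sign, and by the
  exact rule of signs the number of changes is the number of negative \<open>a\<close>.\<close>

lemma nonneg_iff_coeffs_nonneg:
  fixes as :: "real list"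
  shows "(\<forall>a\<in>set as. 0 \<le> a) \<longleftrightarrow> (\<forall>k\<le>length as. 0 \<le> coeff (\<Prod>a\<leftarrow>as. [:1, a:]) k)"
proof
  assume "\<forall>a\<in>set as. 0 \<le> a"
  then have "0 \<le> coeff (\<Prod>a\<leftarrow>as. [:1, a:]) k" for k
  proof (induction as arbitrary: k)
    case Nil
    show ?case by (cases k) auto
  next
    case (Cons a as)
    then show ?case by (cases k) auto
  qed
  then show "\<forall>k\<le>length as. 0 \<le> coeff (\<Prod>a\<leftarrow>as. [:1, a:]) k" by blast
next
  let ?F = "coeff (\<Prod>a\<leftarrow>as. [:1, a:])"
  assume nn: "\<forall>k\<le>length as. 0 \<le> ?F k"
  have f0: "?F 0 = 1" by (induction as) auto
  have "k \<le> length as \<Longrightarrow> variations ?F k = 0 \<and> last_sign ?F k = 1" for k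
  proof (induction k)
    case (Suc k)
    then have "0 \<le> ?F (Suc k)" using nn by blast
    then show ?case using Suc by (auto simp: sgn_if)
  qed (simp add: f0)
  then have "length (filter (\<lambda>a. a < 0) as) = 0" using variations_real_rooted[of as] by simp
  then show "\<forall>a\<in>set as. 0 \<le> a" by (auto simp: filter_empty_conv not_less)
qed

section \<open>Hermite's quadratic form of a real polynomial\<close>

lemma sum_list_sum_swap:
  "(\<Sum>a\<leftarrow>as. \<Sum>i\<in>I. f a i) = (\<Sum>i\<in>I. \<Sum>a\<leftarrow>as. (f a i :: 'b::comm_monoid_add))"
  by (induction as) (simp_all add: sum.distrib)

lemma sum_list_count:
  fixes f :: "'a \<Rightarrow> 'b::comm_semiring_1"
  shows "(\<Sum>a\<leftarrow>as. f a) = (\<Sum>a\<in>set as. of_nat (count_list as a) * f a)"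
proof (induction as)
  case (Cons a as)
  have "(\<Sum>b\<in>set (a # as). of_nat (count_list (a # as) b) * f b) =
      (\<Sum>b\<in>set (a # as). (if b = a then f b else 0) + of_nat (count_list as b) * f b)"
    by (intro sum.cong) (auto simp: algebra_simps)
  also have "\<dots> = f a + (\<Sum>b\<in>set (a # as). of_nat (count_list as b) * f b)"
    by (simp add: sum.distrib sum.delta')
  also have "(\<Sum>b\<in>set (a # as). of_nat (count_list as b) * f b) = (\<Sum>b\<in>set as. of_nat (count_list as b) * f b)"
    by (rule sum.mono_neutral_right) (auto simp: count_list_0_iff)
  finally show ?case using Cons by simp
qed simp

lemma order_linear_factors:
  fixes as :: "'a::idom list"
  shows "order x (\<Prod>a\<leftarrow>as. [:- a, 1:]) = count_list as x"
proof (induction as)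
  case (Cons a as)
  have "(\<Prod>a\<leftarrow>as. [:- a, 1:]) \<noteq> 0" by (auto simp: prod_list_zero_iff)
  then have nz: "[:- a, 1:] * (\<Prod>a\<leftarrow>as. [:- a, 1:]) \<noteq> 0" by (metis mult_eq_0_iff pCons_eq_0_iff one_neq_zero)
  have "order x [:- a, 1:] = (if a = x then 1 else 0)"
    using order_power_n_n[of x 1] by (auto intro: order_0I)
  then show ?case unfolding list.map prod_list.Cons order_mult[OF nz] using Cons by simp
qed (simp add: order_0I)

abbreviation cpoly :: "real poly \<Rightarrow> complex \<Rightarrow> complex" where
  "cpoly q z \<equiv> poly (map_poly complex_of_real q) z"

lemma cpoly_sum: "degree q < K \<Longrightarrow> cpoly q z = (\<Sum>k<K. of_real (coeff q k) * z ^ k)"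
proof -
  assume "degree q < K"
  then have "degree (map_poly complex_of_real q) < K" by simp
  then have "cpoly q z = (\<Sum>k<K. coeff (map_poly complex_of_real q) k * z ^ k)"
    unfolding poly_altdef by (intro sum.mono_neutral_left) (auto intro: coeff_eq_0)
  then show ?thesis by (simp add: coeff_map_poly)
qed

lemma cpoly_cnj: "cpoly q (cnj z) = cnj (cpoly q z)"
  by (simp add: cpoly_sum[of q "Suc (degree q)"])

lemma cpoly_of_real: "cpoly q (of_real x) = of_real (poly q x)"
proof -
  have "of_real (poly q x) = (\<Sum>k<Suc (degree q). complex_of_real (coeff q k) * of_real x ^ k)"
    unfolding poly_altdef by (simp add: lessThan_Suc_atMost del: sum.lessThan_Suc)
  then show ?thesis by (simp add: cpoly_sum[of q "Suc (degree q)"] del: sum.lessThan_Suc)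
qed

lemma cpoly_mult: "cpoly (p * q) z = cpoly p z * cpoly q z"
proof -
  have "map_poly complex_of_real (p * q) = map_poly complex_of_real p * map_poly complex_of_real q"
    by (intro poly_eqI) (simp add: coeff_map_poly coeff_mult)
  then show ?thesis by simp
qed

text \<open>The complex roots form a list with multiplicities, because power sums obtained from
  coefficients count roots with multiplicity.\<close>

locale real_poly_roots =
  fixes h :: "real poly" and as :: "complex list" and c :: real
  assumes factors: "map_poly complex_of_real h = smult (of_real c) (\<Prod>a\<leftarrow>as. [:- a, 1:])"
    and c: "c \<noteq> 0"
begin

text \<open>Conjugating all roots yields another factorization of the same real polynomial, and
  multiplicities are orders of roots, which do not depend on the factorization.\<close>

lemma count_cnj: "count_list as (cnj a) = count_list as a"
proof -
  have "map_poly complex_of_real h = smult (of_real c) (\<Prod>a\<leftarrow>map cnj as. [:- a, 1:])"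
  proof (rule poly_eq_poly_eq_iff[THEN iffD1], rule ext)
    fix z
    have *: "poly (\<Prod>a\<leftarrow>map cnj xs. [:- a, 1:]) z = cnj (poly (\<Prod>a\<leftarrow>xs. [:- a, 1:]) (cnj z))" for xs
      by (induction xs) simp_all
    have "cpoly h z = cnj (cpoly h (cnj z))" by (simp add: cpoly_cnj)
    also have "\<dots> = poly (smult (of_real c) (\<Prod>a\<leftarrow>map cnj as. [:- a, 1:])) z"
      unfolding factors poly_smult * by simp
    finally show "cpoly h z = poly (smult (of_real c) (\<Prod>a\<leftarrow>map cnj as. [:- a, 1:])) z" .
  qed
  then have "smult (complex_of_real c) (\<Prod>a\<leftarrow>as. [:- a, 1:]) = smult (of_real c) (\<Prod>a\<leftarrow>map cnj as. [:- a, 1:])"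
    using factors by simp
  moreover have "p = q" if "smult (complex_of_real c) p = smult (of_real c) q" for p q
    using arg_cong[OF that, of "smult (inverse (complex_of_real c))"] c by simp
  ultimately have "(\<Prod>a\<leftarrow>as. [:- a, 1:]) = (\<Prod>a\<leftarrow>map cnj as. [:- a, 1:])" by blast
  then have "count_list as (cnj a) = count_list (map cnj as) (cnj a)"
    using order_linear_factors[of "cnj a" as] order_linear_factors[of "cnj a" "map cnj as"] by (simp only:)
  also have "\<dots> = count_list as a" by (induction as) auto
  finally show ?thesis .
qed

lemma cnj_root: "a \<in> set as \<Longrightarrow> cnj a \<in> set as"
  using count_cnj[of a] by (metis count_list_0_iff)

lemma root_iff: "a \<in> set as \<longleftrightarrow> cpoly h a = 0"
  unfolding factors using c by (simp add: poly_prod_list_zero_iff) 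

lemma power_sum_real: "(\<Sum>a\<leftarrow>as. a ^ j) \<in> \<real>"
proof -
  have s: "(\<Sum>a\<leftarrow>as. a ^ j) = (\<Sum>a\<in>set as. of_nat (count_list as a) * a ^ j)" by (rule sum_list_count)
  have "cnj (\<Sum>a\<in>set as. of_nat (count_list as a) * a ^ j) = (\<Sum>a\<in>set as. of_nat (count_list as (cnj a)) * cnj a ^ j)"
    by (simp add: count_cnj)
  also have "\<dots> = (\<Sum>a\<in>set as. of_nat (count_list as a) * a ^ j)"
    by (rule sum.reindex_bij_witness[of _ cnj cnj]) (auto simp: cnj_root)
  finally show ?thesis unfolding s by (simp add: Reals_cnj_iff)
qed

text \<open>The number of negative squares of the Hermite form.\<close>

definition negative_count :: "real poly \<Rightarrow> nat" where
  "negative_count q = card {a\<in>set as. Im a = 0 \<and> poly q (Re a) < 0} + card {a\<in>set as. Im a < 0 \<and> cpoly q a \<noteq> 0}"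

text \<open>Lagrange interpolation gives a complex polynomial \<open>p\<close> with value
  \<open>z\<close> at \<open>a\<close> and 0 at the other roots. The sum of \<open>p\<close> and its
  coefficientwise conjugate is real and has the values \<open>z\<close> at \<open>a\<close> and
  \<open>cnj z\<close> at \<open>cnj a\<close>. At a real \<open>a\<close> both summands contribute
  \<open>z\<close>, so half of the sum is taken there, that is, the real parts of the
  coefficients.\<close>

lemma interpolation:
  assumes a: "a \<in> set as" and z: "Im a = 0 \<Longrightarrow> Im z = 0" and m: "card (set as) \<le> m"
  shows "\<exists>v. \<forall>b\<in>set as. (\<Sum>i<m. of_real (v i) * b ^ i) = (if b = a then z else if b = cnj a then cnj z else 0)"
proof -
  let ?R = "set as - {a}"
  define w where "w = (\<Prod>b\<in>?R. a - b)"
  have w: "w \<noteq> 0" unfolding w_def by (auto simp: prod_zero_iff)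
  define p where "p = smult (z / w) (\<Prod>b\<in>?R. [:- b, 1:])"
  have pb: "poly p b = (if b = a then z else 0)" if "b \<in> set as" for b
  proof (cases "b = a")
    case True
    then show ?thesis using w by (simp add: p_def poly_prod w_def)
  next
    case False
    then have "b \<in> ?R" using that by simp
    then have "(\<Prod>b'\<in>?R. poly [:- b', 1:] b) = 0" by (intro prod_zero) auto
    then show ?thesis using False by (simp add: p_def poly_prod)
  qed
  have "degree (\<Prod>b\<in>?R. [:- b, 1:]) = card ?R"
    by (subst degree_prod_eq_sum_degree) auto
  moreover have "card ?R < card (set as)" using a by (intro psubset_card_mono) auto
  ultimately have "degree p < m" using m degree_smult_le[of "z / w" "\<Prod>b\<in>?R. [:- b, 1:]"] by (simp add: p_def)
  then have ps: "poly p b = (\<Sum>i<m. coeff p i * b ^ i)" for b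
    unfolding poly_altdef by (intro sum.mono_neutral_left) (auto intro: coeff_eq_0)
  have re: "(\<Sum>i<m. of_real (2 * Re (coeff p i)) * b ^ i) = poly p b + cnj (poly p (cnj b))" for b
  proof -
    have "cnj (poly p (cnj b)) = (\<Sum>i<m. cnj (coeff p i) * b ^ i)" by (simp add: ps)
    then show ?thesis
      by (simp add: ps sum.distrib[symmetric] distrib_right[symmetric] complex_add_cnj)
  qed
  show ?thesis
  proof (cases "Im a = 0")
    case True
    then have ca: "cnj a = a" "cnj z = z" using z by (simp_all add: complex_eq_iff)
    have "(\<Sum>i<m. of_real (Re (coeff p i)) * b ^ i) = (if b = a then z else 0)" if b: "b \<in> set as" for b
    proof -
      have "2 * (\<Sum>i<m. of_real (Re (coeff p i)) * b ^ i) = (\<Sum>i<m. of_real (2 * Re (coeff p i)) * b ^ i)"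
        by (simp add: sum_distrib_left mult_ac)
      also have "\<dots> = (if b = a then 2 * z else 0)"
      proof -
        have "cnj b = a \<longleftrightarrow> b = a" using ca by (metis complex_cnj_cnj)
        then show ?thesis unfolding re using pb[OF b] pb[OF cnj_root[OF b]] ca by simp
      qed
      finally show ?thesis by (auto split: if_splits)
    qed
    then show ?thesis using ca by (intro exI[of _ "\<lambda>i. Re (coeff p i)"]) simp
  next
    case False
    then have "cnj a \<noteq> a" by (simp add: complex_eq_iff)
    moreover have "cnj b = a \<longleftrightarrow> b = cnj a" for b by auto
    ultimately show ?thesis
      using pb cnj_root by (intro exI[of _ "\<lambda>i. 2 * Re (coeff p i)"]) (simp only: re, auto)
  qed
qed

lemma sum_conjugate_pairs:
  fixes F :: "complex \<Rightarrow> real"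
  assumes "S \<subseteq> set as" "\<And>a. a \<in> S \<Longrightarrow> cnj a \<in> S"
  shows "sum F S = sum F {a\<in>S. Im a = 0} + (\<Sum>a\<in>{a\<in>S. 0 < Im a}. F a + F (cnj a))"
proof -
  have fin: "finite S" using assms(1) finite_subset by blast
  have "sum F S = sum F ({a\<in>S. Im a = 0} \<union> ({a\<in>S. 0 < Im a} \<union> {a\<in>S. Im a < 0}))"
    by (rule arg_cong[of _ _ "sum F"]) auto
  also have "\<dots> = sum F {a\<in>S. Im a = 0} + sum F ({a\<in>S. 0 < Im a} \<union> {a\<in>S. Im a < 0})"
    by (rule sum.union_disjoint) (use fin in auto)
  also have "sum F ({a\<in>S. 0 < Im a} \<union> {a\<in>S. Im a < 0}) = sum F {a\<in>S. 0 < Im a} + sum F {a\<in>S. Im a < 0}"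
    by (rule sum.union_disjoint) (use fin in auto)
  finally have "sum F S = sum F {a\<in>S. Im a = 0} + (sum F {a\<in>S. 0 < Im a} + sum F {a\<in>S. Im a < 0})" .
  moreover have "sum F {a\<in>S. Im a < 0} = (\<Sum>a\<in>{a\<in>S. 0 < Im a}. F (cnj a))"
    by (rule sum.reindex_bij_witness[of _ cnj cnj]) (auto simp: assms(2))
  ultimately show ?thesis by (simp add: sum.distrib)
qed

text \<open>By linearity in the power sums, the entry \<open>H i j\<close> is the sum of
  \<open>q(a) * a^i * a^j\<close> over the roots, so the form is a sum of \<open>q(a)\<close> times
  squares. The matrix is padded with zeros to the size \<open>M\<close>, because the program works
  with a size known from the format, whereas the number of roots is only bounded by it.\<close>

lemma hermite_form:
  fixes N :: "nat \<Rightarrow> real"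
  assumes N: "\<And>j. of_real (N j) = (\<Sum>a\<leftarrow>as. a ^ j)"
    and K: "degree q < K" and mM: "length as \<le> M"
    and H: "\<And>i j. i < M \<Longrightarrow> j < M \<Longrightarrow>
      H i j = (if i < length as \<and> j < length as then \<Sum>k<K. coeff q k * N (k + i + j) else 0)"
  shows "(\<Sum>i<M. \<Sum>j<M. v i * H i j * v j) =
    (\<Sum>a\<in>set as. Re (of_nat (count_list as a) * (cpoly q a * (\<Sum>i<length as. of_real (v i) * a ^ i)\<^sup>2)))"
proof -
  let ?m = "length as"
  define t where "t a i j k = complex_of_real (v i) * a ^ i * (of_real (v j) * a ^ j) * (of_real (coeff q k) * a ^ k)" for a i j k
  have "(\<Sum>i<M. \<Sum>j<M. v i * H i j * v j) = (\<Sum>i<?m. \<Sum>j<M. v i * H i j * v j)"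
    using mM by (intro sum.mono_neutral_right) (auto simp: H)
  also have "\<dots> = (\<Sum>i<?m. \<Sum>j<?m. v i * H i j * v j)"
    using mM by (intro sum.cong sum.mono_neutral_right) (auto simp: H)
  also have "\<dots> = (\<Sum>i<?m. \<Sum>j<?m. v i * (\<Sum>k<K. coeff q k * N (k + i + j)) * v j)"
    using mM by (intro sum.cong refl) (auto simp: H)
  finally have 1: "complex_of_real (\<Sum>i<M. \<Sum>j<M. v i * H i j * v j) =
      (\<Sum>i<?m. \<Sum>j<?m. \<Sum>k<K. of_real (v i) * (of_real (coeff q k) * (\<Sum>a\<leftarrow>as. a ^ (k + i + j))) * of_real (v j))"
    by (simp add: sum_distrib_left sum_distrib_right N)
  have "of_real (v i) * (of_real (coeff q k) * (\<Sum>a\<leftarrow>as. a ^ (k + i + j))) * of_real (v j) = (\<Sum>a\<leftarrow>as. t a i j k)" for i j k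
  proof -
    have "x * (y * (\<Sum>a\<leftarrow>as. f a)) * z = (\<Sum>a\<leftarrow>as. x * (y * f a) * z)" for x y z :: complex and f
      by (induction as) (simp_all add: algebra_simps)
    moreover have "of_real (v i) * (of_real (coeff q k) * a ^ (k + i + j)) * of_real (v j) = t a i j k" for a
      by (simp add: t_def power_add mult_ac)
    ultimately show ?thesis by simp
  qed
  then have "complex_of_real (\<Sum>i<M. \<Sum>j<M. v i * H i j * v j) =
      (\<Sum>a\<leftarrow>as. \<Sum>i<?m. \<Sum>j<?m. \<Sum>k<K. t a i j k)"
    unfolding 1 sum_list_sum_swap by simp
  also have "(\<lambda>a. \<Sum>i<?m. \<Sum>j<?m. \<Sum>k<K. t a i j k) = (\<lambda>a. cpoly q a * (\<Sum>i<?m. of_real (v i) * a ^ i)\<^sup>2)"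
  proof
    fix a
    have "(\<Sum>i<?m. \<Sum>j<?m. \<Sum>k<K. t a i j k) =
        (\<Sum>i<?m. \<Sum>j<?m. of_real (v i) * a ^ i * (of_real (v j) * a ^ j)) * (\<Sum>k<K. of_real (coeff q k) * a ^ k)"
      unfolding t_def sum_distrib_right unfolding sum_distrib_left ..
    moreover have "(\<Sum>i<?m. of_real (v i) * a ^ i)\<^sup>2 =
        (\<Sum>i<?m. \<Sum>j<?m. of_real (v i) * a ^ i * (of_real (v j) * a ^ j))"
      by (simp only: power2_eq_square sum_product)
    ultimately show "(\<Sum>i<?m. \<Sum>j<?m. \<Sum>k<K. t a i j k) = cpoly q a * (\<Sum>i<?m. of_real (v i) * a ^ i)\<^sup>2"
      by (simp only: cpoly_sum[OF K] mult.commute)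
  qed
  also have "(\<Sum>a\<leftarrow>as. cpoly q a * (\<Sum>i<?m. of_real (v i) * a ^ i)\<^sup>2) =
      (\<Sum>a\<in>set as. of_nat (count_list as a) * (cpoly q a * (\<Sum>i<?m. of_real (v i) * a ^ i)\<^sup>2))"
    by (rule sum_list_count)
  finally have "complex_of_real (\<Sum>i<M. \<Sum>j<M. v i * H i j * v j) =
      (\<Sum>a\<in>set as. of_nat (count_list as a) * (cpoly q a * (\<Sum>i<?m. of_real (v i) * a ^ i)\<^sup>2))" .
  from arg_cong[OF this, of Re] show ?thesis by (simp only: Re_complex_of_real Re_sum)
qed

text \<open>
  Diagonalising the Hermite form: a real root contributes one square, a pair of conjugate roots
  contributes \<open>2 * Re (z\<^sup>2) = 2 * (Re z)\<^sup>2 - 2 * (Im z)\<^sup>2\<close>, indexed by the two roots.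
\<close>

lemma hermite_inertia:
  fixes N :: "nat \<Rightarrow> real"
  assumes N: "\<And>j. of_real (N j) = (\<Sum>a\<leftarrow>as. a ^ j)"
    and K: "degree q < K" and mM: "length as \<le> M"
    and H: "\<And>i j. i < M \<Longrightarrow> j < M \<Longrightarrow>
      H i j = (if i < length as \<and> j < length as then \<Sum>k<K. coeff q k * N (k + i + j) else 0)"
    and u: "\<And>a b. a < M \<Longrightarrow> b < M \<Longrightarrow> (\<Sum>i<M. u a i * u b i) = (if a = b then 1 else 0)"
    and diag: "\<And>v. (\<Sum>i<M. \<Sum>j<M. v i * H i j * v j) = (\<Sum>a<M. l a * (\<Sum>i<M. u a i * v i)\<^sup>2)"
  shows "card {a\<in>{..<M}. l a < 0} = negative_count q"
proof -
  let ?m = "length as"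
  define rt where "rt = csqrt"
  have rt: "(rt z)\<^sup>2 = z" "rt z = 0 \<longleftrightarrow> z = 0" for z by (simp_all add: rt_def)
  define S where "S = {a\<in>set as. cpoly q a \<noteq> 0}"
  define cnt where "cnt a = real (count_list as a)" for a
  define x where "x a = (if Im a = 0 then cnt a * Re (cpoly q a) else if 0 < Im a then 2 * cnt a else - 2 * cnt a)" for a
  \<comment> \<open>At a nonreal root, \<open>rt\<close> moves \<open>q(a)\<close> under the square,
    so that the weight \<open>x\<close> depends on the multiplicity alone. The root in the upper
    half plane carries the real part of the resulting complex form, its conjugate the imaginary part
    of that same form.\<close>
  define L where "L a i = (if i < ?m then
      (if Im a = 0 then Re (a ^ i) else if 0 < Im a then Re (rt (cpoly q a) * a ^ i)
       else Im (rt (cpoly q (cnj a)) * cnj a ^ i)) else 0)" for a i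
  define val where "val v a = (\<Sum>i<?m. complex_of_real (v i) * a ^ i)" for v a
  have S: "S \<subseteq> set as" "finite S" by (auto simp: S_def)
  have cnjS: "cnj a \<in> S" if "a \<in> S" for a using that by (simp add: S_def cnj_root cpoly_cnj)
  have cnt: "cnt a > 0" if "a \<in> S" for a
    using that by (auto simp: cnt_def S_def count_list_0_iff intro: gr0I)
  have Lv: "(\<Sum>i<M. L a i * v i) = (if Im a = 0 then Re (val v a)
      else if 0 < Im a then Re (rt (cpoly q a) * val v a) else Im (rt (cpoly q (cnj a)) * val v (cnj a)))" for a v
  proof -
    have "(\<Sum>i<M. L a i * v i) = (\<Sum>i<?m. L a i * v i)"
      using mM by (intro sum.mono_neutral_right) (auto simp: L_def)
    also have "\<dots> = (if Im a = 0 then (\<Sum>i<?m. Re (a ^ i) * v i)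
      else if 0 < Im a then (\<Sum>i<?m. Re (rt (cpoly q a) * a ^ i) * v i)
      else (\<Sum>i<?m. Im (rt (cpoly q (cnj a)) * cnj a ^ i) * v i))"
      by (simp add: L_def)
    also have "\<dots> = (if Im a = 0 then Re (val v a)
      else if 0 < Im a then Re (rt (cpoly q a) * val v a) else Im (rt (cpoly q (cnj a)) * val v (cnj a)))"
    proof -
      have r: "Re (z * val v b) = (\<Sum>i<?m. Re (z * b ^ i) * v i)"
        and i: "Im (z * val v b) = (\<Sum>i<?m. Im (z * b ^ i) * v i)" for z b
        by (simp_all add: val_def sum_distrib_left sum_distrib_right algebra_simps sum_subtractf sum.distrib)
      show ?thesis using r[of 1 a] by (simp only: r i mult_1_left)
    qed
    finally show ?thesis .
  qed
  have val_cnj: "val v (cnj a) = cnj (val v a)" for v a by (simp add: val_def)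
  define g where "g v a = Re (of_nat (count_list as a) * (cpoly q a * (val v a)\<^sup>2))" for v a
  have gcnj: "g v (cnj a) = g v a" for v a
  proof -
    have "of_nat (count_list as (cnj a)) * (cpoly q (cnj a) * (val v (cnj a))\<^sup>2) =
        cnj (of_nat (count_list as a) * (cpoly q a * (val v a)\<^sup>2))"
      by (simp add: count_cnj cpoly_cnj val_cnj)
    then show ?thesis unfolding g_def by (simp only: cnj.sel)
  qed
  have form: "(\<Sum>a\<in>S. x a * (\<Sum>i<M. L a i * v i)\<^sup>2) = (\<Sum>a<M. l a * (\<Sum>i<M. u a i * v i)\<^sup>2)" for v
  proof -
    have "(\<Sum>a<M. l a * (\<Sum>i<M. u a i * v i)\<^sup>2) = (\<Sum>a\<in>set as. g v a)"
      unfolding diag[symmetric] g_def val_def by (rule hermite_form[OF N K mM H])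
    also have "\<dots> = sum (g v) S"
      by (rule sum.mono_neutral_right) (auto simp: S_def g_def)
    also have "\<dots> = sum (g v) {a\<in>S. Im a = 0} + (\<Sum>a\<in>{a\<in>S. 0 < Im a}. g v a + g v (cnj a))"
      by (rule sum_conjugate_pairs[OF S(1) cnjS])
    also have "sum (g v) {a\<in>S. Im a = 0} = (\<Sum>a\<in>{a\<in>S. Im a = 0}. x a * (\<Sum>i<M. L a i * v i)\<^sup>2)"
    proof (rule sum.cong[OF refl])
      fix a assume "a \<in> {a\<in>S. Im a = 0}"
      then have im: "Im a = 0" by simp
      then have "cnj a = a" by (simp add: complex_eq_iff)
      then have "Im (cpoly q a) = 0" "Im (val v a) = 0"
        using arg_cong[OF cpoly_cnj[of q a], of Im] arg_cong[OF val_cnj[of v a], of Im] by simp_all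
      then have "g v a = cnt a * Re (cpoly q a) * (Re (val v a))\<^sup>2"
        unfolding g_def cnt_def by (simp add: power2_eq_square)
      then show "g v a = x a * (\<Sum>i<M. L a i * v i)\<^sup>2" unfolding Lv using im by (simp add: x_def)
    qed
    also have "(\<Sum>a\<in>{a\<in>S. 0 < Im a}. g v a + g v (cnj a)) =
        (\<Sum>a\<in>{a\<in>S. 0 < Im a}. x a * (\<Sum>i<M. L a i * v i)\<^sup>2 + x (cnj a) * (\<Sum>i<M. L (cnj a) i * v i)\<^sup>2)"
    proof (rule sum.cong[OF refl])
      fix a assume "a \<in> {a\<in>S. 0 < Im a}"
      then have im: "0 < Im a" by simp
      let ?z = "rt (cpoly q a) * val v a"
      have z2: "cpoly q a * (val v a)\<^sup>2 = ?z\<^sup>2" by (simp only: power_mult_distrib rt)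
      have re2: "Re (of_nat k * z\<^sup>2) = real k * ((Re z)\<^sup>2 - (Im z)\<^sup>2)" for k z
        by (simp add: power2_eq_square)
      have eq: "k * (X - Y) + k * (X - Y) = 2 * k * X + - 2 * k * Y" for k X Y :: real
        by (simp add: algebra_simps)
      have ga: "g v a = cnt a * ((Re ?z)\<^sup>2 - (Im ?z)\<^sup>2)"
        unfolding g_def cnt_def z2 by (rule re2)
      then show "g v a + g v (cnj a) = x a * (\<Sum>i<M. L a i * v i)\<^sup>2 + x (cnj a) * (\<Sum>i<M. L (cnj a) i * v i)\<^sup>2"
      proof -
        have "(\<Sum>i<M. L a i * v i) = Re ?z" "(\<Sum>i<M. L (cnj a) i * v i) = Im ?z"
          unfolding Lv using im by (simp_all)
        moreover have "x a = 2 * cnt a" "x (cnj a) = - 2 * cnt a"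
          using im by (simp_all add: x_def cnt_def count_cnj)
        ultimately show ?thesis
          by (simp only: gcnj ga eq)
      qed
    qed
    also have "(\<Sum>a\<in>{a\<in>S. Im a = 0}. x a * (\<Sum>i<M. L a i * v i)\<^sup>2) + \<dots> =
        (\<Sum>a\<in>S. x a * (\<Sum>i<M. L a i * v i)\<^sup>2)"
      by (rule sum_conjugate_pairs[OF S(1) cnjS, symmetric])
    finally show ?thesis by simp
  qed
  \<comment> \<open>Dual vectors come from interpolation. The prescribed value is 1 at a real root,
    \<open>1 / ?c\<close> at an upper root and \<open>\<i> / ?c\<close> at the conjugate of a lower
    one, so that after multiplication by \<open>?c\<close> exactly the wanted one of real and
    imaginary part is 1 and the other is 0.\<close>
  have "\<exists>v. \<forall>a'\<in>S. (\<Sum>i<M. L a' i * v i) = (if a' = a then 1 else 0)" if a: "a \<in> S" for a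
  proof -
    have aR: "a \<in> set as" "cnj a \<in> set as" "cpoly q a \<noteq> 0" "cpoly q (cnj a) \<noteq> 0"
      using a cnjS[OF a] by (auto simp: S_def)
    note interp = interpolation[OF _ _ card_length[of as], folded val_def]
    consider "Im a = 0" | "0 < Im a" | "Im a < 0" by linarith
    then show ?thesis
    proof cases
      case 1
      then have ca: "cnj a = a" by (simp add: complex_eq_iff)
      have "\<exists>v. \<forall>b\<in>set as. val v b = (if b = a then 1 else if b = cnj a then cnj 1 else 0)"
        by (rule interp[OF aR(1)]) simp
      then obtain v where "\<forall>b\<in>set as. val v b = (if b = a then 1 else if b = cnj a then cnj 1 else 0)"
        by blast
      then have v: "val v b = (if b = a then 1 else 0)" if "b \<in> set as" for b
        using that ca by simp
      have "(\<Sum>i<M. L a' i * v i) = (if a' = a then 1 else 0)" if "a' \<in> S" for a'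
      proof -
        have "a' \<in> set as" "cnj a' \<in> set as" using that cnjS[OF that] by (auto simp: S_def)
        moreover have "a' \<noteq> a \<and> cnj a' \<noteq> a" if "Im a' \<noteq> 0" using that 1 by auto
        ultimately show ?thesis unfolding Lv using v 1 by auto
      qed
      then show ?thesis by blast
    next
      case 2
      let ?c = "rt (cpoly q a)"
      have c0: "?c \<noteq> 0" using aR(3) by (simp add: rt)
      have "\<exists>v. \<forall>b\<in>set as. val v b = (if b = a then 1 / ?c else if b = cnj (a) then cnj (1 / ?c) else 0)"
        by (rule interp[OF aR(1)]) (use 2 in simp)
      then obtain v where "\<forall>b\<in>set as. val v b = (if b = a then 1 / ?c else if b = cnj (a) then cnj (1 / ?c) else 0)" by blast
      then have v: "val v b = (if b = a then 1 / ?c else if b = cnj a then cnj (1 / ?c) else 0)" if "b \<in> set as" for b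
        using that by simp
      have "(\<Sum>i<M. L a' i * v i) = (if a' = a then 1 else 0)" if "a' \<in> S" for a'
      proof -
        have R: "a' \<in> set as" "cnj a' \<in> set as" using that cnjS[OF that] by (auto simp: S_def)
        consider "Im a' = 0" | "0 < Im a'" | "Im a' < 0" by linarith
        then show ?thesis
        proof cases
          case 1
          then have "a' \<noteq> a" "a' \<noteq> cnj a" using 2 by auto
          then show ?thesis unfolding Lv using 1 v[OF R(1)] by simp
        next
          case p: 2
          then have n: "a' \<noteq> cnj a" using 2 by auto
          show ?thesis
          proof (cases "a' = a")
            case True
            then have e: "rt (cpoly q a') * val v a' = 1" using v[OF R(1)] c0 by simp
            show ?thesis unfolding Lv e using p True n by simp
          next
            case False
            then show ?thesis unfolding Lv using p v[OF R(1)] n by simp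
          qed
        next
          case 3
          then have n: "cnj a' \<noteq> cnj a" "a' \<noteq> a" using 2 by auto
          show ?thesis
          proof (cases "cnj a' = a")
            case True
            then have e: "rt (cpoly q (cnj a')) * val v (cnj a') = 1" using v[OF R(2)] c0 by simp
            show ?thesis unfolding Lv e using 3 True n by simp
          next
            case False
            then show ?thesis unfolding Lv using 3 v[OF R(2)] n by simp
          qed
        qed
      qed
      then show ?thesis by blast
    next
      case 3
      let ?c = "rt (cpoly q (cnj a))"
      have c0: "?c \<noteq> 0" using aR(4) by (simp add: rt)
      have "\<exists>v. \<forall>b\<in>set as. val v b = (if b = cnj a then \<i> / ?c else if b = cnj (cnj a) then cnj (\<i> / ?c) else 0)"
        by (rule interp[OF aR(2)]) (use 3 in simp)
      then obtain v where "\<forall>b\<in>set as. val v b = (if b = cnj a then \<i> / ?c else if b = cnj (cnj a) then cnj (\<i> / ?c) else 0)" by blast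
      then have v: "val v b = (if b = cnj a then \<i> / ?c else if b = a then cnj (\<i> / ?c) else 0)" if "b \<in> set as" for b
        using that by simp
      have "(\<Sum>i<M. L a' i * v i) = (if a' = a then 1 else 0)" if "a' \<in> S" for a'
      proof -
        have R: "a' \<in> set as" "cnj a' \<in> set as" using that cnjS[OF that] by (auto simp: S_def)
        consider "Im a' = 0" | "0 < Im a'" | "Im a' < 0" by linarith
        then show ?thesis
        proof cases
          case 1
          then have "a' \<noteq> a" "a' \<noteq> cnj a" using 3 by auto
          then show ?thesis unfolding Lv using 1 v[OF R(1)] by simp
        next
          case 2
          then have m: "a' \<noteq> a" using 3 by auto
          show ?thesis
          proof (cases "a' = cnj a")
            case True
            then have e: "rt (cpoly q a') * val v a' = \<i>" using v[OF R(1)] c0 by simp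
            show ?thesis unfolding Lv e using 2 True m by simp
          next
            case False
            then show ?thesis unfolding Lv using 2 v[OF R(1)] m by simp
          qed
        next
          case n: 3
          then have m: "cnj a' \<noteq> a" using 3 by auto
          show ?thesis
          proof (cases "a' = a")
            case True
            then have e: "rt (cpoly q (cnj a')) * val v (cnj a') = \<i>" using v[OF R(2)] c0 by simp
            show ?thesis unfolding Lv e using n True m by simp
          next
            case False
            then show ?thesis unfolding Lv using n v[OF R(2)] m by simp
          qed
        qed
      qed
      then show ?thesis by blast
    qed
  qed
  then have "\<forall>a\<in>S. \<exists>v. \<forall>a'\<in>S. (\<Sum>i<M. L a' i * v i) = (if a' = a then 1 else 0)" by blast
  from bchoice[OF this] obtain D where
    D: "\<forall>a\<in>S. \<forall>a'\<in>S. (\<Sum>i<M. L a' i * D a i) = (if a' = a then 1 else 0)" by blast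
  \<comment> \<open>The two diagonal forms agree on all vectors, so inertia is applied in both
    directions; the orthonormal vectors \<open>u\<close> are their own dual system.\<close>
  have "card {a\<in>S. x a < 0} \<le> card {a\<in>{..<M}. l a < 0}"
    by (rule inertia_le[where L = L and K = u and M = M and D = D, OF S(2) finite_lessThan form])
      (use D in blast)
  moreover have "card {a\<in>{..<M}. l a < 0} \<le> card {a\<in>S. x a < 0}"
    by (rule inertia_le[where L = u and K = L and M = M and D = u, OF finite_lessThan S(2) form[symmetric]])
      (simp add: u)
  moreover have "card {a\<in>S. x a < 0} = negative_count q"
  proof -
    have re: "Re (cpoly q a) = poly q (Re a)" if "Im a = 0" for a
    proof -
      have "a = of_real (Re a)" using that by (simp add: complex_eq_iff)
      then have "cpoly q a = of_real (poly q (Re a))" using cpoly_of_real by metis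
      then show ?thesis by simp
    qed
    let ?B = "{a\<in>set as. Im a = 0 \<and> poly q (Re a) < 0}" and ?C = "{a\<in>set as. Im a < 0 \<and> cpoly q a \<noteq> 0}"
    have "a \<in> S \<and> x a < 0 \<longleftrightarrow> a \<in> ?B \<or> a \<in> ?C" for a
    proof (cases "a \<in> S")
      case True
      have "Im a = 0 \<or> Im a < 0 \<or> 0 < Im a" by linarith
      then show ?thesis using cnt[OF True] re[of a] True
        by (elim disjE) (simp_all add: x_def S_def mult_less_0_iff)
    next
      case False
      then have "a \<notin> set as \<or> cpoly q a = 0" by (auto simp: S_def)
      then show ?thesis using re[of a] by (auto simp: S_def)
    qed
    then have "{a\<in>S. x a < 0} = ?B \<union> ?C" by blast
    moreover have "card (?B \<union> ?C) = card ?B + card ?C" by (rule card_Un_disjoint) auto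
    ultimately show ?thesis by (simp add: negative_count_def)
  qed
  ultimately show ?thesis by simp
qed

end

section \<open>Nonnegativity on [-1,1] by counting critical points\<close>

text \<open>The minimum over the compact interval is attained either at an end point or at an
  interior point, where the derivative vanishes.\<close>

lemma nonneg_iff_critical_points:
  fixes f :: "real poly"
  assumes "pderiv f \<noteq> 0"
  shows "(\<forall>t\<in>{-1..1}. 0 \<le> poly f t) \<longleftrightarrow> 0 \<le> poly f 1 \<and> 0 \<le> poly f (- 1) \<and>
    (\<forall>t. poly (pderiv f) t = 0 \<longrightarrow> poly f t < 0 \<longrightarrow> \<not> 0 < 1 - t\<^sup>2)"
proof (intro iffI conjI)
  assume *: "\<forall>t\<in>{-1..1}. 0 \<le> poly f t"
  then show "0 \<le> poly f 1" "0 \<le> poly f (- 1)" by auto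
  show "\<forall>t. poly (pderiv f) t = 0 \<longrightarrow> poly f t < 0 \<longrightarrow> \<not> 0 < 1 - t\<^sup>2"
  proof (intro allI impI notI)
    fix t assume "poly f t < 0" "0 < 1 - t\<^sup>2"
    then have "\<bar>t\<bar> \<le> 1" using abs_le_square_iff[of t 1] by simp
    then have "t \<in> {-1..1}" by (simp add: abs_le_iff)
    then have "0 \<le> poly f t" using * by blast
    then show False using \<open>poly f t < 0\<close> by simp
  qed
next
  assume *: "0 \<le> poly f 1 \<and> 0 \<le> poly f (- 1) \<and>
    (\<forall>t. poly (pderiv f) t = 0 \<longrightarrow> poly f t < 0 \<longrightarrow> \<not> 0 < 1 - t\<^sup>2)"
  have "continuous_on {-1..1} (poly f)" by (intro continuous_on_poly continuous_on_id)
  from continuous_attains_inf[OF compact_Icc _ this]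
  obtain s where s': "s \<in> {-1..1}" "\<forall>t\<in>{-1..1}. poly f s \<le> poly f t" by auto
  have s: "s \<in> {-1..1}" "poly f s \<le> poly f t" if "t \<in> {-1..1}" for t
    using s' that by blast+
  have s1: "-1 \<le> s" "s \<le> 1" using s'(1) by simp_all
  have pos: "0 \<le> poly f s"
  proof (rule ccontr)
    assume neg: "\<not> 0 \<le> poly f s"
    then have "s \<noteq> 1" "s \<noteq> - 1" using * by auto
    then have s': "-1 < s" "s < 1" using s1 by linarith+
    have "poly (pderiv f) s = 0"
    proof (rule DERIV_local_min[OF poly_DERIV])
      show "0 < min (1 - s) (s + 1)" using s' by simp
      show "\<forall>y. \<bar>s - y\<bar> < min (1 - s) (s + 1) \<longrightarrow> poly f s \<le> poly f y"
        by (intro allI impI s(2)) (auto simp: abs_less_iff)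
    qed
    moreover have "0 < 1 - s\<^sup>2" using s' abs_square_less_1[of s] by (simp add: abs_less_iff)
    ultimately show False using *[THEN conjunct2, THEN conjunct2, rule_format, of s] neg by simp
  qed
  show "\<forall>t\<in>{-1..1}. 0 \<le> poly f t"
  proof
    fix t :: real assume "t \<in> {-1..1}"
    then show "0 \<le> poly f t" by (rule order.trans[OF pos s(2)])
  qed
qed

text \<open>All four polynomials vanish at the same points, namely where \<open>f\<close> or
  \<open>w\<close> does, so the nonreal roots contribute the same number to each count and cancel.
  At a real root the left side exceeds the right one by 2 if \<open>f < 0 < w\<close>, and otherwise
  both sides agree.\<close>

lemma (in real_poly_roots) nonneg_criterion:
  assumes h: "h = pderiv f"
  defines "w \<equiv> [:1, 0, - 1:]"
  shows "(\<forall>t\<in>{-1..1}. 0 \<le> poly f t) \<longleftrightarrow> 0 \<le> poly f 1 \<and> 0 \<le> poly f (- 1) \<and>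
    negative_count (f * w) + negative_count (f * (w * w)) =
    negative_count (f * f * w) + negative_count (f * f * (w * w))"
proof -
  let ?R = "{a\<in>set as. Im a = 0}"
  let ?C = "{a\<in>set as. Im a < 0 \<and> cpoly f a \<noteq> 0 \<and> cpoly w a \<noteq> 0}"
  let ?B = "{a\<in>?R. poly f (Re a) < 0 \<and> 0 < poly w (Re a)}"
  have card: "card {a\<in>set as. Im a = 0 \<and> P a} = (\<Sum>a\<in>?R. if P a then 1 else 0)" for P
  proof -
    have "{a\<in>set as. Im a = 0 \<and> P a} = {a\<in>?R. P a}" by auto
    then show ?thesis by (simp add: sum.If_cases Int_def)
  qed
  have nc: "negative_count q = (\<Sum>a\<in>?R. if poly q (Re a) < 0 then 1 else 0) + card ?C"
    if "\<And>a. cpoly q a \<noteq> 0 \<longleftrightarrow> cpoly f a \<noteq> 0 \<and> cpoly w a \<noteq> 0" for q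
    using that by (simp add: negative_count_def card)
  have "(\<Sum>a\<in>?R. if poly (f * w) (Re a) < 0 then 1 else 0) + (\<Sum>a\<in>?R. if poly (f * (w * w)) (Re a) < 0 then 1 else 0) =
     (\<Sum>a\<in>?R. if poly (f * f * w) (Re a) < 0 then 1 else 0) + (\<Sum>a\<in>?R. if poly (f * f * (w * w)) (Re a) < 0 then 1 else 0) +
     2 * (\<Sum>a\<in>?R. if poly f (Re a) < 0 \<and> 0 < poly w (Re a) then 1 else (0::nat))"
    unfolding sum.distrib[symmetric] sum_distrib_left
  proof (rule sum.cong[OF refl])
    fix a
    define \<alpha> \<beta> where "\<alpha> = poly f (Re a)" and "\<beta> = poly w (Re a)"
    \<comment> \<open>Nine combinations of signs; only a negative \<open>\<alpha>\<close> with a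
      positive \<open>\<beta>\<close> makes both products on the left negative and none on the
      right.\<close>
    have "(if \<alpha> * \<beta> < 0 then 1 else 0) + (if \<alpha> * (\<beta> * \<beta>) < 0 then 1 else 0) =
      (if \<alpha> * \<alpha> * \<beta> < 0 then 1 else 0) + (if \<alpha> * \<alpha> * (\<beta> * \<beta>) < 0 then 1 else 0) +
      2 * (if \<alpha> < 0 \<and> 0 < \<beta> then 1 else (0::nat))"
    proof -
      have "\<alpha> < 0 \<or> \<alpha> = 0 \<or> 0 < \<alpha>" "\<beta> < 0 \<or> \<beta> = 0 \<or> 0 < \<beta>" by linarith+
      then show ?thesis by (elim disjE) (simp_all add: mult_less_0_iff zero_less_mult_iff)
    qed
    then show "(if poly (f * w) (Re a) < 0 then 1 else 0) + (if poly (f * (w * w)) (Re a) < 0 then 1 else 0) =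
     (if poly (f * f * w) (Re a) < 0 then 1 else 0) + (if poly (f * f * (w * w)) (Re a) < 0 then 1 else 0) +
     2 * (if poly f (Re a) < 0 \<and> 0 < poly w (Re a) then 1 else (0::nat))"
      by (simp only: poly_mult \<alpha>_def \<beta>_def)
  qed
  moreover have "(\<Sum>a\<in>?R. if poly f (Re a) < 0 \<and> 0 < poly w (Re a) then 1 else (0::nat)) = card ?B"
    by (simp add: sum.If_cases Int_def)
  moreover have "negative_count (f * w) = (\<Sum>a\<in>?R. if poly (f * w) (Re a) < 0 then 1 else 0) + card ?C"
    by (rule nc) (simp add: cpoly_mult)
  moreover have "negative_count (f * (w * w)) = (\<Sum>a\<in>?R. if poly (f * (w * w)) (Re a) < 0 then 1 else 0) + card ?C"
    by (rule nc) (simp add: cpoly_mult)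
  moreover have "negative_count (f * f * w) = (\<Sum>a\<in>?R. if poly (f * f * w) (Re a) < 0 then 1 else 0) + card ?C"
    by (rule nc) (simp add: cpoly_mult)
  moreover have "negative_count (f * f * (w * w)) = (\<Sum>a\<in>?R. if poly (f * f * (w * w)) (Re a) < 0 then 1 else 0) + card ?C"
    by (rule nc) (simp add: cpoly_mult)
  ultimately have "negative_count (f * w) + negative_count (f * (w * w)) =
      negative_count (f * f * w) + negative_count (f * f * (w * w)) + 2 * card ?B"
    by linarith
  then have "negative_count (f * w) + negative_count (f * (w * w)) =
      negative_count (f * f * w) + negative_count (f * f * (w * w)) \<longleftrightarrow> ?B = {}"
    by simp
  also have "?B = {} \<longleftrightarrow> (\<forall>t. poly (pderiv f) t = 0 \<longrightarrow> poly f t < 0 \<longrightarrow> \<not> 0 < 1 - t\<^sup>2)"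
  proof -
    have w: "poly w t = 1 - t\<^sup>2" for t by (simp add: w_def power2_eq_square)
    have "a \<in> ?B \<longleftrightarrow> (\<exists>t. a = of_real t \<and> poly (pderiv f) t = 0 \<and> poly f t < 0 \<and> 0 < 1 - t\<^sup>2)" for a
    proof
      assume a: "a \<in> ?B"
      then have "a = of_real (Re a)" by (simp add: complex_eq_iff)
      moreover have "cpoly h a = 0" using a root_iff by auto
      ultimately have "poly h (Re a) = 0" using cpoly_of_real[of h "Re a"] by simp
      then show "\<exists>t. a = of_real t \<and> poly (pderiv f) t = 0 \<and> poly f t < 0 \<and> 0 < 1 - t\<^sup>2"
        using a \<open>a = of_real (Re a)\<close> by (intro exI[of _ "Re a"]) (auto simp: w h)
    next
      assume "\<exists>t. a = of_real t \<and> poly (pderiv f) t = 0 \<and> poly f t < 0 \<and> 0 < 1 - t\<^sup>2"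
      then show "a \<in> ?B" by (auto simp: root_iff cpoly_of_real h w)
    qed
    then show ?thesis by blast
  qed
  finally have eq: "negative_count (f * w) + negative_count (f * (w * w)) =
      negative_count (f * f * w) + negative_count (f * f * (w * w)) \<longleftrightarrow>
      (\<forall>t. poly (pderiv f) t = 0 \<longrightarrow> poly f t < 0 \<longrightarrow> \<not> 0 < 1 - t\<^sup>2)" .
  have "pderiv f \<noteq> 0"
  proof
    assume "pderiv f = 0"
    then have "smult (complex_of_real c) (\<Prod>a\<leftarrow>as. [:- a, 1:]) = 0" using factors h by simp
    then show False using c by (auto simp: prod_list_zero_iff)
  qed
  then show ?thesis unfolding eq by (rule nonneg_iff_critical_points)
qed

section \<open>Rational polynomials at real points and characteristic coefficients\<close>

lemma spectral_decomposition_ex: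
  fixes A :: "nat \<Rightarrow> nat \<Rightarrow> real"
  assumes sym: "\<And>i j. i < N \<Longrightarrow> j < N \<Longrightarrow> A i j = A j i"
  shows "\<exists>u l. (\<forall>a<N. \<forall>b<N. (\<Sum>i<N. u a i * u b i) = (if a = b then 1 else 0)) \<and>
    (\<forall>v. (\<Sum>i<N. \<Sum>j<N. v i * A i j * v j) = (\<Sum>a<N. l a * (\<Sum>i<N. u a i * v i)\<^sup>2)) \<and>
    (\<forall>k. trace_power N A k = (\<Sum>a<N. l a ^ k))"
  by (rule spectral_decomposition[of N A, OF sym], assumption+, intro exI conjI allI impI) simp_all

definition eval_real :: "real \<Rightarrow> rat poly \<Rightarrow> real" where
  "eval_real t p = poly (map_poly of_rat p) t"

lemma eval_real_0 [simp]: "eval_real t 0 = 0"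
  by (simp add: eval_real_def)

lemma eval_real_1 [simp]: "eval_real t 1 = 1"
  by (simp add: eval_real_def)

lemma eval_real_add: "eval_real t (p + q) = eval_real t p + eval_real t q"
proof -
  have "map_poly (of_rat :: rat \<Rightarrow> real) (p + q) = map_poly of_rat p + map_poly of_rat q"
    by (intro poly_eqI) (simp add: coeff_map_poly of_rat_add)
  then show ?thesis by (simp add: eval_real_def)
qed

lemma map_poly_of_rat_mult:
  "map_poly (of_rat :: rat \<Rightarrow> real) (p * q) = map_poly of_rat p * map_poly of_rat q"
  by (intro poly_eqI) (simp add: coeff_map_poly coeff_mult of_rat_sum of_rat_mult)

lemma eval_real_mult: "eval_real t (p * q) = eval_real t p * eval_real t q"
  by (simp add: eval_real_def map_poly_of_rat_mult)

lemma eval_real_smult: "eval_real t (smult c p) = of_rat c * eval_real t p"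
proof -
  have "map_poly (of_rat :: rat \<Rightarrow> real) (smult c p) = smult (of_rat c) (map_poly of_rat p)"
    by (intro poly_eqI) (simp add: coeff_map_poly of_rat_mult)
  then show ?thesis by (simp add: eval_real_def)
qed

lemma eval_real_sum: "eval_real t (sum f A) = (\<Sum>i\<in>A. eval_real t (f i))"
  by (induction A rule: infinite_finite_induct) (simp_all add: eval_real_add)

lemma eval_real_0_eq_coeff: "eval_real 0 p = of_rat (coeff p 0)"
  by (simp add: eval_real_def poly_0_coeff_0 coeff_map_poly)

lemma map_poly_of_rat_pCons:
  "map_poly (of_rat :: rat \<Rightarrow> real) (pCons a p) = pCons (of_rat a) (map_poly of_rat p)"
  by (intro poly_eqI) (simp add: coeff_map_poly coeff_pCons split: nat.split)

lemma eval_real_of_rat: "eval_real (of_rat x) p = of_rat (poly p x)"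
proof (induction p)
  case (pCons a p)
  then show ?case by (simp add: eval_real_def map_poly_of_rat_pCons of_rat_add of_rat_mult)
qed simp

text \<open>Newton's identities as a recursion for the coefficients. With the traces of powers of
  \<open>A\<close> for \<open>p\<close> it yields the coefficients of \<open>det (1 - x A)\<close>.
  The only divisions are by natural numbers, so polynomials are allowed as entries and no pivots
  have to be chosen.\<close>

function newton_coeffs :: "(nat \<Rightarrow> rat poly) \<Rightarrow> nat \<Rightarrow> rat poly" where
  "newton_coeffs p k = (if k = 0 then 1 else smult (- 1 / of_nat k) (\<Sum>i<k. newton_coeffs p i * p (k - i)))"
  by pat_completeness auto
termination by (relation "measure snd") auto

declare newton_coeffs.simps [simp del]

lemma newton_coeffs_0 [simp]: "newton_coeffs p 0 = 1"
  by (simp add: newton_coeffs.simps)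

lemma newton_seq_eval_real:
  "newton_seq (\<lambda>k. eval_real t (p k)) (\<lambda>k. eval_real t (newton_coeffs p k))"
  unfolding newton_seq_def
proof (intro conjI allI)
  fix k
  show "of_nat k * eval_real t (newton_coeffs p k) =
      - (\<Sum>i<k. eval_real t (newton_coeffs p i) * eval_real t (p (k - i)))"
  proof (cases "k = 0")
    case False
    have "newton_coeffs p k = smult (- 1 / of_nat k) (\<Sum>i<k. newton_coeffs p i * p (k - i))"
      using False by (subst newton_coeffs.simps) simp
    then have "eval_real t (newton_coeffs p k) =
        of_rat (- 1 / of_nat k) * (\<Sum>i<k. eval_real t (newton_coeffs p i) * eval_real t (p (k - i)))"
      by (simp only: eval_real_smult eval_real_sum eval_real_mult)
    then show ?thesis using False by (simp add: of_rat_divide of_rat_minus)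
  qed simp
qed simp

lemma eval_real_mat_power:
  "eval_real t (mat_power N A k i j) = mat_power N (\<lambda>i j. eval_real t (A i j)) k i j"
  by (induction k arbitrary: i) (simp_all add: eval_real_sum eval_real_mult)

lemma eval_real_trace_power:
  "eval_real t (trace_power N A k) = trace_power N (\<lambda>i j. eval_real t (A i j)) k"
  by (simp add: trace_power_def eval_real_sum eval_real_mat_power)

text \<open>Evaluation at \<open>t\<close> commutes with all operations of the recursion, and
  Newton's identities have only one solution; the sign turns the factors \<open>1 - a x\<close> into
  \<open>1 + a x\<close>.\<close>

lemma eval_newton_coeffs_trace_power:
  assumes "\<And>k. trace_power N (\<lambda>i j. eval_real t (A i j)) k = (\<Sum>a<N. l a ^ k)"
  shows "(- 1) ^ k * eval_real t (newton_coeffs (trace_power N A) k) =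
    coeff (\<Prod>a\<leftarrow>map l [0..<N]. [:1, a:]) k"
proof -
  have "(\<Sum>a\<leftarrow>map l [0..<N]. a ^ k) = (\<Sum>a<N. l a ^ k)" for k
    by (simp add: comp_def interv_sum_list_conv_sum_set_nat lessThan_atLeast0)
  then have "eval_real t (newton_coeffs (trace_power N A) k) = coeff (\<Prod>a\<leftarrow>map l [0..<N]. [:1, - a:]) k"
    using newton_seq_unique[OF newton_seq_eval_real newton_seq_list[of "map l [0..<N]"]]
    by (simp only: eval_real_trace_power assms)
  then show ?thesis by (simp only: coeff_prod_minus)
qed

lemma degree_newton_coeffs:
  assumes "\<And>j. degree (p j) \<le> j * d"
  shows "degree (newton_coeffs p k) \<le> k * d"
proof (induction k rule: less_induct)
  case (less k)
  have "degree (newton_coeffs p i * p (k - i)) \<le> k * d" if "i < k" for i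
  proof -
    have "degree (newton_coeffs p i * p (k - i)) \<le> i * d + (k - i) * d"
      using less[OF that] assms[of "k - i"] degree_mult_le[of "newton_coeffs p i" "p (k - i)"] by linarith
    also have "\<dots> = k * d" using that by (simp add: add_mult_distrib[symmetric])
    finally show ?thesis .
  qed
  then have "degree (\<Sum>i<k. newton_coeffs p i * p (k - i)) \<le> k * d"
    by (intro degree_sum_le) auto
  then show ?case by (subst newton_coeffs.simps) (auto intro: order.trans[OF degree_smult_le])
qed

lemma degree_mat_power:
  assumes "\<And>i j. i < N \<Longrightarrow> j < N \<Longrightarrow> degree (A i j) \<le> d" "i < N" "j < N"
  shows "degree (mat_power N A k i j) \<le> k * d"
  using assms(2)
proof (induction k arbitrary: i)
  case (Suc k)
  have "degree (A i m * mat_power N A k m j) \<le> Suc k * d" if "m < N" for m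
    using Suc.IH[OF that] assms(1)[OF Suc.prems that] degree_mult_le[of "A i m" "mat_power N A k m j"] by simp
  then show ?case by (auto intro!: degree_sum_le)
qed simp

lemma degree_trace_power:
  "(\<And>i j. i < N \<Longrightarrow> j < N \<Longrightarrow> degree (A i j) \<le> d) \<Longrightarrow> degree (trace_power N A k) \<le> k * d"
  unfolding trace_power_def by (intro degree_sum_le) (auto intro: degree_mat_power)

subsection \<open>Counting negative eigenvalues\<close>

lemma variations_of_rat:
  "variations (\<lambda>i. of_rat (f i) :: real) k = variations f k \<and>
    last_sign (\<lambda>i. of_rat (f i) :: real) k = of_rat (last_sign f k)"
proof (induction k)
  case 0
  show ?case by (simp add: sgn_if)
next
  case (Suc k)
  have "last_sign (\<lambda>i. of_rat (f i) :: real) k * of_rat (f (Suc k)) = of_rat (last_sign f k * f (Suc k))"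
    using Suc by (simp add: of_rat_mult)
  then show ?case using Suc by (simp add: sgn_if)
qed

text \<open>The entries are made constant polynomials so that \<open>newton_coeffs\<close>, and
  later its tables, serve for numerical matrices too. The sequence consists of the coefficients of
  the product of all \<open>1 + a x\<close> over the eigenvalues \<open>a\<close>, to which the
  exact rule of signs applies.\<close>

definition neg_eigenvalues :: "nat \<Rightarrow> (nat \<Rightarrow> nat \<Rightarrow> rat) \<Rightarrow> nat" where
  "neg_eigenvalues M H =
     variations (\<lambda>k. (- 1) ^ k * coeff (newton_coeffs (trace_power M (\<lambda>i j. [:H i j:])) k) 0) M"

lemma neg_eigenvalues_eq_card:
  assumes "\<And>k. trace_power M (\<lambda>i j. of_rat (H i j)) k = (\<Sum>a<M. l a ^ k)"
  shows "neg_eigenvalues M H = card {a\<in>{..<M}. l a < (0::real)}"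
proof -
  have tr: "trace_power M (\<lambda>i j. eval_real 0 [:H i j:]) k = (\<Sum>a<M. l a ^ k)" for k
    using assms[of k] by (simp add: eval_real_0_eq_coeff)
  have "neg_eigenvalues M H =
      variations (\<lambda>k. of_rat ((- 1) ^ k * coeff (newton_coeffs (trace_power M (\<lambda>i j. [:H i j:])) k) 0) :: real) M"
    unfolding neg_eigenvalues_def using variations_of_rat by metis
  also have "(\<lambda>k. of_rat ((- 1) ^ k * coeff (newton_coeffs (trace_power M (\<lambda>i j. [:H i j:])) k) 0) :: real) =
      coeff (\<Prod>a\<leftarrow>map l [0..<M]. [:1, a:])"
    using eval_newton_coeffs_trace_power[OF tr]
    by (simp add: fun_eq_iff eval_real_0_eq_coeff of_rat_mult of_rat_power of_rat_minus)
  also have "variations (coeff (\<Prod>a\<leftarrow>map l [0..<M]. [:1, a:])) M = length (filter (\<lambda>a. a < 0) (map l [0..<M]))"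
    using variations_real_rooted[of "map l [0..<M]"] by simp
  also have "\<dots> = card {a\<in>{..<M}. l a < 0}"
    by (simp add: filter_map comp_def length_filter_conv_card) (rule arg_cong[of _ _ card], auto)
  finally show ?thesis .
qed

section \<open>Power sums of roots and Hermite matrices over the rationals\<close>

text \<open>One more than the degree, and 0 for the zero polynomial: zero and constants are told
  apart, and the number can be found by counting indices.\<close>

definition deg1 :: "rat poly \<Rightarrow> nat" where
  "deg1 h = (if h = 0 then 0 else Suc (degree h))"

text \<open>The coefficients of the reversed monic polynomial, which is the product of the factors
  \<open>1 - a x\<close> over the roots \<open>a\<close> of \<open>h\<close>.\<close>

definition root_coeff :: "rat poly \<Rightarrow> nat \<Rightarrow> rat" where
  "root_coeff h i = (if i < deg1 h then coeff h (degree h - i) / lead_coeff h else 0)"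

text \<open>Newton's identities solved for the power sums of the roots of \<open>h\<close>; the one
  of order 0 is the number of roots.\<close>

function root_power_sum :: "rat poly \<Rightarrow> nat \<Rightarrow> rat" where
  "root_power_sum h k = (if k = 0 then of_nat (deg1 h - 1)
     else - of_nat k * root_coeff h k - (\<Sum>i\<in>{1..<k}. root_coeff h i * root_power_sum h (k - i)))"
  by pat_completeness auto
termination by (relation "measure snd") auto

declare root_power_sum.simps [simp del]

text \<open>The condition \<open>i + 2 \<le> deg1 h\<close> means \<open>i < degree h\<close>, and
  it fails for \<open>h = 0\<close>, whose matrix is therefore zero.\<close>

definition hermite :: "rat poly \<Rightarrow> nat \<Rightarrow> rat poly \<Rightarrow> nat \<Rightarrow> nat \<Rightarrow> rat" where
  "hermite h K q i j = (if i + 2 \<le> deg1 h \<and> j + 2 \<le> deg1 h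
     then \<Sum>k<K. coeff q k * root_power_sum h (k + i + j) else 0)"

lemma real_poly_factorization:
  fixes h :: "rat poly"
  assumes h: "h \<noteq> 0"
  obtains as where "real_poly_roots (map_poly of_rat h) as (of_rat (lead_coeff h))"
    "length as = degree h"
    "\<And>j. of_real (of_rat (root_power_sum h j)) = (\<Sum>a\<leftarrow>as. a ^ j)"
proof -
  let ?h = "map_poly of_rat h :: real poly"
  let ?hc = "map_poly complex_of_real ?h"
  have hc: "coeff ?hc i = of_real (of_rat (coeff h i))" for i by (simp add: coeff_map_poly)
  have deg: "degree ?hc = degree h" by simp
  obtain as where as: "smult (lead_coeff ?hc) (\<Prod>a\<leftarrow>as. [:- a, 1:]) = ?hc" "length as = degree h"
    using fundamental_theorem_algebra_factorized[of ?hc] deg by auto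
  let ?c = "complex_of_real (of_rat (lead_coeff h))"
  have lc: "lead_coeff ?hc = ?c" unfolding deg hc ..
  have c0: "?c \<noteq> 0" using h by simp
  have roots: "real_poly_roots ?h as (of_rat (lead_coeff h))"
    by unfold_locales (use as(1) lc h in simp_all)
  let ?F = "\<Prod>a\<leftarrow>as. [:- a, 1:]"
  have degF: "degree ?F = degree h" using degree_linear_factors[of uminus as] as(2) by simp
  \<comment> \<open>Reversing the coefficients turns the factors \<open>x - a\<close> into
    \<open>1 - a x\<close>, the form that Newton's identities use.\<close>
  have "reflect_poly ?F = (\<Prod>a\<leftarrow>as. [:1, - a:])"
    unfolding reflect_poly_prod_list by (simp add: comp_def reflect_poly_def)
  then have rc: "coeff (\<Prod>a\<leftarrow>as. [:1, - a:]) i = of_real (of_rat (root_coeff h i))" for i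
  proof -
    have "coeff ?F i * ?c = of_real (of_rat (coeff h i))" for i
    proof -
      have "coeff (smult ?c ?F) i = coeff ?hc i" using as(1) lc by simp
      then show ?thesis unfolding hc by (simp add: mult.commute)
    qed
    then have F: "coeff ?F i = of_real (of_rat (coeff h i / lead_coeff h))" for i
      using c0 by (simp add: of_rat_divide eq_divide_eq)
    have "coeff (\<Prod>a\<leftarrow>as. [:1, - a:]) i = (if degree h < i then 0 else coeff ?F (degree h - i))"
      using \<open>reflect_poly ?F = _\<close> coeff_reflect_poly[of ?F i] degF by simp
    then show ?thesis unfolding F using h by (auto simp: root_coeff_def deg1_def)
  qed
  have newton: "newton_seq (\<lambda>k. \<Sum>a\<leftarrow>as. a ^ k) (\<lambda>i. complex_of_real (of_rat (root_coeff h i)))"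
    using newton_seq_list[of as] unfolding rc[symmetric] .
  have "of_real (of_rat (root_power_sum h j)) = (\<Sum>a\<leftarrow>as. a ^ j)" for j
  proof (induction j rule: less_induct)
    case (less k)
    show ?case
    proof (cases "k = 0")
      case True
      then show ?thesis using h as(2) by (subst root_power_sum.simps) (simp add: deg1_def sum_list_triv)
    next
      case False
      then have "root_power_sum h k = - of_nat k * root_coeff h k - (\<Sum>i\<in>{1..<k}. root_coeff h i * root_power_sum h (k - i))"
        by (subst root_power_sum.simps) simp
      then have "complex_of_real (of_rat (root_power_sum h k)) = - of_nat k * of_real (of_rat (root_coeff h k)) -
          (\<Sum>i\<in>{1..<k}. of_real (of_rat (root_coeff h i)) * of_real (of_rat (root_power_sum h (k - i))))"
        by (simp add: of_rat_diff of_rat_minus of_rat_mult of_rat_sum)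
      also have "\<dots> = - of_nat k * of_real (of_rat (root_coeff h k)) -
          (\<Sum>i\<in>{1..<k}. of_real (of_rat (root_coeff h i)) * (\<Sum>a\<leftarrow>as. a ^ (k - i)))"
        using less False by simp
      also have "\<dots> = (\<Sum>a\<leftarrow>as. a ^ k)"
        using newton_seq_power_sum[OF newton, of k] False by simp
      finally show ?thesis .
    qed
  qed
  then show ?thesis using that[OF roots as(2)] by blast
qed

lemma hermite_sym: "hermite h K q i j = hermite h K q j i"
  by (simp add: hermite_def ac_simps)

lemma neg_eigenvalues_hermite:
  fixes h q :: "rat poly"
  assumes roots: "real_poly_roots (map_poly of_rat h) as c" "length as = degree h"
    and ps: "\<And>j. of_real (of_rat (root_power_sum h j)) = (\<Sum>a\<leftarrow>as. a ^ j)"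
    and h: "h \<noteq> 0" "degree h \<le> M" and K: "degree q < K"
  shows "neg_eigenvalues M (hermite h K q) = real_poly_roots.negative_count as (map_poly of_rat q)"
proof -
  interpret real_poly_roots "map_poly of_rat h" as c by (rule roots(1))
  let ?H = "\<lambda>i j. of_rat (hermite h K q i j) :: real"
  have sym: "?H i j = ?H j i" for i j by (subst hermite_sym) (rule refl)
  obtain u l where ul: "\<forall>a<M. \<forall>b<M. (\<Sum>i<M. u a i * u b i) = (if a = b then 1 else 0)"
    and "\<forall>v. (\<Sum>i<M. \<Sum>j<M. v i * ?H i j * v j) = (\<Sum>a<M. l a * (\<Sum>i<M. u a i * v i)\<^sup>2)"
    and "\<forall>k. trace_power M ?H k = (\<Sum>a<M. l a ^ k)"
    using spectral_decomposition_ex[of M ?H, OF sym] by blast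
  then have diag: "(\<Sum>i<M. \<Sum>j<M. v i * ?H i j * v j) = (\<Sum>a<M. l a * (\<Sum>i<M. u a i * v i)\<^sup>2)"
    and tr: "trace_power M ?H k = (\<Sum>a<M. l a ^ k)" for v k
    by blast+
  have u: "(\<Sum>i<M. u a i * u b i) = (if a = b then 1 else 0)" if "a < M" "b < M" for a b
    using ul that by blast
  have "card {a\<in>{..<M}. l a < 0} = negative_count (map_poly of_rat q)"
  proof (rule hermite_inertia[where N = "\<lambda>j. of_rat (root_power_sum h j)" and K = K and M = M and H = ?H and u = u])
    show "?H i j = (if i < length as \<and> j < length as
        then \<Sum>k<K. coeff (map_poly of_rat q) k * of_rat (root_power_sum h (k + i + j)) else 0)" for i j
      using roots(2) h by (auto simp: hermite_def deg1_def of_rat_sum of_rat_mult coeff_map_poly)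
  qed (use ps K h roots(2) u diag in simp_all)
  then show ?thesis using neg_eigenvalues_eq_card[OF tr] by simp
qed

lemma neg_eigenvalues_zero:
  assumes "\<And>i j. H i j = 0"
  shows "neg_eigenvalues M H = 0"
proof -
  have "mat_power M (\<lambda>i j. of_rat (H i j)) (Suc k) i j = (0::real)" for k i j
    by (simp add: assms)
  then have "trace_power M (\<lambda>i j. of_rat (H i j)) k = (\<Sum>a<M. (0::real) ^ k)" for k
    unfolding trace_power_def by (cases k) (simp_all add: assms)
  from neg_eigenvalues_eq_card[OF this] show ?thesis by simp
qed

text \<open>\<open>neg_count f a b K M\<close> counts negative squares for \<open>f\<^bsup>1 + a\<^esup> * (1 - x\<^sup>2)\<^bsup>1 + b\<^esup>\<close>.\<close>

definition sign_poly :: "rat poly \<Rightarrow> nat \<Rightarrow> nat \<Rightarrow> rat poly" where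
  "sign_poly f a b = (if a = 0 then f else f * f) * (if b = 0 then [:1, 0, - 1:] else [:1, 0, - 1:] * [:1, 0, - 1:])"

definition neg_count :: "rat poly \<Rightarrow> nat \<Rightarrow> nat \<Rightarrow> nat \<Rightarrow> nat \<Rightarrow> nat" where
  "neg_count f K M a b = neg_eigenvalues M (hermite (pderiv f) K (sign_poly f a b))"

lemma map_poly_pderiv: "map_poly (of_rat :: rat \<Rightarrow> real) (pderiv p) = pderiv (map_poly of_rat p)"
  by (intro poly_eqI) (simp add: coeff_map_poly coeff_pderiv of_rat_mult of_rat_add)

lemma degree_sign_poly: "degree (sign_poly f a b) \<le> 2 * degree f + 4"
proof -
  have "degree (if a = 0 then f else f * f) \<le> 2 * degree f"
    using degree_mult_le[of f f] by simp
  moreover have "degree (if b = 0 then [:1, 0, - 1:] else [:1, 0, - 1:] * [:1, 0, - 1:] :: rat poly) \<le> 4"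
    using degree_mult_le[of "[:1, 0, - 1:] :: rat poly" "[:1, 0, - 1:]"] by simp
  ultimately show ?thesis
    unfolding sign_poly_def by (intro order.trans[OF degree_mult_le]) linarith
qed

lemma nonneg_iff_neg_count:
  fixes f :: "rat poly"
  assumes K: "2 * degree f + 4 < K" and M: "degree f \<le> M"
  shows "(\<forall>t\<in>{-1..1}. 0 \<le> eval_real t f) \<longleftrightarrow> 0 \<le> poly f 1 \<and> 0 \<le> poly f (- 1) \<and>
    neg_count f K M 0 0 + neg_count f K M 0 1 = neg_count f K M 1 0 + neg_count f K M 1 1"
proof -
  let ?f = "map_poly of_rat f :: real poly"
  have e: "eval_real 1 f = of_rat (poly f 1)" "eval_real (- 1) f = of_rat (poly f (- 1))"
    using eval_real_of_rat[of 1 f] eval_real_of_rat[of "- 1" f] by (simp_all add: of_rat_minus)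
  show ?thesis
  proof (cases "pderiv f = 0")
    case True
    \<comment> \<open>If \<open>f\<close> is constant, its derivative has \<open>deg1\<close> equal
      to 0, so all four matrices vanish, the counts agree trivially and the end points
      decide.\<close>
    have "neg_count f K M a b = 0" for a b
      unfolding neg_count_def by (rule neg_eigenvalues_zero) (simp add: hermite_def deg1_def True)
    moreover have "degree f = 0" using True by (simp add: pderiv_eq_0_iff)
    then obtain a where "f = [:a:]" using degree_eq_zeroE by blast
    then have "eval_real t f = of_rat a" "poly f x = a" for t x
      by (simp_all add: eval_real_def map_poly_of_rat_pCons)
    moreover have "(0::real) \<in> {-1..1}" by simp
    ultimately show ?thesis by auto
  next
    case False
    obtain as where as: "real_poly_roots (map_poly of_rat (pderiv f)) as (of_rat (lead_coeff (pderiv f)))"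
      "length as = degree (pderiv f)"
      "\<And>j. of_real (of_rat (root_power_sum (pderiv f) j)) = (\<Sum>a\<leftarrow>as. a ^ j)"
      using real_poly_factorization[OF False] by blast
    interpret real_poly_roots "map_poly of_rat (pderiv f)" as "of_rat (lead_coeff (pderiv f))" by (rule as(1))
    have dM: "degree (pderiv f) \<le> M" using M degree_pderiv_le[of f] by linarith
    have nc: "neg_count f K M a b = negative_count (map_poly of_rat (sign_poly f a b))" for a b
      unfolding neg_count_def using degree_sign_poly[of f a b] K
      by (intro neg_eigenvalues_hermite[OF as False dM]) linarith
    have w: "map_poly (of_rat :: rat \<Rightarrow> real) [:1, 0, - 1:] = [:1, 0, - 1:]"
      by (simp add: map_poly_of_rat_pCons of_rat_minus)
    have s: "map_poly of_rat (sign_poly f 0 0) = ?f * [:1, 0, - 1:]"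
      "map_poly of_rat (sign_poly f 0 1) = ?f * ([:1, 0, - 1:] * [:1, 0, - 1:])"
      "map_poly of_rat (sign_poly f 1 0) = ?f * ?f * [:1, 0, - 1:]"
      "map_poly of_rat (sign_poly f 1 1) = ?f * ?f * ([:1, 0, - 1:] * [:1, 0, - 1:])"
      unfolding sign_poly_def by (simp_all only: map_poly_of_rat_mult w one_neq_zero simp_thms if_True if_False)
    show ?thesis
      using nonneg_criterion[OF map_poly_pderiv] e unfolding nc s eval_real_def
      by (simp only: zero_le_of_rat_iff)
  qed
qed

subsection \<open>Positive semidefinite matrices\<close>

lemma positive_semidefinite_iff_form:
  assumes M: "M \<in> carrier_mat n n" "transpose_mat M = M"
  shows "positive_semidefinite M \<longleftrightarrow> (\<forall>v. 0 \<le> (\<Sum>i<n. \<Sum>j<n. v i * M $$ (i, j) * v j))"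
proof -
  have q: "v \<bullet> (M *\<^sub>v v) = (\<Sum>i<n. \<Sum>j<n. v $ i * M $$ (i, j) * v $ j)" if "v \<in> carrier_vec n" for v
    using M(1) that
    by (simp add: scalar_prod_def mult_mat_vec_def lessThan_atLeast0 sum_distrib_left mult_ac)
  show ?thesis
  proof
    assume psd: "positive_semidefinite M"
    show "\<forall>v. 0 \<le> (\<Sum>i<n. \<Sum>j<n. v i * M $$ (i, j) * v j)"
    proof
      fix v :: "nat \<Rightarrow> real"
      have "0 \<le> vec n v \<bullet> (M *\<^sub>v vec n v)" using psd M(1) by (simp add: positive_semidefinite_def)
      then show "0 \<le> (\<Sum>i<n. \<Sum>j<n. v i * M $$ (i, j) * v j)" by (simp add: q)
    qed
  next
    assume "\<forall>v. 0 \<le> (\<Sum>i<n. \<Sum>j<n. v i * M $$ (i, j) * v j)"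
    then show "positive_semidefinite M"
      unfolding positive_semidefinite_def using M q by (auto simp: square_mat.simps)
  qed
qed

text \<open>The elementary symmetric function of order \<open>j + 1\<close> of the eigenvalues of
  \<open>P(t)\<close>, as a polynomial in \<open>t\<close>. The one of order 0 is constantly 1,
  hence the shift of the index.\<close>

definition matrix_coeff :: "nat \<Rightarrow> rat poly mat \<Rightarrow> nat \<Rightarrow> rat poly" where
  "matrix_coeff n P j = smult ((- 1) ^ Suc j) (newton_coeffs (trace_power n (\<lambda>i l. P $$ (i, l))) (Suc j))"

text \<open>Positive semidefinite means that all eigenvalues are nonnegative, and real numbers are
  nonnegative iff all their elementary symmetric functions are. One condition on a matrix becomes
  \<open>n\<close> conditions on polynomials in \<open>t\<close>.\<close>

lemma positive_semidefinite_iff_matrix_coeff: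
  assumes P: "symmetric_poly_mat n d P"
  shows "positive_semidefinite (eval_poly_mat P t) \<longleftrightarrow> (\<forall>j<n. 0 \<le> eval_real t (matrix_coeff n P j))"
proof -
  let ?M = "eval_poly_mat P t"
  have Pc: "P \<in> carrier_mat n n" "transpose_mat P = P" using P by (auto simp: symmetric_poly_mat_def)
  have M: "?M \<in> carrier_mat n n" using Pc by (simp add: eval_poly_mat_def)
  have Mij: "?M $$ (i, j) = eval_real t (P $$ (i, j))" if "i < n" "j < n" for i j
    using that Pc by (simp add: eval_poly_mat_def eval_real_def)
  have Ps: "P $$ (i, j) = P $$ (j, i)" if "i < n" "j < n" for i j
    using that Pc by (metis carrier_matD index_transpose_mat(1))
  have Mt: "transpose_mat ?M = ?M"
    by (rule eq_matI) (use M Mij Ps in \<open>auto simp: eval_poly_mat_def\<close>)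
  let ?A = "\<lambda>i j. eval_real t (P $$ (i, j))"
  have sym: "?A i j = ?A j i" if "i < n" "j < n" for i j by (simp only: Ps[OF that])
  obtain u l where ul: "\<forall>a<n. \<forall>b<n. (\<Sum>i<n. u a i * u b i) = (if a = b then 1 else 0)"
    and "\<forall>v. (\<Sum>i<n. \<Sum>j<n. v i * ?A i j * v j) = (\<Sum>a<n. l a * (\<Sum>i<n. u a i * v i)\<^sup>2)"
    and "\<forall>k. trace_power n ?A k = (\<Sum>a<n. l a ^ k)"
    using spectral_decomposition_ex[of n ?A, OF sym] by blast
  then have diag: "(\<Sum>i<n. \<Sum>j<n. v i * ?A i j * v j) = (\<Sum>a<n. l a * (\<Sum>i<n. u a i * v i)\<^sup>2)"
    and tr: "trace_power n ?A k = (\<Sum>a<n. l a ^ k)" for v k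
    by blast+
  have u: "(\<Sum>i<n. u a i * u b i) = (if a = b then 1 else 0)" if "a < n" "b < n" for a b
    using ul that by blast
  have "positive_semidefinite ?M \<longleftrightarrow> (\<forall>v. 0 \<le> (\<Sum>i<n. \<Sum>j<n. v i * ?A i j * v j))"
    unfolding positive_semidefinite_iff_form[OF M Mt] by (simp add: Mij)
  also have "\<dots> \<longleftrightarrow> (\<forall>a<n. 0 \<le> l a)"
  proof
    assume *: "\<forall>v. 0 \<le> (\<Sum>i<n. \<Sum>j<n. v i * ?A i j * v j)"
    show "\<forall>a<n. 0 \<le> l a"
    proof (intro allI impI)
      fix a assume a: "a < n"
      have "(\<Sum>b<n. l b * (\<Sum>i<n. u b i * u a i)\<^sup>2) = (\<Sum>b<n. if b = a then l b else 0)"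
        by (rule sum.cong) (use a in \<open>auto simp: u\<close>)
      then have "(\<Sum>b<n. l b * (\<Sum>i<n. u b i * u a i)\<^sup>2) = l a" using a by (simp add: sum.delta)
      then show "0 \<le> l a" using *[rule_format, of "u a"] diag[of "u a"] by simp
    qed
  next
    assume "\<forall>a<n. 0 \<le> l a"
    then show "\<forall>v. 0 \<le> (\<Sum>i<n. \<Sum>j<n. v i * ?A i j * v j)"
      unfolding diag by (auto intro!: sum_nonneg)
  qed
  also have "\<dots> \<longleftrightarrow> (\<forall>k\<le>n. 0 \<le> coeff (\<Prod>a\<leftarrow>map l [0..<n]. [:1, a:]) k)"
    using nonneg_iff_coeffs_nonneg[of "map l [0..<n]"] by auto
  also have "\<dots> \<longleftrightarrow> (\<forall>j<n. 0 \<le> eval_real t (matrix_coeff n P j))"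
  proof -
    have "coeff (\<Prod>a\<leftarrow>map l [0..<n]. [:1, a:]) (Suc j) = eval_real t (matrix_coeff n P j)" for j
      unfolding matrix_coeff_def eval_real_smult eval_newton_coeffs_trace_power[OF tr, symmetric]
      by (simp add: of_rat_minus of_rat_power of_rat_mult)
    moreover have "coeff (\<Prod>a\<leftarrow>map l [0..<n]. [:1, a:]) 0 = 1"
      using eval_newton_coeffs_trace_power[OF tr, of 0] by simp
    moreover have "(\<forall>k\<le>n. R k) \<longleftrightarrow> R 0 \<and> (\<forall>j<n. R (Suc j))" for R
      by (metis Suc_le_eq le0 not0_implies_Suc)
    ultimately show ?thesis by simp
  qed
  finally show ?thesis .
qed

lemma degree_matrix_coeff:
  assumes "symmetric_poly_mat n d P" "j < n"
  shows "degree (matrix_coeff n P j) \<le> n * d"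
proof -
  have "degree (P $$ (i, l)) \<le> d" if "i < n" "l < n" for i l
    using assms(1) that by (simp add: symmetric_poly_mat_def)
  then have "degree (newton_coeffs (trace_power n (\<lambda>i l. P $$ (i, l))) (Suc j)) \<le> Suc j * d"
    by (intro degree_newton_coeffs degree_trace_power)
  also have "\<dots> \<le> n * d" using assms(2) by (intro mult_le_mono1) simp
  finally show ?thesis unfolding matrix_coeff_def by (rule order.trans[OF degree_smult_le])
qed

text \<open>The bound on \<open>K\<close> is the largest possible degree of
  \<open>f^2 (1 - t^2)^2\<close>. Both \<open>K\<close> and the matrix size \<open>n * d\<close> can
  be chosen from the format alone, before any actual degree is known.\<close>

theorem psd_criterion:
  assumes P: "symmetric_poly_mat n d P" and K: "2 * (n * d) + 4 < K"
  shows "(\<forall>t\<in>{-1..1}. positive_semidefinite (eval_poly_mat P t)) \<longleftrightarrow>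
    (\<forall>j<n. let f = matrix_coeff n P j in 0 \<le> poly f 1 \<and> 0 \<le> poly f (- 1) \<and>
      neg_count f K (n * d) 0 0 + neg_count f K (n * d) 0 1 =
      neg_count f K (n * d) 1 0 + neg_count f K (n * d) 1 1)"
proof -
  have "(\<forall>t\<in>{-1..1}. positive_semidefinite (eval_poly_mat P t)) \<longleftrightarrow>
      (\<forall>j<n. \<forall>t\<in>{-1..1}. 0 \<le> eval_real t (matrix_coeff n P j))"
    using positive_semidefinite_iff_matrix_coeff[OF P] by blast
  also have "\<dots> \<longleftrightarrow> (\<forall>j<n. let f = matrix_coeff n P j in 0 \<le> poly f 1 \<and> 0 \<le> poly f (- 1) \<and>
      neg_count f K (n * d) 0 0 + neg_count f K (n * d) 0 1 =
      neg_count f K (n * d) 1 0 + neg_count f K (n * d) 1 1)"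
    unfolding Let_def
  proof (intro all_cong nonneg_iff_neg_count)
    fix j assume "j < n"
    from degree_matrix_coeff[OF P this]
    show "2 * degree (matrix_coeff n P j) + 4 < K" "degree (matrix_coeff n P j) \<le> n * d"
      using K by linarith+
  qed
  finally show ?thesis .
qed

section \<open>Index and value expressions and their compilation\<close>

text \<open>Index expressions depend on variables only and never on the data, so lengths of sums and
  addresses are determined by the format. Truncated subtraction and division by zero with value 0
  make them total.\<close>

datatype nexp = NC nat | NV nat | NAdd nexp nexp | NMul nexp nexp | NSub nexp nexp | NDiv nexp nexp

text \<open>Variables are numbered from outside to inside. In a table, 0 and 1 are the format
  \<open>n\<close>, \<open>d\<close>, 2 is the number of the cell, and each \<open>XSum\<close>
  binds the next number.\<close>

datatype xexp =
    XN nexp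
  | XCell string nexp
  | XOp arith_op xexp xexp
  | XSum nexp xexp
  | XIf comparison xexp xexp xexp xexp

fun nval :: "nexp \<Rightarrow> nat list \<Rightarrow> nat" where
  "nval (NC k) \<rho> = k"
| "nval (NV i) \<rho> = (if i < length \<rho> then \<rho> ! i else 0)"
| "nval (NAdd x y) \<rho> = nval x \<rho> + nval y \<rho>"
| "nval (NMul x y) \<rho> = nval x \<rho> * nval y \<rho>"
| "nval (NSub x y) \<rho> = nval x \<rho> - nval y \<rho>"
| "nval (NDiv x y) \<rho> = nval x \<rho> div nval y \<rho>"

fun xval :: "xexp \<Rightarrow> nat list \<Rightarrow> store \<Rightarrow> rat" where
  "xval (XN e) \<rho> s = of_nat (nval e \<rho>)"
| "xval (XCell a e) \<rho> s = s a (nval e \<rho>)"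
| "xval (XOp f x y) \<rho> s = arith f (xval x \<rho> s) (xval y \<rho> s)"
| "xval (XSum e x) \<rho> s = (\<Sum>k<nval e \<rho>. xval x (\<rho> @ [k]) s)"
| "xval (XIf r a b c d) \<rho> s =
     (if compare r (xval a \<rho> s) (xval b \<rho> s) then xval c \<rho> s else xval d \<rho> s)"

fun arrays :: "xexp \<Rightarrow> string set" where
  "arrays (XN e) = {}"
| "arrays (XCell a e) = {a}"
| "arrays (XOp f x y) = arrays x \<union> arrays y"
| "arrays (XSum e x) = arrays x"
| "arrays (XIf r a b c d) = arrays a \<union> arrays b \<union> arrays c \<union> arrays d"

lemma xval_cong: "(\<And>a. a \<in> arrays e \<Longrightarrow> s a = s' a) \<Longrightarrow> xval e \<rho> s = xval e \<rho> s'"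
proof (induction e arbitrary: \<rho>)
  case (XOp f x y)
  from XOp.IH(1)[of \<rho>] XOp.IH(2)[of \<rho>] XOp.prems show ?case by simp
next
  case (XIf r a b c d)
  from XIf.IH(1)[of \<rho>] XIf.IH(2)[of \<rho>] XIf.IH(3)[of \<rho>] XIf.IH(4)[of \<rho>] XIf.prems
  show ?case by simp
qed auto

text \<open>The nesting depth is known when an expression is compiled, so variables and intermediate
  results live in cells with constant addresses.\<close>

definition stack_cell :: "nat \<Rightarrow> aexp" where
  "stack_cell p = Cell ''stack'' (Const (of_nat p))"

definition var_cell :: "nat \<Rightarrow> aexp" where
  "var_cell l = Cell ''var'' (Const (of_nat l))"

abbreviation set_stack :: "nat \<Rightarrow> aexp \<Rightarrow> com" where
  "set_stack p \<equiv> Assign ''stack'' (Const (of_nat p))"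

abbreviation set_var :: "nat \<Rightarrow> aexp \<Rightarrow> com" where
  "set_var l \<equiv> Assign ''var'' (Const (of_nat l))"

lemma address_of_nat [simp]: "address (of_nat k) = k"
  by (simp add: address_def)

lemma stack_cell_simps [simp]:
  "aval (stack_cell p) s = s ''stack'' p" "defined (stack_cell p) s" "asteps (stack_cell p) = 2"
  "occurring (stack_cell p) s = {s ''stack'' p, of_nat p}"
  by (simp_all add: stack_cell_def)

lemma var_cell_simps [simp]:
  "aval (var_cell p) s = s ''var'' p" "defined (var_cell p) s" "asteps (var_cell p) = 2"
  "occurring (var_cell p) s = {s ''var'' p, of_nat p}"
  by (simp_all add: var_cell_def)

declare of_nat_Suc [simp del]

definition For :: "nat \<Rightarrow> nat \<Rightarrow> com \<Rightarrow> com" where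
  "For l p c = Seq (set_var l (Const 0))
     (While (Compare LT (var_cell l) (stack_cell p))
       (Seq c (set_var l (Arith Add (var_cell l) (Const 1)))))"

text \<open>The result is left in stack cell \<open>p\<close>, and cells below \<open>p\<close> stay
  untouched. Division of rationals does not give the integer quotient and there is no rounding, so
  the quotient is found by counting upwards.\<close>

fun compile_nexp :: "nexp \<Rightarrow> nat \<Rightarrow> nat \<Rightarrow> com" where
  "compile_nexp (NC k) l p = set_stack p (Const (of_nat k))"
| "compile_nexp (NV i) l p = set_stack p (if i < l then var_cell i else Const 0)"
| "compile_nexp (NAdd x y) l p = Seq (compile_nexp x l p) (Seq (compile_nexp y l (Suc p))
     (set_stack p (Arith Add (stack_cell p) (stack_cell (Suc p)))))"
| "compile_nexp (NMul x y) l p = Seq (compile_nexp x l p) (Seq (compile_nexp y l (Suc p))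
     (set_stack p (Arith Mul (stack_cell p) (stack_cell (Suc p)))))"
| "compile_nexp (NSub x y) l p = Seq (compile_nexp x l p) (Seq (compile_nexp y l (Suc p))
     (If (Compare LT (stack_cell p) (stack_cell (Suc p)))
        (set_stack p (Const 0))
        (set_stack p (Arith Sub (stack_cell p) (stack_cell (Suc p))))))"
| "compile_nexp (NDiv x y) l p = Seq (compile_nexp x l p) (Seq (compile_nexp y l (Suc p))
     (If (Compare EQ (stack_cell (Suc p)) (Const 0))
        (set_stack p (Const 0))
        (Seq (set_stack (Suc (Suc p)) (Const 0))
        (Seq (While (Compare LE (Arith Mul (Arith Add (stack_cell (Suc (Suc p))) (Const 1))
                 (stack_cell (Suc p))) (stack_cell p))
               (set_stack (Suc (Suc p)) (Arith Add (stack_cell (Suc (Suc p))) (Const 1))))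
             (set_stack p (stack_cell (Suc (Suc p))))))))"

text \<open>Division by zero is an error of the machine but has the value 0 in the semantics of
  expressions, hence the test. In a sum, cell \<open>p\<close> holds the number of terms and
  \<open>p + 1\<close> the partial sum.\<close>

fun compile_xexp :: "xexp \<Rightarrow> nat \<Rightarrow> nat \<Rightarrow> com" where
  "compile_xexp (XN e) l p = compile_nexp e l p"
| "compile_xexp (XCell a e) l p =
     Seq (compile_nexp e l p) (set_stack p (Cell a (stack_cell p)))"
| "compile_xexp (XOp f x y) l p = Seq (compile_xexp x l p) (Seq (compile_xexp y l (Suc p))
     (if f = Div
      then If (Compare EQ (stack_cell (Suc p)) (Const 0)) (set_stack p (Const 0))
             (set_stack p (Arith Div (stack_cell p) (stack_cell (Suc p))))
      else set_stack p (Arith f (stack_cell p) (stack_cell (Suc p)))))"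
| "compile_xexp (XSum e x) l p =
     Seq (compile_nexp e l p) (Seq (set_stack (Suc p) (Const 0))
     (Seq (For l p (Seq (compile_xexp x (Suc l) (Suc (Suc p)))
        (set_stack (Suc p) (Arith Add (stack_cell (Suc p)) (stack_cell (Suc (Suc p)))))))
     (set_stack p (stack_cell (Suc p)))))"
| "compile_xexp (XIf r a b c d) l p = Seq (compile_xexp a l p) (Seq (compile_xexp b l (Suc p))
     (If (Compare r (stack_cell p) (stack_cell (Suc p)))
        (compile_xexp c l p) (compile_xexp d l p)))"

section \<open>The size of rational numbers\<close>

text \<open>Some fraction, reduced or not, with short numerator and denominator: the bounds for sums
  and products then follow from the schoolbook formulas.\<close>

definition rat_bits :: "nat \<Rightarrow> rat \<Rightarrow> bool" where
  "rat_bits N x \<longleftrightarrow> (\<exists>p q. x = of_int p / of_int q \<and> 0 < q \<and> q \<le> 2 ^ N \<and> \<bar>p\<bar> \<le> 2 ^ N)"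

lemma rat_bits_mono:
  assumes "rat_bits N x" "N \<le> N'" shows "rat_bits N' x"
proof -
  obtain p q where "x = of_int p / of_int q" "0 < q" "q \<le> 2 ^ N" "\<bar>p\<bar> \<le> 2 ^ N"
    using assms unfolding rat_bits_def by blast
  moreover have "(2::int) ^ N \<le> 2 ^ N'" using assms(2) by (simp add: power_increasing)
  ultimately show ?thesis unfolding rat_bits_def
    by (intro exI[of _ p] exI[of _ q]) linarith
qed

lemma rat_bits_of_nat:
  assumes "k \<le> 2 ^ N" shows "rat_bits N (of_nat k)"
proof -
  have "int k \<le> int (2 ^ N)" using assms by (simp only: of_nat_le_iff)
  then show ?thesis unfolding rat_bits_def
    by (intro exI[of _ "int k"] exI[of _ 1]) simp
qed

lemma rat_bits_of_nat': "k \<le> N \<Longrightarrow> rat_bits N (of_nat k)"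
  using less_exp[of N] by (intro rat_bits_of_nat) linarith

lemma rat_bits_0 [simp]: "rat_bits N 0"
  using rat_bits_of_nat[of 0 N] by simp

lemma rat_bits_1 [simp]: "rat_bits N 1"
  using rat_bits_of_nat[of 1 N] by (simp add: of_nat_Suc)

lemma rat_bits_uminus: "rat_bits N x \<Longrightarrow> rat_bits N (- x)"
  unfolding rat_bits_def
  by (elim exE, rule_tac x = "- p" in exI, rule_tac x = q in exI) simp

lemma rat_bits_mult:
  assumes "rat_bits N x" "rat_bits M y"
  shows "rat_bits (N + M) (x * y)"
proof -
  obtain p q p' q' where *: "x = of_int p / of_int q" "0 < q" "q \<le> 2 ^ N" "\<bar>p\<bar> \<le> 2 ^ N"
    "y = of_int p' / of_int q'" "0 < q'" "q' \<le> 2 ^ M" "\<bar>p'\<bar> \<le> 2 ^ M"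
    using assms unfolding rat_bits_def by blast
  have "q * q' \<le> 2 ^ (N + M)" "\<bar>p * p'\<bar> \<le> 2 ^ (N + M)"
    using * by (auto simp: power_add abs_mult intro!: mult_mono)
  with * show ?thesis
    unfolding rat_bits_def by (intro exI[of _ "p * p'"] exI[of _ "q * q'"]) auto
qed

lemma rat_bits_inverse:
  assumes "rat_bits N x" shows "rat_bits N (inverse x)"
proof -
  obtain p q where *: "x = of_int p / of_int q" "0 < q" "q \<le> 2 ^ N" "\<bar>p\<bar> \<le> 2 ^ N"
    using assms unfolding rat_bits_def by blast
  show ?thesis
  proof (cases "p = 0")
    case False
    have "inverse x = of_int (sgn p * q) / of_int \<bar>p\<bar>"
      using * False by (auto simp: sgn_if abs_if)
    moreover have "\<bar>sgn p * q\<bar> \<le> 2 ^ N"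
      using * False by (simp add: abs_mult)
    ultimately show ?thesis
      unfolding rat_bits_def using * False by (intro exI[of _ "sgn p * q"] exI[of _ "\<bar>p\<bar>"]) auto
  qed (use * in auto)
qed

lemma rat_bits_add:
  assumes "rat_bits N x" "rat_bits M y"
  shows "rat_bits (N + M + 1) (x + y)"
proof -
  obtain p q p' q' where *: "x = of_int p / of_int q" "0 < q" "q \<le> 2 ^ N" "\<bar>p\<bar> \<le> 2 ^ N"
    "y = of_int p' / of_int q'" "0 < q'" "q' \<le> 2 ^ M" "\<bar>p'\<bar> \<le> 2 ^ M"
    using assms unfolding rat_bits_def by blast
  have 1: "q * q' \<le> 2 ^ (N + M)" "\<bar>p * q'\<bar> \<le> 2 ^ (N + M)" "\<bar>p' * q\<bar> \<le> 2 ^ M * 2 ^ N"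
    using * by (auto simp: power_add abs_mult intro!: mult_mono)
  then have "\<bar>p * q' + p' * q\<bar> \<le> 2 ^ (N + M + 1)" "q * q' \<le> 2 ^ (N + M + 1)"
    using * by (auto simp: power_add mult.commute)
  with * show ?thesis
    unfolding rat_bits_def
    by (intro exI[of _ "p * q' + p' * q"] exI[of _ "q * q'"]) (auto simp: field_simps)
qed

lemma rat_bits_arith:
  assumes "rat_bits N x" "rat_bits M y"
  shows "rat_bits (N + M + 1) (arith f x y)"
  using rat_bits_add[OF assms] rat_bits_add[OF assms(1) rat_bits_uminus[OF assms(2)]]
    rat_bits_mult[OF assms] rat_bits_mult[OF assms(1) rat_bits_inverse[OF assms(2)]]
  by (cases f) (auto simp: divide_inverse intro: rat_bits_mono)

lemma rat_bits_sum:
  assumes "\<And>i. i < (n::nat) \<Longrightarrow> rat_bits (N i) (f i)"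
  shows "rat_bits (\<Sum>i<n. N i + 1) (\<Sum>i<n. f i)"
  using assms
proof (induction n)
  case (Suc n)
  then have "rat_bits (\<Sum>i<n. N i + 1) (\<Sum>i<n. f i)" "rat_bits (N n) (f n)" by auto
  from rat_bits_add[OF this] show ?case by (simp add: of_nat_Suc ac_simps)
qed simp

text \<open>Cancelling can only shorten a fraction. A numerator or denominator of absolute value at
  most \<open>2 ^ N\<close> has at most \<open>N + 1\<close> binary digits and a sign bit.\<close>

lemma rat_bits_encoding_length:
  assumes "rat_bits N x" shows "encoding_length x \<le> 2 * N + 4"
proof -
  obtain p q where *: "x = of_int p / of_int q" "0 < q" "q \<le> 2 ^ N" "\<bar>p\<bar> \<le> 2 ^ N"
    using assms unfolding rat_bits_def by blast
  obtain a b where ab: "quotient_of x = (a, b)" by (cases "quotient_of x")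
  have "x = Rat.Fract p q" using * by (simp add: Fract_of_int_quotient)
  then have n: "Rat.normalize (p, q) = (a, b)" using ab by (simp add: quotient_of_Fract)
  have b: "b > 0" and x: "x = of_int a / of_int b" using ab
    by (auto intro: quotient_of_denom_pos quotient_of_div)
  have "a = p div gcd p q" "b = q div gcd p q"
    using n *(2) by (auto simp: Rat.normalize_def Let_def)
  moreover have "gcd p q > 0" using * by simp
  moreover have "p div gcd p q dvd p" "q div gcd p q dvd q"
    by (metis dvd_div_mult_self dvd_triv_left gcd_dvd1) (metis dvd_div_mult_self dvd_triv_left gcd_dvd2)
  ultimately have ap: "a dvd p" "b dvd q" by simp_all
  have "b \<le> q" using ap(2) *(2) by (rule zdvd_imp_le)
  moreover have "\<bar>a\<bar> \<le> \<bar>p\<bar>"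
  proof (cases "p = 0")
    case False
    with ap(1) show ?thesis by (simp add: dvd_imp_le_int)
  qed (use \<open>a = p div gcd p q\<close> in simp)
  ultimately have "\<bar>a\<bar> \<le> \<bar>p\<bar>" "b \<le> q" by auto
  then have le: "\<bar>a\<bar> \<le> 2 ^ N" "b \<le> 2 ^ N" using * by auto
  have fl: "floorlog 2 (nat \<bar>z\<bar>) \<le> N + 1" if "\<bar>z\<bar> \<le> 2 ^ N" for z :: int
  proof -
    have "nat \<bar>z\<bar> \<le> 2 ^ N" using that by (simp add: nat_le_iff)
    then have "nat \<bar>z\<bar> < 2 * 2 ^ N" by (rule order.strict_trans1) simp
    then show ?thesis
      using floorlog_le_iff[of 2 "nat \<bar>z\<bar>" "N + 1"] by simp
  qed
  show ?thesis
    using fl[of a] fl[of b] le b ab by (simp add: encoding_length_def int_length_def)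
qed

lemma encoding_length_rat_bits: "rat_bits (encoding_length x) x"
proof -
  obtain a b where ab: "quotient_of x = (a, b)" by (cases "quotient_of x")
  have b: "b > 0" and x: "x = of_int a / of_int b" using ab
    by (auto intro: quotient_of_denom_pos quotient_of_div)
  have fl: "\<bar>z\<bar> \<le> 2 ^ M" if "floorlog 2 (nat \<bar>z\<bar>) \<le> M" for z :: int and M
  proof -
    have "nat \<bar>z\<bar> < 2 ^ M" if "z \<noteq> 0"
      using floorlog_le_iff[of 2 "nat \<bar>z\<bar>" M] \<open>floorlog 2 (nat \<bar>z\<bar>) \<le> M\<close> by simp
    then show ?thesis by (cases "z = 0") (auto simp: nat_less_iff)
  qed
  have "\<bar>a\<bar> \<le> 2 ^ encoding_length x" "\<bar>b\<bar> \<le> 2 ^ encoding_length x"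
    by (intro fl; simp add: encoding_length_def int_length_def ab)+
  then show ?thesis unfolding rat_bits_def using b x by auto
qed


section \<open>Executions with bounds on steps and numbers\<close>

definition runs :: "com \<Rightarrow> store \<Rightarrow> nat \<Rightarrow> nat \<Rightarrow> store \<Rightarrow> bool" where
  "runs c s K N s' \<longleftrightarrow> (\<exists>k W. exec c s k W s' \<and> k \<le> K \<and> (\<forall>w\<in>W. rat_bits N w))"

lemma runs_mono: "runs c s K N s' \<Longrightarrow> K \<le> K' \<Longrightarrow> N \<le> N' \<Longrightarrow> runs c s K' N' s'"
  unfolding runs_def
  by (elim exE, rule_tac x = k in exI, rule_tac x = W in exI) (auto intro: rat_bits_mono)

lemma runs_Seq:
  assumes "runs c s K N s'" "runs c' s' K' N' s''" "K + K' \<le> L" "N \<le> M" "N' \<le> M"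
  shows "runs (Seq c c') s L M s''"
proof -
  obtain k W where 1: "exec c s k W s'" "k \<le> K" "\<forall>w\<in>W. rat_bits N w"
    using assms(1) unfolding runs_def by blast
  obtain k' W' where 2: "exec c' s' k' W' s''" "k' \<le> K'" "\<forall>w\<in>W'. rat_bits N' w"
    using assms(2) unfolding runs_def by blast
  have "\<forall>w\<in>W \<union> W'. rat_bits M w"
    using 1(3) 2(3) assms(4,5) rat_bits_mono by blast
  with exec.Seq[OF 1(1) 2(1)] 1(2) 2(2) assms(3) show ?thesis
    unfolding runs_def by (intro exI[of _ "k + k'"] exI[of _ "W \<union> W'"]) auto
qed

lemma runs_Assign:
  assumes "defined e s" "asteps e + 2 \<le> K" "\<And>w. w \<in> occurring e s \<Longrightarrow> rat_bits N w" "p \<le> N"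
  shows "runs (Assign a (Const (of_nat p)) e) s K N (s(a := (s a)(p := aval e s)))"
  unfolding runs_def using exec.Assign[of "Const (of_nat p)" s e a] assms
  by (intro exI[of _ "asteps e + 2"] exI[of _ "insert (of_nat p) (occurring e s)"])
     (auto simp: rat_bits_of_nat')

lemma runs_If:
  assumes "test_defined b s" "test_steps b + K' \<le> K" "\<And>w. w \<in> test_occurring b s \<Longrightarrow> rat_bits N w"
    and "holds b s \<Longrightarrow> runs c s K' N s'" "\<not> holds b s \<Longrightarrow> runs c' s K' N s'"
  shows "runs (If b c c') s K N s'"
proof (cases "holds b s")
  case True
  then obtain k W where "exec c s k W s'" "k \<le> K'" "\<forall>w\<in>W. rat_bits N w"
    using assms(4) unfolding runs_def by blast
  with exec.IfTrue[OF assms(1) True, of c k W s' c'] assms(2,3) show ?thesis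
    unfolding runs_def
    by (intro exI[of _ "test_steps b + k"] exI[of _ "test_occurring b s \<union> W"]) auto
next
  case False
  then obtain k W where "exec c' s k W s'" "k \<le> K'" "\<forall>w\<in>W. rat_bits N w"
    using assms(5) unfolding runs_def by blast
  with exec.IfFalse[OF assms(1) False, of c' k W s' c] assms(2,3) show ?thesis
    unfolding runs_def
    by (intro exI[of _ "test_steps b + k"] exI[of _ "test_occurring b s \<union> W"]) auto
qed

lemma runs_While_False:
  assumes "test_defined b s" "\<not> holds b s" "test_steps b \<le> K"
    "\<And>w. w \<in> test_occurring b s \<Longrightarrow> rat_bits N w"
  shows "runs (While b c) s K N s"
  using exec.WhileFalse[OF assms(1,2), of c] assms(3,4) unfolding runs_def by blast

lemma runs_While_True:
  assumes "test_defined b s" "holds b s" "runs c s K1 N s'" "runs (While b c) s' K2 N s''"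
    "test_steps b + K1 + K2 \<le> K" "\<And>w. w \<in> test_occurring b s \<Longrightarrow> rat_bits N w"
  shows "runs (While b c) s K N s''"
proof -
  obtain k W where 1: "exec c s k W s'" "k \<le> K1" "\<forall>w\<in>W. rat_bits N w"
    using assms(3) unfolding runs_def by blast
  obtain k' W' where 2: "exec (While b c) s' k' W' s''" "k' \<le> K2" "\<forall>w\<in>W'. rat_bits N w"
    using assms(4) unfolding runs_def by blast
  show ?thesis
    unfolding runs_def using exec.WhileTrue[OF assms(1,2) 1(1) 2(1)] 1 2 assms(5,6)
    by (intro exI[of _ "test_steps b + k + k'"] exI[of _ "test_occurring b s \<union> W \<union> W'"]) auto
qed

text \<open>The cost may vary from round to round, and the invariant speaks about the store in which
  the loop variable already has its next value. The 10 covers the initialisation and the last test,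
  the 20 the test and the increment of one round.\<close>

lemma runs_For:
  fixes I :: "nat \<Rightarrow> store \<Rightarrow> bool"
  assumes stack: "\<And>k s. I k s \<Longrightarrow> s ''stack'' p = of_nat n"
    and I0: "I 0 (s(''var'' := (s ''var'')(l := 0)))"
    and step: "\<And>k s. k < n \<Longrightarrow> I k s \<Longrightarrow> s ''var'' l = of_nat k \<Longrightarrow>
      \<exists>s'. runs c s (K k) N s' \<and> s' ''var'' l = of_nat k \<and>
        I (Suc k) (s'(''var'' := (s' ''var'')(l := of_nat (Suc k))))"
    and N: "n \<le> 2 ^ N" "l \<le> N" "p \<le> N"
    and L: "10 + (\<Sum>k<n. K k + 20) \<le> L"
  shows "\<exists>s'. runs (For l p c) s L N s' \<and> I n s'"
proof -
  let ?b = "Compare LT (var_cell l) (stack_cell p)"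
  let ?inc = "set_var l (Arith Add (var_cell l) (Const 1))"
  have bits: "rat_bits N (of_nat k)" if "k \<le> n" for k
    using that N by (intro rat_bits_of_nat) simp
  have while: "\<exists>s'. runs (While ?b (Seq c ?inc)) s (5 + (\<Sum>i\<in>{k..<n}. K i + 20)) N s' \<and> I n s'"
    if "k \<le> n" "I k s" "s ''var'' l = of_nat k" for k s
    using that
  proof (induction k arbitrary: s rule: inc_induct)
    case base
    then show ?case using stack[of n s] N bits
      by (intro exI[of _ s] conjI runs_While_False) (auto simp: rat_bits_of_nat')
  next
    case (step k s)
    obtain s' where s': "runs c s (K k) N s'" "s' ''var'' l = of_nat k"
      "I (Suc k) (s'(''var'' := (s' ''var'')(l := of_nat (Suc k))))"
      using assms(3)[of k s] step.hyps step.prems by auto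
    let ?s = "s'(''var'' := (s' ''var'')(l := of_nat (Suc k)))"
    have "rat_bits N w" if "w \<in> occurring (Arith Add (var_cell l) (Const 1)) s'" for w
      using that s'(2) bits[of k] bits[of "Suc k"] step.hyps N(2) rat_bits_of_nat'[of l N]
      by (auto simp: of_nat_Suc ac_simps)
    then have inc: "runs ?inc s' 6 N ?s"
      using runs_Assign[of "Arith Add (var_cell l) (Const 1)" s' 6 N l "''var''"] s'(2) N(2)
      by (simp add: of_nat_Suc ac_simps)
    have "?s ''var'' l = of_nat (Suc k)" by simp
    from step.IH[OF s'(3) this]
    obtain s'' where s'': "runs (While ?b (Seq c ?inc)) ?s (5 + (\<Sum>i\<in>{Suc k..<n}. K i + 20)) N s''"
      "I n s''" by blast
    have "runs (While ?b (Seq c ?inc)) s (5 + (\<Sum>i\<in>{k..<n}. K i + 20)) N s''"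
    proof (rule runs_While_True[OF _ _ runs_Seq[OF s'(1) inc order.refl] s''(1)])
      show "test_steps ?b + (K k + 6) + (5 + (\<Sum>i\<in>{Suc k..<n}. K i + 20))
          \<le> 5 + (\<Sum>i\<in>{k..<n}. K i + 20)"
        using step.hyps by (simp add: sum.atLeast_Suc_lessThan)
      show "rat_bits N w" if "w \<in> test_occurring ?b s" for w
        using that stack[OF step.prems(1)] step.prems(2) bits[of k] bits[of n] step.hyps N
        by (auto simp: rat_bits_of_nat')
      show "holds ?b s" using stack[OF step.prems(1)] step.prems(2) step.hyps by simp
    qed auto
    with s''(2) show ?case by blast
  qed
  let ?s = "s(''var'' := (s ''var'')(l := 0))"
  have "runs (set_var l (Const 0)) s 3 N ?s"
    using runs_Assign[of "Const 0" s 3 N l "''var''"] N(2) by simp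
  moreover obtain s' where "runs (While ?b (Seq c ?inc)) ?s (5 + (\<Sum>i\<in>{0..<n}. K i + 20)) N s'" "I n s'"
    using while[of 0 ?s] I0 by auto
  moreover have "3 + (5 + (\<Sum>i\<in>{0..<n}. K i + 20)) \<le> L"
    using L by (simp add: lessThan_atLeast0)
  ultimately show ?thesis
    unfolding For_def using runs_Seq[where L = L and M = N] by blast
qed

section \<open>Cost and correctness of compiled expressions\<close>

definition preserves :: "nat \<Rightarrow> nat \<Rightarrow> store \<Rightarrow> store \<Rightarrow> bool" where
  "preserves l p s s' \<longleftrightarrow> (\<forall>a. a \<noteq> ''var'' \<longrightarrow> a \<noteq> ''stack'' \<longrightarrow> s' a = s a) \<and>
     (\<forall>i<l. s' ''var'' i = s ''var'' i) \<and> (\<forall>i<p. s' ''stack'' i = s ''stack'' i)"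

lemma preserves_refl [simp]: "preserves l p s s"
  by (simp add: preserves_def)

lemma preserves_trans:
  "preserves l p s s' \<Longrightarrow> preserves l' p' s' s'' \<Longrightarrow> l \<le> l' \<Longrightarrow> p \<le> p' \<Longrightarrow> preserves l p s s''"
  by (simp add: preserves_def)

lemma preserves_stack:
  "preserves l p s s' \<Longrightarrow> p \<le> q \<Longrightarrow> preserves l p s (s'(''stack'' := (s' ''stack'')(q := x)))"
  by (simp add: preserves_def)

lemma preserves_var:
  "preserves l p s s' \<Longrightarrow> l \<le> q \<Longrightarrow> preserves l p s (s'(''var'' := (s' ''var'')(q := x)))"
  by (simp add: preserves_def)

lemma runs_set_stackI:
  "runs c s K N (s'(''stack'' := (s' ''stack'')(p := z))) \<Longrightarrow> preserves l p t s' \<Longrightarrow>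
    \<exists>s''. runs c s K N s'' \<and> s'' ''stack'' p = z \<and> preserves l p t s''"
  by (rule exI[of _ "s'(''stack'' := (s' ''stack'')(p := z))"]) (simp add: preserves_stack)

text \<open>One number bounds both the steps of the compiled code and the bits of all numbers in it,
  so only one recursion has to be estimated. Constants, variables and stack addresses enter because
  they occur as numbers; \<open>30 * nval x \<rho>\<close> pays for the counting loop of a
  division.\<close>

fun nweight :: "nexp \<Rightarrow> nat list \<Rightarrow> nat \<Rightarrow> nat" where
  "nweight (NC k) \<rho> p = k + p + 10"
| "nweight (NV i) \<rho> p = nval (NV i) \<rho> + length \<rho> + p + 10"
| "nweight (NAdd x y) \<rho> p = nweight x \<rho> p + nweight y \<rho> (Suc p) + 20"
| "nweight (NMul x y) \<rho> p = nweight x \<rho> p + nweight y \<rho> (Suc p) + 20"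
| "nweight (NSub x y) \<rho> p = nweight x \<rho> p + nweight y \<rho> (Suc p) + 20"
| "nweight (NDiv x y) \<rho> p = nweight x \<rho> p + nweight y \<rho> (Suc p) + 30 * nval x \<rho> + 60"

text \<open>The parameter \<open>b\<close> is the size of the cells that are read. With the actual
  size the weight bounds the bits of numbers; with \<open>b = 0\<close> it still bounds the steps,
  which must not depend on the length of the data.\<close>

fun xweight :: "xexp \<Rightarrow> nat list \<Rightarrow> nat \<Rightarrow> nat \<Rightarrow> nat" where
  "xweight (XN e) \<rho> p b = nweight e \<rho> p"
| "xweight (XCell a e) \<rho> p b = nweight e \<rho> p + b + 20"
| "xweight (XOp f x y) \<rho> p b = xweight x \<rho> p b + xweight y \<rho> (Suc p) b + 20"
| "xweight (XSum e x) \<rho> p b = nweight e \<rho> p + length \<rho> + 60 +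
     (\<Sum>k<nval e \<rho>. xweight x (\<rho> @ [k]) (Suc (Suc p)) b + 40)"
| "xweight (XIf r a a' c d) \<rho> p b =
     xweight a \<rho> p b + xweight a' \<rho> (Suc p) b + xweight c \<rho> p b + xweight d \<rho> p b + 20"

lemma nweight_ge: "p + 10 \<le> nweight e \<rho> p"
  by (induction e arbitrary: p) (simp_all add: trans_le_add1)

lemma xweight_ge: "p + 10 \<le> xweight e \<rho> p b"
  by (induction e arbitrary: p \<rho>) (simp_all add: trans_le_add1 nweight_ge)

lemma two_power_add_le: "(2::nat) ^ a + 2 ^ b \<le> 2 ^ (a + b + 1)"
proof -
  have "(2::nat) ^ a \<le> 2 ^ (a + b)" "(2::nat) ^ b \<le> 2 ^ (a + b)"
    by (simp_all add: power_increasing)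
  then have "(2::nat) ^ a + 2 ^ b \<le> 2 * 2 ^ (a + b)" by linarith
  then show ?thesis by simp
qed

lemma le_two_power: "k \<le> w \<Longrightarrow> k \<le> 2 ^ w" for k w :: nat
  using less_exp[of w] by linarith

lemma nval_le_weight: "nval e \<rho> \<le> 2 ^ nweight e \<rho> p"
proof (induction e arbitrary: p)
  case (NC k)
  show ?case by (rule le_two_power) simp
next
  case (NV i)
  show ?case by (rule le_two_power) simp
next
  case (NAdd x y)
  have "nval x \<rho> + nval y \<rho> \<le> 2 ^ (nweight x \<rho> p + nweight y \<rho> (Suc p) + 1)"
    by (rule order.trans[OF add_mono[OF NAdd.IH(1)[of p] NAdd.IH(2)[of "Suc p"]] two_power_add_le])
  also have "\<dots> \<le> 2 ^ nweight (NAdd x y) \<rho> p" by (rule power_increasing) simp_all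
  finally show ?case by (simp only: nval.simps)
next
  case (NMul x y)
  have "nval x \<rho> * nval y \<rho> \<le> 2 ^ (nweight x \<rho> p + nweight y \<rho> (Suc p))"
    using mult_le_mono[OF NMul.IH(1)[of p] NMul.IH(2)[of "Suc p"]] by (simp only: power_add)
  also have "\<dots> \<le> 2 ^ nweight (NMul x y) \<rho> p" by (rule power_increasing) simp_all
  finally show ?case by (simp only: nval.simps)
next
  case (NSub x y)
  have "nval x \<rho> - nval y \<rho> \<le> 2 ^ nweight x \<rho> p" by (rule order.trans[OF diff_le_self NSub.IH(1)])
  also have "\<dots> \<le> 2 ^ nweight (NSub x y) \<rho> p" by (rule power_increasing) simp_all
  finally show ?case by (simp only: nval.simps)
next
  case (NDiv x y)
  have "nval x \<rho> div nval y \<rho> \<le> 2 ^ nweight x \<rho> p"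
    by (rule order.trans[OF div_le_dividend NDiv.IH(1)])
  also have "\<dots> \<le> 2 ^ nweight (NDiv x y) \<rho> p" by (rule power_increasing) simp_all
  finally show ?case by (simp only: nval.simps)
qed


text \<open>A round costs 10 steps for the test and 6 for the increment. The last test forms
  \<open>(q + 1) * b\<close>, which exceeds \<open>a\<close> but not \<open>a + b\<close>; hence the
  bound on \<open>a + b\<close>.\<close>

lemma runs_quotient:
  fixes a b p q :: nat and s :: store
  defines "t \<equiv> Compare LE (Arith Mul (Arith Add (stack_cell (Suc (Suc p))) (Const 1))
                 (stack_cell (Suc p))) (stack_cell p)"
    and "c \<equiv> set_stack (Suc (Suc p)) (Arith Add (stack_cell (Suc (Suc p))) (Const 1))"
  assumes "0 < b" "q * b \<le> a" "s ''stack'' p = of_nat a" "s ''stack'' (Suc p) = of_nat b"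
    "s ''stack'' (Suc (Suc p)) = of_nat q" "a + b \<le> 2 ^ N" "p + 2 \<le> N"
  shows "runs (While t c) s (16 * (a div b - q) + 10) N
    (s(''stack'' := (s ''stack'')(Suc (Suc p) := of_nat (a div b))))"
  using assms(4-7)
proof (induction "a div b - q" arbitrary: q s)
  case 0
  have q: "q = a div b" "a < (q + 1) * b"
    using 0 assms(3) by (auto simp: div_less_iff_less_mult less_eq_div_iff_mult_less_eq)
      (simp_all add: le_antisym less_eq_div_iff_mult_less_eq,
       metis add.commute dividend_less_times_div mult.commute mult_Suc le_antisym
        less_eq_div_iff_mult_less_eq)
  then have s: "s(''stack'' := (s ''stack'')(Suc (Suc p) := of_nat (a div b))) = s"
    using 0 by (auto simp: fun_eq_iff)
  have eq: "(of_nat q + 1) * of_nat b = (of_nat ((q + 1) * b) :: rat)"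
    by (simp only: of_nat_mult of_nat_add of_nat_1)
  have "a div b \<le> a" by simp
  then have le: "(q + 1) * b \<le> a + b" "q + 1 \<le> a + b"
    using 0(2) assms(3) q(1) by (simp add: algebra_simps, linarith)
  have bits: "rat_bits N (of_nat k)" if "k \<le> a + b" for k
    using that assms(8) by (intro rat_bits_of_nat) simp
  have n: "\<not> holds t s"
    using 0 q(2) unfolding t_def
    by (simp only: holds.simps compare.simps aval.simps arith.simps stack_cell_simps eq of_nat_le_iff not_le)
  have "rat_bits N w" if "w \<in> test_occurring t s" for w
    using that 0 eq bits[OF le(1)] bits[OF le(2)] bits[of a] bits[of b] bits[of q] le(2) assms(9)
      rat_bits_of_nat'[of p N] rat_bits_of_nat'[of "Suc p" N] rat_bits_of_nat'[of "Suc (Suc p)" N]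
    unfolding t_def by (auto simp: of_nat_Suc add.commute)
  with n show ?case unfolding s by (intro runs_While_False) (auto simp: t_def)
next
  case (Suc k)
  let ?s = "s(''stack'' := (s ''stack'')(Suc (Suc p) := of_nat (Suc q)))"
  have q: "Suc q \<le> a div b" using Suc.hyps(2) by linarith
  then have qa: "Suc q * b \<le> a" using assms(3) by (metis less_eq_div_iff_mult_less_eq)
  have "runs (While t c) ?s (16 * (a div b - Suc q) + 10) N
    (?s(''stack'' := (?s ''stack'')(Suc (Suc p) := of_nat (a div b))))"
    using Suc.hyps(2) Suc.prems qa by (intro Suc.hyps(1)) auto
  then have r: "runs (While t c) ?s (16 * (a div b - Suc q) + 10) N
    (s(''stack'' := (s ''stack'')(Suc (Suc p) := of_nat (a div b))))"
    by simp
  have eq: "(of_nat q + 1) * of_nat b = (of_nat (Suc q * b) :: rat)" by (simp add: of_nat_Suc algebra_simps)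
  have le: "Suc q * b \<le> a + b" "Suc q \<le> a + b" "q \<le> a + b" using q qa assms(3)
    using div_le_dividend[of a b] by linarith+
  have bits: "rat_bits N (of_nat k)" if "k \<le> a + b" for k
    using that assms(8) by (intro rat_bits_of_nat) simp
  have h: "holds t s"
    using Suc.prems qa unfolding t_def
    by (simp only: holds.simps compare.simps aval.simps arith.simps stack_cell_simps eq of_nat_le_iff)
  have tb: "rat_bits N w" if "w \<in> test_occurring t s" for w
    using that Suc.prems eq bits[OF le(1)] bits[OF le(2)] bits[of a] bits[of b] bits[OF le(3)] assms(9)
      rat_bits_of_nat'[of p N] rat_bits_of_nat'[of "Suc p" N] rat_bits_of_nat'[of "Suc (Suc p)" N]
    unfolding t_def by (auto simp: of_nat_Suc add.commute)
  have "rat_bits N w" if "w \<in> occurring (Arith Add (stack_cell (Suc (Suc p))) (Const 1)) s" for w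
    using that Suc.prems bits[OF le(2)] bits[OF le(3)] assms(9)
      rat_bits_of_nat'[of "Suc (Suc p)" N]
    by (auto simp: of_nat_Suc ac_simps)
  then have c: "runs c s 6 N ?s"
    unfolding c_def
    using runs_Assign[of "Arith Add (stack_cell (Suc (Suc p))) (Const 1)" s 6 N "Suc (Suc p)" "''stack''"]
      Suc.prems assms(9) by (simp add: of_nat_Suc ac_simps)
  show ?case
    by (rule runs_While_True[OF _ h c r _ tb]) (use q in \<open>auto simp: t_def\<close>)
qed

lemma runs_nexp:
  assumes "\<And>i. i < length \<rho> \<Longrightarrow> s ''var'' i = of_nat (\<rho> ! i)"
  shows "\<exists>s'. runs (compile_nexp e (length \<rho>) p) s (nweight e \<rho> p) (nweight e \<rho> p) s' \<and>
    s' ''stack'' p = of_nat (nval e \<rho>) \<and> preserves (length \<rho>) p s s'"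
proof -
  define good where "good e \<longleftrightarrow> (\<forall>s p. (\<forall>i<length \<rho>. s ''var'' i = of_nat (\<rho> ! i)) \<longrightarrow>
    (\<exists>s'. runs (compile_nexp e (length \<rho>) p) s (nweight e \<rho> p) (nweight e \<rho> p) s' \<and>
    s' ''stack'' p = of_nat (nval e \<rho>) \<and> preserves (length \<rho>) p s s'))" for e
  \<comment> \<open>The common part of the four binary operations: both operands are computed into
    the cells \<open>p\<close> and \<open>p + 1\<close>, and only the final command \<open>c\<close>
    differs.\<close>
  have both: "\<exists>s'. runs (Seq (compile_nexp x (length \<rho>) p) (Seq (compile_nexp y (length \<rho>) (Suc p)) c)) s
      (nweight x \<rho> p + nweight y \<rho> (Suc p) + K) N s' \<and>
      s' ''stack'' p = z \<and> preserves (length \<rho>) p s s'"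
    if gx: "good x" and gy: "good y" and var: "\<And>i. i < length \<rho> \<Longrightarrow> s ''var'' i = of_nat (\<rho> ! i)"
      and c: "\<And>s'. s' ''stack'' p = of_nat (nval x \<rho>) \<Longrightarrow> s' ''stack'' (Suc p) = of_nat (nval y \<rho>) \<Longrightarrow>
         \<exists>s''. runs c s' K N s'' \<and> s'' ''stack'' p = z \<and> preserves (length \<rho>) p s' s''"
      and N: "nweight x \<rho> p + nweight y \<rho> (Suc p) \<le> N"
    for x y s p c K N z
  proof -
    obtain s1 where s1: "runs (compile_nexp x (length \<rho>) p) s (nweight x \<rho> p) (nweight x \<rho> p) s1"
      "s1 ''stack'' p = of_nat (nval x \<rho>)" "preserves (length \<rho>) p s s1"
      using gx var unfolding good_def by blast
    have "\<forall>i<length \<rho>. s1 ''var'' i = of_nat (\<rho> ! i)"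
      using s1(3) var by (simp add: preserves_def)
    then obtain s2 where s2: "runs (compile_nexp y (length \<rho>) (Suc p)) s1 (nweight y \<rho> (Suc p)) (nweight y \<rho> (Suc p)) s2"
      "s2 ''stack'' (Suc p) = of_nat (nval y \<rho>)" "preserves (length \<rho>) (Suc p) s1 s2"
      using gy unfolding good_def by blast
    have "s2 ''stack'' p = of_nat (nval x \<rho>)" using s1(2) s2(3) by (simp add: preserves_def)
    then obtain s3 where s3: "runs c s2 K N s3" "s3 ''stack'' p = z" "preserves (length \<rho>) p s2 s3"
      using c s2(2) by blast
    have "runs (Seq (compile_nexp x (length \<rho>) p) (Seq (compile_nexp y (length \<rho>) (Suc p)) c)) s
      (nweight x \<rho> p + nweight y \<rho> (Suc p) + K) N s3"
      by (rule runs_Seq[OF s1(1) runs_Seq[OF s2(1) s3(1) order.refl, where M = N]]) (use N in linarith)+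
    moreover have "preserves (length \<rho>) p s s3"
      by (rule preserves_trans[OF preserves_trans[OF s1(3) s2(3)] s3(3)]) auto
    ultimately show ?thesis using s3(2) by blast
  qed
  have bits: "rat_bits N (of_nat (nval x \<rho>))" if "nweight x \<rho> p \<le> N" for x p N
    using rat_bits_mono[OF rat_bits_of_nat[OF nval_le_weight] that] .
  have ge: "rat_bits N (of_nat p)" "rat_bits N (of_nat (Suc p))"
    if "nweight y \<rho> (Suc p) \<le> N" for y p N
    using nweight_ge[of "Suc p" y \<rho>] that by (intro rat_bits_of_nat'; linarith)+
  have "good e"
  proof (induction e)
    case (NC k)
    show ?case unfolding good_def
    proof (intro allI impI)
      fix s :: store and p
      have "runs (set_stack p (Const (of_nat k))) s (nweight (NC k) \<rho> p) (nweight (NC k) \<rho> p)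
         (s(''stack'' := (s ''stack'')(p := of_nat (nval (NC k) \<rho>))))"
        using runs_Assign[of "Const (of_nat k)" s "nweight (NC k) \<rho> p" "nweight (NC k) \<rho> p" p]
          rat_bits_of_nat'[of k] by simp
      then show "\<exists>s'. runs (compile_nexp (NC k) (length \<rho>) p) s (nweight (NC k) \<rho> p) (nweight (NC k) \<rho> p) s' \<and>
          s' ''stack'' p = of_nat (nval (NC k) \<rho>) \<and> preserves (length \<rho>) p s s'"
        unfolding compile_nexp.simps by (rule runs_set_stackI) simp
    qed
  next
    case (NV i)
    show ?case unfolding good_def
    proof (intro allI impI)
      fix s :: store and p
      assume *: "\<forall>i<length \<rho>. s ''var'' i = of_nat (\<rho> ! i)"
      let ?e = "if i < length \<rho> then var_cell i else Const 0"
      have "runs (set_stack p ?e) s (nweight (NV i) \<rho> p) (nweight (NV i) \<rho> p)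
         (s(''stack'' := (s ''stack'')(p := aval ?e s)))"
        using * rat_bits_of_nat'[of i] rat_bits_of_nat'[of "\<rho> ! i"] by (intro runs_Assign) auto
      moreover have "aval ?e s = of_nat (nval (NV i) \<rho>)" using * by simp
      ultimately have "runs (set_stack p ?e) s (nweight (NV i) \<rho> p) (nweight (NV i) \<rho> p)
         (s(''stack'' := (s ''stack'')(p := of_nat (nval (NV i) \<rho>))))" by (simp only:)
      then show "\<exists>s'. runs (compile_nexp (NV i) (length \<rho>) p) s (nweight (NV i) \<rho> p) (nweight (NV i) \<rho> p) s' \<and>
          s' ''stack'' p = of_nat (nval (NV i) \<rho>) \<and> preserves (length \<rho>) p s s'"
        unfolding compile_nexp.simps by (rule runs_set_stackI) simp
    qed
  next
    case (NAdd x y)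
    show ?case unfolding good_def compile_nexp.simps nweight.simps
    proof (intro allI impI both[OF NAdd])
      fix s s' :: store and p
      let ?N = "nweight x \<rho> p + nweight y \<rho> (Suc p) + 20"
      let ?e = "Arith Add (stack_cell p) (stack_cell (Suc p))"
      assume *: "s' ''stack'' p = of_nat (nval x \<rho>)" "s' ''stack'' (Suc p) = of_nat (nval y \<rho>)"
      have "rat_bits ?N (of_nat (nval x \<rho> + nval y \<rho>))"
        using bits[of "NAdd x y" p ?N] by simp
      then have "runs (set_stack p ?e) s' 20 ?N (s'(''stack'' := (s' ''stack'')(p := aval ?e s')))"
        using * bits[of x p ?N] bits[of y "Suc p" ?N] ge[of y p ?N] nweight_ge[of p x \<rho>]
        by (intro runs_Assign) auto
      then show "\<exists>s''. runs (set_stack p ?e) s' 20 ?N s'' \<and>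
          s'' ''stack'' p = of_nat (nval (NAdd x y) \<rho>) \<and> preserves (length \<rho>) p s' s''"
        using * by (intro runs_set_stackI[where s' = s']) simp_all
    qed auto
  next
    case (NMul x y)
    show ?case unfolding good_def compile_nexp.simps nweight.simps
    proof (intro allI impI both[OF NMul])
      fix s s' :: store and p
      let ?N = "nweight x \<rho> p + nweight y \<rho> (Suc p) + 20"
      let ?e = "Arith Mul (stack_cell p) (stack_cell (Suc p))"
      assume *: "s' ''stack'' p = of_nat (nval x \<rho>)" "s' ''stack'' (Suc p) = of_nat (nval y \<rho>)"
      have "rat_bits ?N (of_nat (nval x \<rho> * nval y \<rho>))"
        using bits[of "NMul x y" p ?N] by simp
      then have "runs (set_stack p ?e) s' 20 ?N (s'(''stack'' := (s' ''stack'')(p := aval ?e s')))"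
        using * bits[of x p ?N] bits[of y "Suc p" ?N] ge[of y p ?N] nweight_ge[of p x \<rho>]
        by (intro runs_Assign) auto
      then show "\<exists>s''. runs (set_stack p ?e) s' 20 ?N s'' \<and>
          s'' ''stack'' p = of_nat (nval (NMul x y) \<rho>) \<and> preserves (length \<rho>) p s' s''"
        using * by (intro runs_set_stackI[where s' = s']) simp_all
    qed auto
  next
    case (NSub x y)
    show ?case unfolding good_def compile_nexp.simps nweight.simps
    proof (intro allI impI both[OF NSub])
      fix s s' :: store and p
      let ?N = "nweight x \<rho> p + nweight y \<rho> (Suc p) + 20"
      let ?e = "Arith Sub (stack_cell p) (stack_cell (Suc p))"
      let ?c = "If (Compare LT (stack_cell p) (stack_cell (Suc p)))
        (set_stack p (Const 0)) (set_stack p ?e)"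
      let ?s = "s'(''stack'' := (s' ''stack'')(p := of_nat (nval (NSub x y) \<rho>)))"
      assume *: "s' ''stack'' p = of_nat (nval x \<rho>)" "s' ''stack'' (Suc p) = of_nat (nval y \<rho>)"
      have b: "rat_bits ?N (of_nat (nval x \<rho> - nval y \<rho>))"
        using bits[of "NSub x y" p ?N] by simp
      have p: "p \<le> ?N" using nweight_ge[of p x \<rho>] by linarith
      have "runs ?c s' 20 ?N ?s"
      proof (rule runs_If[where K' = 10])
        show "rat_bits ?N w" if "w \<in> test_occurring (Compare LT (stack_cell p) (stack_cell (Suc p))) s'" for w
          using that * bits[of x p ?N] bits[of y "Suc p" ?N] ge[of y p ?N] by auto
      next
        assume "holds (Compare LT (stack_cell p) (stack_cell (Suc p))) s'"
        then show "runs (set_stack p (Const 0)) s' 10 ?N ?s"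
          using runs_Assign[of "Const 0" s' 10 ?N p "''stack''"] p * by simp
      next
        assume n: "\<not> holds (Compare LT (stack_cell p) (stack_cell (Suc p))) s'"
        have "rat_bits ?N w" if "w \<in> occurring ?e s'" for w
          using that n * bits[of x p ?N] bits[of y "Suc p" ?N] ge[of y p ?N] b by (auto simp: of_nat_diff)
        then show "runs (set_stack p ?e) s' 10 ?N ?s"
          using runs_Assign[of ?e s' 10 ?N p "''stack''"] n * p by (simp add: of_nat_diff)
      qed auto
      then show "\<exists>s''. runs ?c s' 20 ?N s'' \<and>
          s'' ''stack'' p = of_nat (nval (NSub x y) \<rho>) \<and> preserves (length \<rho>) p s' s''"
        by (rule runs_set_stackI) simp
    qed auto
  next
    case (NDiv x y)
    have "nweight (NDiv x y) \<rho> p = nweight x \<rho> p + nweight y \<rho> (Suc p) + (30 * nval x \<rho> + 60)" for p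
      by simp
    then show ?case unfolding good_def compile_nexp.simps
    proof (simp only:, intro allI impI both[OF NDiv])
      fix s s' :: store and p
      let ?K = "30 * nval x \<rho> + 60"
      let ?N = "nweight x \<rho> p + nweight y \<rho> (Suc p) + ?K"
      let ?t = "Compare LE (Arith Mul (Arith Add (stack_cell (Suc (Suc p))) (Const 1))
                 (stack_cell (Suc p))) (stack_cell p)"
      let ?d = "set_stack (Suc (Suc p)) (Arith Add (stack_cell (Suc (Suc p))) (Const 1))"
      let ?b = "Compare EQ (stack_cell (Suc p)) (Const 0)"
      let ?w = "Seq (set_stack (Suc (Suc p)) (Const 0))
        (Seq (While ?t ?d) (set_stack p (stack_cell (Suc (Suc p)))))"
      let ?c = "If ?b (set_stack p (Const 0)) ?w"
      assume *: "s' ''stack'' p = of_nat (nval x \<rho>)" "s' ''stack'' (Suc p) = of_nat (nval y \<rho>)"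
      have p: "p + 2 \<le> ?N" using nweight_ge[of p x \<rho>] by linarith
      have r2: "rat_bits ?N (of_nat (Suc (Suc p)))" using p by (intro rat_bits_of_nat') simp
      have N: "nval x \<rho> + nval y \<rho> \<le> 2 ^ ?N"
        by (rule order.trans[OF order.trans[OF add_mono[OF nval_le_weight[of x \<rho> p]
              nval_le_weight[of y \<rho> "Suc p"]] two_power_add_le]]) (rule power_increasing, simp_all)
      have bt: "rat_bits ?N w" if "w \<in> test_occurring ?b s'" for w
        using that * bits[of y "Suc p" ?N] ge[of y p ?N] by auto
      have "\<exists>s''. runs ?c s' ?K ?N s'' \<and> s'' ''stack'' p = of_nat (nval x \<rho> div nval y \<rho>) \<and>
        preserves (length \<rho>) p s' s''"
      proof (cases "nval y \<rho> = 0")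
        case True
        let ?s = "s'(''stack'' := (s' ''stack'')(p := 0))"
        have "runs ?c s' ?K ?N ?s"
        proof (rule runs_If[where K' = 10])
          show "runs (set_stack p (Const 0)) s' 10 ?N ?s"
            using runs_Assign[of "Const 0" s' 10 ?N p "''stack''"] p by simp
        qed (use True * bt in auto)
        then show ?thesis using True by (intro runs_set_stackI[where s' = s']) simp_all
      next
        case False
        let ?s1 = "s'(''stack'' := (s' ''stack'')(Suc (Suc p) := 0))"
        let ?s2 = "?s1(''stack'' := (?s1 ''stack'')(Suc (Suc p) := of_nat (nval x \<rho> div nval y \<rho>)))"
        let ?s3 = "?s2(''stack'' := (?s2 ''stack'')(p := of_nat (nval x \<rho> div nval y \<rho>)))"
        have 1: "runs (set_stack (Suc (Suc p)) (Const 0)) s' 3 ?N ?s1"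
          using runs_Assign[of "Const 0" s' 3 ?N "Suc (Suc p)" "''stack''"] p by simp
        have 2: "runs (While ?t ?d) ?s1 (16 * (nval x \<rho> div nval y \<rho> - 0) + 10) ?N ?s2"
          using False * N p by (intro runs_quotient) auto
        have "rat_bits ?N (of_nat (nval x \<rho> div nval y \<rho>))"
          by (rule rat_bits_of_nat[OF order.trans[OF div_le_dividend order.trans[OF le_add1 N]]])
        then have 3: "runs (set_stack p (stack_cell (Suc (Suc p)))) ?s2 4 ?N ?s3"
          using runs_Assign[of "stack_cell (Suc (Suc p))" ?s2 4 ?N p "''stack''"] p r2 by auto
        have le: "nval x \<rho> div nval y \<rho> \<le> nval x \<rho>" by simp
        have w: "runs ?w s' (30 * nval x \<rho> + 30) ?N ?s3"
          by (rule runs_Seq[OF 1 runs_Seq[OF 2 3 order.refl, where M = ?N]]) (use le in linarith)+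
        have "runs ?c s' ?K ?N ?s3"
        proof (rule runs_If[OF _ _ bt _ w])
          assume "holds ?b s'"
          then show "runs (set_stack p (Const 0)) s' (30 * nval x \<rho> + 30) ?N ?s3"
            using False * by simp
        qed auto
        then show ?thesis by (rule runs_set_stackI) (simp add: preserves_def)
      qed
      then show "\<exists>s''. runs ?c s' ?K ?N s'' \<and>
          s'' ''stack'' p = of_nat (nval (NDiv x y) \<rho>) \<and> preserves (length \<rho>) p s' s''"
        by simp
    qed auto
  qed
  with assms show ?thesis unfolding good_def by blast
qed


text \<open>Since no common denominator is used, the bits of all summands add up. For an expression
  of fixed shape the result is still polynomial; along a recursion it would not be.\<close>

lemma rat_bits_xval:
  assumes "\<And>a i. a \<in> arrays e \<Longrightarrow> rat_bits b (s a i)"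
  shows "rat_bits (xweight e \<rho> p b) (xval e \<rho> s)"
  using assms
proof (induction e arbitrary: \<rho> p)
  case (XN e)
  show ?case using rat_bits_of_nat[OF nval_le_weight] by simp
next
  case (XCell a e)
  then have "rat_bits b (s a (nval e \<rho>))" by simp
  then show ?case by (simp add: rat_bits_mono)
next
  case (XOp f x y)
  have "rat_bits (xweight x \<rho> p b + xweight y \<rho> (Suc p) b + 1) (xval (XOp f x y) \<rho> s)"
    unfolding xval.simps by (intro rat_bits_arith XOp.IH XOp.prems) auto
  then show ?case by (rule rat_bits_mono) simp
next
  case (XSum e x)
  have "rat_bits (\<Sum>k<nval e \<rho>. xweight x (\<rho> @ [k]) (Suc (Suc p)) b + 1) (xval (XSum e x) \<rho> s)"
    unfolding xval.simps by (intro rat_bits_sum XSum.IH XSum.prems) auto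
  moreover have "(\<Sum>k<nval e \<rho>. xweight x (\<rho> @ [k]) (Suc (Suc p)) b + 1) \<le> xweight (XSum e x) \<rho> p b"
    unfolding xweight.simps by (rule trans_le_add2, rule sum_mono) simp
  ultimately show ?case by (rule rat_bits_mono)
next
  case (XIf r a1 a2 c d)
  have "rat_bits (xweight c \<rho> p b) (xval c \<rho> s)" "rat_bits (xweight d \<rho> p b) (xval d \<rho> s)"
    by (rule XIf.IH, simp add: XIf.prems)+
  then have "rat_bits (xweight (XIf r a1 a2 c d) \<rho> p b) (xval c \<rho> s)"
    "rat_bits (xweight (XIf r a1 a2 c d) \<rho> p b) (xval d \<rho> s)"
    by (simp_all add: rat_bits_mono)
  then show ?case by simp
qed

lemma preserves_array:
  "preserves l p s s' \<Longrightarrow> a \<in> arrays e \<Longrightarrow> ''var'' \<notin> arrays e \<Longrightarrow> ''stack'' \<notin> arrays e \<Longrightarrow> s' a = s a"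
  unfolding preserves_def by metis

lemma xval_preserves:
  assumes "preserves l p s s'" "''var'' \<notin> arrays e" "''stack'' \<notin> arrays e"
  shows "xval e \<rho> s' = xval e \<rho> s"
  by (rule xval_cong) (rule preserves_array[OF assms(1) _ assms(2,3)])

lemma runs_xexp:
  assumes "''var'' \<notin> arrays e" "''stack'' \<notin> arrays e"
    and "\<And>i. i < length \<rho> \<Longrightarrow> s ''var'' i = of_nat (\<rho> ! i)"
    and "\<And>a i. a \<in> arrays e \<Longrightarrow> rat_bits b (s a i)"
  shows "\<exists>s'. runs (compile_xexp e (length \<rho>) p) s (xweight e \<rho> p 0) (xweight e \<rho> p b) s' \<and>
    s' ''stack'' p = xval e \<rho> s \<and> preserves (length \<rho>) p s s'"
  using assms
proof (induction e arbitrary: \<rho> s p)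
  case (XN e)
  then show ?case using runs_nexp[of \<rho> s e p] by simp
next
  case (XCell a e)
  let ?N = "xweight (XCell a e) \<rho> p b"
  obtain s1 where s1: "runs (compile_nexp e (length \<rho>) p) s (nweight e \<rho> p) (nweight e \<rho> p) s1"
    "s1 ''stack'' p = of_nat (nval e \<rho>)" "preserves (length \<rho>) p s s1"
    using runs_nexp[of \<rho> s e p] XCell.prems(3) by blast
  have s1a: "s1 a = s a" using s1(3) XCell.prems(1,2) by (auto simp: preserves_def)
  have "rat_bits b (s a (nval e \<rho>))" using XCell.prems(4) by simp
  then have b: "rat_bits ?N (s a (nval e \<rho>))" "rat_bits ?N (of_nat (nval e \<rho>))" "rat_bits ?N (of_nat p)"
    using rat_bits_of_nat[OF nval_le_weight[of e \<rho> p]] nweight_ge[of p e \<rho>]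
    by (auto intro: rat_bits_mono rat_bits_of_nat')
  have p: "p \<le> ?N" using nweight_ge[of p e \<rho>] by simp
  have "rat_bits ?N w" if "w \<in> occurring (Cell a (stack_cell p)) s1" for w
    using that b s1(2) s1a by auto
  from runs_Assign[of "Cell a (stack_cell p)" s1 5, OF _ _ this p, of "''stack''"]
  have "runs (set_stack p (Cell a (stack_cell p))) s1 5 ?N
      (s1(''stack'' := (s1 ''stack'')(p := xval (XCell a e) \<rho> s)))"
    using s1(2) s1a by simp
  from runs_set_stackI[OF this s1(3)]
  obtain s2 where s2: "runs (set_stack p (Cell a (stack_cell p))) s1 5 ?N s2"
    "s2 ''stack'' p = xval (XCell a e) \<rho> s" "preserves (length \<rho>) p s s2" by blast
  have "runs (compile_xexp (XCell a e) (length \<rho>) p) s (xweight (XCell a e) \<rho> p 0) ?N s2"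
    unfolding compile_xexp.simps by (rule runs_Seq[OF s1(1) s2(1)]) auto
  with s2 show ?case by blast
next
  case (XOp f x y)
  let ?N = "xweight (XOp f x y) \<rho> p b" and ?z = "xval (XOp f x y) \<rho> s"
  obtain s1 where s1: "runs (compile_xexp x (length \<rho>) p) s (xweight x \<rho> p 0) (xweight x \<rho> p b) s1"
    "s1 ''stack'' p = xval x \<rho> s" "preserves (length \<rho>) p s s1"
    using XOp.IH(1)[of \<rho> s p] XOp.prems by auto
  have "\<exists>s2. runs (compile_xexp y (length \<rho>) (Suc p)) s1 (xweight y \<rho> (Suc p) 0) (xweight y \<rho> (Suc p) b) s2 \<and>
    s2 ''stack'' (Suc p) = xval y \<rho> s1 \<and> preserves (length \<rho>) (Suc p) s1 s2"
  proof (rule XOp.IH(2))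
    show "''var'' \<notin> arrays y" "''stack'' \<notin> arrays y" using XOp.prems(1,2) by auto
    then show "rat_bits b (s1 a i)" if "a \<in> arrays y" for a i
      using preserves_array[OF s1(3) that] XOp.prems(4)[of a i] that by simp
    show "s1 ''var'' i = of_nat (\<rho> ! i)" if "i < length \<rho>" for i
      using s1(3) XOp.prems(3) that by (simp add: preserves_def)
  qed
  then obtain s2 where s2:
    "runs (compile_xexp y (length \<rho>) (Suc p)) s1 (xweight y \<rho> (Suc p) 0) (xweight y \<rho> (Suc p) b) s2"
    "s2 ''stack'' (Suc p) = xval y \<rho> s" "preserves (length \<rho>) (Suc p) s1 s2"
    using xval_preserves[OF s1(3), of y] XOp.prems by auto
  have s2p: "s2 ''stack'' p = xval x \<rho> s" using s1(2) s2(3) by (simp add: preserves_def)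
  have pr: "preserves (length \<rho>) p s s2" by (rule preserves_trans[OF s1(3) s2(3)]) auto
  have p: "Suc p \<le> ?N" using xweight_ge[of p x \<rho> b] by simp
  have "rat_bits ?N (xval (XOp f x y) \<rho> s)"
    by (rule rat_bits_xval) (use XOp.prems in auto)
  moreover have "rat_bits (xweight x \<rho> p b) (xval x \<rho> s)" "rat_bits (xweight y \<rho> (Suc p) b) (xval y \<rho> s)"
    by (intro rat_bits_xval; use XOp.prems in auto)+
  ultimately have b: "rat_bits ?N (xval (XOp f x y) \<rho> s)" "rat_bits ?N (xval x \<rho> s)" "rat_bits ?N (xval y \<rho> s)"
    "rat_bits ?N (of_nat p)" "rat_bits ?N (of_nat (Suc p))"
    using p rat_bits_of_nat'[of p ?N] rat_bits_of_nat'[of "Suc p" ?N]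
    by (auto elim!: rat_bits_mono simp del: xval.simps)
  let ?c = "if f = Div
      then If (Compare EQ (stack_cell (Suc p)) (Const 0)) (set_stack p (Const 0))
             (set_stack p (Arith Div (stack_cell p) (stack_cell (Suc p))))
      else set_stack p (Arith f (stack_cell p) (stack_cell (Suc p)))"
  let ?s = "s2(''stack'' := (s2 ''stack'')(p := ?z))"
  have op: "runs (set_stack p (Arith f (stack_cell p) (stack_cell (Suc p)))) s2 7 ?N ?s"
    if "f = Div \<Longrightarrow> xval y \<rho> s \<noteq> 0"
  proof -
    have "rat_bits ?N w" if "w \<in> occurring (Arith f (stack_cell p) (stack_cell (Suc p))) s2" for w
      using that b s2p s2(2) by auto
    from runs_Assign[of "Arith f (stack_cell p) (stack_cell (Suc p))" s2 7, OF _ _ this, of p "''stack''"]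
    show ?thesis using p that s2p s2(2) by simp
  qed
  have "runs ?c s2 20 ?N ?s"
  proof (cases "f = Div")
    case True
    have "runs (If (Compare EQ (stack_cell (Suc p)) (Const 0)) (set_stack p (Const 0))
             (set_stack p (Arith Div (stack_cell p) (stack_cell (Suc p))))) s2 20 ?N ?s"
    proof (rule runs_If[where K' = 7])
      show "rat_bits ?N w" if "w \<in> test_occurring (Compare EQ (stack_cell (Suc p)) (Const 0)) s2" for w
        using that b s2(2) by auto
      assume "holds (Compare EQ (stack_cell (Suc p)) (Const 0)) s2"
      then show "runs (set_stack p (Const 0)) s2 7 ?N ?s"
        using runs_Assign[of "Const 0" s2 7 ?N p "''stack''"] p s2(2) True by simp
    next
      assume "\<not> holds (Compare EQ (stack_cell (Suc p)) (Const 0)) s2"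
      then show "runs (set_stack p (Arith Div (stack_cell p) (stack_cell (Suc p)))) s2 7 ?N ?s"
        using op s2(2) True by simp
    qed auto
    then show ?thesis by (simp only: True simp_thms if_True)
  next
    case False
    with op show ?thesis by (auto intro: runs_mono)
  qed
  from runs_set_stackI[OF this pr]
  obtain s3 where s3: "runs ?c s2 20 ?N s3" "s3 ''stack'' p = ?z" "preserves (length \<rho>) p s s3" by blast
  have "runs (compile_xexp (XOp f x y) (length \<rho>) p) s (xweight (XOp f x y) \<rho> p 0) ?N s3"
    unfolding compile_xexp.simps
    by (rule runs_Seq[OF s1(1) runs_Seq[OF s2(1) s3(1) order.refl, where M = ?N]]) auto
  with s3 show ?case by blast
next
  case (XIf r a1 a2 c d)
  let ?N = "xweight (XIf r a1 a2 c d) \<rho> p b"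
  obtain s1 where s1: "runs (compile_xexp a1 (length \<rho>) p) s (xweight a1 \<rho> p 0) (xweight a1 \<rho> p b) s1"
    "s1 ''stack'' p = xval a1 \<rho> s" "preserves (length \<rho>) p s s1"
    using XIf.IH(1)[of \<rho> s p] XIf.prems by auto
  have "\<exists>s2. runs (compile_xexp a2 (length \<rho>) (Suc p)) s1 (xweight a2 \<rho> (Suc p) 0) (xweight a2 \<rho> (Suc p) b) s2 \<and>
    s2 ''stack'' (Suc p) = xval a2 \<rho> s1 \<and> preserves (length \<rho>) (Suc p) s1 s2"
  proof (rule XIf.IH(2))
    show "''var'' \<notin> arrays a2" "''stack'' \<notin> arrays a2" using XIf.prems(1,2) by auto
    then show "rat_bits b (s1 a i)" if "a \<in> arrays a2" for a i
      using preserves_array[OF s1(3) that] XIf.prems(4)[of a i] that by simp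
    show "s1 ''var'' i = of_nat (\<rho> ! i)" if "i < length \<rho>" for i
      using s1(3) XIf.prems(3) that by (simp add: preserves_def)
  qed
  then obtain s2 where s2:
    "runs (compile_xexp a2 (length \<rho>) (Suc p)) s1 (xweight a2 \<rho> (Suc p) 0) (xweight a2 \<rho> (Suc p) b) s2"
    "s2 ''stack'' (Suc p) = xval a2 \<rho> s" "preserves (length \<rho>) (Suc p) s1 s2"
    using xval_preserves[OF s1(3), of a2] XIf.prems by auto
  have s2p: "s2 ''stack'' p = xval a1 \<rho> s" using s1(2) s2(3) by (simp add: preserves_def)
  have pr: "preserves (length \<rho>) p s s2" by (rule preserves_trans[OF s1(3) s2(3)]) auto
  have branch: "\<exists>s3. runs (compile_xexp e (length \<rho>) p) s2 (xweight e \<rho> p 0) (xweight e \<rho> p b) s3 \<and>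
    s3 ''stack'' p = xval e \<rho> s \<and> preserves (length \<rho>) p s s3"
    if IH: "\<And>\<rho> s p. ''var'' \<notin> arrays e \<Longrightarrow> ''stack'' \<notin> arrays e \<Longrightarrow>
        (\<And>i. i < length \<rho> \<Longrightarrow> s ''var'' i = of_nat (\<rho> ! i)) \<Longrightarrow>
        (\<And>a i. a \<in> arrays e \<Longrightarrow> rat_bits b (s a i)) \<Longrightarrow>
        \<exists>s'. runs (compile_xexp e (length \<rho>) p) s (xweight e \<rho> p 0) (xweight e \<rho> p b) s' \<and>
           s' ''stack'' p = xval e \<rho> s \<and> preserves (length \<rho>) p s s'"
      and sub: "arrays e \<subseteq> arrays (XIf r a1 a2 c d)" for e
  proof -
    have wf: "''var'' \<notin> arrays e" "''stack'' \<notin> arrays e" using sub XIf.prems(1,2) by auto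
    have cells: "rat_bits b (s2 a i)" if "a \<in> arrays e" for a i
    proof -
      have "s2 a = s a" by (rule preserves_array[OF pr that wf])
      moreover have "a \<in> arrays (XIf r a1 a2 c d)" using sub that by blast
      ultimately show ?thesis using XIf.prems(4)[of a i] by simp
    qed
    have "\<exists>s'. runs (compile_xexp e (length \<rho>) p) s2 (xweight e \<rho> p 0) (xweight e \<rho> p b) s' \<and>
           s' ''stack'' p = xval e \<rho> s2 \<and> preserves (length \<rho>) p s2 s'"
    proof (rule IH[OF wf])
      show "s2 ''var'' i = of_nat (\<rho> ! i)" if "i < length \<rho>" for i
        using pr XIf.prems(3) that by (simp add: preserves_def)
    qed (rule cells)
    then obtain s3 where s3: "runs (compile_xexp e (length \<rho>) p) s2 (xweight e \<rho> p 0) (xweight e \<rho> p b) s3"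
      "s3 ''stack'' p = xval e \<rho> s2" "preserves (length \<rho>) p s2 s3" by blast
    have "preserves (length \<rho>) p s s3" by (rule preserves_trans[OF pr s3(3)]) auto
    then show ?thesis
      using s3(1,2) xval_preserves[OF pr wf, of \<rho>] by (intro exI[of _ s3]) simp
  qed
  let ?t = "Compare r (stack_cell p) (stack_cell (Suc p))"
  let ?c = "If ?t (compile_xexp c (length \<rho>) p) (compile_xexp d (length \<rho>) p)"
  have p: "Suc p \<le> ?N" using xweight_ge[of p a1 \<rho> b] by simp
  have "rat_bits (xweight a1 \<rho> p b) (xval a1 \<rho> s)" "rat_bits (xweight a2 \<rho> (Suc p) b) (xval a2 \<rho> s)"
    by (intro rat_bits_xval; use XIf.prems in auto)+
  then have b: "rat_bits ?N (xval a1 \<rho> s)" "rat_bits ?N (xval a2 \<rho> s)"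
    "rat_bits ?N (of_nat p)" "rat_bits ?N (of_nat (Suc p))"
    using p rat_bits_of_nat'[of p ?N] rat_bits_of_nat'[of "Suc p" ?N]
    by (auto elim!: rat_bits_mono simp del: xval.simps)
  have tb: "rat_bits ?N w" if "w \<in> test_occurring ?t s2" for w
    using that b s2p s2(2) by auto
  have t: "holds ?t s2 \<longleftrightarrow> compare r (xval a1 \<rho> s) (xval a2 \<rho> s)" using s2p s2(2) by simp
  \<comment> \<open>\<open>e\<close> is the branch that is executed. The weight contains both
    branches, since it must not depend on the outcome of the test.\<close>
  define e where "e = (if holds ?t s2 then c else d)"
  have "\<exists>s3. runs (compile_xexp e (length \<rho>) p) s2 (xweight e \<rho> p 0) (xweight e \<rho> p b) s3 \<and>
    s3 ''stack'' p = xval e \<rho> s \<and> preserves (length \<rho>) p s s3"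
  proof (cases "holds ?t s2")
    case True
    then have "e = c" by (simp add: e_def)
    show ?thesis unfolding \<open>e = c\<close> by (rule branch[OF XIf.IH(3)]) auto
  next
    case False
    then have "e = d" by (simp add: e_def)
    show ?thesis unfolding \<open>e = d\<close> by (rule branch[OF XIf.IH(4)]) auto
  qed
  then obtain s3 where s3: "runs (compile_xexp e (length \<rho>) p) s2 (xweight e \<rho> p 0) (xweight e \<rho> p b) s3"
    "s3 ''stack'' p = xval e \<rho> s" "preserves (length \<rho>) p s s3" by blast
  have e: "runs (compile_xexp e (length \<rho>) p) s2 (xweight c \<rho> p 0 + xweight d \<rho> p 0) ?N s3"
    by (rule runs_mono[OF s3(1)]) (auto simp: e_def)
  have "runs ?c s2 (xweight c \<rho> p 0 + xweight d \<rho> p 0 + 20) ?N s3"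
    by (rule runs_If[OF _ _ tb, where K' = "xweight c \<rho> p 0 + xweight d \<rho> p 0"])
      (use e in \<open>simp_all add: e_def del: xweight.simps split: if_splits\<close>)
  then have "runs (compile_xexp (XIf r a1 a2 c d) (length \<rho>) p) s (xweight (XIf r a1 a2 c d) \<rho> p 0) ?N s3"
    unfolding compile_xexp.simps
    by (intro runs_Seq[OF s1(1) runs_Seq[OF s2(1) _ order.refl, where M = ?N]]) auto
  moreover have "xval e \<rho> s = xval (XIf r a1 a2 c d) \<rho> s" using t by (simp add: e_def)
  ultimately show ?case using s3 by auto
next
  case (XSum e x)
  let ?l = "length \<rho>" and ?n = "nval e \<rho>"
  let ?N = "xweight (XSum e x) \<rho> p b"
  let ?w = "\<lambda>k b. xweight x (\<rho> @ [k]) (Suc (Suc p)) b"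
  let ?add = "set_stack (Suc p) (Arith Add (stack_cell (Suc p)) (stack_cell (Suc (Suc p))))"
  obtain s1 where s1: "runs (compile_nexp e ?l p) s (nweight e \<rho> p) (nweight e \<rho> p) s1"
    "s1 ''stack'' p = of_nat ?n" "preserves ?l p s s1"
    using runs_nexp[of \<rho> s e p] XSum.prems(3) by blast
  have p: "Suc (Suc p) \<le> ?N" "?l \<le> ?N" using nweight_ge[of p e \<rho>] by auto
  have pb: "rat_bits ?N (of_nat p)" "rat_bits ?N (of_nat (Suc p))" "rat_bits ?N (of_nat (Suc (Suc p)))"
    using p by (auto intro!: rat_bits_of_nat' simp del: xweight.simps)
  have part: "rat_bits ?N (\<Sum>i<k. xval x (\<rho> @ [i]) s)" if "k \<le> ?n" for k
  proof -
    have "rat_bits (\<Sum>i<k. ?w i b + 1) (\<Sum>i<k. xval x (\<rho> @ [i]) s)"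
      using XSum.prems(4) by (intro rat_bits_sum rat_bits_xval) auto
    moreover have "(\<Sum>i<k. ?w i b + 1) \<le> (\<Sum>i<?n. ?w i b + 40)"
      by (rule order.trans[OF sum_mono2[of "{..<?n}" "{..<k}"] sum_mono]) (use that in auto)
    ultimately show ?thesis by (elim rat_bits_mono) simp
  qed
  have wle: "?w k b \<le> ?N" if "k < ?n" for k
  proof -
    have "?w k b \<le> ?w k b + 40" by simp
    also have "\<dots> \<le> (\<Sum>i<?n. ?w i b + 40)" using that by (intro member_le_sum) auto
    finally show ?thesis by simp
  qed
  let ?s2 = "s1(''stack'' := (s1 ''stack'')(Suc p := 0))"
  have s2: "runs (set_stack (Suc p) (Const 0)) s1 3 ?N ?s2"
    using runs_Assign[of "Const 0" s1 3 ?N "Suc p" "''stack''"] p by (simp del: xweight.simps)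
  \<comment> \<open>The summand is computed from cell \<open>p + 2\<close> upwards, so neither the
    number of rounds in \<open>p\<close> nor the partial sum in \<open>p + 1\<close> is
    overwritten.\<close>
  define I where "I k t \<longleftrightarrow> preserves ?l p s t \<and> t ''stack'' p = of_nat ?n \<and>
    t ''stack'' (Suc p) = (\<Sum>i<k. xval x (\<rho> @ [i]) s)" for k t
  have "\<exists>s3. runs (For ?l p (Seq (compile_xexp x (Suc ?l) (Suc (Suc p))) ?add)) ?s2
    (10 + (\<Sum>k<?n. (?w k 0 + 7) + 20)) ?N s3 \<and> I ?n s3"
  proof (rule runs_For[where I = I])
    show "I 0 (?s2(''var'' := (?s2 ''var'')(?l := 0)))"
      using s1(2) unfolding I_def
      by (intro conjI preserves_var preserves_stack s1(3)) simp_all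
  next
    show "?n \<le> 2 ^ ?N"
      by (rule order.trans[OF nval_le_weight[of e \<rho> p]]) (rule power_increasing, simp_all)
  next
    fix k t assume k: "k < ?n" "I k t" "t ''var'' ?l = of_nat k"
    have pr: "preserves ?l p s t" using k(2) by (simp add: I_def)
    have wf: "''var'' \<notin> arrays x" "''stack'' \<notin> arrays x" using XSum.prems(1,2) by auto
    have cells: "rat_bits b (t a i)" if "a \<in> arrays x" for a i
    proof -
      have "t a = s a" by (rule preserves_array[OF pr that wf])
      then show ?thesis using XSum.prems(4)[of a i] that by simp
    qed
    have "t ''var'' i = of_nat ((\<rho> @ [k]) ! i)" if "i < length (\<rho> @ [k])" for i
    proof (cases "i < ?l")
      case True
      then have "t ''var'' i = s ''var'' i" using pr by (simp add: preserves_def)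
      then show ?thesis using True XSum.prems(3) by (simp add: nth_append)
    next
      case False
      then have "i = ?l" using that by simp
      then show ?thesis using k(3) by simp
    qed
    then have "\<exists>s'. runs (compile_xexp x (length (\<rho> @ [k])) (Suc (Suc p))) t (?w k 0) (?w k b) s' \<and>
      s' ''stack'' (Suc (Suc p)) = xval x (\<rho> @ [k]) t \<and> preserves (length (\<rho> @ [k])) (Suc (Suc p)) t s'"
      using wf cells by (intro XSum.IH) auto
    then obtain t1 where t1: "runs (compile_xexp x (Suc ?l) (Suc (Suc p))) t (?w k 0) (?w k b) t1"
      "t1 ''stack'' (Suc (Suc p)) = xval x (\<rho> @ [k]) s" "preserves (Suc ?l) (Suc (Suc p)) t t1"
      using xval_preserves[OF pr wf] by auto
    let ?t2 = "t1(''stack'' := (t1 ''stack'')(Suc p := (\<Sum>i<Suc k. xval x (\<rho> @ [i]) s)))"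
    have v: "t1 ''stack'' (Suc p) = (\<Sum>i<k. xval x (\<rho> @ [i]) s)"
      using t1(3) k(2) by (simp add: I_def preserves_def)
    have xb: "rat_bits ?N (xval x (\<rho> @ [k]) s)"
      using rat_bits_mono[OF rat_bits_xval wle[OF k(1)]] XSum.prems(4) by auto
    have "rat_bits ?N w" if "w \<in> occurring (Arith Add (stack_cell (Suc p)) (stack_cell (Suc (Suc p)))) t1" for w
      using that pb part[of k] part[of "Suc k"] xb k(1) v t1(2) by (auto simp del: xweight.simps)
    from runs_Assign[of "Arith Add (stack_cell (Suc p)) (stack_cell (Suc (Suc p)))" t1 7, OF _ _ this, of "Suc p" "''stack''"]
    have "runs ?add t1 7 ?N ?t2" using p v t1(2) by (simp del: xweight.simps)
    then have "runs (Seq (compile_xexp x (Suc ?l) (Suc (Suc p))) ?add) t (?w k 0 + 7) ?N ?t2"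
      by (rule runs_Seq[OF t1(1)]) (use wle[OF k(1)] in \<open>simp_all del: xweight.simps\<close>)
    moreover have "?t2 ''var'' ?l = of_nat k" using t1(3) k(3) by (simp add: preserves_def)
    moreover have "I (Suc k) (?t2(''var'' := (?t2 ''var'')(?l := of_nat (Suc k))))"
    proof -
      have "preserves ?l p s t1" by (rule preserves_trans[OF pr t1(3)]) auto
      then have "preserves ?l p s (?t2(''var'' := (?t2 ''var'')(?l := of_nat (Suc k))))"
        by (intro preserves_var preserves_stack) simp_all
      moreover have "t1 ''stack'' p = t ''stack'' p" using t1(3) by (simp add: preserves_def)
      ultimately show ?thesis using k(2) unfolding I_def by simp
    qed
    ultimately show "\<exists>s'. runs (Seq (compile_xexp x (Suc ?l) (Suc (Suc p))) ?add) t (?w k 0 + 7) ?N s' \<and>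
      s' ''var'' ?l = of_nat k \<and> I (Suc k) (s'(''var'' := (s' ''var'')(?l := of_nat (Suc k))))"
      by blast
  qed (use p in \<open>auto simp: I_def simp del: xweight.simps\<close>)
  then obtain s3 where s3: "runs (For ?l p (Seq (compile_xexp x (Suc ?l) (Suc (Suc p))) ?add)) ?s2
    (10 + (\<Sum>k<?n. (?w k 0 + 7) + 20)) ?N s3" "I ?n s3" by blast
  have v: "s3 ''stack'' (Suc p) = xval (XSum e x) \<rho> s" using s3(2) by (simp add: I_def)
  have pr: "preserves ?l p s s3" using s3(2) by (simp add: I_def)
  have "rat_bits ?N w" if "w \<in> occurring (stack_cell (Suc p)) s3" for w
    using that pb v part[of ?n] by (auto simp del: xweight.simps)
  from runs_Assign[of "stack_cell (Suc p)" s3 4, OF _ _ this, of p "''stack''"]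
  have "runs (set_stack p (stack_cell (Suc p))) s3 4 ?N (s3(''stack'' := (s3 ''stack'')(p := xval (XSum e x) \<rho> s)))"
    using p v by (simp del: xweight.simps xval.simps)
  from runs_set_stackI[OF this pr]
  obtain s4 where s4: "runs (set_stack p (stack_cell (Suc p))) s3 4 ?N s4"
    "s4 ''stack'' p = xval (XSum e x) \<rho> s" "preserves ?l p s s4" by blast
  have "(\<Sum>k<?n. (?w k 0 + 7) + 20) \<le> (\<Sum>k<?n. ?w k 0 + 40)" by (rule sum_mono) simp
  then have K: "nweight e \<rho> p + (3 + (10 + (\<Sum>k<?n. (?w k 0 + 7) + 20) + 4)) \<le> xweight (XSum e x) \<rho> p 0"
    by simp
  have "nweight e \<rho> p \<le> ?N" by simp
  then have "runs (compile_xexp (XSum e x) ?l p) s (xweight (XSum e x) \<rho> p 0) ?N s4"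
    unfolding compile_xexp.simps
    by (rule runs_Seq[OF s1(1) runs_Seq[OF s2 runs_Seq[OF s3(1) s4(1) order.refl order.refl order.refl] order.refl order.refl order.refl] K _ order.refl])
  with s4 show ?case by blast
qed

section \<open>Filling an array\<close>

text \<open>Variables 0 and 1 hold the format and variable 2 the number of the cell, which explains
  the depths 2 and 3. The loop bound stays in stack cell 0, so \<open>e\<close> works from stack
  cell 1.\<close>

definition compile_table :: "string \<Rightarrow> nexp \<Rightarrow> xexp \<Rightarrow> com" where
  "compile_table a sz e = Seq (compile_nexp sz 2 0)
     (For 2 0 (Seq (compile_xexp e 3 1) (Assign a (var_cell 2) (stack_cell 1))))"

definition table_weight :: "nexp \<Rightarrow> xexp \<Rightarrow> nat \<Rightarrow> nat \<Rightarrow> nat \<Rightarrow> nat" where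
  "table_weight sz e n d b = nweight sz [n, d] 0 + 20 +
     (\<Sum>i<nval sz [n, d]. xweight e [n, d, i] 1 b + 40)"

text \<open>The hypothesis on \<open>T\<close> evaluates \<open>e\<close> in a store where the cells
  before \<open>i\<close> hold their final values. This is the state when cell \<open>i\<close> is
  reached, and it admits tables that read their own earlier entries.\<close>

lemma runs_table:
  fixes a :: string and s :: store
  defines "upd \<equiv> \<lambda>T m. s(a := \<lambda>k. if k < m then T k else s a k)"
  assumes a: "a \<noteq> ''var''" "a \<noteq> ''stack''"
    and wf: "''var'' \<notin> arrays e" "''stack'' \<notin> arrays e"
    and s: "s ''var'' 0 = of_nat n" "s ''var'' 1 = of_nat d"
    and N: "N = nval sz [n, d]"
    and T: "\<And>i. i < N \<Longrightarrow> xval e [n, d, i] (upd T i) = T i"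
    and bits: "\<And>c i. c \<in> arrays e \<Longrightarrow> rat_bits b (s c i)" "\<And>i. i < N \<Longrightarrow> a \<in> arrays e \<Longrightarrow> rat_bits b (T i)"
  shows "\<exists>s'. runs (compile_table a sz e) s (table_weight sz e n d 0) (table_weight sz e n d b) s' \<and>
    (\<forall>c. c \<noteq> ''var'' \<longrightarrow> c \<noteq> ''stack'' \<longrightarrow> s' c = upd T N c) \<and>
    s' ''var'' 0 = of_nat n \<and> s' ''var'' 1 = of_nat d"
proof -
  let ?M = "table_weight sz e n d b"
  let ?w = "\<lambda>i b. xweight e [n, d, i] 1 b"
  have v2: "s ''var'' i = of_nat ([n, d] ! i)" if "i < length [n, d]" for i
  proof -
    have "i = 0 \<or> i = 1" using that by auto
    then show ?thesis using s by (elim disjE) simp_all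
  qed
  have len2: "length [n, d] = 2" by simp
  obtain s1 where s1: "runs (compile_nexp sz 2 0) s (nweight sz [n, d] 0) (nweight sz [n, d] 0) s1"
    "s1 ''stack'' 0 = of_nat N" "preserves 2 0 s s1"
    using runs_nexp[of "[n, d]" s sz 0, OF v2] N unfolding len2 by blast
  have wle: "?w k b \<le> ?M" if "k < N" for k
  proof -
    have "?w k b \<le> ?w k b + 40" by simp
    also have "\<dots> \<le> (\<Sum>i<N. ?w i b + 40)" using that by (intro member_le_sum) auto
    finally show ?thesis by (simp add: table_weight_def N)
  qed
  have M: "20 \<le> ?M" "nweight sz [n, d] 0 \<le> ?M" by (simp_all add: table_weight_def)
  have nM: "N \<le> 2 ^ ?M" unfolding N
    by (rule order.trans[OF nval_le_weight[of sz _ 0]]) (use M(2) in \<open>simp add: power_increasing\<close>)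
  define I where "I k t \<longleftrightarrow> t ''stack'' 0 = of_nat N \<and> t ''var'' 0 = of_nat n \<and> t ''var'' 1 = of_nat d \<and>
    (\<forall>c. c \<noteq> ''var'' \<longrightarrow> c \<noteq> ''stack'' \<longrightarrow> t c = upd T k c)" for k t
  have "\<exists>s2. runs (For 2 0 (Seq (compile_xexp e 3 1) (Assign a (var_cell 2) (stack_cell 1)))) s1
    (10 + (\<Sum>k<N. (?w k 0 + 7) + 20)) ?M s2 \<and> I N s2"
  proof (rule runs_For[where I = I])
    have "upd T 0 = s" by (simp add: upd_def)
    moreover have "s1 c = s c" if "c \<noteq> ''var''" "c \<noteq> ''stack''" for c
      using s1(3) that by (simp add: preserves_def)
    moreover have "s1 ''var'' 0 = s ''var'' 0" "s1 ''var'' 1 = s ''var'' 1"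
      using s1(3) by (simp_all add: preserves_def)
    ultimately show "I 0 (s1(''var'' := (s1 ''var'')(2 := 0)))"
      using s1(2) s by (simp add: I_def)
  next
    fix k t assume k: "k < N" "I k t" "t ''var'' 2 = of_nat k"
    have tc: "t c = upd T k c" if "c \<in> arrays e" for c
    proof -
      have "c \<noteq> ''var''" "c \<noteq> ''stack''" using wf that by auto
      then show ?thesis using k(2) by (simp add: I_def)
    qed
    have cells: "rat_bits b (t c i)" if "c \<in> arrays e" for c i
      using bits(1)[OF that, of i] bits(1)[of a i] bits(2)[of i] k(1) that
      unfolding tc[OF that] upd_def by (cases "c = a"; cases "i < k") simp_all
    have "t ''var'' i = of_nat ([n, d, k] ! i)" if "i < length [n, d, k]" for i
    proof -
      have "i = 0 \<or> i = 1 \<or> i = 2" using that by auto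
      then show ?thesis using k(2,3) unfolding I_def by (elim disjE) simp_all
    qed
    note vk = this
    have len3: "length [n, d, k] = 3" by simp
    obtain t1 where t1: "runs (compile_xexp e 3 1) t (?w k 0) (?w k b) t1"
      "t1 ''stack'' 1 = xval e [n, d, k] t" "preserves 3 1 t t1"
      using runs_xexp[of e "[n, d, k]" t b 1, OF wf vk cells] unfolding len3 by blast
    have x: "xval e [n, d, k] t = T k"
      using xval_cong[of e t "upd T k", OF tc] T[OF k(1)] by simp
    have t1k: "t1 ''var'' 2 = of_nat k" using t1(3) k(3) by (simp add: preserves_def)
    let ?t2 = "t1(a := (t1 a)(k := T k))"
    have kb: "rat_bits ?M (of_nat k)" using nM k(1) by (intro rat_bits_of_nat) simp
    have Tb: "rat_bits ?M (T k)"
      using rat_bits_mono[OF rat_bits_xval[of e b t, OF cells] wle[OF k(1)]] x by simp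
    have c12: "rat_bits ?M (of_nat 1)" "rat_bits ?M (of_nat 2)"
      using M(1) by (intro rat_bits_of_nat'; simp)+
    have "exec (Assign a (var_cell 2) (stack_cell 1)) t1 5 ({of_nat k, of_nat 2} \<union> {T k, of_nat 1}) ?t2"
      using exec.Assign[of "var_cell 2" t1 "stack_cell 1" a] t1k t1(2) x by simp
    then have "runs (Assign a (var_cell 2) (stack_cell 1)) t1 5 ?M ?t2"
      unfolding runs_def using kb Tb c12
      by (intro exI[of _ 5] exI[of _ "{of_nat k, of_nat 2} \<union> {T k, of_nat 1}"]) auto
    then have r: "runs (Seq (compile_xexp e 3 1) (Assign a (var_cell 2) (stack_cell 1))) t (?w k 0 + 7) ?M ?t2"
      by (rule runs_Seq[OF t1(1)]) (use wle[OF k(1)] in simp_all)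
    have "upd T (Suc k) c = (if c = a then (upd T k a)(k := T k) else upd T k c)" for c
      by (auto simp: upd_def fun_eq_iff less_Suc_eq)
    moreover have "t1 c = upd T k c" if "c \<noteq> ''var''" "c \<noteq> ''stack''" for c
      using t1(3) k(2) that by (simp add: preserves_def I_def)
    moreover have "t1 ''var'' 0 = t ''var'' 0" "t1 ''var'' 1 = t ''var'' 1" "t1 ''stack'' 0 = t ''stack'' 0"
      using t1(3) by (simp_all add: preserves_def)
    ultimately have "I (Suc k) (?t2(''var'' := (?t2 ''var'')(2 := of_nat (Suc k))))"
      using k(2) a by (simp add: I_def)
    then show "\<exists>s'. runs (Seq (compile_xexp e 3 1) (Assign a (var_cell 2) (stack_cell 1))) t (?w k 0 + 7) ?M s' \<and>
      s' ''var'' 2 = of_nat k \<and> I (Suc k) (s'(''var'' := (s' ''var'')(2 := of_nat (Suc k))))"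
      using r t1k a by (intro exI[of _ ?t2]) simp
  qed (use M(1) nM in \<open>auto simp: I_def\<close>)
  then obtain s2 where s2: "runs (For 2 0 (Seq (compile_xexp e 3 1) (Assign a (var_cell 2) (stack_cell 1)))) s1
    (10 + (\<Sum>k<N. (?w k 0 + 7) + 20)) ?M s2" "I N s2" by blast
  have "(\<Sum>k<N. (?w k 0 + 7) + 20) \<le> (\<Sum>k<N. ?w k 0 + 40)" by (rule sum_mono) simp
  then have "runs (compile_table a sz e) s (table_weight sz e n d 0) ?M s2"
    unfolding compile_table_def
    by (intro runs_Seq[OF s1(1) s2(1) _ M(2) order.refl]) (simp add: table_weight_def N)
  with s2(2) show ?thesis by (auto simp: I_def)
qed

section \<open>Polynomial bounds for weights\<close>

lemma sum_lessThan_le_mult: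
  fixes f :: "nat \<Rightarrow> nat"
  assumes "\<And>k. k < m \<Longrightarrow> f k \<le> c" shows "(\<Sum>k<m. f k) \<le> m * c"
  using sum_bounded_above[of "{..<m}" f c] assms by simp

lemma poly_nat_mono: "x \<le> y \<Longrightarrow> poly p x \<le> poly p y" for p :: "nat poly"
  by (induction p) (auto intro: add_mono mult_mono)

text \<open>The expression is fixed while the variables range over numbers up to \<open>X\<close>,
  so one polynomial, read off from the structure of the expression, bounds all values.\<close>

lemma nval_poly: "\<exists>q. \<forall>\<rho> X. (\<forall>v\<in>set \<rho>. v \<le> X) \<longrightarrow> nval e \<rho> \<le> poly q X"
proof (induction e)
  case (NC k)
  show ?case by (rule exI[of _ "[:k:]"]) simp
next
  case (NV i)
  show ?case by (rule exI[of _ "[:0, 1:]"]) auto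
next
  case (NAdd x y)
  then obtain p q where "\<And>\<rho> X. (\<forall>v\<in>set \<rho>. v \<le> X) \<Longrightarrow> nval x \<rho> \<le> poly p X"
    "\<And>\<rho> X. (\<forall>v\<in>set \<rho>. v \<le> X) \<Longrightarrow> nval y \<rho> \<le> poly q X" by blast
  then show ?case by (intro exI[of _ "p + q"]) (simp add: add_mono)
next
  case (NMul x y)
  then obtain p q where "\<And>\<rho> X. (\<forall>v\<in>set \<rho>. v \<le> X) \<Longrightarrow> nval x \<rho> \<le> poly p X"
    "\<And>\<rho> X. (\<forall>v\<in>set \<rho>. v \<le> X) \<Longrightarrow> nval y \<rho> \<le> poly q X" by blast
  then show ?case by (intro exI[of _ "p * q"]) (simp add: mult_le_mono)
next
  case (NSub x y)
  then obtain p where "\<And>\<rho> X. (\<forall>v\<in>set \<rho>. v \<le> X) \<Longrightarrow> nval x \<rho> \<le> poly p X" by blast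
  then show ?case
    by (intro exI[of _ p] allI impI) (simp add: order.trans[OF diff_le_self])
next
  case (NDiv x y)
  then obtain p where "\<And>\<rho> X. (\<forall>v\<in>set \<rho>. v \<le> X) \<Longrightarrow> nval x \<rho> \<le> poly p X" by blast
  then show ?case
    by (intro exI[of _ p] allI impI) (simp add: order.trans[OF div_le_dividend])
qed

lemma nweight_poly: "\<exists>q. \<forall>\<rho> X. length \<rho> = l \<longrightarrow> (\<forall>v\<in>set \<rho>. v \<le> X) \<longrightarrow> nweight e \<rho> p \<le> poly q X"
proof (induction e arbitrary: p)
  case (NC k)
  show ?case by (rule exI[of _ "[:k + p + 10:]"]) simp
next
  case (NV i)
  obtain q where "\<And>\<rho> X. (\<forall>v\<in>set \<rho>. v \<le> X) \<Longrightarrow> nval (NV i) \<rho> \<le> poly q X"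
    using nval_poly by blast
  then show ?case
    by (intro exI[of _ "q + [:l + p + 10:]"]) (simp del: nval.simps)
next
  case (NAdd x y)
  obtain q q' where "\<And>\<rho> X. length \<rho> = l \<Longrightarrow> (\<forall>v\<in>set \<rho>. v \<le> X) \<Longrightarrow> nweight x \<rho> p \<le> poly q X"
    "\<And>\<rho> X. length \<rho> = l \<Longrightarrow> (\<forall>v\<in>set \<rho>. v \<le> X) \<Longrightarrow> nweight y \<rho> (Suc p) \<le> poly q' X"
    using NAdd.IH(1)[of p] NAdd.IH(2)[of "Suc p"] by blast
  then show ?case by (intro exI[of _ "q + q' + [:20:]"]) (simp add: add_mono)
next
  case (NMul x y)
  obtain q q' where "\<And>\<rho> X. length \<rho> = l \<Longrightarrow> (\<forall>v\<in>set \<rho>. v \<le> X) \<Longrightarrow> nweight x \<rho> p \<le> poly q X"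
    "\<And>\<rho> X. length \<rho> = l \<Longrightarrow> (\<forall>v\<in>set \<rho>. v \<le> X) \<Longrightarrow> nweight y \<rho> (Suc p) \<le> poly q' X"
    using NMul.IH(1)[of p] NMul.IH(2)[of "Suc p"] by blast
  then show ?case by (intro exI[of _ "q + q' + [:20:]"]) (simp add: add_mono)
next
  case (NSub x y)
  obtain q q' where "\<And>\<rho> X. length \<rho> = l \<Longrightarrow> (\<forall>v\<in>set \<rho>. v \<le> X) \<Longrightarrow> nweight x \<rho> p \<le> poly q X"
    "\<And>\<rho> X. length \<rho> = l \<Longrightarrow> (\<forall>v\<in>set \<rho>. v \<le> X) \<Longrightarrow> nweight y \<rho> (Suc p) \<le> poly q' X"
    using NSub.IH(1)[of p] NSub.IH(2)[of "Suc p"] by blast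
  then show ?case by (intro exI[of _ "q + q' + [:20:]"]) (simp add: add_mono)
next
  case (NDiv x y)
  obtain q q' where 1: "\<And>\<rho> X. length \<rho> = l \<Longrightarrow> (\<forall>v\<in>set \<rho>. v \<le> X) \<Longrightarrow> nweight x \<rho> p \<le> poly q X"
    and 2: "\<And>\<rho> X. length \<rho> = l \<Longrightarrow> (\<forall>v\<in>set \<rho>. v \<le> X) \<Longrightarrow> nweight y \<rho> (Suc p) \<le> poly q' X"
    using NDiv.IH(1)[of p] NDiv.IH(2)[of "Suc p"] by blast
  obtain r where 3: "\<And>\<rho> X. (\<forall>v\<in>set \<rho>. v \<le> X) \<Longrightarrow> nval x \<rho> \<le> poly r X"
    using nval_poly by blast
  show ?case
  proof (intro exI[of _ "q + q' + smult 30 r + [:60:]"] allI impI)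
    fix \<rho> :: "nat list" and X assume "length \<rho> = l" "\<forall>v\<in>set \<rho>. v \<le> X"
    from 1[OF this] 2[OF this] 3[OF this(2)]
    show "nweight (NDiv x y) \<rho> p \<le> poly (q + q' + smult 30 r + [:60:]) X" by simp
  qed
qed

lemma xweight_poly:
  "\<exists>q. \<forall>\<rho> b X. length \<rho> = l \<longrightarrow> (\<forall>v\<in>set \<rho>. v \<le> X) \<longrightarrow> b \<le> X \<longrightarrow> xweight e \<rho> p b \<le> poly q X"
proof (induction e arbitrary: l p)
  case (XN e)
  obtain q where 1: "\<And>\<rho> X. length \<rho> = l \<Longrightarrow> (\<forall>v\<in>set \<rho>. v \<le> X) \<Longrightarrow> nweight e \<rho> p \<le> poly q X"
    using nweight_poly by blast
  show ?case
  proof (intro exI[of _ q] allI impI)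
    fix \<rho> :: "nat list" and b X assume "length \<rho> = l" "\<forall>v\<in>set \<rho>. v \<le> X"
    from 1[OF this] show "xweight (XN e) \<rho> p b \<le> poly q X" by simp
  qed
next
  case (XCell a e)
  obtain q where 1: "\<And>\<rho> X. length \<rho> = l \<Longrightarrow> (\<forall>v\<in>set \<rho>. v \<le> X) \<Longrightarrow> nweight e \<rho> p \<le> poly q X"
    using nweight_poly by blast
  show ?case
  proof (intro exI[of _ "q + [:20, 1:]"] allI impI)
    fix \<rho> :: "nat list" and b X assume *: "length \<rho> = l" "\<forall>v\<in>set \<rho>. v \<le> X" "b \<le> X"
    from 1[OF this(1,2)] *(3)
    show "xweight (XCell a e) \<rho> p b \<le> poly (q + [:20, 1:]) X" by simp
  qed
next
  case (XOp f x y)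
  obtain q where 1: "\<And>\<rho> b X. length \<rho> = l \<Longrightarrow> (\<forall>v\<in>set \<rho>. v \<le> X) \<Longrightarrow> b \<le> X \<Longrightarrow> xweight x \<rho> p b \<le> poly q X"
    using XOp.IH(1)[of l "p"] by blast
  obtain q' where 2: "\<And>\<rho> b X. length \<rho> = l \<Longrightarrow> (\<forall>v\<in>set \<rho>. v \<le> X) \<Longrightarrow> b \<le> X \<Longrightarrow> xweight y \<rho> (Suc p) b \<le> poly q' X"
    using XOp.IH(2)[of l "(Suc p)"] by blast
  show ?case
  proof (intro exI[of _ "q + q' + [:20:]"] allI impI)
    fix \<rho> :: "nat list" and b X assume *: "length \<rho> = l" "\<forall>v\<in>set \<rho>. v \<le> X" "b \<le> X"
    from 1[OF *] 2[OF *]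
    show "xweight (XOp f x y) \<rho> p b \<le> poly (q + q' + [:20:]) X" by simp
  qed
next
  case (XIf r a1 a2 c d)
  obtain q1 where 1: "\<And>\<rho> b X. length \<rho> = l \<Longrightarrow> (\<forall>v\<in>set \<rho>. v \<le> X) \<Longrightarrow> b \<le> X \<Longrightarrow> xweight a1 \<rho> p b \<le> poly q1 X"
    using XIf.IH(1)[of l "p"] by blast
  obtain q2 where 2: "\<And>\<rho> b X. length \<rho> = l \<Longrightarrow> (\<forall>v\<in>set \<rho>. v \<le> X) \<Longrightarrow> b \<le> X \<Longrightarrow> xweight a2 \<rho> (Suc p) b \<le> poly q2 X"
    using XIf.IH(2)[of l "(Suc p)"] by blast
  obtain q3 where 3: "\<And>\<rho> b X. length \<rho> = l \<Longrightarrow> (\<forall>v\<in>set \<rho>. v \<le> X) \<Longrightarrow> b \<le> X \<Longrightarrow> xweight c \<rho> p b \<le> poly q3 X"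
    using XIf.IH(3)[of l "p"] by blast
  obtain q4 where 4: "\<And>\<rho> b X. length \<rho> = l \<Longrightarrow> (\<forall>v\<in>set \<rho>. v \<le> X) \<Longrightarrow> b \<le> X \<Longrightarrow> xweight d \<rho> p b \<le> poly q4 X"
    using XIf.IH(4)[of l "p"] by blast
  show ?case
  proof (intro exI[of _ "q1 + q2 + q3 + q4 + [:20:]"] allI impI)
    fix \<rho> :: "nat list" and b X assume *: "length \<rho> = l" "\<forall>v\<in>set \<rho>. v \<le> X" "b \<le> X"
    from 1[OF *] 2[OF *] 3[OF *] 4[OF *]
    show "xweight (XIf r a1 a2 c d) \<rho> p b \<le> poly (q1 + q2 + q3 + q4 + [:20:]) X" by simp
  qed
next
  case (XSum e x)
  obtain q where q: "\<And>\<rho> X. length \<rho> = l \<Longrightarrow> (\<forall>v\<in>set \<rho>. v \<le> X) \<Longrightarrow> nweight e \<rho> p \<le> poly q X"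
    using nweight_poly by blast
  obtain r where r: "\<And>\<rho> X. (\<forall>v\<in>set \<rho>. v \<le> X) \<Longrightarrow> nval e \<rho> \<le> poly r X"
    using nval_poly by blast
  obtain t where t: "\<And>\<rho> b X. length \<rho> = Suc l \<Longrightarrow> (\<forall>v\<in>set \<rho>. v \<le> X) \<Longrightarrow> b \<le> X \<Longrightarrow>
      xweight x \<rho> (Suc (Suc p)) b \<le> poly t X"
    using XSum.IH[of "Suc l" "Suc (Suc p)"] by blast
  \<comment> \<open>The summation variable is bounded by the number of terms, at most
    \<open>poly r X\<close>, which may exceed \<open>X\<close>; the bound for the summand is
    therefore taken at \<open>X + poly r X\<close>.\<close>
  let ?t = "pcompose t ([:0, 1:] + r)"
  show ?case
  proof (intro exI[of _ "q + [:l + 60:] + r * (?t + [:40:])"] allI impI)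
    fix \<rho> :: "nat list" and b X assume *: "length \<rho> = l" "\<forall>v\<in>set \<rho>. v \<le> X" "b \<le> X"
    have "xweight x (\<rho> @ [k]) (Suc (Suc p)) b + 40 \<le> poly (?t + [:40:]) X" if "k < nval e \<rho>" for k
    proof -
      have "k \<le> poly r X" using that r[OF *(2)] by simp
      then have "xweight x (\<rho> @ [k]) (Suc (Suc p)) b \<le> poly t (X + poly r X)"
        using * by (intro t) auto
      then show ?thesis by (simp add: poly_pcompose)
    qed
    then have "(\<Sum>k<nval e \<rho>. xweight x (\<rho> @ [k]) (Suc (Suc p)) b + 40) \<le> nval e \<rho> * poly (?t + [:40:]) X"
      by (rule sum_lessThan_le_mult)
    also have "\<dots> \<le> poly (r * (?t + [:40:])) X"
      using r[OF *(2)] by (simp only: poly_mult mult_le_mono1)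
    finally show "xweight (XSum e x) \<rho> p b \<le> poly (q + [:l + 60:] + r * (?t + [:40:])) X"
      using q[OF *(1,2)] *(1) by (simp only: xweight.simps poly_add) simp
  qed
qed

lemma table_weight_poly:
  "\<exists>q. \<forall>n d b X. n \<le> X \<longrightarrow> d \<le> X \<longrightarrow> b \<le> X \<longrightarrow> table_weight sz e n d b \<le> poly q X"
proof -
  obtain q where q: "\<And>\<rho> X. length \<rho> = 2 \<Longrightarrow> (\<forall>v\<in>set \<rho>. v \<le> X) \<Longrightarrow> nweight sz \<rho> 0 \<le> poly q X"
    using nweight_poly by blast
  obtain r where r: "\<And>\<rho> X. (\<forall>v\<in>set \<rho>. v \<le> X) \<Longrightarrow> nval sz \<rho> \<le> poly r X"
    using nval_poly by blast
  obtain t where t: "\<And>\<rho> b X. length \<rho> = 3 \<Longrightarrow> (\<forall>v\<in>set \<rho>. v \<le> X) \<Longrightarrow> b \<le> X \<Longrightarrow>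
      xweight e \<rho> 1 b \<le> poly t X"
    using xweight_poly[of 3 e 1] by blast
  let ?t = "pcompose t ([:0, 1:] + r)"
  show ?thesis
  proof (intro exI[of _ "q + [:20:] + r * (?t + [:40:])"] allI impI)
    fix n d b X :: nat assume *: "n \<le> X" "d \<le> X" "b \<le> X"
    then have nd: "\<forall>v\<in>set [n, d]. v \<le> X" by simp
    have "xweight e [n, d, k] 1 b + 40 \<le> poly (?t + [:40:]) X" if "k < nval sz [n, d]" for k
    proof -
      have "k \<le> poly r X" using that r[OF nd] by simp
      then have "xweight e [n, d, k] 1 b \<le> poly t (X + poly r X)"
        using * by (intro t) auto
      then show ?thesis by (simp add: poly_pcompose)
    qed
    then have "(\<Sum>k<nval sz [n, d]. xweight e [n, d, k] 1 b + 40) \<le> nval sz [n, d] * poly (?t + [:40:]) X"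
      by (rule sum_lessThan_le_mult)
    also have "\<dots> \<le> poly (r * (?t + [:40:])) X"
      using r[OF nd] by (simp only: poly_mult mult_le_mono1)
    finally show "table_weight sz e n d b \<le> poly (q + [:20:] + r * (?t + [:40:])) X"
      using q[OF _ nd] by (simp only: table_weight_def poly_add) simp
  qed
qed

section \<open>Programs that run on a family of instances\<close>

text \<open>The two inequalities are what turns a number of steps polynomial in \<open>n\<close> and
  \<open>d\<close> into one polynomial in the dimension of the input.\<close>

locale input_family =
  fixes X :: "'x set" and n d :: "'x \<Rightarrow> nat" and data :: "'x \<Rightarrow> rat list"
  assumes n_le: "x \<in> X \<Longrightarrow> n x \<le> length (data x)" and d_le: "x \<in> X \<Longrightarrow> d x \<le> length (data x)"
begin

definition input_length :: "'x \<Rightarrow> nat" where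
  "input_length x = (\<Sum>y\<leftarrow>data x. encoding_length y)"

definition poly_bounded :: "('x \<Rightarrow> nat) \<Rightarrow> bool" where
  "poly_bounded f \<longleftrightarrow> (\<exists>q. \<forall>x\<in>X. f x \<le> poly q (input_length x))"

lemma length_le_input_length: "length (data x) \<le> input_length x"
proof -
  have "1 \<le> encoding_length y" for y
    by (auto simp: encoding_length_def int_length_def split: prod.split)
  then have "(\<Sum>y\<leftarrow>xs. 1) \<le> (\<Sum>y\<leftarrow>xs. encoding_length y)" for xs :: "rat list"
    by (intro sum_list_mono) auto
  then show ?thesis unfolding input_length_def by (simp add: sum_list_triv)
qed

lemma poly_bounded_mono: "poly_bounded g \<Longrightarrow> (\<And>x. x \<in> X \<Longrightarrow> f x \<le> g x) \<Longrightarrow> poly_bounded f"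
  unfolding poly_bounded_def by (elim exE, rule_tac x = q in exI)
    (blast intro: order.trans)

lemma poly_bounded_poly: "poly_bounded f \<Longrightarrow> poly_bounded (\<lambda>x. poly q (f x))"
  unfolding poly_bounded_def
  by (elim exE, rule_tac x = "pcompose q qa" in exI) (simp add: poly_pcompose poly_nat_mono)

lemma poly_bounded_add: "poly_bounded f \<Longrightarrow> poly_bounded g \<Longrightarrow> poly_bounded (\<lambda>x. f x + g x)"
  unfolding poly_bounded_def
  by (elim exE, rule_tac x = "q + qa" in exI) (simp add: add_mono)

lemma poly_bounded_mult: "poly_bounded f \<Longrightarrow> poly_bounded g \<Longrightarrow> poly_bounded (\<lambda>x. f x * g x)"
  unfolding poly_bounded_def
  by (elim exE, rule_tac x = "q * qa" in exI) (simp add: mult_le_mono)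

lemma poly_bounded_const: "poly_bounded (\<lambda>x. k)"
  unfolding poly_bounded_def by (rule exI[of _ "[:k:]"]) simp

lemma poly_bounded_power: "poly_bounded f \<Longrightarrow> poly_bounded (\<lambda>x. f x ^ k)"
  by (induction k) (simp_all add: poly_bounded_const poly_bounded_mult)

lemma poly_bounded_input_length: "poly_bounded input_length"
  unfolding poly_bounded_def by (rule exI[of _ "[:0, 1:]"]) simp

lemma poly_bounded_n: "poly_bounded n"
  by (rule poly_bounded_mono[OF poly_bounded_input_length order.trans[OF n_le length_le_input_length]])

lemma poly_bounded_d: "poly_bounded d"
  by (rule poly_bounded_mono[OF poly_bounded_input_length order.trans[OF d_le length_le_input_length]])

lemmas poly_bounded_intros = poly_bounded_add poly_bounded_mult poly_bounded_const poly_bounded_power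
  poly_bounded_n poly_bounded_d

text \<open>\<open>M x\<close> describes the memory after the run, apart from the two work arrays.
  Steps are measured against the dimension, numbers against the encoding length.\<close>

definition run_ok :: "com \<Rightarrow> ('x \<Rightarrow> store) \<Rightarrow> nat poly \<Rightarrow> nat poly \<Rightarrow> 'x \<Rightarrow> bool" where
  "run_ok c M p q x \<longleftrightarrow> (\<exists>s.
     runs c (input_store [n x, d x] (data x)) (poly p (length (data x))) (poly q (input_length x)) s \<and>
     s ''var'' 0 = of_nat (n x) \<and> s ''var'' 1 = of_nat (d x) \<and>
     (\<forall>a. a \<noteq> ''var'' \<longrightarrow> a \<noteq> ''stack'' \<longrightarrow> s a = M x a))"

definition bits_ok :: "('x \<Rightarrow> store) \<Rightarrow> nat poly \<Rightarrow> 'x \<Rightarrow> bool" where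
  "bits_ok M q x \<longleftrightarrow>
     (\<forall>a i. a \<noteq> ''var'' \<longrightarrow> a \<noteq> ''stack'' \<longrightarrow> rat_bits (poly q (input_length x)) (M x a i))"

definition computes :: "com \<Rightarrow> ('x \<Rightarrow> store) \<Rightarrow> bool" where
  "computes c M \<longleftrightarrow> (\<exists>p q. \<forall>x\<in>X. run_ok c M p q x \<and> bits_ok M q x)"

lemma bits_okD:
  "bits_ok M q x \<Longrightarrow> a \<noteq> ''var'' \<Longrightarrow> a \<noteq> ''stack'' \<Longrightarrow> rat_bits (poly q (input_length x)) (M x a i)"
  unfolding bits_ok_def by simp

lemma computes_bits:
  assumes "computes c M"
  obtains b where "poly_bounded b"
    "\<And>x a i. x \<in> X \<Longrightarrow> a \<noteq> ''var'' \<Longrightarrow> a \<noteq> ''stack'' \<Longrightarrow> rat_bits (b x) (M x a i)"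
proof -
  obtain p q where pq: "\<And>x. x \<in> X \<Longrightarrow> run_ok c M p q x \<and> bits_ok M q x"
    using assms unfolding computes_def by blast
  have "poly_bounded (\<lambda>x. poly q (input_length x))"
    by (intro poly_bounded_poly poly_bounded_input_length)
  then show ?thesis by (rule that) (use pq bits_okD in simp)
qed

definition load_format :: com where
  "load_format = Seq (set_var 0 (Cell ''format'' (Const 0))) (set_var 1 (Cell ''format'' (Const 1)))"

lemma computes_load_format: "computes load_format (\<lambda>x. input_store [n x, d x] (data x))"
proof -
  have "run_ok load_format (\<lambda>x. input_store [n x, d x] (data x)) [:8:] [:1, 1:] x \<and>
      bits_ok (\<lambda>x. input_store [n x, d x] (data x)) [:1, 1:] x"
    if x: "x \<in> X" for x
  proof -
    let ?s = "input_store [n x, d x] (data x)" and ?N = "Suc (input_length x)"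
    have le: "n x \<le> ?N" "d x \<le> ?N"
      using n_le[OF x] d_le[OF x] length_le_input_length[of x] by simp_all
    have f: "?s ''format'' 0 = of_nat (n x)" "?s ''format'' 1 = of_nat (d x)"
      by (simp_all add: input_store_def)
    have b: "rat_bits ?N (of_nat (n x))" "rat_bits ?N (of_nat (d x))"
      using le by (simp_all add: rat_bits_of_nat')
    have enc: "encoding_length y \<le> ?N" if "y \<in> set (data x)" for y
      using member_le_sum_list[of "encoding_length y" "map encoding_length (data x)"] that
      by (simp add: input_length_def)
    have cells: "rat_bits ?N (?s a i)" for a i
    proof -
      have "rat_bits ?N (data x ! i)" if "i < length (data x)" for i
        using rat_bits_mono[OF encoding_length_rat_bits enc] that by simp
      moreover have "rat_bits ?N (of_nat ([n x, d x] ! i))" if "i < 2" for i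
        using that b by (auto simp: less_2_cases_iff)
      ultimately show ?thesis by (simp add: input_store_def)
    qed
    let ?s1 = "?s(''var'' := (?s ''var'')(0 := of_nat (n x)))"
    let ?s2 = "?s1(''var'' := (?s1 ''var'')(1 := of_nat (d x)))"
    have "runs (set_var 0 (Cell ''format'' (Const 0))) ?s 4 ?N ?s1"
    proof -
      have "rat_bits ?N w" if "w \<in> occurring (Cell ''format'' (Const 0)) ?s" for w
        using that f b by (auto simp: address_def)
      from runs_Assign[of "Cell ''format'' (Const 0)" ?s 4, OF _ _ this, of 0 "''var''"]
      show ?thesis using f by (simp add: address_def)
    qed
    moreover have "runs (set_var 1 (Cell ''format'' (Const 1))) ?s1 4 ?N ?s2"
    proof -
      have "rat_bits ?N w" if "w \<in> occurring (Cell ''format'' (Const 1)) ?s1" for w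
        using that f b by (auto simp: address_def)
      from runs_Assign[of "Cell ''format'' (Const 1)" ?s1 4, OF _ _ this, of 1 "''var''"]
      show ?thesis using f by (simp add: address_def)
    qed
    ultimately have "runs load_format ?s 8 ?N ?s2"
      unfolding load_format_def by (rule runs_Seq) auto
    then show ?thesis
      using cells unfolding run_ok_def bits_ok_def by (intro conjI exI[of _ ?s2]) simp_all
  qed
  then show ?thesis unfolding computes_def
    by - (rule exI[of _ "[:8:]"], rule exI[of _ "[:1, 1:]"], rule ballI)
qed

text \<open>The bound \<open>b\<close> on the entries is a hypothesis: entries of the array may be
  read while it is being filled, and their size cannot then be derived from the sizes of the other
  arrays alone.\<close>

lemma computes_table:
  assumes c: "computes c M"
    and wf: "a \<noteq> ''var''" "a \<noteq> ''stack''" "''var'' \<notin> arrays e" "''stack'' \<notin> arrays e"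
    and T: "\<And>x i. x \<in> X \<Longrightarrow> i < nval sz [n x, d x] \<Longrightarrow>
      xval e [n x, d x, i] ((M x)(a := \<lambda>k. if k < i then T x k else M x a k)) = T x i"
    and b: "poly_bounded b" "\<And>x i. x \<in> X \<Longrightarrow> i < nval sz [n x, d x] \<Longrightarrow> rat_bits (b x) (T x i)"
  shows "computes (Seq c (compile_table a sz e))
    (\<lambda>x. (M x)(a := \<lambda>k. if k < nval sz [n x, d x] then T x k else M x a k))"
proof -
  obtain p q where pq: "\<And>x. x \<in> X \<Longrightarrow> run_ok c M p q x" and Mq: "\<And>x. x \<in> X \<Longrightarrow> bits_ok M q x"
    using c unfolding computes_def by blast
  obtain r where r: "\<And>x. x \<in> X \<Longrightarrow> b x \<le> poly r (input_length x)"
    using b(1) unfolding poly_bounded_def by blast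
  obtain t where t: "\<And>n d b X. n \<le> X \<Longrightarrow> d \<le> X \<Longrightarrow> b \<le> X \<Longrightarrow> table_weight sz e n d b \<le> poly t X"
    using table_weight_poly by blast
  \<comment> \<open>The cells hold numbers of at most \<open>q + r\<close> bits, and the input
    length is added to cover \<open>n\<close> and \<open>d\<close>; the weight of the table is
    bounded at this sum.\<close>
  let ?q = "q + r + pcompose t ([:0, 1:] + q + r)"
  show ?thesis unfolding computes_def
  proof (rule exI[of _ "p + t"], rule exI[of _ ?q], rule ballI)
    fix x assume x: "x \<in> X"
    let ?L = "input_length x" and ?D = "length (data x)"
    let ?b = "poly q ?L + poly r ?L"
    let ?M = "(M x)(a := \<lambda>k. if k < nval sz [n x, d x] then T x k else M x a k)"
    obtain s where s: "runs c (input_store [n x, d x] (data x)) (poly p ?D) (poly q ?L) s"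
      "s ''var'' 0 = of_nat (n x)" "s ''var'' 1 = of_nat (d x)"
      "\<And>a. a \<noteq> ''var'' \<Longrightarrow> a \<noteq> ''stack'' \<Longrightarrow> s a = M x a"
      using pq[OF x] unfolding run_ok_def by blast
    have sM: "s a' = M x a'" if "a' \<in> arrays e" for a'
    proof -
      have "a' \<noteq> ''var''" "a' \<noteq> ''stack''" using that wf by auto
      then show ?thesis by (rule s(4))
    qed
    have sa: "s a = M x a" using s(4) wf by simp
    have Tb: "rat_bits ?b (T x i)" if "i < nval sz [n x, d x]" for i
      using rat_bits_mono[OF b(2)[OF x that], of ?b] r[OF x] by simp
    have Mb: "rat_bits ?b (M x a' i)" if "a' \<noteq> ''var''" "a' \<noteq> ''stack''" for a' i
      using rat_bits_mono[OF bits_okD[OF Mq[OF x] that], of ?b] by simp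
    have "\<exists>s'. runs (compile_table a sz e) s (table_weight sz e (n x) (d x) 0) (table_weight sz e (n x) (d x) ?b) s' \<and>
      (\<forall>c. c \<noteq> ''var'' \<longrightarrow> c \<noteq> ''stack'' \<longrightarrow>
        s' c = (s(a := \<lambda>k. if k < nval sz [n x, d x] then T x k else s a k)) c) \<and>
      s' ''var'' 0 = of_nat (n x) \<and> s' ''var'' 1 = of_nat (d x)"
    proof (rule runs_table[where a = a and e = e and s = s and n = "n x" and d = "d x" and sz = sz
          and N = "nval sz [n x, d x]" and T = "T x" and b = ?b, OF wf s(2,3) refl])
      fix i assume i: "i < nval sz [n x, d x]"
      have "xval e [n x, d x, i] (s(a := \<lambda>k. if k < i then T x k else s a k)) =
        xval e [n x, d x, i] ((M x)(a := \<lambda>k. if k < i then T x k else M x a k))"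
        by (rule xval_cong) (simp add: sM sa fun_eq_iff)
      also have "\<dots> = T x i" by (rule T[OF x i])
      finally show "xval e [n x, d x, i] (s(a := \<lambda>k. if k < i then T x k else s a k)) = T x i" .
      show "rat_bits ?b (T x i)" by (rule Tb[OF i])
    next
      fix a' i assume a': "a' \<in> arrays e"
      then have "a' \<noteq> ''var''" "a' \<noteq> ''stack''" using wf by auto
      then show "rat_bits ?b (s a' i)" using Mb sM[OF a'] by simp
    qed
    then obtain s' where s': "runs (compile_table a sz e) s (table_weight sz e (n x) (d x) 0) (table_weight sz e (n x) (d x) ?b) s'"
      "\<And>c. c \<noteq> ''var'' \<Longrightarrow> c \<noteq> ''stack'' \<Longrightarrow>
        s' c = (s(a := \<lambda>k. if k < nval sz [n x, d x] then T x k else s a k)) c"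
      "s' ''var'' 0 = of_nat (n x)" "s' ''var'' 1 = of_nat (d x)" by blast
    have k: "table_weight sz e (n x) (d x) 0 \<le> poly t ?D"
      using n_le[OF x] d_le[OF x] by (intro t) auto
    have "table_weight sz e (n x) (d x) ?b \<le> poly t (?L + poly q ?L + poly r ?L)"
      using n_le[OF x] d_le[OF x] length_le_input_length[of x] by (intro t) auto
    then have w: "table_weight sz e (n x) (d x) ?b \<le> poly ?q ?L" by (simp add: poly_pcompose)
    have "runs (Seq c (compile_table a sz e)) (input_store [n x, d x] (data x)) (poly (p + t) ?D) (poly ?q ?L) s'"
      by (rule runs_Seq[OF s(1) s'(1) _ _ w]) (use k in simp_all)
    moreover have "s' a' = ?M a'" if "a' \<noteq> ''var''" "a' \<noteq> ''stack''" for a'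
      using s'(2)[OF that] s(4)[OF that] sa by (simp add: fun_eq_iff)
    moreover have "rat_bits (poly ?q ?L) (?M a' i)" if "a' \<noteq> ''var''" "a' \<noteq> ''stack''" for a' i
    proof -
      have "rat_bits ?b (?M a' i)" using Mb[OF that, of i] Mb[OF wf(1,2), of i] Tb[of i] by simp
      then show ?thesis by (rule rat_bits_mono) simp
    qed
    ultimately show "run_ok (Seq c (compile_table a sz e)) (\<lambda>x. (M x)(a := \<lambda>k. if k < nval sz [n x, d x] then T x k else M x a k)) (p + t) ?q x \<and>
      bits_ok (\<lambda>x. (M x)(a := \<lambda>k. if k < nval sz [n x, d x] then T x k else M x a k)) ?q x"
      unfolding run_ok_def bits_ok_def
      using s'(3,4) by blast
  qed
qed

text \<open>If the array is not read by its own defining expression, the weight of the expression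
  already bounds the entries.\<close>

lemma computes_table_explicit:
  assumes c: "computes c M"
    and wf: "a \<noteq> ''var''" "a \<noteq> ''stack''" "''var'' \<notin> arrays e" "''stack'' \<notin> arrays e" "a \<notin> arrays e"
  shows "computes (Seq c (compile_table a sz e))
    (\<lambda>x. (M x)(a := \<lambda>k. if k < nval sz [n x, d x] then xval e [n x, d x, k] (M x) else M x a k))"
proof -
  obtain b where b: "poly_bounded b"
    "\<And>x a i. x \<in> X \<Longrightarrow> a \<noteq> ''var'' \<Longrightarrow> a \<noteq> ''stack'' \<Longrightarrow> rat_bits (b x) (M x a i)"
    using computes_bits[OF c] by blast
  obtain t where t: "\<And>\<rho> b X. length \<rho> = 3 \<Longrightarrow> (\<forall>v\<in>set \<rho>. v \<le> X) \<Longrightarrow> b \<le> X \<Longrightarrow>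
      xweight e \<rho> 1 b \<le> poly t X"
    using xweight_poly[of 3 e 1] by blast
  obtain r where r: "\<And>\<rho> X. (\<forall>v\<in>set \<rho>. v \<le> X) \<Longrightarrow> nval sz \<rho> \<le> poly r X"
    using nval_poly by blast
  let ?B = "\<lambda>x. poly t (n x + d x + b x + poly r (n x + d x))"
  show ?thesis
  proof (rule computes_table[OF c wf(1-4)])
    fix x i assume x: "x \<in> X" and i: "i < nval sz [n x, d x]"
    show "xval e [n x, d x, i] ((M x)(a := \<lambda>k. if k < i then xval e [n x, d x, k] (M x) else M x a k)) =
      xval e [n x, d x, i] (M x)"
      using wf(5) by (intro xval_cong) auto
    have "rat_bits (b x) (M x a' j)" if "a' \<in> arrays e" for a' j
    proof -
      have "a' \<noteq> ''var''" "a' \<noteq> ''stack''" using that wf by auto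
      then show ?thesis by (rule b(2)[OF x])
    qed
    then have "rat_bits (xweight e [n x, d x, i] 1 (b x)) (xval e [n x, d x, i] (M x))"
      by (rule rat_bits_xval)
    moreover have "i \<le> poly r (n x + d x)" using i r[of "[n x, d x]" "n x + d x"] by simp
    then have "xweight e [n x, d x, i] 1 (b x) \<le> ?B x" by (intro t) auto
    ultimately show "rat_bits (?B x) (xval e [n x, d x, i] (M x))" by (rule rat_bits_mono)
  qed (intro poly_bounded_poly poly_bounded_intros b(1))
qed

lemma decides_if_computes:
  assumes "computes c M" "\<And>x. x \<in> X \<Longrightarrow> M x ''result'' 0 = (if Q x then 1 else 0)"
  shows "decides_in_strongly_polynomial_time c X (\<lambda>x. [n x, d x]) data Q"
proof -
  obtain p q where pq: "\<And>x. x \<in> X \<Longrightarrow> run_ok c M p q x" and Mq: "\<And>x. x \<in> X \<Longrightarrow> bits_ok M q x"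
    using assms(1) unfolding computes_def by blast
  show ?thesis unfolding decides_in_strongly_polynomial_time_def
  proof (rule exI[of _ p], rule exI[of _ "smult 2 q + [:4:]"], rule ballI)
    fix x assume x: "x \<in> X"
    obtain s where s: "runs c (input_store [n x, d x] (data x)) (poly p (length (data x))) (poly q (input_length x)) s"
      "s ''result'' = M x ''result''"
    proof -
      from pq[OF x] show ?thesis unfolding run_ok_def by (elim exE conjE) (rule that, assumption, simp)
    qed
    then obtain k W where "exec c (input_store [n x, d x] (data x)) k W s" "k \<le> poly p (length (data x))"
      "\<forall>w\<in>W. rat_bits (poly q (input_length x)) w"
      unfolding runs_def by blast
    then show "\<exists>k W s. exec c (input_store [n x, d x] (data x)) k W s \<and>
        s ''result'' 0 = (if Q x then 1 else 0) \<and> k \<le> poly p (length (data x)) \<and>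
        (\<forall>w\<in>W. encoding_length w \<le> poly (smult 2 q + [:4:]) (\<Sum>y\<leftarrow>data x. encoding_length y))"
      using s(2) assms(2)[OF x] rat_bits_encoding_length
      by (intro exI[of _ k] exI[of _ W] exI[of _ s]) (simp add: input_length_def)
  qed
qed

end

section \<open>A priori bounds for numbers defined by recursion\<close>

declare of_nat_Suc [simp]

text \<open>One number \<open>K\<close> serves as a denominator and as a bound on the size. If
  \<open>K\<close> is common to all summands, a sum multiplies it only by the number of terms,
  whereas multiplying the denominators of the summands would give exponential length along the
  recursions.\<close>

definition frac_bounded :: "nat \<Rightarrow> rat \<Rightarrow> bool" where
  "frac_bounded K x \<longleftrightarrow> of_nat K * x \<in> \<int> \<and> \<bar>x\<bar> \<le> of_nat K"

lemma frac_bounded_0 [simp]: "frac_bounded K 0"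
  by (simp add: frac_bounded_def)

lemma frac_bounded_1: "0 < K \<Longrightarrow> frac_bounded K 1"
  by (simp add: frac_bounded_def)

lemma frac_bounded_uminus: "frac_bounded K x \<Longrightarrow> frac_bounded K (- x)"
  by (simp add: frac_bounded_def)

lemma frac_bounded_dvd:
  assumes "frac_bounded K x" "K dvd K'" "0 < K'"
  shows "frac_bounded K' x"
proof -
  obtain c where c: "K' = K * c" using assms(2) by (rule dvdE)
  have "of_nat c * (of_nat K * x) \<in> \<int>" using assms(1) by (simp add: frac_bounded_def)
  moreover have "K \<le> K'" using assms(2,3) by (rule dvd_imp_le)
  then have "(of_nat K :: rat) \<le> of_nat K'" by simp
  ultimately show ?thesis using assms(1) by (auto simp: frac_bounded_def c mult_ac)
qed

lemma frac_bounded_mult: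
  assumes "frac_bounded K x" "frac_bounded K' y"
  shows "frac_bounded (K * K') (x * y)"
proof -
  have "(of_nat K * x) * (of_nat K' * y) \<in> \<int>"
    by (rule Ints_mult) (use assms in \<open>simp_all only: frac_bounded_def\<close>)
  moreover have "\<bar>x * y\<bar> \<le> of_nat K * of_nat K'"
    unfolding abs_mult using assms by (intro mult_mono) (simp_all add: frac_bounded_def)
  ultimately show ?thesis by (simp add: frac_bounded_def mult_ac)
qed

lemma frac_bounded_sum:
  assumes "\<And>i. i \<in> A \<Longrightarrow> frac_bounded K (f i)" "card A \<le> s" "finite A"
  shows "frac_bounded (s * K) (sum f A)"
proof -
  have "of_nat (s * K) * sum f A = (\<Sum>i\<in>A. of_nat s * (of_nat K * f i))"
    by (simp add: sum_distrib_left mult_ac)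
  also have "\<dots> \<in> \<int>"
    by (intro Ints_sum, rule Ints_mult) (use assms(1) in \<open>simp_all add: frac_bounded_def\<close>)
  finally have 1: "of_nat (s * K) * sum f A \<in> \<int>" .
  have "\<bar>sum f A\<bar> \<le> (\<Sum>i\<in>A. of_nat K)"
    using assms(1) by (intro order.trans[OF sum_abs] sum_mono) (simp add: frac_bounded_def)
  also have "\<dots> = of_nat (card A * K)" by simp
  also have "\<dots> \<le> of_nat (s * K)" using assms(2) by (simp only: of_nat_le_iff mult_le_mono1)
  finally show ?thesis using 1 by (simp only: frac_bounded_def)
qed

lemma frac_bounded_add:
  assumes "frac_bounded K x" "frac_bounded K y" shows "frac_bounded (2 * K) (x + y)"
proof -
  have "of_nat (2 * K) * (x + y) = 2 * (of_nat K * x + of_nat K * y)"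
    by (simp add: algebra_simps)
  also have "\<dots> \<in> \<int>"
    by (rule Ints_mult, simp, rule Ints_add) (use assms in \<open>simp_all only: frac_bounded_def\<close>)
  finally show ?thesis
    using assms abs_triangle_ineq[of x y] unfolding frac_bounded_def by simp
qed

lemma frac_bounded_divide:
  assumes "frac_bounded K x" "0 < j"
  shows "frac_bounded (j * K) (x / of_nat j)"
proof -
  have "\<bar>x / of_nat j\<bar> \<le> \<bar>x\<bar>" using assms(2) by (simp add: divide_le_eq mult_le_cancel_left1)
  also have "\<dots> \<le> of_nat K" using assms(1) by (simp add: frac_bounded_def)
  also have "\<dots> \<le> of_nat (j * K)" using assms(2) by (simp only: of_nat_le_iff) simp
  finally show ?thesis using assms by (simp add: frac_bounded_def)
qed

lemma frac_bounded_rat_bits: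
  assumes "frac_bounded K x" "0 < K" "K \<le> 2 ^ B"
  shows "rat_bits (2 * B) x"
proof -
  obtain p where p: "of_nat K * x = of_int p" using assms(1) by (auto simp: frac_bounded_def elim: Ints_cases)
  then have x: "x = of_int p / of_int (int K)" using assms(2) by (simp add: field_simps)
  have KB: "int K \<le> 2 ^ B"
  proof -
    have "int K \<le> int (2 ^ B)" using assms(3) by (simp only: of_nat_le_iff)
    then show ?thesis by simp
  qed
  have "\<bar>of_int p :: rat\<bar> = of_nat K * \<bar>x\<bar>" using p[symmetric] by (simp add: abs_mult)
  also have "\<dots> \<le> of_nat K * of_nat K"
    using assms(1) by (intro mult_left_mono) (simp_all add: frac_bounded_def)
  finally have "(of_int \<bar>p\<bar> :: rat) \<le> of_int (int K * int K)" by simp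
  then have "\<bar>p\<bar> \<le> int K * int K" by (simp only: of_int_le_iff)
  also have "\<dots> \<le> 2 ^ B * 2 ^ B" using KB by (intro mult_mono) auto
  finally have "\<bar>p\<bar> \<le> 2 ^ (2 * B)" by (simp add: power_add[symmetric] mult_2)
  moreover have "K \<le> 2 ^ (2 * B)"
    by (rule order.trans[OF assms(3) power_increasing]) auto
  ultimately show ?thesis
    unfolding rat_bits_def using assms(2) KB x
    by - (rule exI[of _ p], rule exI[of _ "int K"], auto)
qed

text \<open>The product of one suitable number per entry is a common denominator, and its length is
  at most the sum of theirs, hence polynomial in the number of entries and their size.\<close>

lemma common_bound:
  assumes "finite I" "\<And>i. i \<in> I \<Longrightarrow> rat_bits b (x i)"
  shows "\<exists>K>0. K \<le> 2 ^ ((2 * b + 1) * card I) \<and> (\<forall>i\<in>I. frac_bounded K (x i))"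
  using assms
proof (induction I rule: finite_induct)
  case empty
  show ?case by (intro exI[of _ 1]) simp
next
  case (insert i I)
  have "\<exists>K>0. K \<le> 2 ^ ((2 * b + 1) * card I) \<and> (\<forall>i\<in>I. frac_bounded K (x i))"
    by (rule insert.IH) (simp add: insert.prems)
  then obtain K where K: "0 < K" "K \<le> 2 ^ ((2 * b + 1) * card I)" "\<forall>i\<in>I. frac_bounded K (x i)"
    by blast
  obtain p q where pq: "x i = of_int p / of_int q" "0 < q" "q \<le> 2 ^ b" "\<bar>p\<bar> \<le> 2 ^ b"
    using insert.prems[of i] unfolding rat_bits_def by blast
  \<comment> \<open>A multiple of the denominator \<open>q\<close> that is also at least the
    absolute value of \<open>x i\<close>.\<close>
  define k where "k = nat (q * (\<bar>p\<bar> + 1))"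
  have k: "int k = q * (\<bar>p\<bar> + 1)" using pq(2) by (simp add: k_def)
  have "0 < int k" unfolding k using pq(2) by (intro mult_pos_pos) auto
  then have k0: "0 < k" by simp
  have rk: "(of_nat k :: rat) = of_int q * (of_int \<bar>p\<bar> + 1)"
  proof -
    have "(of_int (int k) :: rat) = of_int q * (of_int \<bar>p\<bar> + 1)"
      by (simp only: k of_int_mult of_int_add of_int_1)
    then show ?thesis by simp
  qed
  have "of_nat k * x i = of_int ((\<bar>p\<bar> + 1) * p)" unfolding rk pq(1) using pq(2) by simp
  then have "of_nat k * x i \<in> \<int>" by (simp only: Ints_of_int)
  moreover have "\<bar>x i\<bar> \<le> of_nat k"
  proof -
    have q1: "(1::rat) \<le> of_int q" using pq(2) by simp
    have "\<bar>x i\<bar> \<le> of_int \<bar>p\<bar>" unfolding pq(1) abs_divide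
      using q1 by (simp add: divide_le_eq mult_le_cancel_left1)
    also have "\<dots> \<le> 1 * (of_int \<bar>p\<bar> + 1)" by simp
    also have "\<dots> \<le> of_nat k" unfolding rk using q1 by (intro mult_right_mono) auto
    finally show ?thesis .
  qed
  ultimately have xk: "frac_bounded k (x i)" unfolding frac_bounded_def by blast
  have "k \<le> 2 ^ (2 * b + 1)"
  proof -
    have one: "(1::int) \<le> 2 ^ b" by simp
    have "int k \<le> 2 ^ b * (2 ^ b + 2 ^ b)" unfolding k
      using pq one by (intro mult_mono) linarith+
    also have "\<dots> = int (2 ^ (2 * b + 1))"
    proof -
      have e: "2 * b + 1 = Suc (b + b)" by simp
      show ?thesis unfolding e by (simp only: power_Suc power_add of_nat_add of_nat_mult of_nat_power of_nat_numeral distrib_left mult_2)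
    qed
    finally show ?thesis by (simp only: of_nat_le_iff)
  qed
  then have "k * K \<le> 2 ^ (2 * b + 1) * 2 ^ ((2 * b + 1) * card I)" using K(2) by (rule mult_le_mono)
  also have "\<dots> = 2 ^ ((2 * b + 1) * card (insert i I))"
    using insert.hyps by (simp add: power_add)
  finally have "k * K \<le> 2 ^ ((2 * b + 1) * card (insert i I))" .
  moreover have "frac_bounded (k * K) (x i)" by (rule frac_bounded_dvd[OF xk]) (use k0 K in auto)
  moreover have "frac_bounded (k * K) (x i')" if "i' \<in> I" for i'
    by (rule frac_bounded_dvd[OF K(3)[rule_format, OF that]]) (use k0 K(1) in auto)
  ultimately show ?case using k0 K(1) by (intro exI[of _ "k * K"]) auto
qed

lemma coeff_mult_bounded:
  assumes "\<And>r. r < w \<Longrightarrow> frac_bounded K (coeff p r)" "\<And>r. r < w \<Longrightarrow> frac_bounded K' (coeff q r)" "k < w"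
  shows "frac_bounded (w * (K * K')) (coeff (p * q) k)"
  unfolding coeff_mult
proof (rule frac_bounded_sum)
  show "frac_bounded (K * K') (coeff p i * coeff q (k - i))" if "i \<in> {..k}" for i
    using that assms(3) by (intro frac_bounded_mult assms(1,2)) auto
qed (use assms(3) in auto)

text \<open>A multiplication by \<open>A\<close> sums \<open>N\<close> products of polynomials, and
  each of their coefficients is a sum of at most \<open>w\<close> products with a factor bounded by
  \<open>K\<close>; hence \<open>N * w * K\<close> per power.\<close>

lemma mat_power_bounded:
  assumes A: "\<And>i l k. i < N \<Longrightarrow> l < N \<Longrightarrow> k < w \<Longrightarrow> frac_bounded K (coeff (A i l) k)" and K: "0 < K"
    and "i < N" "l < N" "k < w"
  shows "frac_bounded ((N * w * K) ^ j) (coeff (mat_power N A j i l) k)"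
  using assms(3,5)
proof (induction j arbitrary: i k)
  case 0
  show ?case by (cases k) (simp_all add: frac_bounded_1)
next
  case (Suc j)
  have "frac_bounded (N * (w * (K * (N * w * K) ^ j))) (\<Sum>m<N. coeff (A i m * mat_power N A j m l) k)"
  proof (rule frac_bounded_sum)
    fix m assume m: "m \<in> {..<N}"
    show "frac_bounded (w * (K * (N * w * K) ^ j)) (coeff (A i m * mat_power N A j m l) k)"
    proof (rule coeff_mult_bounded)
      show "frac_bounded K (coeff (A i m) r)" if "r < w" for r
        using m that Suc.prems by (intro A) auto
      show "frac_bounded ((N * w * K) ^ j) (coeff (mat_power N A j m l) r)" if "r < w" for r
        using m that by (intro Suc.IH) auto
    qed (rule Suc.prems)
  qed auto
  then show ?case by (simp add: coeff_sum mult_ac)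
qed

text \<open>At most \<open>N\<close> products with at most \<open>w\<close> terms per coefficient
  give the factor \<open>N * w * K\<close> per order, and the divisions by 1 to \<open>j\<close>
  accumulate to \<open>fact j\<close>. All earlier bounds divide the one of order
  \<open>j - 1\<close>, which thus is common to the terms of the sum.\<close>

lemma newton_coeffs_bounded:
  assumes p: "\<And>j k. 0 < j \<Longrightarrow> j \<le> N \<Longrightarrow> k < w \<Longrightarrow> frac_bounded K (coeff (p j) k)" and K: "0 < K"
    and "j \<le> N" "k < w"
  shows "frac_bounded (fact j * (N * w * K) ^ j) (coeff (newton_coeffs p j) k)"
  using assms(3,4)
proof (induction j arbitrary: k rule: less_induct)
  case (less j)
  show ?case
  proof (cases "j = 0")
    case True
    then show ?thesis by (cases k) (simp_all add: frac_bounded_1)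
  next
    case False
    then obtain j' where j: "j = Suc j'" by (cases j) auto
    let ?Q = "\<lambda>i. fact i * (N * w * K) ^ i :: nat"
    have pos: "0 < N * w * K" using False less.prems K by auto
    then have Q0: "0 < ?Q i" for i by simp
    have dvd: "?Q i dvd ?Q j'" if "i < j" for i
      using that j by (intro mult_dvd_mono fact_dvd le_imp_power_dvd) auto
    have "frac_bounded (w * (?Q j' * K)) (coeff (newton_coeffs p i * p (j - i)) k)" if i: "i < j" for i
    proof (rule coeff_mult_bounded)
      fix r assume r: "r < w"
      show "frac_bounded (?Q j') (coeff (newton_coeffs p i) r)"
        by (rule frac_bounded_dvd[OF less.IH[OF i _ r] dvd[OF i] Q0]) (use i less.prems in auto)
      show "frac_bounded K (coeff (p (j - i)) r)" using i less.prems r by (intro p) auto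
    qed (rule less.prems)
    then have "frac_bounded (N * (w * (?Q j' * K))) (\<Sum>i<j. coeff (newton_coeffs p i * p (j - i)) k)"
      by (intro frac_bounded_sum) (use less.prems in auto)
    then have "frac_bounded (j * (N * (w * (?Q j' * K)))) ((\<Sum>i<j. coeff (newton_coeffs p i * p (j - i)) k) / of_nat j)"
      using False by (intro frac_bounded_divide) auto
    then have "frac_bounded (j * (N * (w * (?Q j' * K)))) (- ((\<Sum>i<j. coeff (newton_coeffs p i * p (j - i)) k) / of_nat j))"
      by (rule frac_bounded_uminus)
    moreover have "j * (N * (w * (?Q j' * K))) = ?Q j"
      by (simp only: j fact_Suc power_Suc of_nat_id mult_ac)
    moreover have "coeff (newton_coeffs p j) k = - ((\<Sum>i<j. coeff (newton_coeffs p i * p (j - i)) k) / of_nat j)"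
      using False by (subst newton_coeffs.simps) (simp add: coeff_sum)
    ultimately show ?thesis by simp
  qed
qed

text \<open>The multiple of \<open>root_coeff h k\<close> and the sum both count as at most
  \<open>L\<close> terms, which gives \<open>L * K\<close>; the 2 comes from adding the two
  parts.\<close>

lemma root_power_sum_bounded:
  assumes a: "\<And>i. i < L \<Longrightarrow> frac_bounded K (root_coeff h i)" and K: "0 < K" and "0 < k" "k < L"
  shows "frac_bounded ((2 * L * K) ^ k) (root_power_sum h k)"
  using assms(3,4)
proof (induction k rule: less_induct)
  case (less k)
  then obtain k' where k: "k = Suc k'" by (cases k) auto
  let ?W = "2 * L * K"
  have W: "0 < ?W" using less.prems K by simp
  have 1: "frac_bounded (L * K * ?W ^ k') (of_nat k * root_coeff h k)"
  proof -
    have "frac_bounded (L * K) (\<Sum>i<k. root_coeff h k)"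
      by (rule frac_bounded_sum) (use a less.prems in auto)
    then have "frac_bounded (L * K) (of_nat k * root_coeff h k)" by simp
    then show ?thesis by (rule frac_bounded_dvd) (use W less.prems K in auto)
  qed
  have "frac_bounded (K * ?W ^ k') (root_coeff h i * root_power_sum h (k - i))" if i: "i \<in> {1..<k}" for i
  proof (rule frac_bounded_mult)
    show "frac_bounded K (root_coeff h i)" using i less.prems by (intro a) auto
    have "frac_bounded (?W ^ (k - i)) (root_power_sum h (k - i))"
      using i less.prems by (intro less.IH) auto
    then show "frac_bounded (?W ^ k') (root_power_sum h (k - i))"
      by (rule frac_bounded_dvd) (use i k W in \<open>auto intro!: le_imp_power_dvd\<close>)
  qed
  then have "frac_bounded (L * (K * ?W ^ k')) (\<Sum>i\<in>{1..<k}. root_coeff h i * root_power_sum h (k - i))"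
    by (intro frac_bounded_sum) (use less.prems in auto)
  then have 2: "frac_bounded (L * K * ?W ^ k') (\<Sum>i\<in>{1..<k}. root_coeff h i * root_power_sum h (k - i))"
    by (simp only: mult.assoc)
  have "root_power_sum h k = - (of_nat k * root_coeff h k + (\<Sum>i\<in>{1..<k}. root_coeff h i * root_power_sum h (k - i)))"
    using less.prems by (subst root_power_sum.simps) simp
  moreover have "2 * (L * K * ?W ^ k') = ?W ^ k" by (simp add: k)
  ultimately show ?case using frac_bounded_uminus[OF frac_bounded_add[OF 1 2]] by (simp only:)
qed

lemma power_le_two_power: "x \<le> 2 ^ a \<Longrightarrow> x ^ j \<le> 2 ^ (a * j)" for x :: nat
  by (simp add: power_mult power_mono)

lemma mult_le_two_power: "x \<le> 2 ^ a \<Longrightarrow> y \<le> 2 ^ b \<Longrightarrow> x * y \<le> 2 ^ (a + b)" for x y :: nat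
  by (simp add: power_add mult_le_mono)

lemma mat_power_bits:
  assumes A: "\<And>i l k. i < N \<Longrightarrow> l < N \<Longrightarrow> k < w \<Longrightarrow> rat_bits b (coeff (A i l) k)"
    and "i < N" "l < N" "k < w" "j \<le> J"
  shows "rat_bits (2 * ((N + w + (2 * b + 1) * (N * N * w)) * J)) (coeff (mat_power N A j i l) k)"
proof -
  let ?I = "{..<N} \<times> {..<N} \<times> {..<w}"
  have "\<exists>K>0. K \<le> 2 ^ ((2 * b + 1) * card ?I) \<and> (\<forall>t\<in>?I. frac_bounded K (case t of (i, l, k) \<Rightarrow> coeff (A i l) k))"
    by (rule common_bound) (use A in auto)
  then obtain K where K: "0 < K" "K \<le> 2 ^ ((2 * b + 1) * card ?I)"
    "\<And>i l k. i < N \<Longrightarrow> l < N \<Longrightarrow> k < w \<Longrightarrow> frac_bounded K (coeff (A i l) k)" by auto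
  have card: "card ?I = N * N * w" by (simp add: card_cartesian_product)
  have "N * w * K \<le> 2 ^ (N + w + (2 * b + 1) * (N * N * w))"
    using K(2) unfolding card by (intro mult_le_two_power) (auto intro: less_imp_le less_exp)
  then have "(N * w * K) ^ j \<le> 2 ^ ((N + w + (2 * b + 1) * (N * N * w)) * j)" by (rule power_le_two_power)
  also have "\<dots> \<le> 2 ^ ((N + w + (2 * b + 1) * (N * N * w)) * J)"
    using assms(5) by (intro power_increasing mult_le_mono2) auto
  finally have le: "(N * w * K) ^ j \<le> 2 ^ ((N + w + (2 * b + 1) * (N * N * w)) * J)" .
  have "0 < N * w * K" using assms K by auto
  then show ?thesis
    by (intro frac_bounded_rat_bits[OF mat_power_bounded[of N w K A i l k j, OF K(3,1) assms(2-4)] _ le]) simp_all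
qed

lemma newton_coeffs_bits:
  assumes p: "\<And>j k. 0 < j \<Longrightarrow> j \<le> N \<Longrightarrow> k < w \<Longrightarrow> rat_bits b (coeff (p j) k)"
    and "j \<le> N" "k < w"
  shows "rat_bits (2 * (N * N + (N + w + (2 * b + 1) * (N * w)) * N)) (coeff (newton_coeffs p j) k)"
proof -
  let ?I = "{1..N} \<times> {..<w}"
  have "\<exists>K>0. K \<le> 2 ^ ((2 * b + 1) * card ?I) \<and> (\<forall>t\<in>?I. frac_bounded K (case t of (j, k) \<Rightarrow> coeff (p j) k))"
    by (rule common_bound) (use p in auto)
  then obtain K where K: "0 < K" "K \<le> 2 ^ ((2 * b + 1) * card ?I)"
    "\<And>j k. 0 < j \<Longrightarrow> j \<le> N \<Longrightarrow> k < w \<Longrightarrow> frac_bounded K (coeff (p j) k)" by auto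
  have card: "card ?I = N * w" by (simp add: card_cartesian_product)
  let ?B = "N + w + (2 * b + 1) * (N * w)"
  have "N * w * K \<le> 2 ^ ?B"
    using K(2) unfolding card by (intro mult_le_two_power) (auto intro: less_imp_le less_exp)
  then have "(N * w * K) ^ j \<le> 2 ^ (?B * j)" by (rule power_le_two_power)
  also have "\<dots> \<le> 2 ^ (?B * N)" using assms(2) by (intro power_increasing mult_le_mono2) auto
  finally have le: "(N * w * K) ^ j \<le> 2 ^ (?B * N)" .
  have "(fact j :: nat) \<le> fact N" using assms(2) by (rule fact_mono_nat)
  also have "\<dots> \<le> N ^ N" using fact_le_power[of N, where 'a = nat] by (simp only: of_nat_id)
  also have "\<dots> \<le> 2 ^ (N * N)" by (intro power_le_two_power) (auto intro: less_imp_le less_exp)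
  finally have "fact j * (N * w * K) ^ j \<le> 2 ^ (N * N + ?B * N)" using le by (rule mult_le_two_power)
  moreover have "0 < fact j * (N * w * K) ^ j"
    using assms K(1) by (cases "j = 0") auto
  ultimately show ?thesis
    by (intro frac_bounded_rat_bits[OF newton_coeffs_bounded[of N w K p j k, OF K(3,1) assms(2,3)]])
qed

lemma root_power_sum_bits:
  assumes a: "\<And>i. i < L \<Longrightarrow> rat_bits b (root_coeff h i)" and "0 < k" "k < L"
  shows "rat_bits (2 * ((1 + L + (2 * b + 1) * L) * L)) (root_power_sum h k)"
proof -
  have "\<exists>K>0. K \<le> 2 ^ ((2 * b + 1) * card {..<L}) \<and> (\<forall>i\<in>{..<L}. frac_bounded K (root_coeff h i))"
    by (rule common_bound) (use a in auto)
  then obtain K where K: "0 < K" "K \<le> 2 ^ ((2 * b + 1) * L)" "\<And>i. i < L \<Longrightarrow> frac_bounded K (root_coeff h i)"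
    by auto
  let ?B = "1 + L + (2 * b + 1) * L"
  have "2 * L * K \<le> 2 ^ ?B"
    using K(2) by (intro mult_le_two_power) (auto intro: less_imp_le less_exp)
  then have "(2 * L * K) ^ k \<le> 2 ^ (?B * k)" by (rule power_le_two_power)
  also have "\<dots> \<le> 2 ^ (?B * L)" using assms(3) by (intro power_increasing mult_le_mono2) auto
  finally have le: "(2 * L * K) ^ k \<le> 2 ^ (?B * L)" .
  have "0 < (2 * L * K) ^ k" using assms K(1) by simp
  then show ?thesis
    by (intro frac_bounded_rat_bits[OF root_power_sum_bounded[of L K h k, OF K(3,1) assms(2,3)] _ le])
qed

section \<open>Addresses in mixed radix notation\<close>

declare prod_list_zero_iff [simp del]

text \<open>The first digit is the most significant one, so all cells with a smaller first index
  precede. A recursion in the first index therefore finds the entries that it needs already filled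
  in.\<close>

fun flat :: "nat list \<Rightarrow> nat list \<Rightarrow> nat" where
  "flat (r # rs) (i # is) = i * prod_list rs + flat rs is"
| "flat _ _ = 0"

fun unflat :: "nat list \<Rightarrow> nat \<Rightarrow> nat list" where
  "unflat [] i = []"
| "unflat (r # rs) i = i div prod_list rs # unflat rs (i mod prod_list rs)"

lemma flat_less: "list_all2 (<) is rs \<Longrightarrow> flat rs is < prod_list rs"
proof (induction "is" rs rule: list_all2_induct)
  case (Cons i "is" r rs)
  have "i * prod_list rs + flat rs is < Suc i * prod_list rs" using Cons by simp
  also have "\<dots> \<le> r * prod_list rs" using Cons by (intro mult_le_mono1) simp
  finally show ?case by simp
qed simp

lemma unflat_flat: "list_all2 (<) is rs \<Longrightarrow> unflat rs (flat rs is) = is"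
proof (induction "is" rs rule: list_all2_induct)
  case (Cons i "is" r rs)
  have f: "flat rs is < prod_list rs" by (rule flat_less) fact
  then have "prod_list rs \<noteq> 0" by linarith
  then show ?case using f Cons by simp
qed simp

lemma flat_unflat: "i < prod_list rs \<Longrightarrow> list_all2 (<) (unflat rs i) rs \<and> flat rs (unflat rs i) = i"
proof (induction rs arbitrary: i)
  case (Cons r rs)
  have p: "0 < prod_list rs" using Cons.prems by (metis gr0I mult_0_right not_less_zero prod_list.Cons)
  have "i div prod_list rs < r" using Cons.prems by (simp add: less_mult_imp_div_less)
  then show ?case using Cons.IH[of "i mod prod_list rs"] p by simp
qed simp

lemma flat_mono_hd:
  assumes "list_all2 (<) is rs" "list_all2 (<) js rs" "hd is < hd js"
  shows "flat rs is < flat rs js"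
proof (cases rs)
  case (Cons r rs')
  obtain i "is'" j js' where *: "is = i # is'" "js = j # js'" "list_all2 (<) is' rs'"
    using assms(1,2) unfolding Cons by (auto simp: list_all2_Cons2)
  have "flat rs is < Suc i * prod_list rs'" using flat_less[OF *(3)] by (simp add: Cons *)
  also have "\<dots> \<le> j * prod_list rs'" using assms(3) by (intro mult_le_mono1) (simp add: *)
  also have "\<dots> \<le> flat rs js" by (simp add: Cons *)
  finally show ?thesis .
qed (use assms in simp)

fun nprod :: "nexp list \<Rightarrow> nexp" where
  "nprod [] = NC 1"
| "nprod (r # rs) = NMul r (nprod rs)"

fun nflat :: "nexp list \<Rightarrow> nexp list \<Rightarrow> nexp" where
  "nflat (r # rs) (e # es) = NAdd (NMul e (nprod rs)) (nflat rs es)"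
| "nflat _ _ = NC 0"

definition nmod :: "nexp \<Rightarrow> nexp \<Rightarrow> nexp" where
  "nmod x y = NSub x (NMul y (NDiv x y))"

lemma nval_nmod [simp]: "nval (nmod x y) \<rho> = nval x \<rho> mod nval y \<rho>"
  by (simp add: nmod_def minus_mult_div_eq_mod)

text \<open>The program sees only the number of the cell, in variable 2; the digits are recovered
  from it by quotient and remainder.\<close>

definition digit :: "nexp list \<Rightarrow> nat \<Rightarrow> nexp" where
  "digit rs t = nmod (NDiv (NV 2) (nprod (drop (Suc t) rs))) (rs ! t)"

definition cell :: "string \<Rightarrow> nexp list \<Rightarrow> nexp list \<Rightarrow> xexp" where
  "cell a rs es = XCell a (nflat rs es)"

lemma arrays_cell [simp]: "arrays (cell a rs es) = {a}"
  by (simp add: cell_def)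

text \<open>Radices may depend only on \<open>n\<close> and \<open>d\<close>, so they keep their
  values inside sums, where more variables are bound.\<close>

fun format_only :: "nexp \<Rightarrow> bool" where
  "format_only (NC k) \<longleftrightarrow> True"
| "format_only (NV i) \<longleftrightarrow> i < 2"
| "format_only (NAdd x y) \<longleftrightarrow> format_only x \<and> format_only y"
| "format_only (NMul x y) \<longleftrightarrow> format_only x \<and> format_only y"
| "format_only (NSub x y) \<longleftrightarrow> format_only x \<and> format_only y"
| "format_only (NDiv x y) \<longleftrightarrow> format_only x \<and> format_only y"

lemma nval_format_only: "format_only r \<Longrightarrow> nval r (n # d # \<rho>) = nval r [n, d]"
  by (induction r) (auto simp: less_2_cases_iff)

definition radices :: "nexp list \<Rightarrow> nat \<Rightarrow> nat \<Rightarrow> nat list" where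
  "radices rs n d = map (\<lambda>r. nval r [n, d]) rs"

lemma radices_simps [simp]:
  "radices [] n d = []" "radices (r # rs) n d = nval r [n, d] # radices rs n d"
  "length (radices rs n d) = length rs"
  by (simp_all add: radices_def)

lemma nval_nprod: "list_all format_only rs \<Longrightarrow> nval (nprod rs) (n # d # \<rho>) = prod_list (radices rs n d)"
  by (induction rs) (simp_all add: nval_format_only[of _ n d \<rho>])

lemma nval_nflat:
  "list_all format_only rs \<Longrightarrow>
    nval (nflat rs es) (n # d # \<rho>) = flat (radices rs n d) (map (\<lambda>e. nval e (n # d # \<rho>)) es)"
  by (induction rs es rule: nflat.induct) (simp_all add: nval_nprod)

lemma nth_flat:
  "list_all2 (<) is rs \<Longrightarrow> t < length rs \<Longrightarrow>
    flat rs is div prod_list (drop (Suc t) rs) mod rs ! t = is ! t"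
proof (induction "is" rs arbitrary: t rule: list_all2_induct)
  case (Cons i "is" r rs)
  have f: "flat rs is < prod_list rs" by (rule flat_less) fact
  show ?case
  proof (cases t)
    case 0
    then show ?thesis using f Cons by simp
  next
    case (Suc u)
    then have u: "u < length rs" using Cons by simp
    have d: "drop u rs = rs ! u # drop (Suc u) rs" using u by (simp add: Cons_nth_drop_Suc)
    have "prod_list rs = prod_list (take u rs) * prod_list (drop u rs)"
      by (metis append_take_drop_id prod_list.append)
    then have p: "prod_list rs = prod_list (take u rs) * rs ! u * prod_list (drop (Suc u) rs)"
      by (simp only: d prod_list.Cons mult.assoc)
    have "0 < prod_list rs" using f by simp
    then have q: "prod_list (drop (Suc u) rs) \<noteq> 0" using p by (metis mult_0_right less_irrefl)
    have "(i * prod_list rs + flat rs is) div prod_list (drop (Suc u) rs) =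
        (i * prod_list (take u rs)) * rs ! u + flat rs is div prod_list (drop (Suc u) rs)"
      using q unfolding p by (simp add: mult.assoc[symmetric])
    then show ?thesis using Cons.IH[OF u] Suc by simp
  qed
qed simp

lemma nval_digit [simp]:
  assumes "list_all format_only rs" "list_all2 (<) is (radices rs n d)" "t < length rs"
  shows "nval (digit rs t) (n # d # flat (radices rs n d) is # \<rho>) = is ! t"
proof -
  have 1: "nval (nprod (drop (Suc t) rs)) (n # d # \<sigma>) = prod_list (drop (Suc t) (radices rs n d))" for \<sigma>
    using assms(1) by (subst nval_nprod) (auto dest: in_set_dropD simp: radices_def drop_map list_all_iff)
  have 2: "nval (rs ! t) (n # d # \<sigma>) = radices rs n d ! t" for \<sigma>
    using assms(1,3) nval_format_only[of "rs ! t" n d \<sigma>] by (simp add: radices_def list_all_length)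
  show ?thesis using nth_flat[OF assms(2), of t] assms(3) by (simp add: digit_def 1 2)
qed

definition holds_table :: "store \<Rightarrow> nat \<Rightarrow> nat \<Rightarrow> string \<Rightarrow> nexp list \<Rightarrow> (nat list \<Rightarrow> rat) \<Rightarrow> bool" where
  "holds_table s n d a rs f \<longleftrightarrow>
     (\<forall>is. list_all2 (<) is (radices rs n d) \<longrightarrow> s a (flat (radices rs n d) is) = f is)"

section \<open>Tabulated functions\<close>

text \<open>The name of the array, the radices of its index, and the function stored in it, for each
  instance.\<close>

type_synonym 'x table = "string \<times> nexp list \<times> ('x \<Rightarrow> nat list \<Rightarrow> rat)"

context input_family
begin

definition holds_tables :: "'x table set \<Rightarrow> store \<Rightarrow> 'x \<Rightarrow> bool" where
  "holds_tables \<Gamma> s x \<longleftrightarrow> (\<forall>(a, rs, f)\<in>\<Gamma>. holds_table s (n x) (d x) a rs (f x))"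

text \<open>\<open>\<Gamma>\<close> is a context of functions available to further expressions. The
  program is hidden by the existential quantifier: enlarging \<open>\<Gamma>\<close> appends to some
  program, which never has to be written down.\<close>

definition tabulated :: "'x table set \<Rightarrow> bool" where
  "tabulated \<Gamma> \<longleftrightarrow> (\<forall>(a, rs, f)\<in>\<Gamma>. a \<noteq> ''var'' \<and> a \<noteq> ''stack'' \<and> (list_all format_only rs)) \<and>
     (\<exists>c M. computes c M \<and> (\<forall>x\<in>X. holds_tables \<Gamma> (M x) x))"

definition digits_at :: "nexp list \<Rightarrow> 'x \<Rightarrow> nat \<Rightarrow> nat list \<Rightarrow> bool" where
  "digits_at rs x z is \<longleftrightarrow> (\<forall>t<length rs. \<forall>\<rho>. nval (digit rs t) (n x # d x # z # \<rho>) = is ! t)"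

text \<open>What a recursive table may assume about its own array while a cell is being filled. The
  environment is arbitrary because the array may be read inside sums.\<close>

definition earlier_cells :: "string \<Rightarrow> nexp list \<Rightarrow> (nat list \<Rightarrow> rat) \<Rightarrow> store \<Rightarrow> 'x \<Rightarrow> nat list \<Rightarrow> bool" where
  "earlier_cells a rs f s x is \<longleftrightarrow>
     (\<forall>es \<rho>. let js = map (\<lambda>e. nval e (n x # d x # \<rho>)) es in
        list_all2 (<) js (radices rs (n x) (d x)) \<longrightarrow> hd js < hd is \<longrightarrow>
        xval (cell a rs es) (n x # d x # \<rho>) s = f js)"

lemma earlier_cellsD:
  "earlier_cells a rs f s x is \<Longrightarrow>
    list_all2 (<) (map (\<lambda>e. nval e (n x # d x # \<rho>)) es) (radices rs (n x) (d x)) \<Longrightarrow>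
    hd (map (\<lambda>e. nval e (n x # d x # \<rho>)) es) < hd is \<Longrightarrow>
    xval (cell a rs es) (n x # d x # \<rho>) s = f (map (\<lambda>e. nval e (n x # d x # \<rho>)) es)"
  unfolding earlier_cells_def Let_def by blast

lemma poly_bounded_nval: "poly_bounded (\<lambda>x. nval r [n x, d x])"
proof -
  obtain q where q: "\<And>\<rho> Y. (\<forall>v\<in>set \<rho>. v \<le> Y) \<Longrightarrow> nval r \<rho> \<le> poly q Y" using nval_poly by blast
  have "nval r [n x, d x] \<le> poly q (n x + d x)" for x by (rule q) simp
  moreover have "poly_bounded (\<lambda>x. poly q (n x + d x))"
    by (intro poly_bounded_poly poly_bounded_intros)
  ultimately show ?thesis by (blast intro: poly_bounded_mono)
qed

lemma tabulated_bits:
  assumes "tabulated \<Gamma>" "(a, rs, f) \<in> \<Gamma>"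
  shows "\<exists>b. poly_bounded b \<and>
    (\<forall>x\<in>X. \<forall>is. list_all2 (<) is (radices rs (n x) (d x)) \<longrightarrow> rat_bits (b x) (f x is))"
proof -
  obtain c M where M: "computes c M" "\<And>x. x \<in> X \<Longrightarrow> holds_tables \<Gamma> (M x) x" "a \<noteq> ''var''" "a \<noteq> ''stack''"
    using assms unfolding tabulated_def by auto
  obtain b where b: "poly_bounded b"
    "\<And>x a i. x \<in> X \<Longrightarrow> a \<noteq> ''var'' \<Longrightarrow> a \<noteq> ''stack'' \<Longrightarrow> rat_bits (b x) (M x a i)"
    using computes_bits[OF M(1)] by blast
  have "rat_bits (b x) (f x is)" if x: "x \<in> X" and i: "list_all2 (<) is (radices rs (n x) (d x))" for x "is"
  proof -
    have "holds_table (M x) (n x) (d x) a rs (f x)"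
      using M(2)[OF x] assms(2) unfolding holds_tables_def by blast
    then have "M x a (flat (radices rs (n x) (d x)) is) = f x is"
      using i unfolding holds_table_def by blast
    then show ?thesis using b(2)[OF x M(3,4)] by metis
  qed
  then show ?thesis using b(1) by blast
qed

text \<open>By \<open>flat_mono_hd\<close>, entries with a smaller first index are final when they
  are read. The bound \<open>b\<close> has to be supplied from outside: composing the bounds of the
  single rounds would multiply the length in every round.\<close>

lemma tabulated_recursive:
  assumes \<Gamma>: "tabulated \<Gamma>" "a \<notin> fst ` \<Gamma>"
    and wf: "a \<noteq> ''var''" "a \<noteq> ''stack''" "''var'' \<notin> arrays e" "''stack'' \<notin> arrays e"
      "list_all format_only rs"
    and f: "\<And>x is s z. x \<in> X \<Longrightarrow> list_all2 (<) is (radices rs (n x) (d x)) \<Longrightarrow> holds_tables \<Gamma> s x \<Longrightarrow>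
      digits_at rs x z is \<Longrightarrow>
      earlier_cells a rs (f x) s x is \<Longrightarrow>
      xval e [n x, d x, z] s = f x is"
    and b: "poly_bounded b"
      "\<And>x is. x \<in> X \<Longrightarrow> list_all2 (<) is (radices rs (n x) (d x)) \<Longrightarrow> rat_bits (b x) (f x is)"
  shows "tabulated (insert (a, rs, f) \<Gamma>)"
proof -
  obtain c M where M: "computes c M" "\<And>x. x \<in> X \<Longrightarrow> holds_tables \<Gamma> (M x) x"
    using \<Gamma>(1) unfolding tabulated_def by blast
  let ?r = "\<lambda>x. radices rs (n x) (d x)"
  define T where "T x i = f x (unflat (?r x) i)" for x i
  have sz: "nval (nprod rs) [n x, d x] = prod_list (?r x)" for x
    using wf(5) by (rule nval_nprod)
  have keep: "holds_tables \<Gamma> ((M x)(a := g)) x" if "x \<in> X" for x g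
    using M(2)[OF that] \<Gamma>(2) unfolding holds_tables_def holds_table_def by (force simp: image_iff)
  have Tf: "T x (flat (?r x) is) = f x is" if "list_all2 (<) is (?r x)" for x "is"
    using that by (simp add: T_def unflat_flat)
  have "computes (Seq c (compile_table a (nprod rs) e))
    (\<lambda>x. (M x)(a := \<lambda>k. if k < nval (nprod rs) [n x, d x] then T x k else M x a k))"
  proof (rule computes_table[OF M(1) wf(1-4) _ b(1)])
    fix x i assume x: "x \<in> X" and "i < nval (nprod rs) [n x, d x]"
    then have i: "list_all2 (<) (unflat (?r x) i) (?r x)" "flat (?r x) (unflat (?r x) i) = i"
      using flat_unflat[of i "?r x"] by (simp_all add: sz)
    let ?s = "(M x)(a := \<lambda>k. if k < i then T x k else M x a k)"
    have "?s a (flat (?r x) js) = f x js"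
      if "list_all2 (<) js (?r x)" "hd js < hd (unflat (?r x) i)" for js
      using flat_mono_hd[OF that(1) i(1) that(2)] Tf[OF that(1)] by (simp add: i(2))
    then have *: "earlier_cells a rs (f x) ?s x (unflat (?r x) i)"
      unfolding earlier_cells_def Let_def cell_def xval.simps nval_nflat[OF wf(5)] by blast
    have \<delta>: "digits_at rs x (flat (?r x) (unflat (?r x) i)) (unflat (?r x) i)"
      unfolding digits_at_def using nval_digit[OF wf(5) i(1)] by blast
    have "xval e [n x, d x, flat (?r x) (unflat (?r x) i)] ?s = f x (unflat (?r x) i)"
      by (rule f[OF x i(1) keep[OF x] \<delta> *])
    then show "xval e [n x, d x, i] ?s = T x i" by (simp only: i(2) T_def)
    show "rat_bits (b x) (T x i)" unfolding T_def by (rule b(2)[OF x i(1)])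
  qed
  moreover have "holds_tables (insert (a, rs, f) \<Gamma>)
    ((M x)(a := \<lambda>k. if k < nval (nprod rs) [n x, d x] then T x k else M x a k)) x" if "x \<in> X" for x
    using keep[OF that, of "\<lambda>k. if k < nval (nprod rs) [n x, d x] then T x k else M x a k"]
    unfolding holds_tables_def sz by (auto simp: holds_table_def Tf flat_less)
  ultimately have "\<exists>c M. computes c M \<and> (\<forall>x\<in>X. holds_tables (insert (a, rs, f) \<Gamma>) (M x) x)" by blast
  then show ?thesis using \<Gamma>(1) wf(1,2) unfolding tabulated_def by (simp add: wf)
qed

lemma tabulated_explicit:
  assumes \<Gamma>: "tabulated \<Gamma>" "a \<notin> fst ` \<Gamma>"
    and wf: "a \<noteq> ''var''" "a \<noteq> ''stack''" "''var'' \<notin> arrays e" "''stack'' \<notin> arrays e"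
      "a \<notin> arrays e" "list_all format_only rs"
    and f: "\<And>x is s z. x \<in> X \<Longrightarrow> list_all2 (<) is (radices rs (n x) (d x)) \<Longrightarrow> holds_tables \<Gamma> s x \<Longrightarrow>
      digits_at rs x z is \<Longrightarrow>
      xval e [n x, d x, z] s = f x is"
  shows "tabulated (insert (a, rs, f) \<Gamma>)"
proof -
  obtain c M where M: "computes c M" "\<And>x. x \<in> X \<Longrightarrow> holds_tables \<Gamma> (M x) x"
    using \<Gamma>(1) unfolding tabulated_def by blast
  let ?r = "\<lambda>x. radices rs (n x) (d x)"
  let ?M = "\<lambda>x. (M x)(a := \<lambda>k. if k < nval (nprod rs) [n x, d x] then xval e [n x, d x, k] (M x) else M x a k)"
  have sz: "nval (nprod rs) [n x, d x] = prod_list (?r x)" for x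
    using wf(6) by (rule nval_nprod)
  have keep: "holds_tables \<Gamma> ((M x)(a := g)) x" if "x \<in> X" for x g
    using M(2)[OF that] \<Gamma>(2) unfolding holds_tables_def holds_table_def by (force simp: image_iff)
  have "computes (Seq c (compile_table a (nprod rs) e)) ?M"
    by (rule computes_table_explicit[OF M(1) wf(1-5)])
  moreover have "holds_tables (insert (a, rs, f) \<Gamma>) (?M x) x" if x: "x \<in> X" for x
  proof -
    have "digits_at rs x (flat (?r x) is) is" if "list_all2 (<) is (?r x)" for "is"
      unfolding digits_at_def using nval_digit[OF wf(6) that] by blast
    then show ?thesis
    using keep[OF x, of "?M x a"] f[OF x _ M(2)[OF x]]
      unfolding holds_tables_def sz by (auto simp: holds_table_def flat_less)
  qed
  ultimately have "\<exists>c M. computes c M \<and> (\<forall>x\<in>X. holds_tables (insert (a, rs, f) \<Gamma>) (M x) x)" by blast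
  then show ?thesis using \<Gamma>(1) wf(1,2) unfolding tabulated_def by (simp add: wf)
qed

lemma tabulated_name: "tabulated \<Gamma> \<Longrightarrow> (a, rs, f) \<in> \<Gamma> \<Longrightarrow> a \<noteq> ''var'' \<and> a \<noteq> ''stack''"
  unfolding tabulated_def by auto

lemma xval_cell:
  assumes "tabulated \<Gamma>" "holds_tables \<Gamma> s x" "(a, rs, f) \<in> \<Gamma>"
    "list_all2 (<) (map (\<lambda>e. nval e (n x # d x # \<rho>)) es) (radices rs (n x) (d x))"
  shows "xval (cell a rs es) (n x # d x # \<rho>) s = f x (map (\<lambda>e. nval e (n x # d x # \<rho>)) es)"
proof -
  have "list_all format_only rs" using assms(1,3) unfolding tabulated_def by auto
  moreover have "holds_table s (n x) (d x) a rs (f x)"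
    using assms(2,3) unfolding holds_tables_def by auto
  ultimately show ?thesis using assms(4) by (simp add: cell_def nval_nflat holds_table_def)
qed

end

section \<open>Tabulating matrix powers and characteristic coefficients\<close>

lemma coeff_mult_lessThan: "coeff (p * q) k = (\<Sum>i<Suc k. coeff p i * coeff q (k - i))"
  by (simp add: coeff_mult lessThan_Suc_atMost)

text \<open>The digits are the number of a matrix in a family of \<open>b\<close>, row, column and
  power of \<open>t\<close>. Families allow one construction to serve for \<open>P(t)\<close> and
  for all Hermite matrices at once.\<close>

definition matrix_radices :: "nexp \<Rightarrow> nexp \<Rightarrow> nexp \<Rightarrow> nexp list" where
  "matrix_radices b N w = [b, N, N, w]"

text \<open>The exponent comes first because the recursion runs in it; likewise for the order in
  \<open>newton_radices\<close>.\<close>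

definition power_radices :: "nexp \<Rightarrow> nexp \<Rightarrow> nexp \<Rightarrow> nexp list" where
  "power_radices b N w = [NAdd N (NC 1), b, N, N, w]"

definition newton_radices :: "nexp \<Rightarrow> nexp \<Rightarrow> nexp \<Rightarrow> nexp list" where
  "newton_radices b N w = [NAdd N (NC 1), b, w]"

lemma radices_macro [simp]:
  "radices (matrix_radices b N w) n d = [nval b [n, d], nval N [n, d], nval N [n, d], nval w [n, d]]"
  "radices (power_radices b N w) n d =
    [nval N [n, d] + 1, nval b [n, d], nval N [n, d], nval N [n, d], nval w [n, d]]"
  "radices (newton_radices b N w) n d = [nval N [n, d] + 1, nval b [n, d], nval w [n, d]]"
  "length (matrix_radices b N w) = 4" "length (power_radices b N w) = 5" "length (newton_radices b N w) = 3"
  by (simp_all add: matrix_radices_def power_radices_def newton_radices_def)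

lemma format_only_macro [simp]:
  assumes "format_only b" "format_only N" "format_only w"
  shows "list_all format_only (matrix_radices b N w)"
    "list_all format_only (power_radices b N w)"
    "list_all format_only (newton_radices b N w)"
  using assms by (simp_all add: matrix_radices_def power_radices_def newton_radices_def)

context input_family
begin

text \<open>The digits 0 to 4 are exponent, matrix, row, column and power of \<open>t\<close>.
  Variable 3 is the inner index of the matrix product, variable 4 the power of \<open>t\<close>
  taken from the first factor.\<close>

definition power_exp :: "string \<Rightarrow> string \<Rightarrow> nexp \<Rightarrow> nexp \<Rightarrow> nexp \<Rightarrow> xexp" where
  "power_exp a pw b N w = (let \<delta> = digit (power_radices b N w) in
     XIf EQ (XN (\<delta> 0)) (XN (NC 0))
       (XIf EQ (XN (\<delta> 2)) (XN (\<delta> 3)) (XIf EQ (XN (\<delta> 4)) (XN (NC 0)) (XN (NC 1)) (XN (NC 0))) (XN (NC 0)))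
       (XSum N (XSum (NAdd (\<delta> 4) (NC 1))
          (XOp Mul (cell a (matrix_radices b N w) [\<delta> 1, \<delta> 2, NV 3, NV 4])
             (cell pw (power_radices b N w)
                [NSub (\<delta> 0) (NC 1), \<delta> 1, NV 3, \<delta> 3, NSub (\<delta> 4) (NV 4)])))))"

text \<open>Only coefficients below \<open>w\<close> are stored, whatever the degrees are: the
  coefficient of index \<open>k\<close> of a product involves no coefficient of higher
  index.\<close>

lemma tabulated_mat_power:
  fixes A :: "'x \<Rightarrow> nat \<Rightarrow> nat \<Rightarrow> nat \<Rightarrow> rat poly"
  assumes \<Gamma>: "tabulated \<Gamma>" "(a, matrix_radices b N w, \<lambda>x is. coeff (A x (is ! 0) (is ! 1) (is ! 2)) (is ! 3)) \<in> \<Gamma>"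
    and wf: "format_only b" "format_only N" "format_only w"
    and pw: "pw \<notin> fst ` \<Gamma>" "pw \<noteq> ''var''" "pw \<noteq> ''stack''"
  shows "tabulated (insert (pw, power_radices b N w,
    \<lambda>x is. coeff (mat_power (nval N [n x, d x]) (A x (is ! 1)) (is ! 0) (is ! 2) (is ! 3)) (is ! 4)) \<Gamma>)"
proof -
  obtain B where B: "poly_bounded B" and bits': "\<forall>x\<in>X. \<forall>is. list_all2 (<) is (radices (matrix_radices b N w) (n x) (d x)) \<longrightarrow>
      rat_bits (B x) (coeff (A x (is ! 0) (is ! 1) (is ! 2)) (is ! 3))"
    using tabulated_bits[OF \<Gamma>] by blast
  have bits: "rat_bits (B x) (coeff (A x \<beta> i l) k)"
    if "x \<in> X" "\<beta> < nval b [n x, d x]" "i < nval N [n x, d x]" "l < nval N [n x, d x]" "k < nval w [n x, d x]"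
    for x \<beta> i l k
    using bits'[THEN bspec, OF that(1), THEN spec, of "[\<beta>, i, l, k]"] that by simp
  have a: "a \<noteq> ''var''" "a \<noteq> ''stack''" using tabulated_name[OF \<Gamma>] by simp_all
  let ?B = "\<lambda>x. 2 * ((nval N [n x, d x] + nval w [n x, d x] + (2 * B x + 1) *
    (nval N [n x, d x] * nval N [n x, d x] * nval w [n x, d x])) * nval N [n x, d x])"
  define f where "f = (\<lambda>x is. coeff (mat_power (nval N [n x, d x]) (A x (is ! 1)) (is ! 0) (is ! 2) (is ! 3)) (is ! 4))"
  show ?thesis unfolding f_def[symmetric]
  proof (rule tabulated_recursive[OF \<Gamma>(1) pw, where e = "power_exp a pw b N w" and b = ?B])
    show "''var'' \<notin> arrays (power_exp a pw b N w)" "''stack'' \<notin> arrays (power_exp a pw b N w)"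
      using a pw by (auto simp: power_exp_def Let_def)
    show "list_all format_only (power_radices b N w)" using wf by simp
    show "poly_bounded ?B" by (intro poly_bounded_intros poly_bounded_nval B)
  next
    fix x "is" assume x: "x \<in> X" and "list_all2 (<) is (radices (power_radices b N w) (n x) (d x))"
    then obtain j \<beta> i l k where ji: "is = [j, \<beta>, i, l, k]" "j \<le> nval N [n x, d x]" "\<beta> < nval b [n x, d x]"
      "i < nval N [n x, d x]" "l < nval N [n x, d x]" "k < nval w [n x, d x]"
      by (auto simp: list_all2_Cons2)
    have "rat_bits (?B x) (coeff (mat_power (nval N [n x, d x]) (A x \<beta>) j i l) k)"
      by (rule mat_power_bits) (use bits[OF x] ji in auto)
    then show "rat_bits (?B x) (f x is)" by (simp add: ji f_def)
  next
    fix x "is" s z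
    define rs where "rs = power_radices b N w"
    define N' w' b' where "N' = nval N [n x, d x]" and "w' = nval w [n x, d x]" and "b' = nval b [n x, d x]"
    have [simp]: "nval N (n x # d x # \<rho>) = N'" "nval w (n x # d x # \<rho>) = w'" "nval b (n x # d x # \<rho>) = b'" for \<rho>
      unfolding N'_def w'_def b'_def by (rule nval_format_only[OF wf(2)] nval_format_only[OF wf(3)] nval_format_only[OF wf(1)])+
    have rs: "radices rs (n x) (d x) = [Suc N', b', N', N', w']" "length rs = 5"
      by (simp_all add: rs_def)
    have rs': "radices (matrix_radices b N w) (n x) (d x) = [b', N', N', w']"
      by simp
    assume x: "x \<in> X" and i: "list_all2 (<) is (radices (power_radices b N w) (n x) (d x))"
      and h: "holds_tables \<Gamma> s x" and \<delta>: "digits_at (power_radices b N w) x z is"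
      and rec: "earlier_cells pw (power_radices b N w) (f x) s x is"
    note \<delta>[folded rs_def, unfolded digits_at_def, rule_format, simp]
    obtain j \<beta> i l k where ji: "is = [j, \<beta>, i, l, k]" "j \<le> N'" "\<beta> < b'" "i < N'" "l < N'" "k < w'"
      using i unfolding rs_def[symmetric] rs by (auto simp: list_all2_Cons2)
    show "xval (power_exp a pw b N w) [n x, d x, z] s = f x is"
    proof (cases j)
      case 0
      then show ?thesis by (simp add: power_exp_def Let_def rs_def[symmetric] rs ji f_def)
    next
      case (Suc j')
      show ?thesis using ji(2-) Suc
        by (simp add: power_exp_def Let_def rs_def[symmetric] rs rs' ji(1) f_def xval_cell[OF \<Gamma>(1) h \<Gamma>(2)]
            earlier_cellsD[OF rec[folded rs_def]] coeff_sum coeff_mult_lessThan del: sum.lessThan_Suc cong: sum.cong_simp)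
    qed
  qed
qed

text \<open>The digits 0 to 2 are order, matrix and power of \<open>t\<close>. Variable 3 is the
  order of the earlier coefficient, variable 4 splits the power of \<open>t\<close>, and the
  innermost sum over variable 5 is the trace.\<close>

definition newton_exp :: "string \<Rightarrow> string \<Rightarrow> nexp \<Rightarrow> nexp \<Rightarrow> nexp \<Rightarrow> xexp" where
  "newton_exp pw c b N w = (let rs = newton_radices b N w; \<delta> = digit rs in
     XIf EQ (XN (\<delta> 0)) (XN (NC 0)) (XIf EQ (XN (\<delta> 2)) (XN (NC 0)) (XN (NC 1)) (XN (NC 0)))
       (XOp Div (XOp Sub (XN (NC 0)) (XSum (\<delta> 0) (XSum (NAdd (\<delta> 2) (NC 1))
          (XOp Mul (cell c rs [NV 3, \<delta> 1, NV 4])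
             (XSum N (cell pw (power_radices b N w)
                [NSub (\<delta> 0) (NV 3), \<delta> 1, NV 5, NV 5, NSub (\<delta> 2) (NV 4)])))))) (XN (\<delta> 0))))"

lemma tabulated_newton_coeffs:
  fixes A :: "'x \<Rightarrow> nat \<Rightarrow> nat \<Rightarrow> nat \<Rightarrow> rat poly"
  assumes \<Gamma>: "tabulated \<Gamma>" "(pw, power_radices b N w,
      \<lambda>x is. coeff (mat_power (nval N [n x, d x]) (A x (is ! 1)) (is ! 0) (is ! 2) (is ! 3)) (is ! 4)) \<in> \<Gamma>"
    and wf: "format_only b" "format_only N" "format_only w"
    and c: "c \<notin> fst ` \<Gamma>" "c \<noteq> ''var''" "c \<noteq> ''stack''"
  shows "tabulated (insert (c, newton_radices b N w,
    \<lambda>x is. coeff (newton_coeffs (trace_power (nval N [n x, d x]) (A x (is ! 1))) (is ! 0)) (is ! 2)) \<Gamma>)"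
proof -
  obtain B where B: "poly_bounded B" and bits': "\<forall>x\<in>X. \<forall>is. list_all2 (<) is (radices (power_radices b N w) (n x) (d x)) \<longrightarrow>
      rat_bits (B x) (coeff (mat_power (nval N [n x, d x]) (A x (is ! 1)) (is ! 0) (is ! 2) (is ! 3)) (is ! 4))"
    using tabulated_bits[OF \<Gamma>] by blast
  have bits: "rat_bits (B x) (coeff (mat_power (nval N [n x, d x]) (A x \<beta>) j i l) k)"
    if "x \<in> X" "j \<le> nval N [n x, d x]" "\<beta> < nval b [n x, d x]" "i < nval N [n x, d x]" "l < nval N [n x, d x]" "k < nval w [n x, d x]"
    for x j \<beta> i l k
    using bits'[THEN bspec, OF that(1), THEN spec, of "[j, \<beta>, i, l, k]"] that by simp
  have a: "pw \<noteq> ''var''" "pw \<noteq> ''stack''" using tabulated_name[OF \<Gamma>] by simp_all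
  define f where "f = (\<lambda>x is. coeff (newton_coeffs (trace_power (nval N [n x, d x]) (A x (is ! 1))) (is ! 0)) (is ! 2))"
  \<comment> \<open>Size of a trace: \<open>N\<close> diagonal entries of at most \<open>B x\<close>
    bits, and one bit more for each addition.\<close>
  define C where "C x = nval N [n x, d x] * (B x + 1)" for x
  let ?B = "\<lambda>x. 2 * (nval N [n x, d x] * nval N [n x, d x] + (nval N [n x, d x] + nval w [n x, d x] +
    (2 * C x + 1) * (nval N [n x, d x] * nval w [n x, d x])) * nval N [n x, d x])"
  show ?thesis unfolding f_def[symmetric]
  proof (rule tabulated_recursive[OF \<Gamma>(1) c, where e = "newton_exp pw c b N w" and b = ?B])
    show "''var'' \<notin> arrays (newton_exp pw c b N w)" "''stack'' \<notin> arrays (newton_exp pw c b N w)"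
      using a c by (auto simp: newton_exp_def Let_def)
    show "list_all format_only (newton_radices b N w)" using wf by simp
    show "poly_bounded ?B" unfolding C_def by (intro poly_bounded_intros poly_bounded_nval B)
  next
    fix x "is" assume x: "x \<in> X" and "list_all2 (<) is (radices (newton_radices b N w) (n x) (d x))"
    then obtain j \<beta> k where ji: "is = [j, \<beta>, k]" "j \<le> nval N [n x, d x]" "\<beta> < nval b [n x, d x]"
      "k < nval w [n x, d x]"
      by (auto simp: list_all2_Cons2)
    have "rat_bits (?B x) (coeff (newton_coeffs (trace_power (nval N [n x, d x]) (A x \<beta>)) j) k)"
    proof (rule newton_coeffs_bits[OF _ ji(2,4)])
      fix m l assume ml: "m \<le> nval N [n x, d x]" "l < nval w [n x, d x]"
      have "rat_bits (\<Sum>i<nval N [n x, d x]. B x + 1) (\<Sum>i<nval N [n x, d x]. coeff (mat_power (nval N [n x, d x]) (A x \<beta>) m i i) l)"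
        by (intro rat_bits_sum bits x ml ji)
      then show "rat_bits (C x) (coeff (trace_power (nval N [n x, d x]) (A x \<beta>) m) l)"
        by (simp add: trace_power_def coeff_sum C_def)
    qed
    then show "rat_bits (?B x) (f x is)" by (simp add: ji f_def)
  next
    fix x "is" s z
    define rs where "rs = newton_radices b N w"
    define N' w' b' where "N' = nval N [n x, d x]" and "w' = nval w [n x, d x]" and "b' = nval b [n x, d x]"
    have [simp]: "nval N (n x # d x # \<rho>) = N'" "nval w (n x # d x # \<rho>) = w'" "nval b (n x # d x # \<rho>) = b'" for \<rho>
      unfolding N'_def w'_def b'_def by (rule nval_format_only[OF wf(2)] nval_format_only[OF wf(3)] nval_format_only[OF wf(1)])+
    have rs: "radices rs (n x) (d x) = [Suc N', b', w']" "length rs = 3"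
      by (simp_all add: rs_def)
    have rs': "radices (power_radices b N w) (n x) (d x) = [Suc N', b', N', N', w']"
      by simp
    assume x: "x \<in> X" and i: "list_all2 (<) is (radices (newton_radices b N w) (n x) (d x))"
      and h: "holds_tables \<Gamma> s x" and \<delta>: "digits_at (newton_radices b N w) x z is"
      and rec: "earlier_cells c (newton_radices b N w) (f x) s x is"
    note \<delta>[folded rs_def, unfolded digits_at_def, rule_format, simp]
    obtain j \<beta> k where ji: "is = [j, \<beta>, k]" "j \<le> N'" "\<beta> < b'" "k < w'"
      using i unfolding rs_def[symmetric] rs by (auto simp: list_all2_Cons2)
    show "xval (newton_exp pw c b N w) [n x, d x, z] s = f x is"
    proof (cases "j = 0")
      case True
      then show ?thesis by (simp add: newton_exp_def Let_def rs_def[symmetric] rs ji f_def)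
    next
      case False
      let ?p = "trace_power N' (A x \<beta>)"
      have *: "xval (cell pw (power_radices b N w)
          [NSub (digit rs 0) (NV 3), digit rs (Suc 0), NV 5, NV 5, NSub (digit rs 2) (NV 4)])
          [n x, d x, z, i, r, u] s = coeff (mat_power N' (A x \<beta>) (j - i) u u) (k - r)" if "u < N'" for i r u
        using ji(2-) that by (subst xval_cell[OF \<Gamma>(1) h \<Gamma>(2)]) (auto simp: rs rs' ji(1))
      have "xval (newton_exp pw c b N w) [n x, d x, z] s =
        - (\<Sum>i<j. \<Sum>r<Suc k. coeff (newton_coeffs ?p i) r * (\<Sum>u<N'. coeff (mat_power N' (A x \<beta>) (j - i) u u) (k - r))) / of_nat j"
        using ji(2-) False
        by (simp add: newton_exp_def Let_def rs_def[symmetric] rs ji(1) f_def *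
            earlier_cellsD[OF rec[folded rs_def]] del: sum.lessThan_Suc cong: sum.cong_simp)
      also have "\<dots> = coeff (newton_coeffs ?p j) k"
        by (subst (2) newton_coeffs.simps)
          (simp add: False coeff_sum coeff_mult_lessThan trace_power_def[of _ _ "_ - _"] del: sum.lessThan_Suc)
      finally show ?thesis by (simp add: f_def ji(1))
    qed
  qed
qed

end

section \<open>The layout of the input, and closed formulas for the tables\<close>

lemma nth_concat_map:
  "j < m \<Longrightarrow> r < length (f j) \<Longrightarrow>
    concat (map f [0..<m]) ! ((\<Sum>i<j. length (f i)) + r) = f j ! r"
proof (induction m)
  case (Suc m)
  have l: "length (concat (map f [0..<m])) = (\<Sum>i<m. length (f i))"
    by (simp add: length_concat comp_def interv_sum_list_conv_sum_set_nat atLeast0LessThan)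
  show ?case
  proof (cases "j = m")
    case True
    then show ?thesis by (simp add: nth_append l)
  next
    case False
    then have "j < m" using Suc by simp
    have "(\<Sum>i<j. length (f i)) + r < (\<Sum>i<Suc j. length (f i))" using Suc by simp
    also have "\<dots> \<le> (\<Sum>i<m. length (f i))" using \<open>j < m\<close> by (intro sum_mono2) auto
    finally show ?thesis using Suc \<open>j < m\<close> by (simp add: nth_append l)
  qed
qed simp

text \<open>The list is a concatenation of columns, and column \<open>j\<close> consists of
  \<open>j + 1\<close> blocks of length \<open>d + 1\<close>; the columns before \<open>j\<close>
  account for the triangular number.\<close>

lemma nth_poly_mat_coeffs:
  assumes "i \<le> j" "j < dim_row P" "k \<le> d"
  shows "poly_mat_coeffs d P ! ((j * (j + 1) div 2 + i) * (d + 1) + k) = coeff (P $$ (i, j)) k"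
proof -
  define g where "g j i = map (\<lambda>k. coeff (P $$ (i, j)) k) [0..<d + 1]" for j i
  define f where "f j = concat (map (g j) [0..<j + 1])" for j
  have P: "poly_mat_coeffs d P = concat (map f [0..<dim_row P])"
    by (simp add: poly_mat_coeffs_def f_def[abs_def] g_def[abs_def] del: upt_Suc)
  have lg: "length (g j i) = d + 1" for i j by (simp add: g_def)
  have lf: "length (f j) = (j + 1) * (d + 1)" for j
    by (simp add: f_def length_concat comp_def lg sum_list_triv del: upt_Suc)
  have "2 * (\<Sum>i<j. length (f i)) = j * (j + 1) * (d + 1)" for j
    unfolding lf by (induction j) (simp_all add: algebra_simps)
  note two = this
  have "even (j * (j + 1))" by simp
  then obtain q where q: "j * (j + 1) = 2 * q" by (elim evenE)
  have "2 * (\<Sum>i<j. length (f i)) = 2 * (q * (d + 1))" unfolding two q by (simp only: mult.assoc)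
  then have s: "(\<Sum>i<j. length (f i)) = j * (j + 1) div 2 * (d + 1)"
    unfolding q by simp
  have "i * (d + 1) + k < (i + 1) * (d + 1)" using assms by simp
  also have "\<dots> \<le> (j + 1) * (d + 1)" using assms by (intro mult_le_mono1) simp
  finally have r: "i * (d + 1) + k < length (f j)" unfolding lf .
  have "poly_mat_coeffs d P ! ((j * (j + 1) div 2 + i) * (d + 1) + k) =
      concat (map f [0..<dim_row P]) ! ((\<Sum>i<j. length (f i)) + (i * (d + 1) + k))"
    unfolding P s by (simp only: add_mult_distrib add.assoc)
  also have "\<dots> = f j ! (i * (d + 1) + k)"
    by (rule nth_concat_map[of j _ _ f]) (use assms r in auto)
  also have "\<dots> = concat (map (g j) [0..<j + 1]) ! ((\<Sum>l<i. length (g j l)) + k)"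
    by (simp add: f_def lg del: upt_Suc)
  also have "\<dots> = g j i ! k"
    by (rule nth_concat_map[of i _ _ "g j"]) (use assms in \<open>auto simp: lg\<close>)
  also have "\<dots> = coeff (P $$ (i, j)) k" using assms by (simp add: g_def del: upt_Suc)
  finally show ?thesis .
qed

text \<open>A way to find the degree with sums of fixed length: a tail of coefficients vanishes iff
  the sum of its squares does, and the indices with a nonvanishing tail are those below
  \<open>deg1 h\<close>.\<close>

lemma sum_tail_nonzero_eq_deg1:
  fixes h :: "rat poly"
  assumes "\<And>k. M \<le> k \<Longrightarrow> coeff h k = 0"
  shows "(\<Sum>k<M. if (\<Sum>u<M - k. coeff h (k + u) * coeff h (k + u)) = 0 then 0 else 1) = (of_nat (deg1 h) :: rat)"
proof -
  have le: "deg1 h \<le> M"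
    using assms[of "degree h"] by (cases "h = 0") (force simp: deg1_def not_less_eq_eq)+
  have "(\<Sum>u<M - k. coeff h (k + u) * coeff h (k + u)) = 0 \<longleftrightarrow> deg1 h \<le> k" if "k < M" for k
  proof -
    have "(\<Sum>u<M - k. coeff h (k + u) * coeff h (k + u)) = 0 \<longleftrightarrow> (\<forall>u<M - k. coeff h (k + u) = 0)"
      by (subst sum_nonneg_eq_0_iff) auto
    also have "\<dots> \<longleftrightarrow> deg1 h \<le> k"
    proof
      assume *: "\<forall>u<M - k. coeff h (k + u) = 0"
      show "deg1 h \<le> k"
      proof (rule ccontr)
        assume "\<not> deg1 h \<le> k"
        then have "h \<noteq> 0" "k \<le> degree h" "degree h < M" using le by (auto simp: deg1_def split: if_splits)
        moreover from this have "degree h - k < M - k" by linarith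
        ultimately show False using *[rule_format, of "degree h - k"] by simp
      qed
    next
      assume "deg1 h \<le> k"
      then show "\<forall>u<M - k. coeff h (k + u) = 0"
        by (auto simp: deg1_def coeff_eq_0 split: if_splits)
    qed
    finally show ?thesis .
  qed
  then have "(\<Sum>k<M. if (\<Sum>u<M - k. coeff h (k + u) * coeff h (k + u)) = 0 then 0 else 1) =
      (\<Sum>k<M. if k < deg1 h then 1 else (0::rat))"
    by (intro sum.cong) auto
  also have "\<dots> = (\<Sum>k<deg1 h. 1)"
    using le by (intro sum.mono_neutral_cong_right) auto
  finally show ?thesis by simp
qed

text \<open>Addresses cannot depend on data, so \<open>degree h\<close> cannot be used as an index
  directly. It is the only \<open>m\<close> that passes the test in a sum over all
  candidates.\<close>

lemma sum_root_coeff: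
  fixes h :: "rat poly"
  assumes "\<And>k. M \<le> k \<Longrightarrow> coeff h k = 0"
  shows "(\<Sum>m<M. if deg1 h = Suc m then if i \<le> m then coeff h (m - i) / coeff h m else 0 else 0) = root_coeff h i"
proof (cases "h = 0")
  case False
  then have "degree h < M" using assms[of "degree h"] by (force simp: not_less)
  then have "(\<Sum>m<M. if deg1 h = Suc m then if i \<le> m then coeff h (m - i) / coeff h m else 0 else 0) =
    (\<Sum>m\<in>{degree h}. if i \<le> m then coeff h (m - i) / coeff h m else 0)"
    using False by (intro sum.mono_neutral_cong_right) (auto simp: deg1_def)
  then show ?thesis using False by (simp add: root_coeff_def deg1_def)
qed (simp add: root_coeff_def deg1_def)

lemma triangle_less:
  assumes "i \<le> j" "j < n" shows "j * (j + 1) div 2 + i < n * (n + 1) div (2::nat)"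
proof -
  have "j * (j + 1) div 2 + i < (j + 1) * (j + 2) div 2"
    using assms(1) by (auto simp: algebra_simps)
  also have "\<dots> \<le> n * (n + 1) div 2" using assms(2) by (intro div_le_mono mult_le_mono) auto
  finally show ?thesis .
qed

lemma variations_eq_sum:
  "of_nat (variations f M) = (\<Sum>l<M. if last_sign f l * f (Suc l) < 0 then 1 else (0::rat))"
  by (induction M) simp_all

lemma coeff_mult_one_minus_square:
  "coeff (g * [:1, 0, -1:]) k = coeff g k - (if 2 \<le> k then coeff g (k - 2) else 0)" for g :: "rat poly"
proof -
  have "[:1, 0, -1:] = 1 - monom (1::rat) 2"
    by (simp add: poly_eq_iff coeff_pCons split: nat.split)
  then have "g * [:1, 0, -1:] = g - monom 1 2 * g"
    by (simp only: right_diff_distrib mult_1_right mult.commute[of g])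
  then show ?thesis by (simp add: coeff_monom_mult del: mult_pCons_right)
qed

text \<open>For \<open>b\<close> = 0 and 1 the polynomial \<open>(1 - x^2)^(1 + b)\<close> has the
  coefficients \<open>1\<close>, \<open>- (1 + b)\<close> and \<open>b\<close> at the powers 0, 2
  and 4, so one formula covers both cases.\<close>

lemma coeff_sign_poly:
  fixes f :: "rat poly"
  assumes "b < 2"
  shows "coeff (sign_poly f a b) k = (let g = if a = 0 then f else f * f in
    coeff g k - (1 + of_nat b) * (if 2 \<le> k then coeff g (k - 2) else 0) +
    of_nat b * (if 4 \<le> k then coeff g (k - 4) else 0))"
proof -
  define g where "g = (if a = 0 then f else f * f)"
  have "b = 0 \<or> b = 1" using assms by auto
  moreover have "coeff (g * ([:1, 0, -1:] * [:1, 0, -1:])) k = coeff g k -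
      2 * (if 2 \<le> k then coeff g (k - 2) else 0) + (if 4 \<le> k then coeff g (k - 4) else 0)"
    by (simp only: mult.assoc[symmetric] coeff_mult_one_minus_square) (auto simp: diff_diff_left)
  ultimately show ?thesis
    by (elim disjE) (simp_all add: sign_poly_def g_def[symmetric] Let_def coeff_mult_one_minus_square del: mult_pCons_right mult_pCons_left)
qed

lemma last_sign_values: "last_sign f k \<in> {-1, 0, 1 :: rat}"
  by (induction k) (auto simp: sgn_if)

lemma sum_coeff_eq_poly:
  fixes f :: "rat poly"
  assumes "\<And>k. w \<le> k \<Longrightarrow> coeff f k = 0"
  shows "(\<Sum>k<w. coeff f k * x ^ k) = poly f x"
proof -
  have "poly f x = (\<Sum>i\<le>max w (degree f). coeff f i * x ^ i)"
    unfolding poly_altdef by (intro sum.mono_neutral_left) (auto simp: coeff_eq_0)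
  also have "\<dots> = (\<Sum>k<w. coeff f k * x ^ k)"
    by (intro sum.mono_neutral_right) (use assms in \<open>auto simp: not_less\<close>)
  finally show ?thesis by simp
qed

text \<open>\<open>nW\<close> is the number of coefficients of a polynomial of degree
  \<open>n * d\<close>, and \<open>nM\<close> the size of the Hermite matrices. \<open>nK\<close>,
  that is \<open>2 * (n * d) + 6\<close>, exceeds the degree of every sign polynomial, and
  \<open>nL\<close> exceeds every order \<open>k + i + j\<close> of a power sum with
  \<open>k < nK\<close> and \<open>i, j < nM\<close>.\<close>

definition nW :: nexp where "nW = NAdd (NMul (NV 0) (NV 1)) (NC 1)"
definition nM :: nexp where "nM = NMul (NV 0) (NV 1)"
definition nL :: nexp where "nL = NAdd (NMul (NC 4) nW) (NC 4)"
definition nK :: nexp where "nK = NAdd (NMul (NC 2) nW) (NC 4)"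

lemma nval_consts [simp]:
  "nval nW (n # d # \<rho>) = n * d + 1" "nval nM (n # d # \<rho>) = n * d"
  "nval nL (n # d # \<rho>) = 4 * (n * d) + 8" "nval nK (n # d # \<rho>) = 2 * (n * d) + 6"
  "format_only nW" "format_only nM" "format_only nL" "format_only nK"
  by (simp_all add: nW_def nM_def nL_def nK_def)

section \<open>From the input to the power sums of critical points\<close>

locale psd_instances = input_family X n d "\<lambda>x. poly_mat_coeffs (d x) (P x)"
  for X :: "'x set" and n d :: "'x \<Rightarrow> nat" and P :: "'x \<Rightarrow> rat poly mat" +
  assumes symmetric: "x \<in> X \<Longrightarrow> symmetric_poly_mat (n x) (d x) (P x)"
begin

text \<open>A family with the single member number 0, in the shape that the tables for families of
  matrices expect.\<close>

definition entry :: "'x \<Rightarrow> nat \<Rightarrow> nat \<Rightarrow> nat \<Rightarrow> rat poly" where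
  "entry x \<beta> i l = P x $$ (i, l)"

abbreviation F :: "'x \<Rightarrow> nat \<Rightarrow> rat poly" where
  "F x j \<equiv> matrix_coeff (n x) (P x) j"

abbreviation DF :: "'x \<Rightarrow> nat \<Rightarrow> rat poly" where
  "DF x j \<equiv> pderiv (F x j)"

lemma coeff_F_eq_0: "x \<in> X \<Longrightarrow> j < n x \<Longrightarrow> n x * d x < k \<Longrightarrow> coeff (F x j) k = 0"
  using degree_matrix_coeff[OF symmetric, of x j] by (auto intro: coeff_eq_0)

lemma coeff_DF_eq_0: "x \<in> X \<Longrightarrow> j < n x \<Longrightarrow> n x * d x \<le> k \<Longrightarrow> coeff (DF x j) k = 0"
  by (simp add: coeff_pderiv coeff_F_eq_0)

definition data_radices :: "nexp list" where
  "data_radices = [NDiv (NMul (NV 0) (NAdd (NV 0) (NC 1))) (NC 2), NAdd (NV 1) (NC 1)]"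

definition data_table :: "'x table" where
  "data_table = (''data'', data_radices, \<lambda>x is. poly_mat_coeffs (d x) (P x) ! (is ! 0 * (d x + 1) + is ! 1))"

definition entry_table :: "'x table" where
  "entry_table = (''A'', matrix_radices (NC (Suc 0)) (NV 0) nW, \<lambda>x is. coeff (entry x (is ! 0) (is ! 1) (is ! 2)) (is ! 3))"

definition char_table :: "'x table" where
  "char_table = (''C'', newton_radices (NC (Suc 0)) (NV 0) nW,
     \<lambda>x is. coeff (newton_coeffs (trace_power (n x) (entry x (is ! 1))) (is ! 0)) (is ! 2))"

definition poly_radices :: "nexp list" where "poly_radices = [NV 0, nW]"

definition poly_table :: "'x table" where
  "poly_table = (''F'', poly_radices, \<lambda>x is. coeff (F x (is ! 0)) (is ! 1))"

definition deriv_radices :: "nexp list" where "deriv_radices = [NV 0, nM]"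

definition deriv_table :: "'x table" where
  "deriv_table = (''DF'', deriv_radices, \<lambda>x is. coeff (DF x (is ! 0)) (is ! 1))"

definition degree_radices :: "nexp list" where "degree_radices = [NV 0]"

definition degree_table :: "'x table" where
  "degree_table = (''deg'', degree_radices, \<lambda>x is. of_nat (deg1 (DF x (is ! 0))))"

definition root_radices :: "nexp list" where "root_radices = [NV 0, nL]"

definition root_table :: "'x table" where
  "root_table = (''root'', root_radices, \<lambda>x is. root_coeff (DF x (is ! 0)) (is ! 1))"

text \<open>Here the order precedes the number of the polynomial, because the recursion runs in the
  order.\<close>

definition power_sum_radices :: "nexp list" where "power_sum_radices = [nL, NV 0]"

definition power_sum_table :: "'x table" where
  "power_sum_table = (''sum'', power_sum_radices, \<lambda>x is. root_power_sum (DF x (is ! 1)) (is ! 0))"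

lemma radices_values [simp]:
  "radices data_radices N D = [N * (N + 1) div 2, D + 1]"
  "radices poly_radices N D = [N, N * D + 1]"
  "radices deriv_radices N D = [N, N * D]"
  "radices degree_radices N D = [N]"
  "radices root_radices N D = [N, 4 * (N * D) + 8]"
  "radices power_sum_radices N D = [4 * (N * D) + 8, N]"
  by (simp_all add: data_radices_def poly_radices_def deriv_radices_def degree_radices_def
      root_radices_def power_sum_radices_def)

lemma length_radices [simp]:
  "length data_radices = 2" "length poly_radices = 2" "length deriv_radices = 2"
  "length degree_radices = 1" "length root_radices = 2" "length power_sum_radices = 2"
  by (simp_all add: data_radices_def poly_radices_def deriv_radices_def degree_radices_def
      root_radices_def power_sum_radices_def)

lemma format_only_radices [simp]:
  "list_all format_only data_radices" "list_all format_only poly_radices"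
  "list_all format_only deriv_radices" "list_all format_only degree_radices"
  "list_all format_only root_radices" "list_all format_only power_sum_radices"
  by (simp_all add: data_radices_def poly_radices_def deriv_radices_def degree_radices_def
      root_radices_def power_sum_radices_def)

lemma tabulated_data: "tabulated {data_table}"
proof -
  have "holds_tables {data_table} (input_store [n x, d x] (poly_mat_coeffs (d x) (P x))) x" if x: "x \<in> X" for x
  proof -
    have dim: "dim_row (P x) = n x" using symmetric[OF x] by (auto simp: symmetric_poly_mat_def)
    have "input_store [n x, d x] (poly_mat_coeffs (d x) (P x)) ''data'' (flat (radices data_radices (n x) (d x)) is) =
        poly_mat_coeffs (d x) (P x) ! (is ! 0 * (d x + 1) + is ! 1)"
      if "list_all2 (<) is (radices data_radices (n x) (d x))" for "is"
    proof -
      have "flat (radices data_radices (n x) (d x)) is < prod_list (radices data_radices (n x) (d x))"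
        by (rule flat_less[OF that])
      also have "\<dots> = length (poly_mat_coeffs (d x) (P x))"
        by (simp add: length_poly_mat_coeffs dim choose_two mult.commute)
      finally have "flat (radices data_radices (n x) (d x)) is < length (poly_mat_coeffs (d x) (P x))" .
      moreover have "flat (radices data_radices (n x) (d x)) is = is ! 0 * (d x + 1) + is ! 1"
        using that by (auto simp: list_all2_Cons2)
      ultimately show ?thesis by (simp add: input_store_def)
    qed
    then show ?thesis by (simp add: holds_tables_def holds_table_def data_table_def)
  qed
  then show ?thesis using computes_load_format unfolding tabulated_def
    by (auto simp: data_table_def)
qed

definition triangle :: "nexp \<Rightarrow> nexp" where
  "triangle e = NDiv (NMul e (NAdd e (NC 1))) (NC 2)"

text \<open>The input stores only the entries with row at most column and \<open>d + 1\<close>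
  coefficients for each; the table has the full matrix, with rows of coefficients filled up by
  zeros.\<close>

definition entry_exp :: xexp where
  "entry_exp = (let \<delta> = digit (matrix_radices (NC (Suc 0)) (NV 0) nW) in
     XIf LE (XN (\<delta> 3)) (XN (NV 1))
       (XIf LE (XN (\<delta> 1)) (XN (\<delta> 2))
          (cell ''data'' data_radices [NAdd (triangle (\<delta> 2)) (\<delta> 1), \<delta> 3])
          (cell ''data'' data_radices [NAdd (triangle (\<delta> 1)) (\<delta> 2), \<delta> 3]))
       (XN (NC 0)))"

lemma tabulated_entry:
  assumes \<Gamma>: "tabulated \<Gamma>" "data_table \<in> \<Gamma>" and a: "''A'' \<notin> fst ` \<Gamma>"
  shows "tabulated (insert entry_table \<Gamma>)"
  unfolding entry_table_def
proof (rule tabulated_explicit[OF \<Gamma>(1) a, where e = entry_exp])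
  fix x "is" s z
  let ?rs = "matrix_radices (NC (Suc 0)) (NV 0) nW"
  assume x: "x \<in> X" and i: "list_all2 (<) is (radices ?rs (n x) (d x))"
    and h: "holds_tables \<Gamma> s x" and \<delta>: "digits_at ?rs x z is"
  note \<delta>[unfolded digits_at_def, rule_format, simp]
  obtain \<beta> j l k where ji: "is = [\<beta>, j, l, k]" "\<beta> < 1" "j < n x" "l < n x" "k < n x * d x + 1"
    using i by (auto simp: list_all2_Cons2)
  note c = xval_cell[OF \<Gamma>(1) h \<Gamma>(2)[unfolded data_table_def]]
  have P: "dim_row (P x) = n x" "P x $$ (l, j) = P x $$ (j, l)" "degree (P x $$ (j, l)) \<le> d x"
    using symmetric[OF x] ji index_transpose_mat(1)[of l "P x" j] by (auto simp: symmetric_poly_mat_def)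
  have "xval entry_exp [n x, d x, z] s = (if k \<le> d x then if j \<le> l
      then poly_mat_coeffs (d x) (P x) ! ((l * (l + 1) div 2 + j) * (d x + 1) + k)
      else poly_mat_coeffs (d x) (P x) ! ((j * (j + 1) div 2 + l) * (d x + 1) + k) else 0)"
    using ji(2-) triangle_less[of j l "n x"] triangle_less[of l j "n x"]
    by (auto simp: entry_exp_def Let_def triangle_def ji(1) c)
  also have "\<dots> = coeff (P x $$ (j, l)) k"
    using ji(2-) P nth_poly_mat_coeffs[of j l "P x" k "d x"] nth_poly_mat_coeffs[of l j "P x" k "d x"]
    by (auto simp: coeff_eq_0)
  finally show "xval entry_exp [n x, d x, z] s = coeff (entry x (is ! 0) (is ! 1) (is ! 2)) (is ! 3)"
    by (simp add: ji(1) entry_def)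
qed (simp_all add: entry_exp_def Let_def)

text \<open>The powers are an intermediate result: later steps only have to avoid the name of their
  array, so the function stored there is left open.\<close>

lemma tabulated_char:
  assumes \<Gamma>: "tabulated \<Gamma>" "entry_table \<in> \<Gamma>" and a: "''PW'' \<notin> fst ` \<Gamma>" "''C'' \<notin> fst ` \<Gamma>"
  obtains f where "tabulated (insert char_table (insert (''PW'', power_radices (NC (Suc 0)) (NV 0) nW, f) \<Gamma>))"
proof -
  note 1 = tabulated_mat_power[OF \<Gamma>(1) \<Gamma>(2)[unfolded entry_table_def] _ _ _ a(1)]
  note 2 = tabulated_newton_coeffs[OF 1 insertI1, of "''C''"]
  show ?thesis by (rule that) (use 2 a in \<open>simp add: char_table_def\<close>)
qed

definition poly_exp :: xexp where
  "poly_exp = (let \<delta> = digit poly_radices;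
       c = cell ''C'' (newton_radices (NC (Suc 0)) (NV 0) nW) [NAdd (\<delta> 0) (NC 1), NC 0, \<delta> 1] in
     XIf EQ (XN (nmod (\<delta> 0) (NC 2))) (XN (NC 0)) (XOp Sub (XN (NC 0)) c) c)"

lemma tabulated_poly:
  assumes \<Gamma>: "tabulated \<Gamma>" "char_table \<in> \<Gamma>" and a: "''F'' \<notin> fst ` \<Gamma>"
  shows "tabulated (insert poly_table \<Gamma>)"
  unfolding poly_table_def
proof (rule tabulated_explicit[OF \<Gamma>(1) a, where e = poly_exp])
  fix x "is" s z
  assume x: "x \<in> X" and i: "list_all2 (<) is (radices poly_radices (n x) (d x))"
    and h: "holds_tables \<Gamma> s x" and \<delta>: "digits_at poly_radices x z is"
  note \<delta>[unfolded digits_at_def, rule_format, simp]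
  obtain j k where ji: "is = [j, k]" "j < n x" "k < n x * d x + 1"
    using i by (auto simp: list_all2_Cons2)
  note c = xval_cell[OF \<Gamma>(1) h \<Gamma>(2)[unfolded char_table_def]]
  show "xval poly_exp [n x, d x, z] s = coeff (F x (is ! 0)) (is ! 1)"
  proof (cases "j mod 2 = 0")
    case True
    then have "even j" by presburger
    then show ?thesis using ji(2-) True
      by (simp add: poly_exp_def Let_def ji(1) c matrix_coeff_def entry_def[abs_def])
  next
    case False
    then have "odd j" by presburger
    then show ?thesis using ji(2-) False
      by (simp add: poly_exp_def Let_def ji(1) c matrix_coeff_def entry_def[abs_def])
  qed
qed (simp_all add: poly_exp_def Let_def)

definition deriv_exp :: xexp where
  "deriv_exp = (let \<delta> = digit deriv_radices in
     XOp Mul (XN (NAdd (\<delta> 1) (NC 1))) (cell ''F'' poly_radices [\<delta> 0, NAdd (\<delta> 1) (NC 1)]))"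

lemma tabulated_deriv:
  assumes \<Gamma>: "tabulated \<Gamma>" "poly_table \<in> \<Gamma>" and a: "''DF'' \<notin> fst ` \<Gamma>"
  shows "tabulated (insert deriv_table \<Gamma>)"
  unfolding deriv_table_def
proof (rule tabulated_explicit[OF \<Gamma>(1) a, where e = deriv_exp])
  fix x "is" s z
  assume x: "x \<in> X" and i: "list_all2 (<) is (radices deriv_radices (n x) (d x))"
    and h: "holds_tables \<Gamma> s x" and \<delta>: "digits_at deriv_radices x z is"
  note \<delta>[unfolded digits_at_def, rule_format, simp]
  obtain j k where ji: "is = [j, k]" "j < n x" "k < n x * d x"
    using i by (auto simp: list_all2_Cons2)
  note c = xval_cell[OF \<Gamma>(1) h \<Gamma>(2)[unfolded poly_table_def]]
  show "xval deriv_exp [n x, d x, z] s = coeff (DF x (is ! 0)) (is ! 1)"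
    using ji(2-)
    by (simp add: deriv_exp_def Let_def ji(1) c coeff_pderiv)
qed (simp_all add: deriv_exp_def Let_def)

definition degree_exp :: xexp where
  "degree_exp = (let \<delta> = digit degree_radices; c = cell ''DF'' deriv_radices [\<delta> 0, NAdd (NV 3) (NV 4)] in
     XSum nM (XIf EQ (XSum (NSub nM (NV 3)) (XOp Mul c c)) (XN (NC 0)) (XN (NC 0)) (XN (NC 1))))"

lemma tabulated_degree:
  assumes \<Gamma>: "tabulated \<Gamma>" "deriv_table \<in> \<Gamma>" and a: "''deg'' \<notin> fst ` \<Gamma>"
  shows "tabulated (insert degree_table \<Gamma>)"
  unfolding degree_table_def
proof (rule tabulated_explicit[OF \<Gamma>(1) a, where e = degree_exp])
  fix x "is" s z
  assume x: "x \<in> X" and i: "list_all2 (<) is (radices degree_radices (n x) (d x))"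
    and h: "holds_tables \<Gamma> s x" and \<delta>: "digits_at degree_radices x z is"
  note \<delta>[unfolded digits_at_def, rule_format, simp]
  obtain j where ji: "is = [j]" "j < n x"
    using i by (auto simp: list_all2_Cons2)
  note c = xval_cell[OF \<Gamma>(1) h \<Gamma>(2)[unfolded deriv_table_def]]
  have "xval degree_exp [n x, d x, z] s = (\<Sum>k<n x * d x. if (\<Sum>u<n x * d x - k.
      coeff (DF x j) (k + u) * coeff (DF x j) (k + u)) = 0 then 0 else 1)"
    using ji(2-)
    by (simp add: degree_exp_def Let_def ji(1) c cong: sum.cong_simp if_cong)
  then show "xval degree_exp [n x, d x, z] s = of_nat (deg1 (DF x (is ! 0)))"
    using sum_tail_nonzero_eq_deg1[of "n x * d x" "DF x j"] coeff_DF_eq_0[OF x ji(2)] by (simp add: ji(1))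
qed (simp_all add: degree_exp_def Let_def)

definition root_exp :: xexp where
  "root_exp = (let \<delta> = digit root_radices in
     XSum nM (XIf EQ (cell ''deg'' degree_radices [\<delta> 0]) (XN (NAdd (NV 3) (NC 1)))
       (XIf LE (XN (\<delta> 1)) (XN (NV 3))
          (XOp Div (cell ''DF'' deriv_radices [\<delta> 0, NSub (NV 3) (\<delta> 1)]) (cell ''DF'' deriv_radices [\<delta> 0, NV 3]))
          (XN (NC 0)))
       (XN (NC 0))))"

lemma tabulated_root:
  assumes \<Gamma>: "tabulated \<Gamma>" "deriv_table \<in> \<Gamma>" "degree_table \<in> \<Gamma>" and a: "''root'' \<notin> fst ` \<Gamma>"
  shows "tabulated (insert root_table \<Gamma>)"
  unfolding root_table_def
proof (rule tabulated_explicit[OF \<Gamma>(1) a, where e = root_exp])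
  fix x "is" s z
  assume x: "x \<in> X" and i: "list_all2 (<) is (radices root_radices (n x) (d x))"
    and h: "holds_tables \<Gamma> s x" and \<delta>: "digits_at root_radices x z is"
  note \<delta>[unfolded digits_at_def, rule_format, simp]
  obtain j k where ji: "is = [j, k]" "j < n x"
    using i by (auto simp: list_all2_Cons2)
  note c = xval_cell[OF \<Gamma>(1) h \<Gamma>(2)[unfolded deriv_table_def]] xval_cell[OF \<Gamma>(1) h \<Gamma>(3)[unfolded degree_table_def]]
  have eq: "1 + rat_of_nat u = rat_of_nat v \<longleftrightarrow> v = Suc u" "rat_of_nat v = 1 + rat_of_nat u \<longleftrightarrow> v = Suc u" for u v
    by (metis of_nat_Suc of_nat_eq_iff)+
  have "xval root_exp [n x, d x, z] s = (\<Sum>m<n x * d x. if deg1 (DF x j) = Suc m then if k \<le> m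
      then coeff (DF x j) (m - k) / coeff (DF x j) m else 0 else 0)"
    using ji(2-)
    by (simp add: root_exp_def Let_def ji(1) c eq cong: sum.cong_simp if_cong)
  then show "xval root_exp [n x, d x, z] s = root_coeff (DF x (is ! 0)) (is ! 1)"
    using sum_root_coeff[of "n x * d x" "DF x j" k] coeff_DF_eq_0[OF x ji(2)] by (simp add: ji(1))
qed (simp_all add: root_exp_def Let_def)

text \<open>The sum over \<open>i\<close> from 1 to \<open>k - 1\<close> is run from 0, hence the
  shifts by one. A zero derivative, for which the table of degrees contains 0, has power sum 0 at
  order 0.\<close>

definition power_sum_exp :: xexp where
  "power_sum_exp = (let \<delta> = digit power_sum_radices; m = cell ''deg'' degree_radices [\<delta> 1] in
     XIf EQ (XN (\<delta> 0)) (XN (NC 0)) (XIf EQ m (XN (NC 0)) (XN (NC 0)) (XOp Sub m (XN (NC 1))))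
       (XOp Sub (XOp Sub (XN (NC 0)) (XOp Mul (XN (\<delta> 0)) (cell ''root'' root_radices [\<delta> 1, \<delta> 0])))
          (XSum (NSub (\<delta> 0) (NC 1)) (XOp Mul (cell ''root'' root_radices [\<delta> 1, NAdd (NV 3) (NC 1)])
             (cell ''sum'' power_sum_radices [NSub (\<delta> 0) (NAdd (NV 3) (NC 1)), \<delta> 1])))))"

lemma tabulated_power_sum:
  assumes \<Gamma>: "tabulated \<Gamma>" "degree_table \<in> \<Gamma>" "root_table \<in> \<Gamma>" and a: "''sum'' \<notin> fst ` \<Gamma>"
  shows "tabulated (insert power_sum_table \<Gamma>)"
proof -
  obtain b where b: "poly_bounded b" and bits': "\<forall>x\<in>X. \<forall>is. list_all2 (<) is (radices root_radices (n x) (d x)) \<longrightarrow>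
      rat_bits (b x) (root_coeff (DF x (is ! 0)) (is ! 1))"
    using tabulated_bits[OF \<Gamma>(1) \<Gamma>(3)[unfolded root_table_def]] by blast
  have bits: "rat_bits (b x) (root_coeff (DF x j) k)" if "x \<in> X" "j < n x" "k < 4 * (n x * d x) + 8" for x j k
    using bits'[THEN bspec, OF that(1), THEN spec, of "[j, k]"] that by simp
  define f where "f = (\<lambda>x is. root_power_sum (DF x (is ! 1)) (is ! 0))"
  let ?L = "\<lambda>x. 4 * (n x * d x) + 8"
  \<comment> \<open>The additional \<open>n * d\<close> covers order 0, where the power sum is the
    number of roots.\<close>
  let ?B = "\<lambda>x. 2 * ((1 + ?L x + (2 * b x + 1) * ?L x) * ?L x) + n x * d x"
  show ?thesis unfolding power_sum_table_def f_def[symmetric]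
  proof (rule tabulated_recursive[OF \<Gamma>(1) a, where e = power_sum_exp and b = ?B])
    show "poly_bounded ?B" by (intro poly_bounded_intros b)
  next
    fix x "is" assume x: "x \<in> X" and "list_all2 (<) is (radices power_sum_radices (n x) (d x))"
    then obtain k j where ji: "is = [k, j]" "k < ?L x" "j < n x" by (auto simp: list_all2_Cons2)
    have "rat_bits (?B x) (root_power_sum (DF x j) k)"
    proof (cases "k = 0")
      case True
      have "deg1 (DF x j) \<le> n x * d x"
        using coeff_DF_eq_0[OF x ji(3), of "degree (DF x j)"] by (force simp: deg1_def not_less_eq_eq)
      then have "deg1 (DF x j) - 1 \<le> ?B x" by linarith
      from rat_bits_of_nat'[OF this] show ?thesis using True by (simp add: root_power_sum.simps[of _ 0])
    next
      case False
      have "rat_bits (2 * ((1 + ?L x + (2 * b x + 1) * ?L x) * ?L x)) (root_power_sum (DF x j) k)"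
        by (rule root_power_sum_bits) (use False ji bits[OF x ji(3)] in auto)
      then show ?thesis by (rule rat_bits_mono) simp
    qed
    then show "rat_bits (?B x) (f x is)" by (simp add: f_def ji(1))
  next
    fix x "is" s z
    assume x: "x \<in> X" and i: "list_all2 (<) is (radices power_sum_radices (n x) (d x))"
      and h: "holds_tables \<Gamma> s x" and \<delta>: "digits_at power_sum_radices x z is"
      and rec: "earlier_cells ''sum'' power_sum_radices (f x) s x is"
    note \<delta>[unfolded digits_at_def, rule_format, simp]
    obtain k j where ji: "is = [k, j]" "k < ?L x" "j < n x" using i by (auto simp: list_all2_Cons2)
    note c = xval_cell[OF \<Gamma>(1) h \<Gamma>(2)[unfolded degree_table_def]] xval_cell[OF \<Gamma>(1) h \<Gamma>(3)[unfolded root_table_def]]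
      earlier_cellsD[OF rec]
    show "xval power_sum_exp [n x, d x, z] s = f x is"
    proof (cases k)
      case 0
      then show ?thesis using ji(2-)
        by (simp add: power_sum_exp_def Let_def ji(1) c f_def root_power_sum.simps[of _ 0] of_nat_diff)
    next
      case (Suc m)
      have "xval power_sum_exp [n x, d x, z] s = - (of_nat k * root_coeff (DF x j) k) -
          (\<Sum>i<m. root_coeff (DF x j) (Suc i) * root_power_sum (DF x j) (k - Suc i))"
        using ji(2-) Suc
        by (simp add: power_sum_exp_def Let_def ji(1) c f_def cong: sum.cong_simp if_cong)
      also have "\<dots> = root_power_sum (DF x j) k"
        by (subst root_power_sum.simps[of _ k])
          (simp add: Suc sum.shift_bounds_Suc_ivl atLeast0LessThan algebra_simps del: sum.op_ivl_Suc)
      finally show ?thesis by (simp add: f_def ji(1))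
    qed
  qed (simp_all add: power_sum_exp_def Let_def)
qed

end

section \<open>Hermite matrices for the sign conditions and their negative eigenvalues\<close>

context psd_instances
begin

definition square_radices :: "nexp list" where "square_radices = [NV 0, NC 2, NMul (NC 2) nW]"

definition square_table :: "'x table" where
  "square_table = (''FF'', square_radices,
     \<lambda>x is. coeff (if is ! 1 = 0 then F x (is ! 0) else F x (is ! 0) * F x (is ! 0)) (is ! 2))"

text \<open>The second digit \<open>\<beta> = 4 * j + 2 * a + b\<close> encodes the choice of a polynomial and of signs.\<close>

definition sgn_poly :: "'x \<Rightarrow> nat \<Rightarrow> rat poly" where
  "sgn_poly x \<beta> = sign_poly (F x (\<beta> div 4)) (\<beta> div 2 mod 2) (\<beta> mod 2)"

definition sign_radices :: "nexp list" where "sign_radices = [NMul (NC 4) (NV 0), nK]"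

definition sign_table :: "'x table" where
  "sign_table = (''Q'', sign_radices, \<lambda>x is. coeff (sgn_poly x (is ! 0)) (is ! 1))"

text \<open>Constant polynomials, so that the tables for families of polynomial matrices apply with
  coefficient width 1.\<close>

definition hermite_form :: "'x \<Rightarrow> nat \<Rightarrow> nat \<Rightarrow> nat \<Rightarrow> rat poly" where
  "hermite_form x \<beta> u v = [:hermite (DF x (\<beta> div 4)) (2 * (n x * d x) + 6) (sgn_poly x \<beta>) u v:]"

definition hermite_table :: "'x table" where
  "hermite_table = (''H'', matrix_radices (NMul (NC 4) (NV 0)) nM (NC (Suc 0)),
     \<lambda>x is. coeff (hermite_form x (is ! 0) (is ! 1) (is ! 2)) (is ! 3))"

definition hermite_char_table :: "'x table" where
  "hermite_char_table = (''HC'', newton_radices (NMul (NC 4) (NV 0)) nM (NC (Suc 0)),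
     \<lambda>x is. coeff (newton_coeffs (trace_power (n x * d x) (hermite_form x (is ! 1))) (is ! 0)) (is ! 2))"

definition char_seq :: "'x \<Rightarrow> nat \<Rightarrow> nat \<Rightarrow> rat" where
  "char_seq x \<beta> l = (-1) ^ l * coeff (newton_coeffs (trace_power (n x * d x) (hermite_form x \<beta>)) l) 0"

definition last_sign_radices :: "nexp list" where "last_sign_radices = [NAdd nM (NC 1), NMul (NC 4) (NV 0)]"

definition last_sign_table :: "'x table" where
  "last_sign_table = (''S'', last_sign_radices, \<lambda>x is. last_sign (char_seq x (is ! 1)) (is ! 0))"

definition variation_radices :: "nexp list" where "variation_radices = [NMul (NC 4) (NV 0)]"

definition variation_table :: "'x table" where
  "variation_table = (''V'', variation_radices, \<lambda>x is. of_nat (variations (char_seq x (is ! 0)) (n x * d x)))"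

lemma radices_values' [simp]:
  "radices square_radices N D = [N, 2, 2 * (N * D) + 2]"
  "radices sign_radices N D = [4 * N, 2 * (N * D) + 6]"
  "radices last_sign_radices N D = [N * D + 1, 4 * N]"
  "radices variation_radices N D = [4 * N]"
  "length square_radices = 3" "length sign_radices = 2" "length last_sign_radices = 2"
  "length variation_radices = 1"
  "list_all format_only square_radices" "list_all format_only sign_radices"
  "list_all format_only last_sign_radices" "list_all format_only variation_radices"
  by (simp_all add: square_radices_def sign_radices_def last_sign_radices_def variation_radices_def)

text \<open>Indices above \<open>n * d\<close> lie outside the rows of \<open>F\<close>, and reading
  there could hit a neighbouring row; the tests substitute 0, the true value of these
  coefficients.\<close>

definition square_exp :: xexp where
  "square_exp = (let \<delta> = digit square_radices; c = \<lambda>k. cell ''F'' poly_radices [\<delta> 0, k] in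
     XIf EQ (XN (\<delta> 1)) (XN (NC 0))
       (XIf LT (XN (\<delta> 2)) (XN nW) (c (\<delta> 2)) (XN (NC 0)))
       (XSum (NAdd (\<delta> 2) (NC 1)) (XIf LT (XN (NV 3)) (XN nW)
          (XIf LT (XN (NSub (\<delta> 2) (NV 3))) (XN nW) (XOp Mul (c (NV 3)) (c (NSub (\<delta> 2) (NV 3)))) (XN (NC 0)))
          (XN (NC 0)))))"

lemma tabulated_square:
  assumes \<Gamma>: "tabulated \<Gamma>" "poly_table \<in> \<Gamma>" and a: "''FF'' \<notin> fst ` \<Gamma>"
  shows "tabulated (insert square_table \<Gamma>)"
  unfolding square_table_def
proof (rule tabulated_explicit[OF \<Gamma>(1) a, where e = square_exp])
  fix x "is" s z
  assume x: "x \<in> X" and i: "list_all2 (<) is (radices square_radices (n x) (d x))"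
    and h: "holds_tables \<Gamma> s x" and \<delta>: "digits_at square_radices x z is"
  note \<delta>[unfolded digits_at_def, rule_format, simp]
  obtain j a k where ji: "is = [j, a, k]" "j < n x" using i by (auto simp: list_all2_Cons2)
  note c = xval_cell[OF \<Gamma>(1) h \<Gamma>(2)[unfolded poly_table_def]]
  let ?c = "\<lambda>k. if k \<le> n x * d x then coeff (F x j) k else 0"
  have "xval square_exp [n x, d x, z] s = (if a = 0 then ?c k else (\<Sum>r<Suc k. if r \<le> n x * d x then
      if k - r \<le> n x * d x then coeff (F x j) r * coeff (F x j) (k - r) else 0 else 0))"
    using ji(2-)
    by (simp add: square_exp_def Let_def ji(1) c less_Suc_eq_le del: sum.lessThan_Suc of_nat_Suc of_nat_add of_nat_mult of_nat_diff cong: sum.cong_simp if_cong)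
  also have "\<dots> = coeff (if a = 0 then F x j else F x j * F x j) k"
    using coeff_F_eq_0[OF x ji(2)] by (auto simp: coeff_mult_lessThan not_le intro!: sum.cong simp del: sum.lessThan_Suc)
  finally show "xval square_exp [n x, d x, z] s =
      coeff (if is ! 1 = 0 then F x (is ! 0) else F x (is ! 0) * F x (is ! 0)) (is ! 2)"
    by (simp add: ji(1))
qed (simp_all add: square_exp_def Let_def)

text \<open>\<open>u m\<close> is the coefficient of \<open>f\<close> or its square at the index
  lowered by \<open>m\<close>, and 0 outside the stored range; the combination is the formula of
  \<open>coeff_sign_poly\<close>.\<close>

definition sign_exp :: xexp where
  "sign_exp = (let \<delta> = digit sign_radices;
       u = \<lambda>m. XIf LE (XN (NC m)) (XN (\<delta> 1))
         (XIf LT (XN (NSub (\<delta> 1) (NC m))) (XN (NMul (NC 2) nW))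
           (cell ''FF'' square_radices [NDiv (\<delta> 0) (NC 4), nmod (NDiv (\<delta> 0) (NC 2)) (NC 2), NSub (\<delta> 1) (NC m)])
           (XN (NC 0)))
         (XN (NC 0)) in
     XOp Add (XOp Sub (u 0) (XOp Mul (XN (NAdd (NC 1) (nmod (\<delta> 0) (NC 2)))) (u 2)))
       (XOp Mul (XN (nmod (\<delta> 0) (NC 2))) (u 4)))"

lemma tabulated_sign:
  assumes \<Gamma>: "tabulated \<Gamma>" "square_table \<in> \<Gamma>" and a: "''Q'' \<notin> fst ` \<Gamma>"
  shows "tabulated (insert sign_table \<Gamma>)"
  unfolding sign_table_def
proof (rule tabulated_explicit[OF \<Gamma>(1) a, where e = sign_exp])
  fix x "is" s z
  assume x: "x \<in> X" and i: "list_all2 (<) is (radices sign_radices (n x) (d x))"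
    and h: "holds_tables \<Gamma> s x" and \<delta>: "digits_at sign_radices x z is"
  note \<delta>[unfolded digits_at_def, rule_format, simp]
  obtain \<beta> k where ji: "is = [\<beta>, k]" "\<beta> < 4 * n x" using i by (auto simp: list_all2_Cons2)
  note c = xval_cell[OF \<Gamma>(1) h \<Gamma>(2)[unfolded square_table_def]]
  define g where "g = (if \<beta> div 2 mod 2 = 0 then F x (\<beta> div 4) else F x (\<beta> div 4) * F x (\<beta> div 4))"
  have \<beta>: "\<beta> div 4 < n x" "\<beta> div 2 mod 2 < 2" using ji(2) by auto
  have "degree (F x (\<beta> div 4)) \<le> n x * d x" by (rule degree_matrix_coeff[OF symmetric[OF x] \<beta>(1)])
  then have "degree g \<le> 2 * (n x * d x)"
    using degree_mult_le[of "F x (\<beta> div 4)" "F x (\<beta> div 4)"] by (auto simp: g_def)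
  then have g0: "coeff g m = 0" if "\<not> m < 2 * (n x * d x) + 2" for m using that by (intro coeff_eq_0) simp
  have "xval sign_exp [n x, d x, z] s =
    coeff g k - of_nat (1 + \<beta> mod 2) * (if 2 \<le> k then coeff g (k - 2) else 0) +
    of_nat (\<beta> mod 2) * (if 4 \<le> k then coeff g (k - 4) else 0)"
    using \<beta> g0[of k] g0[of "k - 2"] g0[of "k - 4"]
    by (simp add: sign_exp_def Let_def ji(1) c g_def[symmetric]
        del: of_nat_mult of_nat_diff of_nat_add of_nat_Suc of_nat_numeral cong: if_cong)
      arith
  also have "\<dots> = coeff (sgn_poly x \<beta>) k"
    by (simp add: sgn_poly_def coeff_sign_poly Let_def g_def)
  finally show "xval sign_exp [n x, d x, z] s = coeff (sgn_poly x (is ! 0)) (is ! 1)"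
    by (simp add: ji(1))
qed (simp_all add: sign_exp_def Let_def)

definition hermite_exp :: xexp where
  "hermite_exp = (let \<delta> = digit (matrix_radices (NMul (NC 4) (NV 0)) nM (NC (Suc 0)));
       m = cell ''deg'' degree_radices [NDiv (\<delta> 0) (NC 4)] in
     XIf LE (XN (NAdd (\<delta> 1) (NC 2))) m (XIf LE (XN (NAdd (\<delta> 2) (NC 2))) m
       (XSum nK (XOp Mul (cell ''Q'' sign_radices [\<delta> 0, NV 3])
          (cell ''sum'' power_sum_radices [NAdd (NAdd (NV 3) (\<delta> 1)) (\<delta> 2), NDiv (\<delta> 0) (NC 4)])))
       (XN (NC 0))) (XN (NC 0)))"

lemma tabulated_hermite:
  assumes \<Gamma>: "tabulated \<Gamma>" "degree_table \<in> \<Gamma>" "sign_table \<in> \<Gamma>" "power_sum_table \<in> \<Gamma>"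
    and a: "''H'' \<notin> fst ` \<Gamma>"
  shows "tabulated (insert hermite_table \<Gamma>)"
  unfolding hermite_table_def
proof (rule tabulated_explicit[OF \<Gamma>(1) a, where e = hermite_exp])
  fix x "is" s z
  let ?rs = "matrix_radices (NMul (NC 4) (NV 0)) nM (NC (Suc 0))"
  assume x: "x \<in> X" and i: "list_all2 (<) is (radices ?rs (n x) (d x))"
    and h: "holds_tables \<Gamma> s x" and \<delta>: "digits_at ?rs x z is"
  note \<delta>[unfolded digits_at_def, rule_format, simp]
  obtain \<beta> u v where ji: "is = [\<beta>, u, v, 0]" "\<beta> < 4 * n x" "u < n x * d x" "v < n x * d x"
    using i by (auto simp: list_all2_Cons2)
  note c = xval_cell[OF \<Gamma>(1) h \<Gamma>(2)[unfolded degree_table_def]] xval_cell[OF \<Gamma>(1) h \<Gamma>(3)[unfolded sign_table_def]]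
    xval_cell[OF \<Gamma>(1) h \<Gamma>(4)[unfolded power_sum_table_def]]
  have le: "2 + rat_of_nat u \<le> rat_of_nat m \<longleftrightarrow> Suc (Suc u) \<le> m" for u m
    using of_nat_le_iff[where 'a = rat, of "u + 2" m] by simp
  have \<beta>: "\<beta> div 4 < n x" using ji(2) by auto
  have "xval hermite_exp [n x, d x, z] s = hermite (DF x (\<beta> div 4)) (2 * (n x * d x) + 6) (sgn_poly x \<beta>) u v"
    using ji(2-) \<beta> by (simp add: hermite_exp_def Let_def ji(1) c hermite_def le cong: sum.cong_simp if_cong)
  then show "xval hermite_exp [n x, d x, z] s = coeff (hermite_form x (is ! 0) (is ! 1) (is ! 2)) (is ! 3)"
    by (simp add: ji(1) hermite_form_def)
qed (simp_all add: hermite_exp_def Let_def)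

lemma tabulated_hermite_char:
  assumes \<Gamma>: "tabulated \<Gamma>" "hermite_table \<in> \<Gamma>" and a: "''PH'' \<notin> fst ` \<Gamma>" "''HC'' \<notin> fst ` \<Gamma>"
  obtains f where "tabulated (insert hermite_char_table
    (insert (''PH'', power_radices (NMul (NC 4) (NV 0)) nM (NC (Suc 0)), f) \<Gamma>))"
proof -
  note 1 = tabulated_mat_power[OF \<Gamma>(1) \<Gamma>(2)[unfolded hermite_table_def] _ _ _ a(1)]
  note 2 = tabulated_newton_coeffs[OF 1 insertI1, of "''HC''"]
  show ?thesis by (rule that) (use 2 a in \<open>simp add: hermite_char_table_def\<close>)
qed

definition char_seq_exp :: "nexp \<Rightarrow> nexp \<Rightarrow> xexp" where
  "char_seq_exp \<beta> l = (let c = cell ''HC'' (newton_radices (NMul (NC 4) (NV 0)) nM (NC (Suc 0))) [l, \<beta>, NC 0] in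
     XIf EQ (XN (nmod l (NC 2))) (XN (NC 0)) c (XOp Sub (XN (NC 0)) c))"

lemma arrays_char_seq_exp [simp]: "arrays (char_seq_exp \<beta> l) = {''HC''}"
  by (simp add: char_seq_exp_def Let_def)

lemma xval_char_seq_exp:
  assumes "tabulated \<Gamma>" "hermite_char_table \<in> \<Gamma>" "holds_tables \<Gamma> s x"
    and "nval \<beta> (n x # d x # \<rho>) < 4 * n x" "nval l (n x # d x # \<rho>) \<le> n x * d x"
  shows "xval (char_seq_exp \<beta> l) (n x # d x # \<rho>) s = char_seq x (nval \<beta> (n x # d x # \<rho>)) (nval l (n x # d x # \<rho>))"
proof -
  let ?l = "nval l (n x # d x # \<rho>)"
  note c = xval_cell[OF assms(1,3) assms(2)[unfolded hermite_char_table_def]]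
  show ?thesis
  proof (cases "?l mod 2 = 0")
    case True
    then have "even ?l" by presburger
    then show ?thesis using assms(4,5) True
      by (simp add: char_seq_exp_def Let_def c char_seq_def)
  next
    case False
    then have "odd ?l" by presburger
    then show ?thesis using assms(4,5) False
      by (simp add: char_seq_exp_def Let_def c char_seq_def)
  qed
qed

definition sgn_exp :: "xexp \<Rightarrow> xexp" where
  "sgn_exp e = XIf EQ e (XN (NC 0)) (XN (NC 0)) (XIf LT (XN (NC 0)) e (XN (NC 1)) (XOp Sub (XN (NC 0)) (XN (NC 1))))"

lemma sgn_exp [simp]: "xval (sgn_exp e) \<rho> s = sgn (xval e \<rho> s)" "arrays (sgn_exp e) = arrays e"
  by (auto simp: sgn_exp_def sgn_if)

definition last_sign_exp :: xexp where
  "last_sign_exp = (let \<delta> = digit last_sign_radices; e = char_seq_exp (\<delta> 1) (\<delta> 0) in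
     XIf EQ (XN (\<delta> 0)) (XN (NC 0)) (sgn_exp e)
       (XIf EQ e (XN (NC 0)) (cell ''S'' last_sign_radices [NSub (\<delta> 0) (NC 1), \<delta> 1]) (sgn_exp e)))"

lemma tabulated_last_sign:
  assumes \<Gamma>: "tabulated \<Gamma>" "hermite_char_table \<in> \<Gamma>" and a: "''S'' \<notin> fst ` \<Gamma>"
  shows "tabulated (insert last_sign_table \<Gamma>)"
proof -
  define f where "f = (\<lambda>x is. last_sign (char_seq x (is ! 1)) (is ! 0))"
  show ?thesis unfolding last_sign_table_def f_def[symmetric]
  \<comment> \<open>The values -1, 0 and 1 are fractions whose numerator and denominator do not
    exceed \<open>2 ^ 0\<close> in absolute value.\<close>
  proof (rule tabulated_recursive[OF \<Gamma>(1) a, where e = last_sign_exp and b = "\<lambda>x. 0"])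
    show "poly_bounded (\<lambda>x. 0)" by (rule poly_bounded_const)
    show "rat_bits 0 (f x is)" for x "is"
      using last_sign_values[of "char_seq x (is ! 1)" "is ! 0"] rat_bits_uminus[OF rat_bits_1, of 0]
      by (auto simp: f_def)
  next
    fix x "is" s z
    assume x: "x \<in> X" and i: "list_all2 (<) is (radices last_sign_radices (n x) (d x))"
      and h: "holds_tables \<Gamma> s x" and \<delta>: "digits_at last_sign_radices x z is"
      and rec: "earlier_cells ''S'' last_sign_radices (f x) s x is"
    note \<delta>[unfolded digits_at_def, rule_format, simp]
    obtain l \<beta> where ji: "is = [l, \<beta>]" "l < Suc (n x * d x)" "\<beta> < 4 * n x" using i by (auto simp: list_all2_Cons2)
    note c = xval_char_seq_exp[OF \<Gamma> h] earlier_cellsD[OF rec]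
    show "xval last_sign_exp [n x, d x, z] s = f x is"
      using ji(2-) by (cases l) (simp_all add: last_sign_exp_def Let_def ji(1) c f_def)
  qed (simp_all add: last_sign_exp_def Let_def)
qed

definition variation_exp :: xexp where
  "variation_exp = (let \<delta> = digit variation_radices in
     XSum nM (XIf LT (XOp Mul (cell ''S'' last_sign_radices [NV 3, \<delta> 0]) (char_seq_exp (\<delta> 0) (NAdd (NV 3) (NC 1))))
       (XN (NC 0)) (XN (NC 1)) (XN (NC 0))))"

lemma tabulated_variation:
  assumes \<Gamma>: "tabulated \<Gamma>" "hermite_char_table \<in> \<Gamma>" "last_sign_table \<in> \<Gamma>" and a: "''V'' \<notin> fst ` \<Gamma>"
  shows "tabulated (insert variation_table \<Gamma>)"
  unfolding variation_table_def
proof (rule tabulated_explicit[OF \<Gamma>(1) a, where e = variation_exp])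
  fix x "is" s z
  assume x: "x \<in> X" and i: "list_all2 (<) is (radices variation_radices (n x) (d x))"
    and h: "holds_tables \<Gamma> s x" and \<delta>: "digits_at variation_radices x z is"
  note \<delta>[unfolded digits_at_def, rule_format, simp]
  obtain \<beta> where ji: "is = [\<beta>]" "\<beta> < 4 * n x" using i by (auto simp: list_all2_Cons2)
  note c = xval_cell[OF \<Gamma>(1) h \<Gamma>(3)[unfolded last_sign_table_def]] xval_char_seq_exp[OF \<Gamma>(1,2) h]
  show "xval variation_exp [n x, d x, z] s = of_nat (variations (char_seq x (is ! 0)) (n x * d x))"
    using ji(2) by (simp add: variation_exp_def Let_def ji(1) c variations_eq_sum cong: sum.cong_simp if_cong)
qed (simp_all add: variation_exp_def Let_def)

end

section \<open>The decision\<close>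

context psd_instances
begin

text \<open>The offsets 0 to 3 added to \<open>4 * j\<close> are the values
  \<open>2 * a + b\<close>, so the four numbers of variations are the four counts in
  \<open>psd_criterion\<close>.\<close>

definition criterion :: "'x \<Rightarrow> nat \<Rightarrow> bool" where
  "criterion x j \<longleftrightarrow> 0 \<le> poly (F x j) 1 \<and> 0 \<le> poly (F x j) (-1) \<and>
     variations (char_seq x (4 * j)) (n x * d x) + variations (char_seq x (4 * j + 1)) (n x * d x) =
     variations (char_seq x (4 * j + 2)) (n x * d x) + variations (char_seq x (4 * j + 3)) (n x * d x)"

lemma psd_iff_criterion:
  assumes "x \<in> X"
  shows "(\<forall>t\<in>{-1..1}. positive_semidefinite (eval_poly_mat (P x) t)) \<longleftrightarrow> (\<forall>j<n x. criterion x j)"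
proof -
  have nc: "neg_count (F x j) (2 * (n x * d x) + 6) (n x * d x) a b =
      variations (char_seq x (4 * j + 2 * a + b)) (n x * d x)" if "a < 2" "b < 2" for j a b
  proof -
    have "(4 * j + 2 * a + b) div 4 = j" "(4 * j + 2 * a + b) div 2 mod 2 = a" "(4 * j + 2 * a + b) mod 2 = b"
      using that by presburger+
    then show ?thesis
      by (simp add: neg_count_def neg_eigenvalues_def char_seq_def[abs_def] hermite_form_def[abs_def] sgn_poly_def)
  qed
  have "criterion x j \<longleftrightarrow> (let f = F x j; c = neg_count f (2 * (n x * d x) + 6) (n x * d x) in
      0 \<le> poly f 1 \<and> 0 \<le> poly f (-1) \<and> c 0 0 + c 0 1 = c 1 0 + c 1 1)" for j
    unfolding criterion_def Let_def using nc[of 0 0 j] nc[of 0 1 j] nc[of 1 0 j] nc[of 1 1 j]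
    by (simp add: numeral_3_eq_3)
  then show ?thesis
    using psd_criterion[OF symmetric[OF assms], of "2 * (n x * d x) + 6"] by (simp add: Let_def)
qed

text \<open>A universal statement over \<open>j\<close> becomes arithmetic: violations are counted,
  and the count is compared with 0. Variable 3 is \<open>j\<close>; variable 4 runs over the
  coefficients, with alternating signs for the value at -1.\<close>

definition result_exp :: xexp where
  "result_exp = (let c = cell ''F'' poly_radices [NV 3, NV 4];
       v = \<lambda>i. cell ''V'' variation_radices [NAdd (NMul (NC 4) (NV 3)) (NC i)] in
     XIf EQ (XSum (NV 0)
         (XIf LE (XN (NC 0)) (XSum nW c)
           (XIf LE (XN (NC 0)) (XSum nW (XIf EQ (XN (nmod (NV 4) (NC 2))) (XN (NC 0)) c (XOp Sub (XN (NC 0)) c)))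
             (XIf EQ (XOp Add (v 0) (v 1)) (XOp Add (v 2) (v 3)) (XN (NC 0)) (XN (NC 1)))
             (XN (NC 1)))
           (XN (NC 1))))
       (XN (NC 0)) (XN (NC 1)) (XN (NC 0)))"

definition result_table :: "'x table" where
  "result_table = (''result'', [NC (Suc 0)], \<lambda>x is. if \<forall>j<n x. criterion x j then 1 else 0)"

lemma tabulated_result:
  assumes \<Gamma>: "tabulated \<Gamma>" "poly_table \<in> \<Gamma>" "variation_table \<in> \<Gamma>" and a: "''result'' \<notin> fst ` \<Gamma>"
  shows "tabulated (insert result_table \<Gamma>)"
  unfolding result_table_def
proof (rule tabulated_explicit[OF \<Gamma>(1) a, where e = result_exp])
  fix x "is" s z
  assume x: "x \<in> X" and h: "holds_tables \<Gamma> s x"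
  note c = xval_cell[OF \<Gamma>(1) h \<Gamma>(2)[unfolded poly_table_def]] xval_cell[OF \<Gamma>(1) h \<Gamma>(3)[unfolded variation_table_def]]
  have one: "(\<Sum>k<Suc (n x * d x). coeff (F x j) k) = poly (F x j) 1" if "j < n x" for j
    using sum_coeff_eq_poly[of "Suc (n x * d x)" "F x j" 1] coeff_F_eq_0[OF x that] by simp
  have minus_one: "(\<Sum>k<Suc (n x * d x). if k mod 2 = 0 then coeff (F x j) k else - coeff (F x j) k) = poly (F x j) (-1)"
    if "j < n x" for j
  proof -
    have "(\<Sum>k<Suc (n x * d x). if k mod 2 = 0 then coeff (F x j) k else - coeff (F x j) k) =
        (\<Sum>k<Suc (n x * d x). coeff (F x j) k * (-1) ^ k)"
    proof (rule sum.cong[OF refl])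
      fix k :: nat
      have "k mod 2 = 0 \<longleftrightarrow> even k" by presburger
      then show "(if k mod 2 = 0 then coeff (F x j) k else - coeff (F x j) k) = coeff (F x j) k * (-1) ^ k"
        by simp
    qed
    also have "\<dots> = poly (F x j) (-1)"
      using sum_coeff_eq_poly[of "Suc (n x * d x)" "F x j" "-1"] coeff_F_eq_0[OF x that] by simp
    finally show ?thesis .
  qed
  have eq: "rat_of_nat p + rat_of_nat q = rat_of_nat r + rat_of_nat t \<longleftrightarrow> p + q = r + t" for p q r t
    by (metis of_nat_add of_nat_eq_iff)
  define bad where "bad j = (if 0 \<le> (\<Sum>k<Suc (n x * d x). coeff (F x j) k) then
      if 0 \<le> (\<Sum>k<Suc (n x * d x). if k mod 2 = 0 then coeff (F x j) k else - coeff (F x j) k) then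
        if variations (char_seq x (4 * j)) (n x * d x) + variations (char_seq x (4 * j + 1)) (n x * d x) =
          variations (char_seq x (4 * j + 2)) (n x * d x) + variations (char_seq x (4 * j + 3)) (n x * d x)
        then 0 else 1
      else 1 else (1::rat))" for j
  have "xval result_exp [n x, d x, z] s = (if (\<Sum>j<n x. bad j) = 0 then 1 else 0)"
    by (simp add: result_exp_def Let_def c eq bad_def del: sum.lessThan_Suc cong: sum.cong_simp if_cong)
  also have "(\<Sum>j<n x. bad j) = (\<Sum>j<n x. if criterion x j then 0 else 1)"
    by (rule sum.cong[OF refl]) (simp add: bad_def one minus_one criterion_def del: sum.lessThan_Suc)
  also have "(\<dots> = 0) \<longleftrightarrow> (\<forall>j<n x. criterion x j)"
    by (subst sum_nonneg_eq_0_iff) auto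
  finally show "xval result_exp [n x, d x, z] s = (if \<forall>j<n x. criterion x j then 1 else 0)" .
qed (simp_all add: result_exp_def Let_def)

theorem decides_psd:
  "\<exists>c. decides_in_strongly_polynomial_time c X (\<lambda>x. [n x, d x]) (\<lambda>x. poly_mat_coeffs (d x) (P x))
    (\<lambda>x. \<forall>t\<in>{-1..1}. positive_semidefinite (eval_poly_mat (P x) t))"
proof -
  note defs = data_table_def entry_table_def char_table_def poly_table_def deriv_table_def degree_table_def
    root_table_def power_sum_table_def square_table_def sign_table_def hermite_table_def
    hermite_char_table_def last_sign_table_def variation_table_def
  note tabulated_entry[OF tabulated_data]
  then have "tabulated {entry_table, data_table}" by (simp add: defs)
  then obtain f where "tabulated {char_table, (''PW'', power_radices (NC (Suc 0)) (NV 0) nW, f), entry_table, data_table}"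
    by (rule tabulated_char) (simp_all add: defs)
  from tabulated_poly[OF this] have "tabulated {poly_table, char_table,
      (''PW'', power_radices (NC (Suc 0)) (NV 0) nW, f), entry_table, data_table}" by (simp add: defs)
  from tabulated_deriv[OF this]
  \<comment> \<open>Of the tables so far, only those still to be read and the names already taken
    are remembered; new arrays are checked against these names.\<close>
  obtain \<Gamma> where \<Gamma>: "tabulated \<Gamma>" "poly_table \<in> \<Gamma>" "deriv_table \<in> \<Gamma>"
    "fst ` \<Gamma> = {''DF'', ''F'', ''C'', ''PW'', ''A'', ''data''}" 
    by (force simp: defs)
  note 1 = tabulated_degree[OF \<Gamma>(1,3)]
  have "tabulated (insert degree_table \<Gamma>)" using 1 by (simp add: \<Gamma>(4))
  note 2 = tabulated_root[OF this]
  have "tabulated (insert root_table (insert degree_table \<Gamma>))" using 2 \<Gamma>(3) by (simp add: \<Gamma>(4) defs(6))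
  note 3 = tabulated_power_sum[OF this]
  have "tabulated (insert power_sum_table (insert root_table (insert degree_table \<Gamma>)))"
    using 3 by (simp add: \<Gamma>(4) defs(6,7))
  note 4 = tabulated_square[OF this]
  have "tabulated (insert square_table (insert power_sum_table (insert root_table (insert degree_table \<Gamma>))))"
    using 4 \<Gamma>(2) by (simp add: \<Gamma>(4) defs(6-8))
  note 5 = tabulated_sign[OF this]
  define \<Gamma>' where "\<Gamma>' = insert sign_table (insert square_table (insert power_sum_table (insert root_table (insert degree_table \<Gamma>))))"
  have names: "fst ` \<Gamma>' = {''Q'', ''FF'', ''sum'', ''root'', ''deg'', ''DF'', ''F'', ''C'', ''PW'', ''A'', ''data''}"
    by (simp add: \<Gamma>'_def \<Gamma>(4) defs(6-10))
  have \<Gamma>': "tabulated \<Gamma>'" "poly_table \<in> \<Gamma>'" "degree_table \<in> \<Gamma>'" "sign_table \<in> \<Gamma>'" "power_sum_table \<in> \<Gamma>'"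
    using 5 \<Gamma>(2) by (simp_all add: \<Gamma>'_def \<Gamma>(4) defs(6-9))
  have "tabulated (insert hermite_table \<Gamma>')"
    by (rule tabulated_hermite[OF \<Gamma>'(1,3-5)]) (simp add: names)
  then obtain f' where 6: "tabulated (insert hermite_char_table
      (insert (''PH'', power_radices (NMul (NC 4) (NV 0)) nM (NC (Suc 0)), f') (insert hermite_table \<Gamma>')))"
    by (rule tabulated_hermite_char) (simp_all add: names defs(11))
  define \<Delta> where "\<Delta> = insert hermite_char_table
      (insert (''PH'', power_radices (NMul (NC 4) (NV 0)) nM (NC (Suc 0)), f') (insert hermite_table \<Gamma>'))"
  have \<Delta>: "tabulated \<Delta>" "poly_table \<in> \<Delta>" "hermite_char_table \<in> \<Delta>"
    "fst ` \<Delta> = {''HC'', ''PH'', ''H''} \<union> fst ` \<Gamma>'"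
    using 6 \<Gamma>'(2) by (auto simp: \<Delta>_def defs(11,12))
  have 7: "tabulated (insert last_sign_table \<Delta>)"
    by (rule tabulated_last_sign[OF \<Delta>(1,3)]) (simp add: \<Delta>(4) names)
  have 8: "tabulated (insert variation_table (insert last_sign_table \<Delta>))"
    by (rule tabulated_variation[OF 7]) (simp_all add: \<Delta>(3,4) names defs(13))
  have "tabulated (insert result_table (insert variation_table (insert last_sign_table \<Delta>)))"
    by (rule tabulated_result[OF 8]) (simp_all add: \<Delta>(2,4) names defs(13,14))
  then obtain c M where M: "computes c M" "\<And>x. x \<in> X \<Longrightarrow>
      holds_tables (insert result_table (insert variation_table (insert last_sign_table \<Delta>))) (M x) x"
    unfolding tabulated_def by blast
  have "M x ''result'' 0 = (if \<forall>t\<in>{-1..1}. positive_semidefinite (eval_poly_mat (P x) t) then 1 else 0)"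
    if x: "x \<in> X" for x
  proof -
    have "holds_table (M x) (n x) (d x) ''result'' [NC (Suc 0)] (\<lambda>is. if \<forall>j<n x. criterion x j then 1 else 0)"
      using M(2)[OF x] by (simp add: holds_tables_def result_table_def)
    then show ?thesis unfolding holds_table_def psd_iff_criterion[OF x]
      by (auto dest!: spec[of _ "[0]"])
  qed
  from decides_if_computes[OF M(1) this] show ?thesis by blast
qed

end

text \<open>For \<open>n = 0\<close> there would be no data at all while \<open>d\<close> could be
  arbitrary. From \<open>n = 1\<close> on, the number of coefficients dominates both
  \<open>n\<close> and \<open>d\<close>.\<close>

lemma format_le_length:
  assumes "1 \<le> n" "symmetric_poly_mat n d P"
  shows "n \<le> length (poly_mat_coeffs d P)" "d \<le> length (poly_mat_coeffs d P)"
proof -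
  have "2 * n div 2 \<le> (n + 1) * n div 2" using assms(1) by (intro div_le_mono mult_le_mono1) simp
  then have c: "n \<le> (n + 1 choose 2)" by (simp add: choose_two)
  have l: "length (poly_mat_coeffs d P) = (n + 1 choose 2) * (d + 1)"
    using assms(2) by (auto simp: symmetric_poly_mat_def length_poly_mat_coeffs)
  have "n * 1 \<le> (n + 1 choose 2) * (d + 1)" using c by (rule mult_le_mono) simp
  then show "n \<le> length (poly_mat_coeffs d P)" unfolding l by simp
  have "1 * d \<le> (n + 1 choose 2) * (d + 1)" using c assms(1) by (intro mult_le_mono) linarith+
  then show "d \<le> length (poly_mat_coeffs d P)" unfolding l by simp
qed

theorem theorem3p2:
  shows "\<exists>c. decides_in_strongly_polynomial_time c
    {(n, d, P). n \<ge> 1 \<and> symmetric_poly_mat n d P}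
    (\<lambda>(n, d, P). [n, d])
    (\<lambda>(n, d, P). poly_mat_coeffs d P)
    (\<lambda>(n, d, P). \<forall>t\<in>{-1..1}. positive_semidefinite (eval_poly_mat P t))"
proof -
  interpret psd_instances "{(n, d, P). n \<ge> 1 \<and> symmetric_poly_mat n d P}"
    "\<lambda>(n, d, P). n" "\<lambda>(n, d, P). d" "\<lambda>(n, d, P). P"
    by unfold_locales (use format_le_length in auto)
  show ?thesis using decides_psd by (simp add: split_def)
qed

end
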